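(* Let $c\in(a,b)$. The transformation $f\mapsto\hat f$, with \[ \hat f(z)=\int_a^c\phi_z(x)f(x)\,d\chi(x)+\int_a^c\phi_z^{[1]}(x)f^{[1]}(x)\,d\varsigma(x),\quad z\in\mathbb C, \] is a partial isometry from $H^1(a,c)$ onto the de Branges space $B(c)$, with initial subspace \[ D(c)=\overline{\operatorname{span}\{\phi_z|_{(a,c)}:z\in\mathbb C\}} \] (closure in $H^1(a,c)$).
   Context: Let $-\infty\le a<b\le\infty$ and let $\varrho,\varsigma,\chi$ be complex Borel measures on $(a,b)$, finite on compact subintervals, such that $\varrho$ is real-valued, $\varsigma$ is positive with support all of $(a,b)$ and absolutely continuous with respect to Lebesgue measure, $\chi$ is positive and not identically zero, and $\varsigma(\{x\})\chi(\{x\})=\varsigma(\{x\})\varrho(\{x\})=0$ for all $x$. For such a measure $\mu$ write $\int_c^x h\,d\mu=\int_{[c,x)}h\,d\mu$ if $x>c$, $0$ if $x=c$, and $-\int_{[x,c)}h\,d\mu$ if $x<c$. $AC_{\mathrm{loc}}((a,b);\mu)$ is the set of functions $f(x)=f(c)+\int_c^xh\,d\mu$ with $h\in L^1_{\mathrm{loc}}(\mu)$, and $df/d\mu=h$. $\mathfrak D_\tau$ is the set of $f\in AC_{\mathrm{loc}}((a,b);\varsigma)$ for which $x\mapsto-\frac{df}{d\varsigma}(x)+\int_c^xf\,d\chi$ has a (unique) representative in $AC_{\mathrm{loc}}((a,b);\varrho)$. For such $f$, $\tau f$ is its Radon–Nikodym derivative with respect to $\varrho$, and $f^{[1]}=df/d\varsigma$.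 Solutions $u$ of $(\tau-z)u=0$ are identified with pairs $(u,zu)$; set $V(f,g)(x)=f_\tau g^{[1]}-f^{[1]}g_\tau$. For an interval $(a,d)$, $d\le b$, $H^1(a,d)$ is the Hilbert space of $f\in AC_{\mathrm{loc}}((a,d);\varsigma)$ with $\int_a^d|f|^2d\chi+\int_a^d|f^{[1]}|^2d\varsigma<\infty$, with inner product $\int_a^d fg^\ast d\chi+\int_a^df^{[1]}(g^{[1]})^\ast d\varsigma$. $T_{\max}$ is the set of pairs $(f,f_\tau)$ with $\tau f=f_\tau$ and $f,f_\tau\in H^1(a,b)$. "Near an endpoint" refers to a neighbourhood of it; the limits $V(f,g)(a),V(f,g)(b)$ exist for pairs in $T_{\max}$ near the endpoint. $\tau$ is l.c. at an endpoint if for all $z\ne0$ all solutions of $(\tau-z)u=0$ lie in $H^1$ near it, and l.p. otherwise. $S=\{f\in T_{\max}:V(f,v_a^\ast)(a)=V(f,v_b^\ast)(b)=0\}$ is a self-adjoint restriction of $T_{\max}$ with separated boundary conditions ($v_a\in T_{\max}$ satisfies $V(v_a,v_a^\ast)(a)=0$ and $V(f,v_a^\ast)(a)\ne0$ for some $f$ if $\tau$ is l.c. at $a$; analogously $v_b$). $0$ is not an eigenvalue of $S$. A pair lies in $S$ near $a$ if it lies in $T_{\max}$ near $a$ and, in the l.c. case, $V(f,v_a^\ast)(a)=0$. For each $z\in\mathbb C$, $\phi_z$ is a non-trivial solution of $(\tau-z)u=0$ lying in $S$ near $a$ such that $z\mapsto\phi_z(c)$ and $z\mapsto\phi_z^{[1]}(c)$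 are real entire ($F(z^\ast)=F(z)^\ast$) for each $c\in(a,b)$. For $c\in(a,b)$ let $E(z,c)=z\phi_z(c)+\mathrm i\phi_z^{[1]}(c)$. It satisfies $|E(z,c)|>|E(z^\ast,c)|$ for $z$ in the upper half-plane $\mathbb C^+$. $B(c)$ is the associated de Branges space: all entire $F$ with $\int_{\mathbb R}|F(\lambda)|^2|E(\lambda,c)|^{-2}d\lambda<\infty$ such that $F/E$ and $F^\#/E$ (where $F^\#(z)=F(z^\ast)^\ast$) are of bounded type in $\mathbb C^+$ (quotients of bounded analytic functions) with non-positive mean type $\limsup_{y\to\infty}y^{-1}\ln|\cdot(\mathrm iy)|$. Its inner product is $\frac1\pi\int_{\mathbb R}F(\lambda)G(\lambda)^\ast|E(\lambda,c)|^{-2}d\lambda$. *)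

theory Defs
  imports "HOL-Analysis.Analysis" "HOL-Complex_Analysis.Complex_Analysis"
begin

text \<open>Measures on the interval (a,b) are represented by Borel measures on the real line
  that vanish outside (a,b). The real-valued (signed) measure rho is represented by its
  Jordan decomposition rho = rp - rn into mutually singular positive measures.\<close>

definition ivl :: "ereal \<Rightarrow> ereal \<Rightarrow> real set" where
  "ivl l r = {x. l < ereal x \<and> ereal x < r}"

definition loc_finite_on :: "ereal \<Rightarrow> ereal \<Rightarrow> real measure \<Rightarrow> bool" where
  "loc_finite_on a b \<mu> \<longleftrightarrow> sets \<mu> = sets borel \<and> emeasure \<mu> (- ivl a b) = 0 \<and>
     (\<forall>s t. a < ereal s \<and> ereal t < b \<longrightarrow> emeasure \<mu> {s..t} < \<infinity>)"

definition iint :: "real measure \<Rightarrow> real \<Rightarrow> real \<Rightarrow> (real \<Rightarrow> complex) \<Rightarrow> complex" where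
  "iint \<mu> c x h = (if c < x then set_lebesgue_integral \<mu> {c..<x} h
                   else if x = c then 0 else - set_lebesgue_integral \<mu> {x..<c} h)"

definition locint :: "ereal \<Rightarrow> ereal \<Rightarrow> real measure \<Rightarrow> (real \<Rightarrow> complex) \<Rightarrow> bool" where
  "locint l r \<mu> h \<longleftrightarrow> (\<forall>s t. l < ereal s \<and> ereal t < r \<longrightarrow> set_integrable \<mu> {s..t} h)"

definition ACloc :: "ereal \<Rightarrow> ereal \<Rightarrow> real measure \<Rightarrow> (real \<Rightarrow> complex) \<Rightarrow> (real \<Rightarrow> complex) \<Rightarrow> bool" where
  "ACloc l r \<mu> f h \<longleftrightarrow> locint l r \<mu> h \<and>
     (\<forall>c\<in>ivl l r. \<forall>x\<in>ivl l r. f x = f c + iint \<mu> c x h)"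

definition ACloc_s :: "ereal \<Rightarrow> ereal \<Rightarrow> real measure \<Rightarrow> real measure \<Rightarrow> (real \<Rightarrow> complex) \<Rightarrow> (real \<Rightarrow> complex) \<Rightarrow> bool" where
  "ACloc_s l r rp rn f h \<longleftrightarrow> locint l r rp h \<and> locint l r rn h \<and>
     (\<forall>c\<in>ivl l r. \<forall>x\<in>ivl l r. f x = f c + (iint rp c x h - iint rn c x h))"

definition standing :: "ereal \<Rightarrow> ereal \<Rightarrow> real measure \<Rightarrow> real measure \<Rightarrow> real measure \<Rightarrow> real measure \<Rightarrow> bool" where
  "standing a b rp rn s ch \<longleftrightarrow> a < b \<and>
     loc_finite_on a b rp \<and> loc_finite_on a b rn \<and> loc_finite_on a b s \<and> loc_finite_on a b ch \<and>
     (\<exists>P\<in>sets borel. emeasure rn P = 0 \<and> emeasure rp (- P) = 0) \<and>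
     (\<forall>u v. a < ereal u \<and> u < v \<and> ereal v < b \<longrightarrow> emeasure s {u<..<v} > 0) \<and>
     absolutely_continuous lborel s \<and>
     emeasure ch (ivl a b) \<noteq> 0 \<and>
     (\<forall>x. emeasure s {x} * emeasure ch {x} = 0) \<and>
     (\<forall>x. measure s {x} * (measure rp {x} - measure rn {x}) = 0)"

text \<open>Dtau_rel f f1 g: f is in AC_loc(s) with df/ds = f1 (f1 being the representative
  for which -f1(x) + int_c^x f dchi is in AC_loc(rho)), and the rho-derivative of this
  function is g, i.e. tau f = g.\<close>
definition Dtau_rel :: "ereal \<Rightarrow> ereal \<Rightarrow> real measure \<Rightarrow> real measure \<Rightarrow> real measure \<Rightarrow> real measure \<Rightarrow>
    (real \<Rightarrow> complex) \<Rightarrow> (real \<Rightarrow> complex) \<Rightarrow> (real \<Rightarrow> complex) \<Rightarrow> bool" where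
  "Dtau_rel a b rp rn s ch f f1 g \<longleftrightarrow> ACloc a b s f f1 \<and>
     (\<exists>c\<in>ivl a b. ACloc_s a b rp rn (\<lambda>x. - f1 x + iint ch c x f) g)"

definition tau_eq where
  "tau_eq a b rp rn s ch f g \<longleftrightarrow> (\<exists>f1. Dtau_rel a b rp rn s ch f f1 g)"

definition qd where
  "qd a b rp rn s ch f = (THE f1. (\<exists>g. Dtau_rel a b rp rn s ch f f1 g) \<and> (\<forall>x. x \<notin> ivl a b \<longrightarrow> f1 x = 0))"

definition H1rel :: "ereal \<Rightarrow> ereal \<Rightarrow> real measure \<Rightarrow> real measure \<Rightarrow> (real \<Rightarrow> complex) \<Rightarrow> (real \<Rightarrow> complex) \<Rightarrow> bool" where
  "H1rel l r s ch f f1 \<longleftrightarrow> ACloc l r s f f1 \<and>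
     set_integrable ch (ivl l r) (\<lambda>x. (norm (f x))\<^sup>2) \<and>
     set_integrable s (ivl l r) (\<lambda>x. (norm (f1 x))\<^sup>2)"

definition H1 where
  "H1 l r s ch f \<longleftrightarrow> (\<exists>f1. H1rel l r s ch f f1)"

definition H1inner :: "ereal \<Rightarrow> ereal \<Rightarrow> real measure \<Rightarrow> real measure \<Rightarrow>
    (real \<Rightarrow> complex) \<Rightarrow> (real \<Rightarrow> complex) \<Rightarrow> (real \<Rightarrow> complex) \<Rightarrow> (real \<Rightarrow> complex) \<Rightarrow> complex" where
  "H1inner l r s ch f f1 g g1 = set_lebesgue_integral ch (ivl l r) (\<lambda>x. f x * cnj (g x))
      + set_lebesgue_integral s (ivl l r) (\<lambda>x. f1 x * cnj (g1 x))"

definition H1norm2 :: "ereal \<Rightarrow> ereal \<Rightarrow> real measure \<Rightarrow> real measure \<Rightarrow>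
    (real \<Rightarrow> complex) \<Rightarrow> (real \<Rightarrow> complex) \<Rightarrow> real" where
  "H1norm2 l r s ch f f1 = set_lebesgue_integral ch (ivl l r) (\<lambda>x. (norm (f x))\<^sup>2)
      + set_lebesgue_integral s (ivl l r) (\<lambda>x. (norm (f1 x))\<^sup>2)"

definition Tmax where
  "Tmax a b rp rn s ch = {(f, ft). tau_eq a b rp rn s ch f ft \<and> H1 a b s ch f \<and> H1 a b s ch ft}"

definition near_a :: "ereal \<Rightarrow> ereal \<Rightarrow> (ereal \<Rightarrow> bool) \<Rightarrow> bool" where
  "near_a a b P \<longleftrightarrow> (\<exists>d. a < d \<and> d < b \<and> P d)"

definition Tmax_near_a where
  "Tmax_near_a a b rp rn s ch f ft \<longleftrightarrow> tau_eq a b rp rn s ch f ft \<and>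
     (\<exists>d. a < d \<and> d < b \<and> H1 a d s ch f \<and> H1 a d s ch ft)"

definition Tmax_near_b where
  "Tmax_near_b a b rp rn s ch f ft \<longleftrightarrow> tau_eq a b rp rn s ch f ft \<and>
     (\<exists>d. a < d \<and> d < b \<and> H1 d b s ch f \<and> H1 d b s ch ft)"

definition Vw where
  "Vw a b rp rn s ch p q x = snd p x * qd a b rp rn s ch (fst q) x - qd a b rp rn s ch (fst p) x * snd q x"

definition at_a :: "ereal \<Rightarrow> real filter" where
  "at_a a = (if a = - \<infinity> then at_bot else at_right (real_of_ereal a))"

definition at_b :: "ereal \<Rightarrow> real filter" where
  "at_b b = (if b = \<infinity> then at_top else at_left (real_of_ereal b))"

definition Va where "Va a b rp rn s ch p q = Lim (at_a a) (Vw a b rp rn s ch p q)"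
definition Vb where "Vb a b rp rn s ch p q = Lim (at_b b) (Vw a b rp rn s ch p q)"

definition cpair :: "(real \<Rightarrow> complex) \<times> (real \<Rightarrow> complex) \<Rightarrow> (real \<Rightarrow> complex) \<times> (real \<Rightarrow> complex)" where
  "cpair p = ((\<lambda>x. cnj (fst p x)), (\<lambda>x. cnj (snd p x)))"

definition lc_a where
  "lc_a a b rp rn s ch \<longleftrightarrow> (\<forall>z u. z \<noteq> 0 \<and> tau_eq a b rp rn s ch u (\<lambda>x. z * u x) \<longrightarrow>
      (\<exists>d. a < d \<and> d < b \<and> H1 a d s ch u))"

definition lc_b where
  "lc_b a b rp rn s ch \<longleftrightarrow> (\<forall>z u. z \<noteq> 0 \<and> tau_eq a b rp rn s ch u (\<lambda>x. z * u x) \<longrightarrow>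
      (\<exists>d. a < d \<and> d < b \<and> H1 d b s ch u))"

definition bc_a where
  "bc_a a b rp rn s ch va \<longleftrightarrow> (lc_a a b rp rn s ch \<longrightarrow>
     va \<in> Tmax a b rp rn s ch \<and> Va a b rp rn s ch va (cpair va) = 0 \<and>
     (\<exists>f\<in>Tmax a b rp rn s ch. Va a b rp rn s ch f (cpair va) \<noteq> 0))"

definition bc_b where
  "bc_b a b rp rn s ch vb \<longleftrightarrow> (lc_b a b rp rn s ch \<longrightarrow>
     vb \<in> Tmax a b rp rn s ch \<and> Vb a b rp rn s ch vb (cpair vb) = 0 \<and>
     (\<exists>f\<in>Tmax a b rp rn s ch. Vb a b rp rn s ch f (cpair vb) \<noteq> 0))"

definition Sop where
  "Sop a b rp rn s ch va vb = {p \<in> Tmax a b rp rn s ch.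
      (lc_a a b rp rn s ch \<longrightarrow> Va a b rp rn s ch p (cpair va) = 0) \<and>
      (lc_b a b rp rn s ch \<longrightarrow> Vb a b rp rn s ch p (cpair vb) = 0)}"

definition S_near_a where
  "S_near_a a b rp rn s ch va f ft \<longleftrightarrow> Tmax_near_a a b rp rn s ch f ft \<and>
      (lc_a a b rp rn s ch \<longrightarrow> Va a b rp rn s ch (f, ft) (cpair va) = 0)"

definition zero_eigenvalue where
  "zero_eigenvalue a b rp rn s ch va vb \<longleftrightarrow>
     (\<exists>f. (f, (\<lambda>x. 0)) \<in> Sop a b rp rn s ch va vb \<and> (\<exists>x\<in>ivl a b. f x \<noteq> 0))"

definition phi_ok where
  "phi_ok a b rp rn s ch va \<phi> \<longleftrightarrow>
     (\<forall>z. tau_eq a b rp rn s ch (\<phi> z) (\<lambda>x. z * \<phi> z x) \<and> (\<exists>x\<in>ivl a b. \<phi> z x \<noteq> 0) \<and>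
          S_near_a a b rp rn s ch va (\<phi> z) (\<lambda>x. z * \<phi> z x)) \<and>
     (\<forall>x\<in>ivl a b. (\<lambda>z. \<phi> z x) holomorphic_on UNIV \<and> (\<lambda>z. qd a b rp rn s ch (\<phi> z) x) holomorphic_on UNIV \<and>
          (\<forall>z. \<phi> (cnj z) x = cnj (\<phi> z x) \<and> qd a b rp rn s ch (\<phi> (cnj z)) x = cnj (qd a b rp rn s ch (\<phi> z) x)))"

definition UHP :: "complex set" where "UHP = {z. Im z > 0}"

definition bounded_type_UHP :: "(complex \<Rightarrow> complex) \<Rightarrow> bool" where
  "bounded_type_UHP f \<longleftrightarrow> (\<exists>g h. g holomorphic_on UHP \<and> h holomorphic_on UHP \<and>
      bounded (g ` UHP) \<and> bounded (h ` UHP) \<and> (\<exists>z\<in>UHP. h z \<noteq> 0) \<and>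
      (\<forall>z\<in>UHP. f z * h z = g z))"

definition eln :: "real \<Rightarrow> ereal" where
  "eln t = (if t = 0 then - \<infinity> else ereal (ln t))"

definition mean_type_nonpos :: "(complex \<Rightarrow> complex) \<Rightarrow> bool" where
  "mean_type_nonpos f \<longleftrightarrow> Limsup at_top (\<lambda>y::real. eln (norm (f (\<i> * complex_of_real y))) / ereal y) \<le> 0"

definition sharp :: "(complex \<Rightarrow> complex) \<Rightarrow> complex \<Rightarrow> complex" where
  "sharp F z = cnj (F (cnj z))"

definition deBranges :: "(complex \<Rightarrow> complex) \<Rightarrow> (complex \<Rightarrow> complex) set" where
  "deBranges E = {F. F holomorphic_on UNIV \<and>
      integrable lborel (\<lambda>t::real. (norm (F (complex_of_real t)))\<^sup>2 / (norm (E (complex_of_real t)))\<^sup>2) \<and>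
      bounded_type_UHP (\<lambda>z. F z / E z) \<and> mean_type_nonpos (\<lambda>z. F z / E z) \<and>
      bounded_type_UHP (\<lambda>z. sharp F z / E z) \<and> mean_type_nonpos (\<lambda>z. sharp F z / E z)}"

definition dB_norm2 :: "(complex \<Rightarrow> complex) \<Rightarrow> (complex \<Rightarrow> complex) \<Rightarrow> real" where
  "dB_norm2 E F = (1 / pi) * integral\<^sup>L lborel
      (\<lambda>t::real. (norm (F (complex_of_real t)))\<^sup>2 / (norm (E (complex_of_real t)))\<^sup>2)"

definition Efun where
  "Efun a b rp rn s ch \<phi> c z = z * \<phi> z c + \<i> * qd a b rp rn s ch (\<phi> z) c"

definition fhat where
  "fhat a b rp rn s ch \<phi> c f f1 z =
     set_lebesgue_integral ch (ivl a (ereal c)) (\<lambda>x. \<phi> z x * f x)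
     + set_lebesgue_integral s (ivl a (ereal c)) (\<lambda>x. qd a b rp rn s ch (\<phi> z) x * f1 x)"

definition Dc where
  "Dc a b rp rn s ch \<phi> c = {(g, g1). H1rel a (ereal c) s ch g g1 \<and>
     (\<forall>\<epsilon>>0. \<exists>Z \<alpha>. finite Z \<and>
        H1norm2 a (ereal c) s ch
          (\<lambda>x. g x - (\<Sum>z\<in>Z. \<alpha> z * \<phi> z x))
          (\<lambda>x. g1 x - (\<Sum>z\<in>Z. \<alpha> z * qd a b rp rn s ch (\<phi> z) x)) < \<epsilon>)}"

end

theory Submission
  imports Defs
begin

text \<open>By the Lagrange identity, the boundary condition at \<open>a\<close> (or the limit point case) gives
  \<open>(z - w) (\<integral> \<phi>\<^sub>z \<phi>\<^sub>w d\<chi> + \<integral> \<phi>\<^sub>z\<^sup>[\<^sup>1\<^sup>] \<phi>\<^sub>w\<^sup>[\<^sup>1\<^sup>] d\<varsigma>) = A z B w - B z A w\<close> over \<open>(a, c)\<close>, where \<open>A z = z \<phi>\<^sub>z(c)\<close> and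
  \<open>B z = \<phi>\<^sub>z\<^sup>[\<^sup>1\<^sup>](c)\<close>. Thus the Gram matrix of the \<open>\<phi>\<^sub>z\<close> is the reproducing kernel of the de Branges
  space of \<open>E = A + \<i> B\<close>, and the transformation sends the \<open>\<phi>\<^sub>z\<close> to the kernel functions.
  It is therefore isometric on the span of the \<open>\<phi>\<^sub>z\<close>, and it vanishes on the orthogonal complement.

  The reproducing property rests on Cauchy's formula for \<open>F / E\<close>: a function of bounded type with
  nonpositive mean type and square integrable boundary values is recovered from them, by
  Phragmen--Lindelof applied to a primitive. Conversely, a Poisson bound in terms of the boundary
  values passes to limits and yields bounded type and mean type of the limit.\<close>

section \<open>Semi-inner products\<close>

text \<open>The identity for \<open>(z - w)\<close> times the pairing is empty at z = w, and
  Cauchy's formula is used at nonreal points only. Parameters are therefore first kept nonreal or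
  off the diagonal, and continuity supplies the rest: the diagonal of the Gram matrix, the values of
  transforms on the real axis, the span over all parameters.

  \<open>E\<close> may vanish on the real line, though only at 0: A z has the factor z, and B 0 can
  be 0 as well. Uniqueness for initial values makes this zero simple, and square integrability
  forces every F in the space to vanish there, so F / E still extends continuously to the closed
  half-plane.

  The derivative of an element of H1(a,c) is determined only almost everywhere. Pairs are therefore
  kept as functions on \<open>real + real\<close> with a semidefinite form, and no quotient is
  formed. The abstract model needs no completeness; that of H1(a,c) enters once, to produce
  preimages.

  Being limit point at a yields one bad solution for some nonzero z', unrelated to the parameters z
  and w of the pairing, which is why three parameters meet in
  \<open>limit_point_zero\<close>.\<close>

locale semi_inner =
  fixes V :: "('x \<Rightarrow> complex) set" and ip :: "('x \<Rightarrow> complex) \<Rightarrow> ('x \<Rightarrow> complex) \<Rightarrow> complex"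
  assumes lin: "f \<in> V \<Longrightarrow> g \<in> V \<Longrightarrow> (\<lambda>x. f x + \<alpha> * g x) \<in> V"
    and zero: "(\<lambda>x. 0) \<in> V"
    and ip_lin: "f \<in> V \<Longrightarrow> g \<in> V \<Longrightarrow> h \<in> V \<Longrightarrow> ip (\<lambda>x. f x + \<alpha> * g x) h = ip f h + \<alpha> * ip g h"
    and ip_cnj: "f \<in> V \<Longrightarrow> g \<in> V \<Longrightarrow> ip g f = cnj (ip f g)"
    and ip_pos: "f \<in> V \<Longrightarrow> Re (ip f f) \<ge> 0"
begin

definition nrm2 :: "('x \<Rightarrow> complex) \<Rightarrow> real" where "nrm2 f = Re (ip f f)"

lemma ip_self: "f \<in> V \<Longrightarrow> ip f f = of_real (nrm2 f)"
  using ip_cnj[of f f] unfolding nrm2_def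
  by (metis Reals_cnj_iff of_real_Re)

lemma ip_lin2:
  assumes "f \<in> V" "g \<in> V" "h \<in> V"
  shows "ip h (\<lambda>x. f x + \<alpha> * g x) = ip h f + cnj \<alpha> * ip h g"
proof -
  have "ip h (\<lambda>x. f x + \<alpha> * g x) = cnj (ip f h + \<alpha> * ip g h)"
    using ip_cnj[of "\<lambda>x. f x + \<alpha> * g x" h] ip_lin[of f g h \<alpha>] lin assms by simp
  then show ?thesis using ip_cnj[of f h] ip_cnj[of g h] assms by simp
qed

lemma ip_zero: "h \<in> V \<Longrightarrow> ip (\<lambda>x. 0) h = 0"
  using ip_lin[of "\<lambda>x. 0" "\<lambda>x. 0" h "-1"] zero by simp

lemma scale: "f \<in> V \<Longrightarrow> (\<lambda>x. \<alpha> * f x) \<in> V"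
  using lin[OF zero, of f \<alpha>] by simp

lemma diff: "f \<in> V \<Longrightarrow> g \<in> V \<Longrightarrow> (\<lambda>x. f x - g x) \<in> V"
  using lin[of f g "-1"] by simp

lemma add: "f \<in> V \<Longrightarrow> g \<in> V \<Longrightarrow> (\<lambda>x. f x + g x) \<in> V"
  using lin[of f g 1] by simp

lemma ip_diff: "f \<in> V \<Longrightarrow> g \<in> V \<Longrightarrow> h \<in> V \<Longrightarrow> ip (\<lambda>x. f x - g x) h = ip f h - ip g h"
  using ip_lin[of f g h "-1"] by simp

lemma nrm2_ge_0: "f \<in> V \<Longrightarrow> nrm2 f \<ge> 0"
  using ip_pos nrm2_def by simp

lemma nrm2_lin:
  assumes "f \<in> V" "g \<in> V"
  shows "nrm2 (\<lambda>x. f x + \<alpha> * g x) = nrm2 f + 2 * Re (cnj \<alpha> * ip f g) + (norm \<alpha>)\<^sup>2 * nrm2 g"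
proof -
  have "ip (\<lambda>x. f x + \<alpha> * g x) (\<lambda>x. f x + \<alpha> * g x)
      = (ip f f + cnj \<alpha> * ip f g) + \<alpha> * (ip g f + cnj \<alpha> * ip g g)"
    using assms by (simp add: ip_lin ip_lin2 lin)
  also have "\<dots> = ip f f + (cnj \<alpha> * ip f g + cnj (cnj \<alpha> * ip f g)) + of_real ((norm \<alpha>)\<^sup>2) * ip g g"
    using ip_cnj[OF assms] by (simp add: algebra_simps complex_norm_square[symmetric] del: of_real_power)
  finally show ?thesis
    unfolding nrm2_def by (simp add: complex_add_cnj)
qed

lemma nrm2_diff:
  assumes "f \<in> V" "g \<in> V"
  shows "nrm2 (\<lambda>x. f x - g x) = nrm2 f - 2 * Re (ip f g) + nrm2 g"
  using nrm2_lin[OF assms, of "-1"] by simp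

lemma nrm2_diff_commute: "f \<in> V \<Longrightarrow> g \<in> V \<Longrightarrow> nrm2 (\<lambda>x. f x - g x) = nrm2 (\<lambda>x. g x - f x)"
  using ip_cnj[of f g] by (simp add: nrm2_diff)

text \<open>Positivity of \<open>nrm2\<close> on f - t r g, with r the inner product of f and g, is
  a quadratic condition on real t. Since the form is only semidefinite, \<open>nrm2 g = 0\<close> is
  possible; then the condition is linear in t and fails for large t unless r vanishes. Otherwise the
  minimizer t = 1 / \<open>nrm2 g\<close> gives the claim.\<close>

lemma CS2:
  assumes f: "f \<in> V" and g: "g \<in> V"
  shows "(norm (ip f g))\<^sup>2 \<le> nrm2 f * nrm2 g"
proof -
  define r where "r = ip f g"
  have key: "0 \<le> nrm2 f - 2 * t * (norm r)\<^sup>2 + t\<^sup>2 * (norm r)\<^sup>2 * nrm2 g" for t :: real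
  proof -
    have "0 \<le> nrm2 (\<lambda>x. f x + (- of_real t * r) * g x)" by (intro nrm2_ge_0 lin f g)
    also have "\<dots> = nrm2 f + 2 * Re (cnj (- of_real t * r) * r) + (norm (- of_real t * r))\<^sup>2 * nrm2 g"
      by (simp only: nrm2_lin[OF f g] r_def)
    also have "Re (cnj (- of_real t * r) * r) = - t * (norm r)\<^sup>2"
      unfolding cmod_power2 by (simp add: power2_eq_square algebra_simps)
    also have "(norm (- of_real t * r))\<^sup>2 = t\<^sup>2 * (norm r)\<^sup>2" by (simp add: norm_mult power_mult_distrib)
    finally show ?thesis by simp
  qed
  show ?thesis
  proof (cases "nrm2 g = 0")
    case True
    have "norm r = 0"
    proof (rule ccontr)
      assume r: "norm r \<noteq> 0"
      have "0 \<le> nrm2 f - 2 * ((nrm2 f + 1) / (2 * (norm r)\<^sup>2)) * (norm r)\<^sup>2"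
        using key[of "(nrm2 f + 1) / (2 * (norm r)\<^sup>2)"] True by simp
      then show False using r by simp
    qed
    then show ?thesis using True by (simp add: r_def)
  next
    case False
    then have g0: "nrm2 g > 0" using nrm2_ge_0[OF g] by simp
    have "0 \<le> nrm2 f - 2 * (1 / nrm2 g) * (norm r)\<^sup>2 + (1 / nrm2 g)\<^sup>2 * (norm r)\<^sup>2 * nrm2 g"
      by (rule key)
    also have "\<dots> = nrm2 f - (norm r)\<^sup>2 / nrm2 g"
      using False by (simp add: power2_eq_square)
    finally show ?thesis using g0 by (simp add: r_def divide_le_eq)
  qed
qed

definition nrm where "nrm f = sqrt (nrm2 f)"

lemma nrm_ge_0: "f \<in> V \<Longrightarrow> nrm f \<ge> 0" by (simp add: nrm_def nrm2_ge_0)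
lemma nrm_sq: "f \<in> V \<Longrightarrow> (nrm f)\<^sup>2 = nrm2 f" by (simp add: nrm_def nrm2_ge_0)

lemma CS: "f \<in> V \<Longrightarrow> g \<in> V \<Longrightarrow> norm (ip f g) \<le> nrm f * nrm g"
  using CS2[of f g] unfolding nrm_def real_sqrt_mult[symmetric] by (simp add: real_le_rsqrt)

lemma nrm_triangle: "f \<in> V \<Longrightarrow> g \<in> V \<Longrightarrow> nrm (\<lambda>x. f x + g x) \<le> nrm f + nrm g"
proof -
  assume f: "f \<in> V" and g: "g \<in> V"
  have "nrm2 (\<lambda>x. f x + g x) = nrm2 f + 2 * Re (ip f g) + nrm2 g"
    using nrm2_lin[OF f g, of 1] by simp
  also have "\<dots> \<le> nrm2 f + 2 * (nrm f * nrm g) + nrm2 g"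
    using CS[OF f g] complex_Re_le_cmod[of "ip f g"] by linarith
  also have "\<dots> = (nrm f + nrm g)\<^sup>2"
    using nrm_sq[OF f] nrm_sq[OF g] by (simp add: power2_eq_square algebra_simps)
  finally have "nrm2 (\<lambda>x. f x + g x) \<le> (nrm f + nrm g)\<^sup>2" .
  then show ?thesis unfolding nrm_def[of "\<lambda>x. f x + g x"]
    using nrm_ge_0[OF f] nrm_ge_0[OF g] by (intro real_le_lsqrt) (auto simp: nrm2_ge_0 add f g)
qed

lemma nrm_diff_triangle:
  "f \<in> V \<Longrightarrow> g \<in> V \<Longrightarrow> h \<in> V \<Longrightarrow> nrm (\<lambda>x. f x - h x) \<le> nrm (\<lambda>x. f x - g x) + nrm (\<lambda>x. g x - h x)"
  using nrm_triangle[of "\<lambda>x. f x - g x" "\<lambda>x. g x - h x"] diff by simp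

lemma nrm_diff_abs:
  assumes "f \<in> V" "g \<in> V" shows "\<bar>nrm f - nrm g\<bar> \<le> nrm (\<lambda>x. f x - g x)"
  using nrm_triangle[of "\<lambda>x. f x - g x" g] nrm_triangle[of "\<lambda>x. g x - f x" f] diff assms
    nrm2_diff_commute[of f g] by (simp add: nrm_def)

lemma ip_tendsto:
  assumes f: "\<And>n. f n \<in> V" "f0 \<in> V" "(\<lambda>n. nrm2 (\<lambda>x. f n x - f0 x)) \<longlonglongrightarrow> 0" and g: "g \<in> V"
  shows "(\<lambda>n. ip (f n) g) \<longlonglongrightarrow> ip f0 g"
proof -
  have "(\<lambda>n. nrm (\<lambda>x. f n x - f0 x)) \<longlonglongrightarrow> 0"
    unfolding nrm_def using tendsto_real_sqrt[OF f(3)] by simp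
  then have "(\<lambda>n. nrm (\<lambda>x. f n x - f0 x) * nrm g) \<longlonglongrightarrow> 0" by (rule tendsto_mult_left_zero)
  then have "(\<lambda>n. ip (f n) g - ip f0 g) \<longlonglongrightarrow> 0"
    by (rule Lim_null_comparison[rotated]) (use CS[of "\<lambda>x. f _ x - f0 x" g] f g in \<open>auto simp: diff ip_diff\<close>)
  then show ?thesis by (simp add: LIM_zero_iff)
qed

lemma nrm2_tendsto:
  assumes f: "\<And>n. f n \<in> V" "f0 \<in> V" "(\<lambda>n. nrm2 (\<lambda>x. f n x - f0 x)) \<longlonglongrightarrow> 0"
  shows "(\<lambda>n. nrm2 (f n)) \<longlonglongrightarrow> nrm2 f0"
proof -
  have "(\<lambda>n. nrm (\<lambda>x. f n x - f0 x)) \<longlonglongrightarrow> 0"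
    unfolding nrm_def using tendsto_real_sqrt[OF f(3)] by simp
  then have "(\<lambda>n. nrm (f n) - nrm f0) \<longlonglongrightarrow> 0"
    by (rule Lim_null_comparison[rotated]) (use nrm_diff_abs f in auto)
  then have "(\<lambda>n. nrm (f n)) \<longlonglongrightarrow> nrm f0" by (simp add: LIM_zero_iff)
  then have "(\<lambda>n. (nrm (f n))\<^sup>2) \<longlonglongrightarrow> (nrm f0)\<^sup>2" by (rule tendsto_power)
  then show ?thesis using f by (simp add: nrm_sq)
qed

text \<open>The span is generated one term at a time, so that facts about its elements follow by
  induction on a single added multiple, and repeated generators need no merging.\<close>

inductive_set cspan :: "('x \<Rightarrow> complex) set \<Rightarrow> ('x \<Rightarrow> complex) set" for S where
  null: "(\<lambda>x. 0) \<in> cspan S"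
| step: "p \<in> cspan S \<Longrightarrow> e \<in> S \<Longrightarrow> (\<lambda>x. p x + \<alpha> * e x) \<in> cspan S"

lemma cspan_in: "p \<in> cspan S \<Longrightarrow> S \<subseteq> V \<Longrightarrow> p \<in> V"
  by (induction rule: cspan.induct) (auto intro: zero lin)

lemma cspan_lin:
  assumes p: "p \<in> cspan S" and q: "q \<in> cspan S"
  shows "(\<lambda>x. p x + \<beta> * q x) \<in> cspan S"
  using q
proof induction
  case null
  then show ?case using p by simp
next
  case (step q e \<alpha>)
  then show ?case using cspan.step[OF step.IH step.hyps(2), of "\<beta> * \<alpha>"]
    by (simp add: algebra_simps)
qed

lemma cspan_sum:
  assumes "finite Z" "\<And>z. z \<in> Z \<Longrightarrow> e z \<in> S"
  shows "(\<lambda>x. \<Sum>z\<in>Z. \<alpha> z * e z x) \<in> cspan S"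
  using assms
proof (induction Z rule: finite_induct)
  case (insert z Z)
  then have "(\<lambda>x. (\<Sum>z\<in>Z. \<alpha> z * e z x) + \<alpha> z * e z x) \<in> cspan S"
    by (intro cspan.step) auto
  then show ?case using insert.hyps by (simp add: add.commute)
qed (simp add: cspan.null)

definition cauchy_seq :: "(nat \<Rightarrow> 'x \<Rightarrow> complex) \<Rightarrow> bool" where
  "cauchy_seq p \<longleftrightarrow> (\<forall>\<epsilon>>0. \<exists>N. \<forall>m\<ge>N. \<forall>n\<ge>N. nrm2 (\<lambda>x. p m x - p n x) < \<epsilon>)"

text \<open>A substitute for the orthogonal projection onto the closed span that needs no completeness:
  minimizing sequences are Cauchy by the parallelogram law, and their residuals become orthogonal
  to \<open>S\<close>.\<close>

lemma minimizing_sequence: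
  assumes S: "S \<subseteq> V" and f: "f \<in> V"
  obtains p where "\<And>n. p n \<in> cspan S" "cauchy_seq p"
    "\<And>e. e \<in> S \<Longrightarrow> (\<lambda>n. ip (\<lambda>x. f x - p n x) e) \<longlonglongrightarrow> 0"
proof -
  define D where "D = (\<lambda>p. nrm2 (\<lambda>x. f x - p x))"
  define d where "d = Inf (D ` cspan S)"
  have inV: "p \<in> V" if "p \<in> cspan S" for p using cspan_in[OF that S] .
  have D0: "D p \<ge> 0" if "p \<in> cspan S" for p
    unfolding D_def by (intro nrm2_ge_0 diff f inV that)
  have bdd: "bdd_below (D ` cspan S)" by (rule bdd_belowI[of _ 0]) (use D0 in auto)
  have dle: "d \<le> D p" if "p \<in> cspan S" for p unfolding d_def by (intro cINF_lower bdd that)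
  have "\<exists>p\<in>cspan S. D p < d + \<epsilon>" if "\<epsilon> > 0" for \<epsilon>
    using cInf_lessD[of "D ` cspan S" "d + \<epsilon>"] that cspan.null unfolding d_def by fastforce
  then have "\<forall>n. \<exists>p. p \<in> cspan S \<and> D p < d + 1 / real (Suc n)" by (meson zero_less_divide_1_iff of_nat_0_less_iff zero_less_Suc)
  then obtain p where p: "\<And>n. p n \<in> cspan S" "\<And>n. D (p n) < d + 1 / real (Suc n)" by metis
  \<comment> \<open>Parallelogram law for the residuals u and v: their mean is the residual of the
    midpoint, which lies in the span, so its squared norm is at least d.\<close>
  have par: "nrm2 (\<lambda>x. q x - r x) \<le> 2 * (D q - d) + 2 * (D r - d)" if q: "q \<in> cspan S" and r: "r \<in> cspan S" for q r
  proof -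
    define u where "u = (\<lambda>x. f x - q x)"
    define v where "v = (\<lambda>x. f x - r x)"
    have uv: "u \<in> V" "v \<in> V" unfolding u_def v_def by (intro diff f inV q r)+
    have m: "(\<lambda>x. (1/2) * q x + (1/2) * r x) \<in> cspan S"
      using cspan_lin[OF cspan_lin[OF cspan.null q, of "1/2"] r, of "1/2"] by simp
    have "D (\<lambda>x. (1/2) * q x + (1/2) * r x) = nrm2 (\<lambda>x. (1/2) * (u x + 1 * v x))"
      unfolding D_def u_def v_def by (rule arg_cong[of _ _ nrm2]) (auto simp: field_simps)
    also have "\<dots> = (1/4) * nrm2 (\<lambda>x. u x + 1 * v x)"
      using nrm2_lin[OF zero lin[OF uv, of 1], of "1/2"] zero uv
      by (simp add: nrm2_def ip_zero lin[OF uv, of 1, simplified] norm_divide power_divide)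
    also have "nrm2 (\<lambda>x. u x + 1 * v x) = nrm2 u + 2 * Re (ip u v) + nrm2 v"
      using nrm2_lin[OF uv, of 1] by simp
    finally have 1: "4 * d \<le> nrm2 u + 2 * Re (ip u v) + nrm2 v"
      using dle[OF m] by simp
    have "nrm2 (\<lambda>x. q x - r x) = nrm2 (\<lambda>x. v x - u x)"
      by (simp add: u_def v_def)
    also have "\<dots> = nrm2 v - 2 * Re (ip v u) + nrm2 u" using uv by (simp add: nrm2_diff)
    also have "Re (ip v u) = Re (ip u v)" using ip_cnj[OF uv] by simp
    finally show ?thesis using 1 by (simp add: D_def u_def v_def)
  qed
  have "cauchy_seq p"
    unfolding cauchy_seq_def
  proof (intro allI impI)
    fix \<epsilon> :: real assume "\<epsilon> > 0"
    then obtain N where N: "1 / real (Suc N) < \<epsilon> / 4" by (metis nat_approx_posE zero_less_divide_iff zero_less_numeral)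
    have Dn: "D (p n) - d < \<epsilon> / 4" if "n \<ge> N" for n
    proof -
      have "1 / real (Suc n) \<le> 1 / real (Suc N)" using that by (intro divide_left_mono) auto
      then show ?thesis using p(2)[of n] N by linarith
    qed
    have "nrm2 (\<lambda>x. p m x - p n x) < \<epsilon>" if "m \<ge> N" "n \<ge> N" for m n
    proof -
      have "a < \<epsilon>" if "a \<le> 2 * x + 2 * y" "x < \<epsilon> / 4" "y < \<epsilon> / 4" for a x y
        using that by linarith
      from this[OF par[OF p(1) p(1)] Dn[OF that(1)] Dn[OF that(2)]] show ?thesis .
    qed
    then show "\<exists>N. \<forall>m\<ge>N. \<forall>n\<ge>N. nrm2 (\<lambda>x. p m x - p n x) < \<epsilon>" by blast
  qed
  moreover have "(\<lambda>n. ip (\<lambda>x. f x - p n x) e) \<longlonglongrightarrow> 0" if e: "e \<in> S" for e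
  proof -
    have eV: "e \<in> V" using e S by blast
    \<comment> \<open>The best correction of \<open>p n\<close> along e would be
      \<open>r / nrm2 e\<close>; adding 1 keeps the denominator positive when e is a null
      vector.\<close>
    define B where "B = nrm2 e + 1"
    have B: "B > 0" "B \<ge> nrm2 e" using nrm2_ge_0[OF eV] by (simp_all add: B_def)
    have "(norm (ip (\<lambda>x. f x - p n x) e))\<^sup>2 \<le> B * (1 / real (Suc n))" for n
    proof -
      define u where "u = (\<lambda>x. f x - p n x)"
      define r where "r = ip u e"
      have uV: "u \<in> V" unfolding u_def by (intro diff f inV p)
      have "d \<le> D (\<lambda>x. p n x + (r / B) * e x)" by (intro dle cspan.step p e)
      also have "\<dots> = nrm2 (\<lambda>x. u x + (- r / B) * e x)"
        unfolding D_def u_def by (rule arg_cong[of _ _ nrm2]) auto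
      also have "\<dots> = nrm2 u + 2 * Re (cnj (- r / B) * r) + (norm (- r / B))\<^sup>2 * nrm2 e"
        by (simp only: nrm2_lin[OF uV eV] r_def)
      also have "Re (cnj (- r / B) * r) = - (norm r)\<^sup>2 / B"
        unfolding cmod_power2 by (simp add: power2_eq_square add_divide_distrib diff_divide_distrib)
      also have "(norm (- r / B))\<^sup>2 * nrm2 e \<le> (norm (- r / B))\<^sup>2 * B"
        using B by (intro mult_left_mono) auto
      also have "(norm (- r / B))\<^sup>2 * B = (norm r)\<^sup>2 / B"
        using B by (simp add: norm_divide power2_eq_square)
      finally have "(norm r)\<^sup>2 / B \<le> 1 / real (Suc n)"
        using p(2)[of n] by (simp add: D_def u_def)
      then show ?thesis using B unfolding r_def u_def by (simp add: field_simps)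
    qed
    moreover have "(\<lambda>n. B * (1 / real (Suc n))) \<longlonglongrightarrow> 0"
      using tendsto_mult_right_zero[OF LIMSEQ_inverse_real_of_nat, of B] by (simp add: inverse_eq_divide)
    ultimately have "(\<lambda>n. (norm (ip (\<lambda>x. f x - p n x) e))\<^sup>2) \<longlonglongrightarrow> 0"
      by (intro Lim_null_comparison[of "\<lambda>n. (norm (ip (\<lambda>x. f x - p n x) e))\<^sup>2"]) auto
    then show ?thesis
      using tendsto_real_sqrt by (fastforce simp: tendsto_norm_zero_iff dest: tendsto_real_sqrt)
  qed
  ultimately show ?thesis using p(1) that by blast
qed

end

section \<open>Square integrable functions\<close>

definition L2 :: "'a measure \<Rightarrow> ('a \<Rightarrow> complex) set" where
  "L2 M = {f \<in> borel_measurable M. integrable M (\<lambda>x. (norm (f x))\<^sup>2)}"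

definition ip2 :: "'a measure \<Rightarrow> ('a \<Rightarrow> complex) \<Rightarrow> ('a \<Rightarrow> complex) \<Rightarrow> complex" where
  "ip2 M f g = (\<integral>x. f x * cnj (g x) \<partial>M)"

lemma L2_mult_integrable:
  assumes "f \<in> L2 M" "g \<in> L2 M"
  shows "integrable M (\<lambda>x. f x * g x)"
proof (rule Bochner_Integration.integrable_bound)
  show "integrable M (\<lambda>x. (norm (f x))\<^sup>2 + (norm (g x))\<^sup>2)"
    using assms by (auto simp: L2_def)
  show "(\<lambda>x. f x * g x) \<in> borel_measurable M" using assms by (auto simp: L2_def)
  have "norm (f x) * norm (g x) \<le> (norm (f x))\<^sup>2 + (norm (g x))\<^sup>2" for x
    using sum_squares_bound[of "norm (f x)" "norm (g x)"] mult_nonneg_nonneg[OF norm_ge_zero[of "f x"] norm_ge_zero[of "g x"]]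
    unfolding mult.assoc by linarith
  then show "AE x in M. norm (f x * g x) \<le> norm ((norm (f x))\<^sup>2 + (norm (g x))\<^sup>2)"
    by (auto simp: norm_mult)
qed

lemma borel_measurable_cnj [measurable]: "cnj \<in> borel_measurable borel"
  by (intro borel_measurable_continuous_onI continuous_intros)

lemma L2_cnj: "f \<in> L2 M \<Longrightarrow> (\<lambda>x. cnj (f x)) \<in> L2 M"
  by (auto simp: L2_def)

lemma L2_ip_integrable: "f \<in> L2 M \<Longrightarrow> g \<in> L2 M \<Longrightarrow> integrable M (\<lambda>x. f x * cnj (g x))"
  using L2_mult_integrable L2_cnj by blast

lemma L2_bound:
  assumes "f \<in> borel_measurable M" "integrable M h" "\<And>x. x \<in> space M \<Longrightarrow> (norm (f x))\<^sup>2 \<le> h x"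
  shows "f \<in> L2 M"
proof -
  have "integrable M (\<lambda>x. (norm (f x))\<^sup>2)"
    using assms by (intro Bochner_Integration.integrable_bound[OF assms(2)]) (auto intro!: AE_I2 order_trans[OF assms(3)])
  then show ?thesis using assms by (auto simp: L2_def)
qed

lemma L2_lin:
  assumes "f \<in> L2 M" "g \<in> L2 M"
  shows "(\<lambda>x. f x + \<alpha> * g x) \<in> L2 M"
proof (rule L2_bound)
  show "integrable M (\<lambda>x. 2 * (norm (f x))\<^sup>2 + 2 * ((norm \<alpha>)\<^sup>2 * (norm (g x))\<^sup>2))"
    using assms by (auto simp: L2_def)
  fix x
  have "(norm (f x + \<alpha> * g x))\<^sup>2 \<le> (norm (f x) + norm (\<alpha> * g x))\<^sup>2"
    by (intro power_mono norm_triangle_ineq) auto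
  also have "\<dots> \<le> 2 * (norm (f x))\<^sup>2 + 2 * (norm (\<alpha> * g x))\<^sup>2"
    using sum_squares_bound[of "norm (f x)" "norm (\<alpha> * g x)"] by (simp add: power2_sum)
  finally show "(norm (f x + \<alpha> * g x))\<^sup>2 \<le> 2 * (norm (f x))\<^sup>2 + 2 * ((norm \<alpha>)\<^sup>2 * (norm (g x))\<^sup>2)"
    by (simp add: norm_mult power_mult_distrib)
qed (use assms in \<open>auto simp: L2_def\<close>)

lemma semi_inner_L2: "semi_inner (L2 M) (ip2 M)"
proof
  show "(\<lambda>x. 0) \<in> L2 M" by (simp add: L2_def)
next
  fix f g h \<alpha> assume *: "f \<in> L2 M" "g \<in> L2 M" "h \<in> L2 M"
  have "(\<integral>x. (f x + \<alpha> * g x) * cnj (h x) \<partial>M) = (\<integral>x. f x * cnj (h x) + \<alpha> * (g x * cnj (h x)) \<partial>M)"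
    by (simp add: algebra_simps)
  then show "ip2 M (\<lambda>x. f x + \<alpha> * g x) h = ip2 M f h + \<alpha> * ip2 M g h"
    unfolding ip2_def using L2_ip_integrable[OF *(1,3)] L2_ip_integrable[OF *(2,3)] by simp
next
  fix f g assume *: "f \<in> L2 M" "g \<in> L2 M"
  show "ip2 M g f = cnj (ip2 M f g)"
    unfolding ip2_def using integral_bounded_linear[OF bounded_linear_cnj L2_ip_integrable[OF *]]
    by (simp add: mult.commute)
next
  fix f assume *: "f \<in> L2 M"
  have "ip2 M f f = of_real (\<integral>x. (norm (f x))\<^sup>2 \<partial>M)"
    unfolding ip2_def complex_norm_square[symmetric] by (simp add: integral_complex_of_real del: of_real_power)
  then show "Re (ip2 M f f) \<ge> 0" by simp
qed (fact L2_lin)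

interpretation L2: semi_inner "L2 M" "ip2 M" for M by (rule semi_inner_L2)

lemma ip2_self: "ip2 M f f = of_real (\<integral>x. (norm (f x))\<^sup>2 \<partial>M)"
  unfolding ip2_def complex_norm_square[symmetric] by (simp add: integral_complex_of_real del: of_real_power)

lemma L2_nrm2: "L2.nrm2 M f = (\<integral>x. (norm (f x))\<^sup>2 \<partial>M)"
  unfolding L2.nrm2_def ip2_self by simp

lemma L2_nn_nrm2: "f \<in> L2 M \<Longrightarrow> (\<integral>\<^sup>+x. ennreal ((norm (f x))\<^sup>2) \<partial>M) = ennreal (L2.nrm2 M f)"
  unfolding L2_nrm2 by (rule nn_integral_eq_integral) (auto simp: L2_def)

text \<open>Fatou's lemma in k for f n - f (r k). It turns a pointwise limit that is known
  beforehand into the mean-square limit, which is how limits of entire functions and of the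
  solutions are identified. Only a subsequence has to converge pointwise, because the Cauchy
  property controls the rest.\<close>

lemma L2_cauchy_pointwise:
  assumes f: "\<And>n. f n \<in> L2 M" and c: "L2.cauchy_seq M f"
    and r: "strict_mono r" and g: "g \<in> borel_measurable M"
    and conv: "AE x in M. (\<lambda>n. f (r n) x) \<longlonglongrightarrow> g x"
  shows "g \<in> L2 M" "(\<lambda>n. L2.nrm2 M (\<lambda>x. f n x - g x)) \<longlonglongrightarrow> 0"
proof -
  have meas: "f n \<in> borel_measurable M" for n using f[of n] by (simp add: L2_def)
  have key: "\<exists>N. \<forall>n\<ge>N. (\<lambda>x. f n x - g x) \<in> L2 M \<and> L2.nrm2 M (\<lambda>x. f n x - g x) \<le> \<epsilon>" if \<epsilon>: "\<epsilon> > 0" for \<epsilon>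
  proof -
    obtain N where N: "\<And>m n. m \<ge> N \<Longrightarrow> n \<ge> N \<Longrightarrow> L2.nrm2 M (\<lambda>x. f m x - f n x) < \<epsilon>"
      using c \<epsilon> unfolding L2.cauchy_seq_def by blast
    have "(\<lambda>x. f n x - g x) \<in> L2 M \<and> L2.nrm2 M (\<lambda>x. f n x - g x) \<le> \<epsilon>" if n: "n \<ge> N" for n
    proof -
      have "(\<integral>\<^sup>+x. ennreal ((norm (f n x - g x))\<^sup>2) \<partial>M)
          = (\<integral>\<^sup>+x. liminf (\<lambda>k. ennreal ((norm (f n x - f (r k) x))\<^sup>2)) \<partial>M)"
      proof (rule nn_integral_cong_AE)
        show "AE x in M. ennreal ((norm (f n x - g x))\<^sup>2) = liminf (\<lambda>k. ennreal ((norm (f n x - f (r k) x))\<^sup>2))"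
          using conv
        proof eventually_elim
          case (elim x)
          then have "(\<lambda>k. ennreal ((norm (f n x - f (r k) x))\<^sup>2)) \<longlonglongrightarrow> ennreal ((norm (f n x - g x))\<^sup>2)"
            by (intro tendsto_intros tendsto_ennrealI)
          then show ?case by (rule lim_imp_Liminf[OF trivial_limit_sequentially, symmetric])
        qed
      qed
      also have "\<dots> \<le> liminf (\<lambda>k. \<integral>\<^sup>+x. ennreal ((norm (f n x - f (r k) x))\<^sup>2) \<partial>M)"
        using meas by (intro nn_integral_liminf) auto
      also have "\<dots> \<le> ennreal \<epsilon>"
      proof (rule Liminf_le)
        show "\<forall>\<^sub>F k in sequentially. (\<integral>\<^sup>+x. ennreal ((norm (f n x - f (r k) x))\<^sup>2) \<partial>M) \<le> ennreal \<epsilon>"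
          using eventually_ge_at_top[of N]
        proof (rule eventually_mono)
          fix k assume "N \<le> k"
          then have "N \<le> r k" using strict_mono_imp_increasing[OF r, of k] by linarith
          then show "(\<integral>\<^sup>+x. ennreal ((norm (f n x - f (r k) x))\<^sup>2) \<partial>M) \<le> ennreal \<epsilon>"
            using N[OF n, of "r k"] by (simp add: L2_nn_nrm2 L2.diff f ennreal_leI)
        qed
      qed simp
      finally have le: "(\<integral>\<^sup>+x. ennreal ((norm (f n x - g x))\<^sup>2) \<partial>M) \<le> ennreal \<epsilon>" .
      then have "integrable M (\<lambda>x. (norm (f n x - g x))\<^sup>2)"
        using meas g by (intro integrableI_bounded) (auto simp: le_less_trans[OF le])
      then have L: "(\<lambda>x. f n x - g x) \<in> L2 M" using meas g by (auto simp: L2_def)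
      moreover have "L2.nrm2 M (\<lambda>x. f n x - g x) \<le> \<epsilon>"
        using le \<epsilon> unfolding L2_nn_nrm2[OF L] by simp
      ultimately show ?thesis by simp
    qed
    then show ?thesis by blast
  qed
  \<comment> \<open>Membership of g comes from writing it as f N minus a square integrable
    difference.\<close>
  obtain N where "(\<lambda>x. f N x - g x) \<in> L2 M" using key[of 1] by auto
  then have "(\<lambda>x. f N x - (f N x - g x)) \<in> L2 M" by (rule L2.diff[OF f])
  then show gL: "g \<in> L2 M" by simp
  show "(\<lambda>n. L2.nrm2 M (\<lambda>x. f n x - g x)) \<longlonglongrightarrow> 0"
  proof (rule LIMSEQ_I)
    fix \<epsilon> :: real assume "\<epsilon> > 0"
    then obtain N where N: "\<And>n. n \<ge> N \<Longrightarrow> L2.nrm2 M (\<lambda>x. f n x - g x) \<le> \<epsilon> / 2" using key[of "\<epsilon> / 2"] by auto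
    moreover have "0 \<le> L2.nrm2 M (\<lambda>x. f n x - g x)" for n by (intro L2.nrm2_ge_0 L2.diff f gL)
    ultimately show "\<exists>N. \<forall>n\<ge>N. norm (L2.nrm2 M (\<lambda>x. f n x - g x) - 0) < \<epsilon>"
      using \<open>\<epsilon> > 0\<close> by (intro exI[of _ N]) (fastforce intro: le_less_trans)
  qed
qed

text \<open>The terms of the weighted series tend to 0, so eventually
  \<open>a k \<le> (1/2) ^ k\<close>. The weights \<open>4 ^ k\<close> thus replace a
  Cauchy--Schwarz estimate for series by comparison with a geometric one.\<close>

lemma summable_if_weighted_squares:
  fixes a :: "nat \<Rightarrow> real"
  assumes "\<And>k. a k \<ge> 0" and fin: "(\<Sum>k. ennreal (4 ^ k * (a k)\<^sup>2)) \<noteq> \<infinity>"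
  shows "summable a"
proof -
  have "summable (\<lambda>k. 4 ^ k * (a k)\<^sup>2)"
    using fin by (intro summable_suminf_not_top) auto
  then have "(\<lambda>k. 4 ^ k * (a k)\<^sup>2) \<longlonglongrightarrow> 0" by (rule summable_LIMSEQ_zero)
  then have "\<forall>\<^sub>F k in sequentially. 4 ^ k * (a k)\<^sup>2 < 1" by (rule order_tendstoD) simp
  then have "\<forall>\<^sub>F k in sequentially. norm (a k) \<le> (1/2) ^ k"
  proof (rule eventually_mono)
    fix k assume "4 ^ k * (a k)\<^sup>2 < 1"
    moreover have "4 ^ k * (a k)\<^sup>2 = (2 ^ k * a k)\<^sup>2"
      by (simp add: power_mult_distrib power2_eq_square flip: power_mult_distrib)
    ultimately have "2 ^ k * a k < 1" using assms(1)[of k] by (simp add: power_less_one_iff abs_square_less_1)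
    then show "norm (a k) \<le> (1/2) ^ k" using assms(1)[of k] by (simp add: power_one_over field_simps)
  qed
  then show ?thesis by (rule summable_comparison_test_ev) (rule summable_geometric, simp)
qed

text \<open>Riesz--Fischer. The subsequence is chosen with squared increments below
  \<open>(1/8) ^ k\<close>, which leaves \<open>(1/2) ^ k\<close> after weighting with
  \<open>4 ^ k\<close>; the weighted sum of squares then has finite integral, and the increments are
  absolutely summable almost everywhere.\<close>

lemma L2_complete:
  assumes f: "\<And>n. f n \<in> L2 M" and c: "L2.cauchy_seq M f"
  obtains r g where "strict_mono r" "g \<in> L2 M" "AE x in M. (\<lambda>n. f (r n) x) \<longlonglongrightarrow> g x"
    "(\<lambda>n. L2.nrm2 M (\<lambda>x. f n x - g x)) \<longlonglongrightarrow> 0"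
proof -
  have meas [measurable]: "f n \<in> borel_measurable M" for n using f[of n] by (simp add: L2_def)
  have "\<forall>k. \<exists>N. \<forall>m\<ge>N. \<forall>n\<ge>N. L2.nrm2 M (\<lambda>x. f m x - f n x) < (1/8) ^ k"
    using c unfolding L2.cauchy_seq_def by simp
  then obtain N where N: "\<And>k m n. m \<ge> N k \<Longrightarrow> n \<ge> N k \<Longrightarrow> L2.nrm2 M (\<lambda>x. f m x - f n x) < (1/8) ^ k"
    by metis
  \<comment> \<open>The entry \<open>Suc m\<close> makes r strictly increasing, the entry
    \<open>N (Suc k)\<close> guarantees the rate.\<close>
  define r where "r = rec_nat (N 0) (\<lambda>k m. max (Suc m) (N (Suc k)))"
  have r_Suc: "r (Suc k) = max (Suc (r k)) (N (Suc k))" for k by (simp add: r_def)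
  have rs: "strict_mono r" by (rule strict_monoI_Suc) (simp add: r_Suc)
  have rN: "r k \<ge> N k" for k by (cases k) (simp_all add: r_def)
  define d where "d = (\<lambda>k x. f (r (Suc k)) x - f (r k) x)"
  have dL: "d k \<in> L2 M" for k unfolding d_def by (intro L2.diff f)
  have dn: "L2.nrm2 M (d k) < (1/8) ^ k" for k
  proof -
    have "r k \<le> r (Suc k)" by (simp add: r_Suc)
    then show ?thesis unfolding d_def using rN[of k] by (intro N) linarith+
  qed
  have [measurable]: "d k \<in> borel_measurable M" for k unfolding d_def by measurable
  have "(\<integral>\<^sup>+x. (\<Sum>k. ennreal (4 ^ k * (norm (d k x))\<^sup>2)) \<partial>M) = (\<Sum>k. \<integral>\<^sup>+x. ennreal (4 ^ k * (norm (d k x))\<^sup>2) \<partial>M)"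
    by (rule nn_integral_suminf) measurable
  also have "\<dots> \<le> (\<Sum>k. ennreal ((1/2) ^ k))"
  proof (rule suminf_le)
    fix k
    have "(\<integral>\<^sup>+x. ennreal (4 ^ k * (norm (d k x))\<^sup>2) \<partial>M) = ennreal (4 ^ k) * ennreal (L2.nrm2 M (d k))"
      by (simp add: ennreal_mult nn_integral_cmult L2_nn_nrm2[OF dL])
    also have "\<dots> = ennreal (4 ^ k * L2.nrm2 M (d k))"
      using L2.nrm2_ge_0[OF dL] by (simp add: ennreal_mult)
    also have "\<dots> \<le> ennreal (4 ^ k * (1/8) ^ k)"
      using dn[of k] by (intro ennreal_leI mult_left_mono) auto
    also have "4 ^ k * (1/8) ^ k = (1/2 :: real) ^ k" by (simp flip: power_mult_distrib)
    finally show "(\<integral>\<^sup>+x. ennreal (4 ^ k * (norm (d k x))\<^sup>2) \<partial>M) \<le> ennreal ((1/2) ^ k)" .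
  qed auto
  also have "\<dots> = ennreal (\<Sum>k. (1/2) ^ k)"
    by (rule suminf_ennreal2) (auto intro: summable_geometric)
  also have "\<dots> < \<infinity>" by simp
  finally have "AE x in M. (\<Sum>k. ennreal (4 ^ k * (norm (d k x))\<^sup>2)) \<noteq> \<infinity>"
    by (intro nn_integral_PInf_AE) auto
  then have conv: "AE x in M. convergent (\<lambda>n. f (r n) x)"
  proof eventually_elim
    case (elim x)
    then have "summable (\<lambda>k. norm (d k x))" by (intro summable_if_weighted_squares) auto
    then have "summable (\<lambda>k. d k x)" by (rule summable_norm_cancel)
    then have "convergent (\<lambda>n. \<Sum>k<n. d k x)" by (simp add: summable_iff_convergent)
    moreover have "(\<Sum>k<n. d k x) = f (r n) x - f (r 0) x" for n
      unfolding d_def by (rule sum_lessThan_telescope)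
    ultimately have "convergent (\<lambda>n. f (r n) x - f (r 0) x)" by simp
    from convergent_add[OF this convergent_const[of "f (r 0) x"]] show ?case by simp
  qed
  define g where "g = (\<lambda>x. lim (\<lambda>n. f (r n) x))"
  have g: "g \<in> borel_measurable M" unfolding g_def by (rule borel_measurable_lim_metric) measurable
  have cg: "AE x in M. (\<lambda>n. f (r n) x) \<longlonglongrightarrow> g x"
    using conv unfolding g_def by eventually_elim (simp add: convergent_LIMSEQ_iff)
  show ?thesis
    by (rule that[OF rs _ cg]) (rule L2_cauchy_pointwise[OF f c rs g cg])+
qed

section \<open>Functions of bounded type in the half-plane\<close>

text \<open>Carries a bound, or with B = 0 an identity, across a point where a quotient is defined
  only through its removable singularity.\<close>

lemma norm_bound_at_removed_point:
  fixes f :: "complex \<Rightarrow> complex"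
  assumes "open S" "continuous_on S f" "\<alpha> \<in> S" "\<And>z. z \<in> S \<Longrightarrow> z \<noteq> \<alpha> \<Longrightarrow> norm (f z) \<le> B"
  shows "norm (f \<alpha>) \<le> B"
proof -
  have "(f \<longlongrightarrow> f \<alpha>) (at \<alpha>)"
    using assms(1-3) continuous_on_eq_continuous_at isContD by blast
  moreover have "\<forall>\<^sub>F z in at \<alpha>. z \<in> S"
    using assms(1,3) eventually_at_topological by blast
  then have "\<forall>\<^sub>F z in at \<alpha>. norm (f z) \<le> B"
    by (auto simp: eventually_at_filter assms(4) elim: eventually_mono)
  ultimately show ?thesis
    by (intro tendsto_upperbound[OF tendsto_norm[of f "f \<alpha>" "at \<alpha>"]]) auto
qed

lemma cmod_diff_less_cmod_add:
  fixes g :: complex and m :: real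
  assumes "Re g > 0" "m > 0"
  shows "cmod (g - m) < cmod (g + m)"
proof -
  have "(cmod (g + m))\<^sup>2 - (cmod (g - m))\<^sup>2 = 4 * (Re g * m)"
    by (simp only: cmod_power2) (simp add: power2_eq_square algebra_simps)
  moreover have "Re g * m > 0" using assms by simp
  ultimately have "(cmod (g - m))\<^sup>2 < (cmod (g + m))\<^sup>2" by linarith
  then show ?thesis using norm_ge_zero power_less_imp_less_base by blast
qed

text \<open>Harnack's inequality for the nonnegative harmonic function -ln |h|. A logarithm of h
  exists because h has no zeros; its negative maps into the right half-plane, the Cayley transform
  sends it to the disc, and Schwarz's lemma bounds the result.\<close>

lemma harnack_zero_free:
  assumes r: "r > 0" and h: "h holomorphic_on ball 0 r"
    and nz: "\<And>z. norm z < r \<Longrightarrow> h z \<noteq> 0" and le: "\<And>z. norm z < r \<Longrightarrow> norm (h z) \<le> 1"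
    and w: "norm w < r"
  shows "- ln (norm (h w)) \<le> - ln (norm (h 0)) * ((r + norm w) / (r - norm w))"
proof -
  obtain L where L: "L holomorphic_on ball 0 r" "\<And>z. z \<in> ball 0 r \<Longrightarrow> exp (L z) = h z"
    using holomorphic_logarithm_exists[of "ball 0 r" h 0] h nz r by auto
  have ReL: "Re (L z) = ln (norm (h z))" if "norm z < r" for z
    using L(2)[of z] that by (metis ln_exp mem_ball_0 norm_exp_eq_Re)
  have ReL0: "Re (L z) \<le> 0" if "norm z < r" for z
    using ReL[OF that] le[OF that] nz[OF that] by simp
  define q where "q = norm w / r"
  have q: "0 \<le> q" "q < 1" using w r by (auto simp: q_def)
  define K where "K = (r + norm w) / (r - norm w)"
  have Kq: "K = (1 + q) / (1 - q)" using r w by (simp add: K_def q_def field_simps)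
  \<comment> \<open>The shift by \<epsilon> makes the real part strictly positive, as the Cayley
    transform requires; it is removed at the end.\<close>
  have key: "- ln (norm (h w)) + \<epsilon> \<le> (- ln (norm (h 0)) + \<epsilon>) * K" if e: "\<epsilon> > 0" for \<epsilon>
  proof -
    define m where "m = - ln (norm (h 0)) + \<epsilon>"
    have m: "m > 0" using le[of 0] nz[of 0] r e by (smt (verit) ln_le_zero_iff m_def zero_less_norm_iff norm_zero)
    \<comment> \<open>Rescaled to the unit disc and shifted by an imaginary constant, so that g 0 is
      the real number m and the Cayley transform \<Phi> vanishes at 0.\<close>
    define g where "g = (\<lambda>z. - L (of_real r * z) + of_real \<epsilon> + \<i> * of_real (Im (L 0)))"
    have rz: "norm (of_real r * z) < r" if "norm z < 1" for z :: complex
      using that r by (simp add: norm_mult)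
    have gh: "g holomorphic_on ball 0 1"
      unfolding g_def
      by (intro holomorphic_intros holomorphic_on_compose_gen[OF _ L(1), unfolded o_def])
         (use rz in auto)
    have g0: "g 0 = of_real m"
      using ReL[of 0] r by (simp add: g_def m_def complex_eq_iff)
    have gp: "Re (g z) > 0" if "norm z < 1" for z
      using ReL0[OF rz[OF that]] e by (simp add: g_def)
    define \<Phi> where "\<Phi> = (\<lambda>z. (g z - of_real m) / (g z + of_real m))"
    have nzd: "g z + of_real m \<noteq> 0" if "norm z < 1" for z
      using gp[OF that] m by (auto simp: complex_eq_iff)
    have "norm (\<Phi> (w / r)) \<le> norm (w / r)"
    proof (rule Schwarz_Lemma)
      show "\<Phi> holomorphic_on ball 0 1"
        unfolding \<Phi>_def by (intro holomorphic_intros gh) (use nzd in auto)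
      show "\<Phi> 0 = 0" by (simp add: \<Phi>_def g0)
      show "norm (\<Phi> z) < 1" if "norm z < 1" for z
        using cmod_diff_less_cmod_add[OF gp[OF that] m] nzd[OF that]
        by (simp add: \<Phi>_def norm_divide)
      show "norm (w / r) < 1" using w r by (simp add: norm_divide)
    qed
    then have "norm (g (w/r) - m) \<le> q * norm (g (w/r) + m)"
      using nzd[of "w/r"] w r by (simp add: \<Phi>_def norm_divide q_def field_simps)
    also have "\<dots> \<le> q * (norm (g (w/r)) + m)"
      using q m norm_triangle_ineq[of "g (w/r)" "of_real m"] by (intro mult_left_mono) auto
    finally have "norm (g (w/r)) - m \<le> q * (norm (g (w/r)) + m)"
      using norm_triangle_ineq2[of "g (w/r)" "of_real m"] m by auto
    then have "norm (g (w/r)) * (1 - q) \<le> m * (1 + q)" by (simp add: algebra_simps)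
    then have "norm (g (w/r)) \<le> m * K" using q by (simp add: Kq field_simps)
    moreover have "Re (g (w/r)) \<le> norm (g (w/r))" by (rule complex_Re_le_cmod)
    moreover have "Re (g (w/r)) = - ln (norm (h w)) + \<epsilon>"
      using ReL[OF w] r by (simp add: g_def)
    ultimately show ?thesis by (simp add: m_def)
  qed
  have "- ln (norm (h w)) \<le> - ln (norm (h 0)) * K + \<epsilon>" if "\<epsilon> > 0" for \<epsilon>
  proof -
    have K1: "K \<ge> 1" using q by (simp add: Kq field_simps)
    \<comment> \<open>The error is scaled by 1 / K so that exactly \<epsilon> remains after
      multiplication by K.\<close>
    have "- ln (norm (h w)) + \<epsilon> / K \<le> (- ln (norm (h 0)) + \<epsilon> / K) * K"
      using that K1 by (intro key) auto
    moreover have "\<epsilon> / K > 0" using that K1 by auto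
    moreover have "(- ln (norm (h 0)) + \<epsilon> / K) * K = - ln (norm (h 0)) * K + \<epsilon>"
      using K1 by (simp add: left_diff_distrib distrib_right)
    ultimately show ?thesis by linarith
  qed
  then show ?thesis unfolding K_def by (rule field_le_epsilon)
qed

text \<open>Schwarz--Pick: moving \<alpha> to the origin by a Moebius map and applying Schwarz's
  lemma shows that division by the Blaschke factor of a zero keeps the bound 1.\<close>

lemma blaschke_divide:
  assumes p: "p holomorphic_on ball 0 1" and le: "\<And>z. norm z < 1 \<Longrightarrow> norm (p z) \<le> 1"
    and \<alpha>: "norm \<alpha> < 1" "p \<alpha> = 0"
  obtains q where "q holomorphic_on ball 0 1" "\<And>z. norm z < 1 \<Longrightarrow> norm (q z) \<le> 1"
    "\<And>z. p z * (1 - cnj \<alpha> * z) = q z * (z - \<alpha>)"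
proof -
  define q where "q = (\<lambda>z. (if z = \<alpha> then deriv p \<alpha> else (p z - p \<alpha>) / (z - \<alpha>)) * (1 - cnj \<alpha> * z))"
  have qh: "q holomorphic_on ball 0 1"
    unfolding q_def by (intro holomorphic_intros pole_lemma_open p) auto
  have eq: "p z * (1 - cnj \<alpha> * z) = q z * (z - \<alpha>)" for z
    using \<alpha> by (auto simp: q_def)
  have S: "norm (p w) * norm (1 - cnj \<alpha> * w) \<le> norm (w - \<alpha>)" if w: "norm w < 1" for w
  proof -
    define z where "z = Moebius_function 0 \<alpha> w"
    have z: "norm z < 1" using Moebius_function_norm_lt_1[OF \<alpha>(1) w] by (simp add: z_def)
    have inv: "Moebius_function 0 (-\<alpha>) z = w"
      using Moebius_function_compose[of "-\<alpha>" \<alpha> w] \<alpha> w by (simp add: z_def)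
    have nw: "1 - cnj \<alpha> * w \<noteq> 0"
    proof
      assume "1 - cnj \<alpha> * w = 0"
      then have "norm (cnj \<alpha> * w) = 1" by (metis eq_iff_diff_eq_0 norm_one)
      then show False using \<alpha>(1) w by (metis complex_mod_cnj mult_left_less_imp_less norm_ge_zero norm_mult not_less_iff_gr_or_eq mult.right_neutral less_eq_real_def mult_less_cancel_left2 order_less_trans)
    qed
    have zz: "norm z * norm (1 - cnj \<alpha> * w) = norm (w - \<alpha>)"
      using nw by (simp add: z_def Moebius_function_simple norm_divide)
    \<comment> \<open>The values of p lie in the closed disc, whereas Schwarz's lemma wants the open
      one; hence the factor t < 1, which then tends to 1.\<close>
    have "t * norm (p w) \<le> norm z" if t: "0 < t" "t < 1" for t
    proof -
      have "norm ((\<lambda>z. of_real t * p (Moebius_function 0 (-\<alpha>) z)) z) \<le> norm z"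
      proof (rule Schwarz_Lemma)
        show "(\<lambda>z. of_real t * p (Moebius_function 0 (-\<alpha>) z)) holomorphic_on ball 0 1"
          by (intro holomorphic_intros holomorphic_on_compose_gen[OF Moebius_function_holomorphic p, unfolded o_def])
             (use \<alpha> Moebius_function_norm_lt_1[of "-\<alpha>"] in auto)
        show "of_real t * p (Moebius_function 0 (-\<alpha>) 0) = 0"
          using \<alpha> by (simp add: Moebius_function_simple)
        fix z :: complex assume "norm z < 1"
        then have "norm (p (Moebius_function 0 (-\<alpha>) z)) \<le> 1"
          using le Moebius_function_norm_lt_1[of "-\<alpha>"] \<alpha> by auto
        then have "t * norm (p (Moebius_function 0 (-\<alpha>) z)) \<le> t * 1" using t by (intro mult_left_mono) auto
        then have "t * norm (p (Moebius_function 0 (-\<alpha>) z)) < 1" using t by linarith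
        then show "norm (of_real t * p (Moebius_function 0 (-\<alpha>) z)) < 1"
          using t by (simp add: norm_mult)
      qed (use z in auto)
      then show ?thesis using t by (simp add: inv norm_mult)
    qed
    moreover have "((\<lambda>t. t * norm (p w)) \<longlongrightarrow> 1 * norm (p w)) (at_left 1)"
      by (intro tendsto_intros)
    moreover have "\<forall>\<^sub>F t in at_left (1::real). 0 < t \<and> t < 1"
      using eventually_at_left_real[of 0 1] by (auto elim: eventually_mono)
    ultimately have "norm (p w) \<le> norm z"
      by (metis (no_types, lifting) eventually_mono mult_1 tendsto_upperbound trivial_limit_at_left_real)
    then show ?thesis unfolding zz[symmetric] by (intro mult_right_mono) auto
  qed
  have "norm (q z) \<le> 1" if z: "norm z < 1" for z
  proof -
    have *: "norm (q z) \<le> 1" if "z \<in> ball 0 1" "z \<noteq> \<alpha>" for z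
    proof -
      have "norm (q z) * norm (z - \<alpha>) \<le> 1 * norm (z - \<alpha>)"
        using S[of z] arg_cong[OF eq[of z], of norm] that by (simp add: norm_mult)
      then show ?thesis using that by (simp only: mult_le_cancel_right) auto
    qed
    show ?thesis
    proof (cases "z = \<alpha>")
      case True
      then show ?thesis
        using norm_bound_at_removed_point[OF open_ball holomorphic_on_imp_continuous_on[OF qh], of \<alpha> 1] * \<alpha> by auto
    qed (use * z in auto)
  qed
  with qh eq that show ?thesis by blast
qed

text \<open>Induction on the number of zeros of h in the disc of radius \<rho>, for which
  \<open>norm (h 0) > \<rho> ^ n\<close> is the bookkeeping. A zero \<alpha> is divided out of both
  h and G h, which leaves G unchanged; since |\<alpha>| < \<rho>, the modulus at 0 grows at least by
  the factor 1 / \<rho>, and for n = 0 it would exceed 1. Once no zero is left, Harnack applies to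
  h.\<close>

lemma quotient_bound_disc_aux:
  assumes \<rho>: "0 < \<rho>" "\<rho> < 1" and G: "G holomorphic_on ball 0 1"
    and "h holomorphic_on ball 0 1" "\<And>z. norm z < 1 \<Longrightarrow> norm (h z) \<le> 1"
    "\<And>z. norm z < 1 \<Longrightarrow> norm (G z * h z) \<le> 1" "norm (h 0) > \<rho> ^ n" and w: "norm w < \<rho>"
  shows "norm (G w) \<le> exp (- ln (norm (h 0)) * ((\<rho> + norm w) / (\<rho> - norm w)))"
  using assms(4-7)
proof (induction n arbitrary: h)
  case 0
  then have "norm (h 0) \<le> 1" "norm (h 0) > 1" using 0(2)[of 0] by auto
  then show ?case by linarith
next
  case (Suc n)
  have h0: "h 0 \<noteq> 0" using Suc.prems(4) \<rho> by (metis norm_zero not_less_iff_gr_or_eq order_less_trans zero_less_power)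
  show ?case
  proof (cases "\<exists>\<alpha>. norm \<alpha> < \<rho> \<and> h \<alpha> = 0")
    case False
    then have le: "- ln (norm (h w)) \<le> - ln (norm (h 0)) * ((\<rho> + norm w) / (\<rho> - norm w))"
      using Suc.prems \<rho> w by (intro harnack_zero_free) (auto intro: holomorphic_on_subset)
    have hw: "h w \<noteq> 0" using False w by blast
    from hw have "norm (G w) \<le> 1 / norm (h w)"
      using Suc.prems(3)[of w] w \<rho> hw by (simp add: norm_mult field_simps)
    also have "\<dots> = exp (- ln (norm (h w)))" using hw by (simp add: exp_minus inverse_eq_divide)
    finally show ?thesis using le by (smt (verit) exp_le_cancel_iff)
  next
    case True
    then obtain \<alpha> where \<alpha>: "norm \<alpha> < \<rho>" "h \<alpha> = 0" by blast
    have \<alpha>1: "norm \<alpha> < 1" using \<alpha> \<rho> by linarith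
    have \<alpha>0: "\<alpha> \<noteq> 0" using \<alpha> h0 by auto
    obtain q where q: "q holomorphic_on ball 0 1" "\<And>z. norm z < 1 \<Longrightarrow> norm (q z) \<le> 1"
      "\<And>z. h z * (1 - cnj \<alpha> * z) = q z * (z - \<alpha>)"
      using blaschke_divide[OF Suc.prems(1,2) \<alpha>1 \<alpha>(2)] by blast
    obtain q' where q': "q' holomorphic_on ball 0 1" "\<And>z. norm z < 1 \<Longrightarrow> norm (q' z) \<le> 1"
      "\<And>z. G z * h z * (1 - cnj \<alpha> * z) = q' z * (z - \<alpha>)"
      using blaschke_divide[of "\<lambda>z. G z * h z" \<alpha>] Suc.prems(1,3) G \<alpha>1 \<alpha>(2)
      by (auto intro!: holomorphic_intros)
    have *: "norm (G z * q z) \<le> 1" if "z \<in> ball 0 1" "z \<noteq> \<alpha>" for z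
    proof -
      have "G z * q z * (z - \<alpha>) = q' z * (z - \<alpha>)"
        using q(3)[of z] q'(3)[of z] by (metis mult.assoc)
      then have "G z * q z = q' z" using that by simp
      then show ?thesis using q'(2) that by auto
    qed
    have cGq: "continuous_on (ball 0 1) (\<lambda>z. G z * q z)"
      by (intro continuous_intros holomorphic_on_imp_continuous_on G q(1))
    have Gq\<alpha>: "norm (G \<alpha> * q \<alpha>) \<le> 1"
      by (rule norm_bound_at_removed_point[OF open_ball cGq _ *]) (use \<alpha>1 in auto)
    have Gq: "norm (G z * q z) \<le> 1" if "norm z < 1" for z
      using Gq\<alpha> *[of z] that by (cases "z = \<alpha>") auto
    have q0: "norm (q 0) * norm \<alpha> = norm (h 0)"
      using arg_cong[OF q(3)[of 0], of norm] by (simp add: norm_mult)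
    have q0': "norm (q 0) \<ge> norm (h 0) / \<rho>"
      using \<rho> q0 mult_right_mono[of "norm \<alpha>" \<rho> "norm (q 0)"] \<alpha>
      by (simp add: divide_le_eq mult.commute)
    have "norm (q 0) > \<rho> ^ n"
      using q0' Suc.prems(4) \<rho> by (smt (verit) pos_less_divide_eq power_Suc2)
    then have "norm (G w) \<le> exp (- ln (norm (q 0)) * ((\<rho> + norm w) / (\<rho> - norm w)))"
      by (intro Suc.IH q Gq)
    moreover have "norm (q 0) \<ge> norm (h 0)"
      using q0' \<rho> h0 by (smt (verit) divide_le_eq_1_pos le_divide_eq mult_le_cancel_left1 zero_less_norm_iff)
    then have "- ln (norm (q 0)) \<le> - ln (norm (h 0))"
      using h0 by (subst neg_le_iff_le, subst ln_le_cancel_iff) auto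
    then have "- ln (norm (q 0)) * ((\<rho> + norm w) / (\<rho> - norm w))
        \<le> - ln (norm (h 0)) * ((\<rho> + norm w) / (\<rho> - norm w))"
      using w \<rho> by (intro mult_right_mono) auto
    ultimately show ?thesis by (smt (verit) exp_le_cancel_iff)
  qed
qed

lemma quotient_bound_disc:
  assumes G: "G holomorphic_on ball 0 1"
    and h: "h holomorphic_on ball 0 1" "\<And>z. norm z < 1 \<Longrightarrow> norm (h z) \<le> 1"
    and Gh: "\<And>z. norm z < 1 \<Longrightarrow> norm (G z * h z) \<le> 1" and h0: "h 0 \<noteq> 0" and w: "norm w < 1"
  shows "norm (G w) \<le> exp (- ln (norm (h 0)) * ((1 + norm w) / (1 - norm w)))"
proof -
  let ?f = "\<lambda>\<rho>. exp (- ln (norm (h 0)) * ((\<rho> + norm w) / (\<rho> - norm w)))"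
  have "(?f \<longlongrightarrow> ?f 1) (at_left 1)"
    using w by (intro tendsto_intros) auto
  moreover have "\<forall>\<^sub>F \<rho> in at_left (1::real). norm (G w) \<le> ?f \<rho>"
  proof -
    have "\<forall>\<^sub>F \<rho> in at_left (1::real). \<rho> \<in> {norm w<..<1}"
      using w by (intro eventually_at_left_real) auto
    then show ?thesis
    proof (rule eventually_mono)
      fix \<rho> :: real assume r: "\<rho> \<in> {norm w<..<1}"
      then have r0: "0 < \<rho>" "\<rho> < 1" by (auto intro: le_less_trans[OF norm_ge_zero])
      obtain n where "\<rho> ^ n < norm (h 0)"
        using real_arch_pow_inv[of "norm (h 0)" \<rho>] r0 h0 by auto
      then show "norm (G w) \<le> ?f \<rho>"
        using r by (intro quotient_bound_disc_aux[OF r0 G h Gh]) auto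
    qed
  qed
  ultimately show ?thesis by (intro tendsto_lowerbound[of ?f]) auto
qed

text \<open>A point z0 where the denominator h does not vanish is moved to the centre of the disc
  and the disc estimate is pulled back; for \<open>w = (z - z0) / (z - cnj z0)\<close> the ratio (1
  + |w|) / (1 - |w|) is of order |z + i|^2 / Im z. This growth bound is all that the later arguments
  draw from bounded type.\<close>

lemma bounded_type_growth:
  assumes G: "G holomorphic_on UHP" and bt: "bounded_type_UHP G"
  shows "\<exists>C\<ge>0. \<forall>z. Im z > 0 \<longrightarrow> norm (G z) \<le> exp (C * (norm (z + \<i>))\<^sup>2 / Im z)"
proof -
  obtain g h z0 where gh: "g holomorphic_on UHP" "h holomorphic_on UHP" "bounded (g ` UHP)" "bounded (h ` UHP)"
    and z0: "Im z0 > 0" "h z0 \<noteq> 0" and eq: "\<And>z. Im z > 0 \<Longrightarrow> G z * h z = g z"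
    using bt unfolding bounded_type_UHP_def UHP_def by auto
  obtain B1 where B1: "\<And>z. Im z > 0 \<Longrightarrow> norm (g z) \<le> B1"
    using gh(3) unfolding bounded_iff UHP_def by auto
  obtain B2 where B2: "\<And>z. Im z > 0 \<Longrightarrow> norm (h z) \<le> B2"
    using gh(4) unfolding bounded_iff UHP_def by auto
  define B where "B = max 1 (max B1 B2)"
  have B: "B \<ge> 1" "\<And>z. Im z > 0 \<Longrightarrow> norm (g z) \<le> B" "\<And>z. Im z > 0 \<Longrightarrow> norm (h z) \<le> B"
    using B1 B2 by (force simp: B_def)+
  \<comment> \<open>The Cayley map from the unit disc to the upper half-plane with T 0 = z0.\<close>
  define T where "T = (\<lambda>w. (z0 - cnj z0 * w) / (1 - w))"
  have T1: "1 - w \<noteq> 0" if "norm w < 1" for w :: complex using that by auto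
  have ImT: "Im (T w) > 0" if "norm w < 1" for w
  proof -
    have "Im (T w) = Im ((z0 - cnj z0 * w) * cnj (1 - w)) / (norm (1 - w))\<^sup>2"
      unfolding T_def by (subst complex_div_cnj) (simp add: Im_divide_of_real flip: of_real_power)
    also have "Im ((z0 - cnj z0 * w) * cnj (1 - w)) = Im z0 * (1 - (norm w)\<^sup>2)"
      unfolding cmod_power2 by (simp add: power2_eq_square algebra_simps)
    finally show ?thesis using that z0 T1[OF that] by (simp add: power_less_one_iff abs_square_less_1)
  qed
  have Thol: "T holomorphic_on ball 0 1"
    unfolding T_def by (intro holomorphic_intros) auto
  define M where "M = - ln (norm (h z0 / B))"
  have bnd: "norm (G (T w)) \<le> exp (M * ((1 + norm w) / (1 - norm w)))" if w: "norm w < 1" for w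
  proof -
    have "norm ((\<lambda>w. G (T w)) w) \<le> exp (- ln (norm ((\<lambda>w. h (T w) / B) 0)) * ((1 + norm w) / (1 - norm w)))"
    proof (rule quotient_bound_disc)
      show "(\<lambda>w. G (T w)) holomorphic_on ball 0 1"
        by (rule holomorphic_on_compose_gen[OF Thol G, unfolded o_def]) (use ImT in \<open>auto simp: UHP_def\<close>)
      show "(\<lambda>w. h (T w) / B) holomorphic_on ball 0 1"
        by (intro holomorphic_intros holomorphic_on_compose_gen[OF Thol gh(2), unfolded o_def])
           (use ImT B(1) in \<open>auto simp: UHP_def\<close>)
      show "norm (h (T z) / B) \<le> 1" if "norm z < 1" for z
        using B(1) B(3)[OF ImT[OF that]] by (simp add: norm_divide)
      show "norm (G (T z) * (h (T z) / B)) \<le> 1" if "norm z < 1" for z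
        using B(1) B(2)[OF ImT[OF that]] eq[OF ImT[OF that]] by (simp add: norm_divide)
      show "h (T 0) / B \<noteq> 0" using z0 B(1) by (simp add: T_def)
    qed (use w in auto)
    then show ?thesis by (simp add: M_def T_def)
  qed
  have M0: "M \<ge> 0"
  proof -
    have "norm (h z0 / B) \<le> 1" "norm (h z0 / B) > 0" using B(1) B(3)[OF z0(1)] z0 by (auto simp: norm_divide)
    then show ?thesis unfolding M_def by (metis ln_le_zero_iff neg_0_le_iff_le)
  qed
  define L where "L = 1 + norm (\<i> + cnj z0)"
  have "norm (G z) \<le> exp (M * L\<^sup>2 / Im z0 * (norm (z + \<i>))\<^sup>2 / Im z)" if z: "Im z > 0" for z
  proof -
    define a where "a = norm (z - z0)" 
    define b where "b = norm (z - cnj z0)"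
    have nz: "z - cnj z0 \<noteq> 0" using z z0 by (auto simp: complex_eq_iff)
    have b0: "b > 0" using nz by (simp add: b_def)
    have ba: "b\<^sup>2 - a\<^sup>2 = 4 * (Im z * Im z0)"
      unfolding a_def b_def cmod_power2 by (simp add: power2_eq_square algebra_simps)
    have ab: "a < b"
    proof (rule power_less_imp_less_base)
      have "Im z * Im z0 > 0" using z z0 by simp
      then show "a\<^sup>2 < b\<^sup>2" using ba by linarith
    qed (use b0 in simp)
    define w where "w = (z - z0) / (z - cnj z0)"
    have nw: "norm w = a / b" by (simp add: w_def norm_divide a_def b_def)
    have w1: "norm w < 1" using ab b0 by (simp add: nw)
    have "w * (z - cnj z0) = z - z0" using nz by (simp add: w_def)
    then have "z0 - cnj z0 * w = z * (1 - w)" by (simp add: algebra_simps)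
    then have Tw: "T w = z" using T1[OF w1] by (simp add: T_def)
    have "1 + norm w = (b + a) / b" "1 - norm w = (b - a) / b"
      using b0 by (simp_all add: nw add_divide_distrib diff_divide_distrib)
    then have "(1 + norm w) / (1 - norm w) = (b + a) / (b - a)" using b0 by simp
    \<comment> \<open>Expanding by b + a brings in b^2 - a^2, which equals 4 Im z Im z0 and so is
      explicit, unlike b - a.\<close>
    also have "\<dots> = ((b + a) * (b + a)) / ((b + a) * (b - a))"
      using b0 by (subst mult_divide_mult_cancel_left) (auto simp: a_def add_nonneg_eq_0_iff)
    also have "\<dots> = (b + a)\<^sup>2 / (b\<^sup>2 - a\<^sup>2)"
      by (simp add: power2_eq_square square_diff_square_factored)
    also have "\<dots> \<le> (2 * b)\<^sup>2 / (b\<^sup>2 - a\<^sup>2)"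
      unfolding ba using ab b0 z z0 by (intro divide_right_mono power_mono) (auto simp: a_def)
    also have "\<dots> = b\<^sup>2 / (Im z * Im z0)" unfolding ba by (simp add: power2_eq_square)
    also have "\<dots> \<le> (L * norm (z + \<i>))\<^sup>2 / (Im z * Im z0)"
    proof -
      have "b = norm ((z + \<i>) - (\<i> + cnj z0))" by (simp add: b_def)
      also have "\<dots> \<le> norm (z + \<i>) + norm (\<i> + cnj z0)" by (rule norm_triangle_ineq4)
      also have "\<dots> \<le> norm (z + \<i>) + norm (\<i> + cnj z0) * norm (z + \<i>)"
      proof -
        have "norm (z + \<i>) \<ge> 1" using abs_Im_le_cmod[of "z + \<i>"] z by simp
        then show ?thesis by (simp add: mult_le_cancel_left1)
      qed
      also have "\<dots> = L * norm (z + \<i>)" by (simp add: L_def algebra_simps)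
      finally show ?thesis using z z0 b0 by (intro divide_right_mono power_mono) auto
    qed
    finally have "M * ((1 + norm w) / (1 - norm w)) \<le> M * ((L * norm (z + \<i>))\<^sup>2 / (Im z * Im z0))"
      using M0 by (rule mult_left_mono)
    also have "\<dots> = M * L\<^sup>2 / Im z0 * (norm (z + \<i>))\<^sup>2 / Im z"
      by (simp add: power_mult_distrib mult_ac)
    finally show ?thesis using bnd[OF w1] unfolding Tw by (smt (verit) exp_le_cancel_iff)
  qed
  moreover have "M * L\<^sup>2 / Im z0 \<ge> 0" using M0 z0 by simp
  ultimately show ?thesis by blast
qed

section \<open>Phragmen--Lindelof principles for the half-disc, the quadrant and the
  half-plane\<close>

lemma Re_i_over: "Re (\<i> / w) = Im w / (norm w)\<^sup>2"
  by (simp add: Re_divide cmod_power2)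

text \<open>The quotient Im w / |w|^2 is the real part of i / w. The reciprocal of the half-disc
  majorant is therefore, up to a constant, the modulus of a holomorphic function, by which G can be
  multiplied.\<close>

lemma norm_exp_corner:
  "norm (exp (- (\<i> * of_real k * (1 / (z - of_real R) + 1 / (z + of_real R)))))
     = exp (- (k * (Im z / (norm (z - of_real R))\<^sup>2 + Im z / (norm (z + of_real R))\<^sup>2)))"
proof -
  have "Re (\<i> * of_real k * (1 / (z - of_real R) + 1 / (z + of_real R)))
     = k * (Re (\<i> / (z - of_real R)) + Re (\<i> / (z + of_real R)))"
    by (simp add: Re_divide cmod_power2 algebra_simps add_divide_distrib)
  then show ?thesis unfolding norm_exp_eq_Re Re_i_over by simp
qed

text \<open>With z = x + i y on the arc, |z - R|^2 = 2 R (R - x), |z + R|^2 = 2 R (R + x) and (R -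
  x)(R + x) = y^2. The two corners enter with equal weight so that the sum simplifies.\<close>

lemma corner_on_arc:
  assumes "norm z = R" "Im z > 0"
  shows "Im z / (norm (z - of_real R))\<^sup>2 + Im z / (norm (z + of_real R))\<^sup>2 = 1 / Im z"
proof -
  define x y where "x = Re z" and "y = Im z"
  have R2: "R\<^sup>2 = x\<^sup>2 + y\<^sup>2" using assms(1) unfolding x_def y_def by (metis cmod_power2)
  have R0: "R > 0" using assms by (metis norm_zero order_less_irrefl zero_complex.simps(2) zero_less_norm_iff)
  have y: "y > 0" using assms y_def by simp
  have 1: "(norm (z - of_real R))\<^sup>2 = 2 * R * (R - x)" "(norm (z + of_real R))\<^sup>2 = 2 * R * (R + x)"
    unfolding cmod_power2 using R2 by (auto simp: x_def y_def power2_eq_square algebra_simps)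
  have p: "(R - x) * (R + x) = y\<^sup>2" using R2 by (simp add: power2_eq_square algebra_simps)
  then have nz: "R - x \<noteq> 0" "R + x \<noteq> 0" using y by auto
  have "y / (2 * R * (R - x)) + y / (2 * R * (R + x)) = y / ((R - x) * (R + x))"
    using nz R0 by (simp add: divide_simps) (simp add: algebra_simps)
  also have "\<dots> = 1 / y" unfolding p using y by (simp add: power2_eq_square)
  finally show ?thesis unfolding 1 by (simp add: y_def)
qed

text \<open>The majorant has boundary value \<open>K R\<^sup>2 / Im z\<close> on the arc and \<open>0\<close> on the diameter; at the
  corners, where it is singular, the continuity of \<open>G\<close> takes over.\<close>

lemma half_disc_majorant:
  fixes G :: "complex \<Rightarrow> complex"
  assumes cont: "continuous_on {z. Im z \<ge> 0} G" and holo: "G holomorphic_on UHP"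
    and M: "M > 0" and GR: "\<And>x::real. norm (G (of_real x)) \<le> M"
    and R: "R > 0" and K: "K \<ge> 0"
    and arc: "\<And>z. Im z > 0 \<Longrightarrow> norm z = R \<Longrightarrow> norm (G z) \<le> M * exp (K * R\<^sup>2 / Im z)"
    and z: "Im z > 0" "norm z < R"
  shows "norm (G z) \<le> M * exp (K * R\<^sup>2 * (Im z / (norm (z - of_real R))\<^sup>2 + Im z / (norm (z + of_real R))\<^sup>2))"
proof -
  define e where "e = (\<lambda>z. K * R\<^sup>2 * (Im z / (norm (z - of_real R))\<^sup>2 + Im z / (norm (z + of_real R))\<^sup>2))"
  define f where "f = (\<lambda>z. G z * exp (- (\<i> * of_real (K * R\<^sup>2) * (1 / (z - of_real R) + 1 / (z + of_real R)))))"
  have nf: "norm (f z) = norm (G z) * exp (- e z)" for z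
    unfolding f_def e_def norm_mult norm_exp_corner ..
  have e0: "e z \<ge> 0" if "Im z \<ge> 0" for z using that K by (simp add: e_def)
  have "norm (f z) \<le> M + \<eta>" if \<eta>: "\<eta> > 0" for \<eta>
  proof -
    have near: "\<exists>\<delta>>0. \<forall>w. Im w \<ge> 0 \<longrightarrow> norm (w - of_real x) < \<delta> \<longrightarrow> norm (G w) < M + \<eta>" for x :: real
    proof -
      obtain \<delta> where "\<delta> > 0" "\<And>w. Im w \<ge> 0 \<Longrightarrow> norm (w - of_real x) < \<delta> \<Longrightarrow> norm (G w - G (of_real x)) < \<eta>"
        using cont \<eta> unfolding continuous_on_iff dist_norm by (metis Im_complex_of_real mem_Collect_eq order_refl)
      moreover have "norm (G w) \<le> norm (G w - G (of_real x)) + M" for w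
        using norm_triangle_sub[of "G w" "G (of_real x)"] GR[of x] by linarith
      ultimately show ?thesis by (smt (verit))
    qed
    obtain d1 where d1: "d1 > 0" "\<And>w. Im w \<ge> 0 \<Longrightarrow> norm (w - of_real R) < d1 \<Longrightarrow> norm (G w) < M + \<eta>"
      using near[of R] by blast
    obtain d2 where d2: "d2 > 0" "\<And>w. Im w \<ge> 0 \<Longrightarrow> norm (w - of_real (-R)) < d2 \<Longrightarrow> norm (G w) < M + \<eta>"
      using near[of "-R"] by blast
    have nzR: "z \<noteq> of_real R" "z \<noteq> - of_real R" using z by auto
    have pos: "norm (z - of_real R) > 0" "norm (z + of_real R) > 0"
      using nzR by (auto simp: add_eq_0_iff2)
    define m where "m = min (min d1 d2) (min (norm (z - of_real R)) (norm (z + of_real R)))"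
    have m: "0 < m" "m \<le> d1" "m \<le> d2" "m \<le> norm (z - of_real R)" "m \<le> norm (z + of_real R)"
      using d1(1) d2(1) pos by (auto simp: m_def)
    define \<delta> where "\<delta> = m / 2"
    have \<delta>: "0 < \<delta>" "\<delta> < d1" "\<delta> < d2" "\<delta> < norm (z - of_real R)" "\<delta> < norm (z + of_real R)"
      using m by (simp_all add: \<delta>_def)
    \<comment> \<open>Discs of radius \<delta> about the two corners are cut out, where the
      exponential is singular. On their boundary |G| < M + \<eta> by continuity and the exponential
      factor is at most 1, so only \<eta> is lost.\<close>
    define O' where "O' = {z. Im z > 0 \<and> norm z < R \<and> \<delta> < norm (z - of_real R) \<and> \<delta> < norm (z + of_real R)}"
    define S where "S = {z. Im z \<ge> 0 \<and> norm z \<le> R \<and> \<delta> \<le> norm (z - of_real R) \<and> \<delta> \<le> norm (z + of_real R)}"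
    have opn: "open O'" unfolding O'_def
      by (intro open_Collect_conj open_Collect_less continuous_intros)
    have cls: "closed S" unfolding S_def
      by (intro closed_Collect_conj closed_Collect_le continuous_intros)
    have cl: "closure O' \<subseteq> S"
      by (rule closure_minimal[OF _ cls]) (auto simp: O'_def S_def)
    have nz: "w - of_real R \<noteq> 0" "w + of_real R \<noteq> 0" if "w \<in> S" for w
      using that \<delta>(1) by (auto simp: S_def)
    show ?thesis
    proof (rule maximum_modulus_frontier[of f O' "M + \<eta>" z])
      have "G holomorphic_on O'" by (rule holomorphic_on_subset[OF holo]) (auto simp: O'_def UHP_def)
      moreover have "O' \<subseteq> S" using cl closure_subset by blast
      ultimately show "f holomorphic_on interior O'"
        unfolding interior_open[OF opn] f_def by (intro holomorphic_intros) (use nz in blast)+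
      have "continuous_on (closure O') G"
        by (rule continuous_on_subset[OF cont]) (use cl in \<open>auto simp: S_def\<close>)
      then show "continuous_on (closure O') f"
        unfolding f_def by (intro continuous_intros) (use nz cl in blast)+
      show "bounded O'" by (rule bounded_subset[of "ball 0 R"]) (auto simp: O'_def)
      show "z \<in> O'" using z \<delta> by (simp add: O'_def)
      fix w assume "w \<in> frontier O'"
      then have wS: "w \<in> S" and wO: "w \<notin> O'"
        using cl by (auto simp: frontier_def interior_open[OF opn])
      have f_le: "norm (f w) \<le> norm (G w)"
        unfolding nf using e0[of w] wS by (auto simp: S_def intro: mult_left_le)
      consider "Im w = 0" | "Im w > 0" "norm w = R" | "norm (w - of_real R) = \<delta>" | "norm (w + of_real R) = \<delta>"
        using wS wO unfolding S_def O'_def mem_Collect_eq by fastforce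
      then show "norm (f w) \<le> M + \<eta>"
      proof cases
        case 1
        then have "norm (G w) \<le> M" using GR[of "Re w"] by (metis complex_is_Real_iff of_real_Re)
        then show ?thesis using f_le \<eta> by linarith
      next
        case 2
        have "e w = K * R\<^sup>2 / Im w"
          unfolding e_def corner_on_arc[OF 2(2,1)] by simp
        then have "norm (f w) \<le> M * exp (e w) * exp (- e w)"
          unfolding nf using arc[OF 2] by (intro mult_right_mono) auto
        also have "\<dots> = M" by (simp flip: exp_add add: mult.assoc)
        finally show ?thesis using \<eta> by simp
      next
        case 3
        then show ?thesis using d1(2)[of w] \<delta> f_le wS by (auto simp: S_def)
      next
        case 4
        then show ?thesis using d2(2)[of w] \<delta> f_le wS by (auto simp: S_def)
      qed
    qed
  qed
  then have "norm (f z) \<le> M" by (rule field_le_epsilon)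
  then have "norm (G z) * exp (- e z) * exp (e z) \<le> M * exp (e z)"
    unfolding nf by (intro mult_right_mono) auto
  then show ?thesis by (simp add: e_def mult.assoc flip: exp_add)
qed

text \<open>The half-disc majorant with R tending to infinity: R^2 Im z / |z - R|^2 and its mirror
  image each tend to Im z, whence the factor 2.\<close>

lemma half_plane_limit:
  fixes G :: "complex \<Rightarrow> complex"
  assumes cont: "continuous_on {z. Im z \<ge> 0} G" and holo: "G holomorphic_on UHP"
    and M: "M > 0" and GR: "\<And>x::real. norm (G (of_real x)) \<le> M"
    and \<kappa>: "(\<kappa> \<longlongrightarrow> \<kappa>0) at_top" "\<And>R. R \<ge> 1 \<Longrightarrow> \<kappa> R \<ge> 0"
    and arc: "\<And>R z. R \<ge> 1 \<Longrightarrow> Im z > 0 \<Longrightarrow> norm z = R \<Longrightarrow> norm (G z) \<le> M * exp (\<kappa> R * R\<^sup>2 / Im z)"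
    and z: "Im z > 0"
  shows "norm (G z) \<le> M * exp (2 * \<kappa>0 * Im z)"
proof -
  let ?e = "\<lambda>R. \<kappa> R * (Im z / (norm (z / of_real R - 1))\<^sup>2 + Im z / (norm (z / of_real R + 1))\<^sup>2)"
  have 0: "((\<lambda>R. z / of_real R) \<longlongrightarrow> 0) at_top"
    by (rule tendsto_divide_0[OF tendsto_const]) (simp add: filterlim_of_real_at_infinity filterlim_at_top_imp_at_infinity)
  have "((\<lambda>R. M * exp (?e R)) \<longlongrightarrow> M * exp (\<kappa>0 * (Im z / (norm (0 - 1 :: complex))\<^sup>2 + Im z / (norm (0 + 1 :: complex))\<^sup>2))) at_top"
    by (intro tendsto_intros 0 \<kappa>) auto
  moreover have "\<forall>\<^sub>F R in at_top. norm (G z) \<le> M * exp (?e R)"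
    using eventually_gt_at_top[of "max 1 (norm z)"]
  proof (rule eventually_mono)
    fix R assume R: "max 1 (norm z) < R"
    have sc: "R\<^sup>2 * (Im z / (norm (z - w * of_real R))\<^sup>2) = Im z / (norm (z / of_real R - w))\<^sup>2" for w
    proof -
      have "norm (z / of_real R - w) = norm (z - w * of_real R) / R"
      proof -
        have "z / of_real R - w = (z - w * of_real R) / of_real R" using R by (simp add: diff_divide_distrib)
        then show ?thesis using R by (simp add: norm_divide)
      qed
      then show ?thesis using R by (simp add: power_divide)
    qed
    have "norm (G z) \<le> M * exp (\<kappa> R * R\<^sup>2 * (Im z / (norm (z - of_real R))\<^sup>2 + Im z / (norm (z + of_real R))\<^sup>2))"
      using R by (intro half_disc_majorant cont holo M GR \<kappa> arc z) auto
    also have "\<kappa> R * R\<^sup>2 * (Im z / (norm (z - of_real R))\<^sup>2 + Im z / (norm (z + of_real R))\<^sup>2) = ?e R"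
      by (simp only: distrib_left mult.assoc sc[of 1, unfolded mult_1] sc[of "-1", unfolded mult_minus1 diff_minus_eq_add])
    finally show "norm (G z) \<le> M * exp (?e R)" .
  qed
  ultimately have "norm (G z) \<le> M * exp (\<kappa>0 * (Im z / (norm (0 - 1 :: complex))\<^sup>2 + Im z / (norm (0 + 1 :: complex))\<^sup>2))"
    by (rule tendsto_lowerbound) simp
  then show ?thesis by (simp add: algebra_simps)
qed

text \<open>Growth below exponential order on the arcs makes the limit exponent vanish;
  \<open>Im z \<le> R\<close> converts R into R^2 / Im z.\<close>

lemma half_plane_bounded:
  fixes G :: "complex \<Rightarrow> complex"
  assumes cont: "continuous_on {z. Im z \<ge> 0} G" and holo: "G holomorphic_on UHP"
    and M: "M > 0" and GR: "\<And>x::real. norm (G (of_real x)) \<le> M"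
    and \<kappa>: "(\<kappa> \<longlongrightarrow> 0) at_top" "\<And>R. R \<ge> 1 \<Longrightarrow> \<kappa> R \<ge> 0"
    and arc: "\<And>R z. R \<ge> 1 \<Longrightarrow> Im z > 0 \<Longrightarrow> norm z = R \<Longrightarrow> norm (G z) \<le> M * exp (\<kappa> R * R)"
    and z: "Im z > 0"
  shows "norm (G z) \<le> M"
proof -
  have "norm (G z) \<le> M * exp (2 * 0 * Im z)"
  proof (rule half_plane_limit[OF cont holo M GR \<kappa> _ z])
    fix R :: real and z :: complex assume R: "R \<ge> 1" and z: "Im z > 0" "norm z = R"
    have "Im z \<le> R" using abs_Im_le_cmod[of z] z by simp
    then have "R \<le> R\<^sup>2 / Im z" using z R by (simp add: field_simps power2_eq_square)
    then have "\<kappa> R * R \<le> \<kappa> R * (R\<^sup>2 / Im z)" using \<kappa>(2)[OF R] by (rule mult_left_mono)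
    then have "M * exp (\<kappa> R * R) \<le> M * exp (\<kappa> R * R\<^sup>2 / Im z)" using M by simp
    with arc[OF R z] show "norm (G z) \<le> M * exp (\<kappa> R * R\<^sup>2 / Im z)" by linarith
  qed
  then show ?thesis by simp
qed

text \<open>The square root that maps the closed upper half-plane into the closed first quadrant.
  Multiplication by -i moves the half-plane to the right half-plane, away from the cut of
  \<open>csqrt\<close>, and the factor e^(i pi / 4) turns the image back.\<close>

definition quadrant_root :: "complex \<Rightarrow> complex" where
  "quadrant_root s = ((1 + \<i>) / of_real (sqrt 2)) * csqrt (- \<i> * s)"

lemma quadrant_root_sq: "(quadrant_root s)\<^sup>2 = s"
proof -
  have "((1 + \<i>) / of_real (sqrt 2))\<^sup>2 = \<i>"
    by (simp add: power_divide power2_sum flip: of_real_power)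
  moreover have "(quadrant_root s)\<^sup>2 = ((1 + \<i>) / of_real (sqrt 2))\<^sup>2 * (csqrt (- \<i> * s))\<^sup>2"
    unfolding quadrant_root_def by (rule power_mult_distrib)
  ultimately show ?thesis by (simp only: power2_csqrt) simp
qed

lemma norm_quadrant_root: "norm (quadrant_root s) = sqrt (norm s)"
proof -
  have "(norm (quadrant_root s))\<^sup>2 = norm s" by (metis norm_power quadrant_root_sq)
  then show ?thesis by (metis norm_ge_zero real_sqrt_unique)
qed

lemma quadrant_root_parts:
  assumes "Im s \<ge> 0"
  shows "Re (quadrant_root s) \<ge> 0" "Im (quadrant_root s) \<ge> 0"
    "Im s > 0 \<Longrightarrow> Re (quadrant_root s) > 0" "Im s > 0 \<Longrightarrow> Im (quadrant_root s) > 0"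
proof -
  define p where "p = Re (csqrt (- \<i> * s))"
  define q where "q = Im (csqrt (- \<i> * s))"
  have c: "csqrt (- \<i> * s) = Complex p q" unfolding p_def q_def by (rule complex_surj[symmetric])
  have p0: "p \<ge> 0" unfolding p_def by (rule Re_csqrt)
  have "Re ((Complex p q)\<^sup>2) = Im s" unfolding c[symmetric] by simp
  then have pq: "p\<^sup>2 - q\<^sup>2 = Im s" by (simp add: power2_eq_square)
  have R: "Re (quadrant_root s) = (p - q) / sqrt 2" "Im (quadrant_root s) = (p + q) / sqrt 2"
    unfolding quadrant_root_def c by (simp_all add: Re_divide_of_real Im_divide_of_real)
  have "\<bar>q\<bar> \<le> p" using pq assms p0 by (intro abs_le_square_iff[THEN iffD2, of q p, simplified abs_of_nonneg[OF p0]]) simp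
  then show "Re (quadrant_root s) \<ge> 0" "Im (quadrant_root s) \<ge> 0" unfolding R by auto
  assume s: "Im s > 0"
  have "\<bar>q\<bar> < p"
  proof (rule ccontr)
    assume "\<not> \<bar>q\<bar> < p"
    then have "p\<^sup>2 \<le> q\<^sup>2" using p0 by (intro abs_le_square_iff[THEN iffD1]) auto
    then show False using pq s by simp
  qed
  then show "Re (quadrant_root s) > 0" "Im (quadrant_root s) > 0" unfolding R by auto
qed

lemma quadrant_root_real:
  "(\<exists>x\<ge>0. quadrant_root (of_real t) = of_real x) \<or> (\<exists>y\<ge>0. quadrant_root (of_real t) = \<i> * of_real y)"
proof -
  let ?r = "quadrant_root (of_real t)"
  have "Im (?r\<^sup>2) = 0" unfolding quadrant_root_sq by simp
  then have "Re ?r = 0 \<or> Im ?r = 0" by (auto simp: power2_eq_square)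
  moreover have "Re ?r \<ge> 0" "Im ?r \<ge> 0" using quadrant_root_parts[of "of_real t"] by auto
  ultimately show ?thesis by (metis complex_eq mult_zero_left add_0 add.right_neutral mult.commute mult_zero_right of_real_0)
qed

lemma quadrant_root_cont: "continuous_on {z. Im z \<ge> 0} quadrant_root"
  unfolding quadrant_root_def
proof (intro continuous_intros)
  show "continuous_on {z. Im z \<ge> 0} (\<lambda>s. csqrt (- \<i> * s))"
    unfolding continuous_on_eq_continuous_within
  proof
    fix s assume s: "s \<in> {z. Im z \<ge> 0}"
    show "continuous (at s within {z. Im z \<ge> 0}) (\<lambda>s. csqrt (- \<i> * s))"
    proof (cases "s = 0")
      \<comment> \<open>The origin lies on the cut of \<open>csqrt\<close>, so continuity there is
        read off from the modulus.\<close>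
      case True
      have "((\<lambda>s. csqrt (- \<i> * s)) \<longlongrightarrow> 0) (at 0 within {z. Im z \<ge> 0})"
      proof (rule tendsto_norm_zero_cancel)
        have "((\<lambda>s::complex. sqrt (norm s)) \<longlongrightarrow> sqrt (norm (0::complex))) (at 0 within {z. Im z \<ge> 0})"
          by (intro tendsto_intros)
        then show "((\<lambda>s. norm (csqrt (- \<i> * s))) \<longlongrightarrow> 0) (at 0 within {z. Im z \<ge> 0})"
          by (simp add: norm_mult)
      qed
      then show ?thesis using True by (simp add: continuous_within)
    next
      case False
      have "- \<i> * s \<notin> \<real>\<^sub>\<le>\<^sub>0"
      proof
        assume "- \<i> * s \<in> \<real>\<^sub>\<le>\<^sub>0"
        then have "Re (- \<i> * s) \<le> 0" "Im (- \<i> * s) = 0" by (auto simp: complex_nonpos_Reals_iff)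
        then show False using s False by (auto simp: complex_eq_iff)
      qed
      then show ?thesis
        by (intro continuous_within_compose3[OF continuous_at_csqrt] continuous_intros)
    qed
  qed
qed

lemma quadrant_root_holo: "quadrant_root holomorphic_on UHP"
  unfolding quadrant_root_def
  by (intro holomorphic_intros) (auto simp: UHP_def complex_nonpos_Reals_iff)

text \<open>Opening the quadrant to a half-plane by the square root turns growth exp(K |z|) into
  exp(K sqrt R), which is below exponential order. Exponential type, too much for the half-plane, is
  thus harmless in a quadrant.\<close>

lemma quadrant_bounded:
  assumes cont: "continuous_on {z. Im z \<ge> 0} G" and holo: "G holomorphic_on UHP"
    and N: "N > 0" and GR: "\<And>x::real. x \<ge> 0 \<Longrightarrow> norm (G (of_real x)) \<le> N"
    and GI: "\<And>y::real. y \<ge> 0 \<Longrightarrow> norm (G (\<i> * of_real y)) \<le> N"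
    and K: "K \<ge> 0" and ex: "\<And>z. Im z > 0 \<Longrightarrow> norm (G z) \<le> N * exp (K * norm z)"
    and z: "Im z > 0" "Re z \<ge> 0"
  shows "norm (G z) \<le> N"
proof (cases "Re z = 0")
  case True
  then show ?thesis using GI[of "Im z"] z by (metis complex_eq add_0 less_imp_le mult.commute of_real_0)
next
  case False
  define g where "g = (\<lambda>s. G (quadrant_root s))"
  have "norm (g (z\<^sup>2)) \<le> N"
  proof (rule half_plane_bounded[where G = g and z = "z\<^sup>2" and \<kappa> = "\<lambda>R. K / sqrt R"])
    show "continuous_on {z. Im z \<ge> 0} g" unfolding g_def
      by (rule continuous_on_compose2[OF cont quadrant_root_cont]) (use quadrant_root_parts in auto)
    show "g holomorphic_on UHP" unfolding g_def
      by (rule holomorphic_on_compose_gen[OF quadrant_root_holo holo, unfolded o_def])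
         (use quadrant_root_parts in \<open>auto simp: UHP_def\<close>)
    show "norm (g (of_real x)) \<le> N" for x
      using quadrant_root_real[of x] GR GI unfolding g_def by auto
    show "((\<lambda>R. K / sqrt R) \<longlongrightarrow> 0) at_top"
      by (rule tendsto_divide_0[OF tendsto_const])
         (rule filterlim_at_top_imp_at_infinity[OF sqrt_at_top])
    show "K / sqrt R \<ge> 0" if "R \<ge> 1" for R using K that by auto
    show "norm (g s) \<le> N * exp (K / sqrt R * R)" if "R \<ge> 1" "Im s > 0" "norm s = R" for R s
    proof -
      have "norm (g s) \<le> N * exp (K * sqrt R)"
        unfolding g_def using ex[of "quadrant_root s"] quadrant_root_parts[of s] that
        by (simp add: norm_quadrant_root)
      also have "K * sqrt R = K / sqrt R * R" using that(1) by (simp add: real_div_sqrt field_simps)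
      finally show ?thesis .
    qed
    show "0 < Im (z\<^sup>2)" using z False by (simp add: power2_eq_square)
  qed (use N in auto)
  moreover have "quadrant_root (z\<^sup>2) = z"
  proof -
    have "quadrant_root (z\<^sup>2) = z \<or> quadrant_root (z\<^sup>2) = - z"
      using quadrant_root_sq[of "z\<^sup>2"] by (simp add: power2_eq_iff)
    moreover have "Im (quadrant_root (z\<^sup>2)) > 0"
      using z False by (intro quadrant_root_parts) (auto simp: power2_eq_square)
    ultimately show ?thesis using z by auto
  qed
  ultimately show ?thesis by (simp add: g_def)
qed

text \<open>Makes the left quadrant accessible to the statement about the right one.\<close>

lemma holomorphic_reflect_imag_axis:
  assumes "f holomorphic_on UHP"
  shows "(\<lambda>z. cnj (f (- cnj z))) holomorphic_on UHP"
proof -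
  have "(\<lambda>z. f (- z)) holomorphic_on (\<lambda>z. - z) ` UHP"
    by (rule holomorphic_on_compose_gen[OF _ assms, unfolded o_def]) (auto intro: holomorphic_intros)
  moreover have "(\<lambda>z. - z) ` UHP = cnj ` UHP"
  proof -
    have "z \<in> (\<lambda>z. - z) ` UHP \<longleftrightarrow> Im z < 0" for z
      by (auto simp: UHP_def image_iff intro!: exI[of _ "-z"])
    moreover have "z \<in> cnj ` UHP \<longleftrightarrow> Im z < 0" for z
      by (auto simp: UHP_def image_iff intro!: exI[of _ "cnj z"])
    ultimately show ?thesis by blast
  qed
  ultimately have "(cnj \<circ> (\<lambda>z. f (- z)) \<circ> cnj) holomorphic_on UHP"
    by (intro holomorphic_on_compose_cnj_cnj) (auto simp: UHP_def open_halfspace_Im_gt)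
  then show ?thesis by (simp add: o_def)
qed

text \<open>The crude growth bound is first improved to exponential type. Damping by exp(i
  \<epsilon> z) makes the function bounded on the imaginary axis, so each quadrant has bounded
  boundary values and the damped function is bounded in the half-plane. A further application
  replaces that bound by M, and \<epsilon> tends to 0.\<close>

lemma phragmen_lindelof_half_plane:
  fixes G :: "complex \<Rightarrow> complex"
  assumes cont: "continuous_on {z. Im z \<ge> 0} G" and holo: "G holomorphic_on UHP"
    and M: "M > 0" and GR: "\<And>x::real. norm (G (of_real x)) \<le> M"
    and C: "C \<ge> 0" "\<And>z. Im z > 0 \<Longrightarrow> norm (G z) \<le> exp (C * (norm (z + \<i>))\<^sup>2 / Im z)"
    and mt: "\<And>\<epsilon>. \<epsilon> > 0 \<Longrightarrow> \<exists>N. \<forall>y\<ge>0. norm (G (\<i> * of_real y)) \<le> N * exp (\<epsilon> * y)"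
    and z: "Im z > 0"
  shows "norm (G z) \<le> M"
proof -
  \<comment> \<open>The summand 4 C comes from |z + i| \<le> 2 R; |ln M| absorbs the factor M, since
    R^2 / Im z \<ge> 1 on the arc.\<close>
  define K where "K = 4 * C + \<bar>ln M\<bar>"
  have K: "K \<ge> 0" using C by (simp add: K_def)
  have expo: "norm (G w) \<le> M * exp (2 * K * Im w)" if "Im w > 0" for w
  proof (rule half_plane_limit[OF cont holo M GR tendsto_const _ _ that])
    fix R :: real and z assume R: "R \<ge> 1" and z: "Im z > 0" "norm z = R"
    have yR: "Im z \<le> R" using abs_Im_le_cmod[of z] z by simp
    then have q: "R\<^sup>2 / Im z \<ge> 1" using z R
      by (simp add: power2_eq_square) (metis mult_left_mono order_trans mult.right_neutral less_eq_real_def zero_less_one order_less_le_trans)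
    have "norm (z + \<i>) \<le> 2 * R" using norm_triangle_ineq[of z \<i>] z R by simp
    then have "(norm (z + \<i>))\<^sup>2 \<le> (2 * R)\<^sup>2" by (intro power_mono) auto
    then have "C * (norm (z + \<i>))\<^sup>2 / Im z \<le> C * (2 * R)\<^sup>2 / Im z"
      using C z by (intro divide_right_mono mult_left_mono) auto
    also have "\<dots> = 4 * C * (R\<^sup>2 / Im z)" by simp
    also have "\<dots> \<le> ln M + K * (R\<^sup>2 / Im z)"
      using mult_left_mono[OF q, of "\<bar>ln M\<bar>"] by (simp add: K_def algebra_simps)
    finally have "norm (G z) \<le> exp (ln M + K * (R\<^sup>2 / Im z))"
      using C(2)[OF z(1)] by (smt (verit) exp_le_cancel_iff)
    then show "norm (G z) \<le> M * exp (K * R\<^sup>2 / Im z)"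
      using M by (simp add: exp_add)
  qed (use K in auto)
  have "norm (G z) \<le> M * exp (\<epsilon> * Im z)" if e: "\<epsilon> > 0" for \<epsilon>
  proof -
    define H where "H = (\<lambda>z. G z * exp (\<i> * of_real \<epsilon> * z))"
    have nH: "norm (H z) = norm (G z) * exp (- \<epsilon> * Im z)" for z
      unfolding H_def norm_mult norm_exp_eq_Re by simp
    have Hc: "continuous_on {z. Im z \<ge> 0} H" unfolding H_def by (intro continuous_intros cont)
    have Hh: "H holomorphic_on UHP" unfolding H_def by (intro holomorphic_intros holo)
    obtain N where N: "\<And>y. y \<ge> 0 \<Longrightarrow> norm (G (\<i> * of_real y)) \<le> N * exp (\<epsilon> * y)"
      using mt[OF e] by blast
    define L where "L = max M N"
    have L: "L \<ge> M" "L \<ge> N" "L > 0" using M by (auto simp: L_def)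
    have HR: "norm (H (of_real x)) \<le> M" for x using GR by (simp add: nH)
    have HI: "norm (H (\<i> * of_real y)) \<le> L" if "y \<ge> 0" for y
    proof -
      have "norm (H (\<i> * of_real y)) \<le> N * exp (\<epsilon> * y) * exp (- \<epsilon> * y)"
        using N[OF that] by (simp add: nH)
      also have "\<dots> = N" by (simp flip: exp_add add: mult.assoc)
      finally show ?thesis using L by simp
    qed
    have Hex: "norm (H w) \<le> L * exp (2 * K * norm w)" if "Im w > 0" for w
    proof -
      have "norm (H w) \<le> norm (G w)" unfolding nH using e that by (intro mult_left_le) auto
      also have "\<dots> \<le> M * exp (2 * K * Im w)" by (rule expo[OF that])
      also have "\<dots> \<le> L * exp (2 * K * norm w)"
        using L M K abs_Im_le_cmod[of w] by (intro mult_mono) (auto intro!: mult_left_mono)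
      finally show ?thesis .
    qed
    have HL: "norm (H w) \<le> L" if w: "Im w > 0" for w
    proof (cases "Re w \<ge> 0")
      case True
      show ?thesis
        by (rule quadrant_bounded[OF Hc Hh L(3) _ HI _ Hex w True])
           (use HR L K in \<open>auto intro: order_trans\<close>)
    next
      case False
      have "norm (cnj (H (- cnj (- cnj w)))) \<le> L"
      proof (rule quadrant_bounded[where G = "\<lambda>z. cnj (H (- cnj z))" and z = "- cnj w" and K = "2 * K"])
        show "continuous_on {z. 0 \<le> Im z} (\<lambda>z. cnj (H (- cnj z)))"
          by (intro continuous_intros continuous_on_compose2[OF Hc]) auto
        show "(\<lambda>z. cnj (H (- cnj z))) holomorphic_on UHP" by (rule holomorphic_reflect_imag_axis[OF Hh])
        show "norm (cnj (H (- cnj (of_real x)))) \<le> L" for x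
          using HR[of "-x"] L by simp
        show "norm (cnj (H (- cnj (\<i> * of_real y)))) \<le> L" if "y \<ge> 0" for y using HI[OF that] by simp
        show "norm (cnj (H (- cnj z))) \<le> L * exp (2 * K * norm z)" if "Im z > 0" for z
          using Hex[of "- cnj z"] that by simp
      qed (use L K w False in auto)
      then show ?thesis by simp
    qed
    \<comment> \<open>Relative to M, the constant bound L corresponds to the exponent \<kappa> R =
      ln (L / M) / R, which tends to 0.\<close>
    have "norm (H z) \<le> M"
    proof (rule half_plane_bounded[OF Hc Hh M HR, where \<kappa> = "\<lambda>R. ln (L / M) / R"])
      show "((\<lambda>R. ln (L / M) / R) \<longlongrightarrow> 0) at_top"
        by (rule tendsto_divide_0[OF tendsto_const]) (rule filterlim_at_top_imp_at_infinity[OF filterlim_ident])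
      show "0 \<le> ln (L / M) / R" if "R \<ge> 1" for R using that L M by simp
      show "norm (H w) \<le> M * exp (ln (L / M) / R * R)" if "R \<ge> 1" "Im w > 0" for R w
        using HL[OF that(2)] that(1) L M by simp
    qed (use z in auto)
    then have "norm (G z) * exp (- \<epsilon> * Im z) * exp (\<epsilon> * Im z) \<le> M * exp (\<epsilon> * Im z)"
      unfolding nH by (intro mult_right_mono) auto
    then show ?thesis by (simp flip: exp_add add: mult.assoc)
  qed
  moreover have "((\<lambda>\<epsilon>. M * exp (\<epsilon> * Im z)) \<longlongrightarrow> M * exp (0 * Im z)) (at_right 0)"
    by (intro tendsto_intros)
  moreover have "\<forall>\<^sub>F \<epsilon> in at_right (0::real). \<epsilon> > 0" by (rule eventually_at_right_less)
  ultimately have "norm (G z) \<le> M * exp (0 * Im z)"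
    by (intro tendsto_lowerbound[of "\<lambda>\<epsilon>. M * exp (\<epsilon> * Im z)" _ "at_right 0"]) (auto elim: eventually_mono)
  then show ?thesis by simp
qed

section \<open>Hardy space of the half-plane\<close>

abbreviation CUHP :: "complex set" where "CUHP \<equiv> {z. Im z \<ge> 0}"

text \<open>The Hardy space H^2 of the half-plane, for functions continuous up to the boundary.
  Membership is encoded by square integrable boundary values together with two growth conditions,
  since these are what bounded type and nonpositive mean type supply directly.\<close>

definition hardy :: "(complex \<Rightarrow> complex) \<Rightarrow> bool" where
  "hardy f \<longleftrightarrow> continuous_on CUHP f \<and> f holomorphic_on UHP
     \<and> integrable lborel (\<lambda>t::real. (norm (f (of_real t)))\<^sup>2)
     \<and> (\<exists>C\<ge>0. \<forall>z. Im z > 0 \<longrightarrow> norm (f z) \<le> exp (C * (norm (z + \<i>))\<^sup>2 / Im z))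
     \<and> (\<forall>\<epsilon>>0. \<exists>N. \<forall>y\<ge>0. norm (f (\<i> * of_real y)) \<le> N * exp (\<epsilon> * y))"

lemma hardy_continuous_real: "hardy f \<Longrightarrow> continuous_on UNIV (\<lambda>t::real. f (of_real t))"
  unfolding hardy_def by (auto intro!: continuous_on_compose2[of CUHP f] continuous_intros)

lemma hardy_L2: "hardy f \<Longrightarrow> (\<lambda>t::real. f (of_real t)) \<in> L2 lborel"
  using borel_measurable_continuous_onI[OF hardy_continuous_real]
  by (auto simp: hardy_def L2_def)

lemma le_exp_self: "x \<le> exp (x::real)"
  using exp_ge_add_one_self[of x] by linarith

text \<open>The function s + 2 + 1 / s decreases up to s = 1 and increases afterwards. So along the
  segment from i y to i the growth exponent is largest at i y.\<close>

lemma growth_exponent_segment: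
  fixes s y :: real
  assumes "s > 0" "y > 0" "(1 \<le> s \<and> s \<le> y) \<or> (y \<le> s \<and> s \<le> 1)"
  shows "(s + 1)\<^sup>2 / s \<le> (y + 1)\<^sup>2 / y"
proof -
  have "(y + 1)\<^sup>2 / y - (s + 1)\<^sup>2 / s = (y - s) * (s * y - 1) / (s * y)"
    using assms(1,2) by (simp add: field_simps power2_eq_square)
  moreover have "(y - s) * (s * y - 1) \<ge> 0"
    using assms(3)
  proof
    assume a: "1 \<le> s \<and> s \<le> y"
    then have "1 * 1 \<le> s * y" by (intro mult_mono) auto
    then show ?thesis using a by simp
  next
    assume a: "y \<le> s \<and> s \<le> 1"
    then have "s * y \<le> 1 * 1" using assms by (intro mult_mono) auto
    then show ?thesis using a by (simp add: mult_nonpos_nonpos)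
  qed
  ultimately show ?thesis using assms(1,2) by (smt (verit) divide_nonneg_pos mult_pos_pos)
qed

text \<open>A primitive of \<open>f\<close> is bounded on the real line up to the factor \<open>\<bar>x\<bar>\<^sup>1\<^sup>/\<^sup>2\<close>, so that the
  Phragmen--Lindelof principle applies to it although \<open>f\<close> itself need not be bounded there.\<close>

lemma hardy_primitive:
  assumes f: "hardy f"
  shows "\<exists>J \<Phi>. J > 0 \<and> (\<forall>z. Im z \<ge> 0 \<longrightarrow> (\<Phi> has_field_derivative f z) (at z within CUHP))
    \<and> (\<forall>x x'. norm (\<Phi> (of_real x) - \<Phi> (of_real x')) \<le> sqrt (J * \<bar>x - x'\<bar>))
    \<and> (\<forall>z. Im z > 0 \<longrightarrow> norm (\<Phi> z - \<Phi> (of_real (Re z))) \<le> sqrt (2 * J * Im z))"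
proof -
  have cont: "continuous_on CUHP f" and holo: "f holomorphic_on UHP" using f by (auto simp: hardy_def)
  obtain C where C: "C \<ge> 0" "\<And>z. Im z > 0 \<Longrightarrow> norm (f z) \<le> exp (C * (norm (z + \<i>))\<^sup>2 / Im z)"
    using f by (auto simp: hardy_def)
  have mt: "\<exists>N. \<forall>y\<ge>0. norm (f (\<i> * of_real y)) \<le> N * exp (\<epsilon> * y)" if "\<epsilon> > 0" for \<epsilon>
    using f that by (auto simp: hardy_def)
  have cvx: "convex CUHP" by (rule convex_halfspace_Im_ge)
  have int: "interior CUHP = UHP"
    unfolding UHP_def using interior_halfspace_ge[of \<i> 0] by (simp add: inner_complex_def)
  obtain \<Phi> where \<Phi>: "\<And>z. z \<in> CUHP \<Longrightarrow> (\<Phi> has_field_derivative f z) (at z within CUHP)"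
  proof (rule holomorphic_convex_primitive[OF cvx finite.emptyI cont])
    fix x assume "x \<in> interior CUHP - {}"
    then show "f field_differentiable at x"
      using holo unfolding int by (auto simp: UHP_def open_halfspace_Im_gt intro!: holomorphic_on_imp_differentiable_at)
  qed blast
  have \<Phi>c: "continuous_on CUHP \<Phi>" using \<Phi> by (intro DERIV_continuous_on) auto
  have \<Phi>h: "\<Phi> holomorphic_on UHP"
  proof -
    have "(\<Phi> has_field_derivative f z) (at z within UHP)" if "z \<in> UHP" for z
      using \<Phi>[of z] that by (auto intro: has_field_derivative_subset simp: UHP_def)
    then show ?thesis unfolding holomorphic_on_def field_differentiable_def by blast
  qed
  \<comment> \<open>The summand 1 keeps J, and with it the bound M below, positive.\<close>
  define J where "J = L2.nrm2 lborel (\<lambda>t. f (of_real t)) + 1"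
  have J: "J > 0" using L2.nrm2_ge_0[OF hardy_L2[OF f]] by (simp add: J_def)
  have real_le: "norm (\<Phi> (of_real x') - \<Phi> (of_real x)) \<le> sqrt (J * (x' - x))" if "x \<le> x'" for x x'
  proof -
    have fr: "(\<lambda>t::real. f (of_real t)) \<in> L2 lborel" by (rule hardy_L2[OF f])
    have n2: "(\<lambda>t. (norm (indicator {x..x'} t :: complex))\<^sup>2) = (indicator {x..x'} :: real \<Rightarrow> real)"
      by (auto simp: indicator_def)
    have ind: "(\<lambda>t::real. indicator {x..x'} t :: complex) \<in> L2 lborel"
      unfolding L2_def mem_Collect_eq n2 by (auto intro!: integrable_real_indicator simp: emeasure_lborel_Icc_eq)
    have "\<Phi> (of_real x') - \<Phi> (of_real x) = (\<integral>t. indicator {x..x'} t *\<^sub>R f (of_real t) \<partial>lborel)"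
    proof (rule integral_FTC_atLeastAtMost[symmetric, OF that])
      fix t assume "x \<le> t" "t \<le> x'"
      have "((\<Phi> \<circ> of_real) has_vector_derivative (1 * f (of_real t))) (at t within {x..x'})"
        by (rule field_vector_diff_chain_within)
           (auto intro!: derivative_eq_intros has_field_derivative_subset[OF \<Phi>])
      then show "((\<lambda>t. \<Phi> (of_real t)) has_vector_derivative f (of_real t)) (at t within {x..x'})"
        by (simp add: o_def)
    qed (rule continuous_on_subset[OF hardy_continuous_real[OF f]], simp)
    also have "\<dots> = ip2 lborel (\<lambda>t. f (of_real t)) (\<lambda>t. indicator {x..x'} t)"
      unfolding ip2_def by (rule Bochner_Integration.integral_cong) (auto simp: indicator_def)
    also have "norm \<dots> \<le> L2.nrm lborel (\<lambda>t. f (of_real t)) * L2.nrm lborel (\<lambda>t. indicator {x..x'} t)"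
      by (rule L2.CS[OF fr ind])
    also have "L2.nrm lborel (\<lambda>t. indicator {x..x'} t) = sqrt (x' - x)"
      unfolding L2.nrm_def L2_nrm2 n2 using that by simp
    also have "L2.nrm lborel (\<lambda>t. f (of_real t)) * sqrt (x' - x) \<le> sqrt J * sqrt (x' - x)"
      using that by (intro mult_right_mono) (auto simp: L2.nrm_def J_def)
    finally show ?thesis by (simp add: real_sqrt_mult)
  qed
  have real_bd: "norm (\<Phi> (of_real x) - \<Phi> (of_real x')) \<le> sqrt (J * \<bar>x - x'\<bar>)" for x x'
    using real_le[of x x'] real_le[of x' x] by (cases "x \<le> x'") (auto simp: norm_minus_commute abs_if)
  have up: "norm (\<Phi> z - \<Phi> (of_real (Re z))) \<le> sqrt (2 * J * Im z)" if z: "Im z > 0" for z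
  proof -
    define x0 where "x0 = Re z"
    define \<eta> where "\<eta> = Im z"
    have \<eta>: "\<eta> > 0" using z by (simp add: \<eta>_def)
    \<comment> \<open>D vanishes at the conjugate of z, below the axis. Dividing by it makes the
      square-root growth of \<Phi> on the line bounded, and at z itself it costs only |D z| = 2
      \<eta>.\<close>
    define D where "D = (\<lambda>w. w - of_real x0 + \<i> * of_real \<eta>)"
    have D: "norm (D w) \<ge> \<eta>" if "Im w \<ge> 0" for w
      using abs_Im_le_cmod[of "D w"] that \<eta> by (simp add: D_def)
    have D0: "D w \<noteq> 0" if "Im w \<ge> 0" for w using D[OF that] \<eta> by auto
    define Q where "Q = (\<lambda>w. (\<Phi> w - \<Phi> (of_real x0)) / D w)"
    define M where "M = sqrt J / sqrt (2 * \<eta>)"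
    have M: "M > 0" using J \<eta> by (simp add: M_def)
    define c where "c = norm (\<Phi> \<i> - \<Phi> (of_real x0))"
    have c0: "c \<ge> 0" by (simp add: c_def)
    have "norm (Q z) \<le> M"
    \<comment> \<open>In the exponent, C is the growth of f, 2 pays for the two legs of the path
      from w to i y to i, c for the step from i to the base point, and 1 / \<eta> for the
      denominator D.\<close>
    proof (rule phragmen_lindelof_half_plane[where G = Q and z = z and C = "C + 2 + c + 1 / \<eta>"])
      show "continuous_on CUHP Q" unfolding Q_def D_def
        by (intro continuous_intros \<Phi>c) (use D0 in \<open>auto simp: D_def\<close>)
      show "Q holomorphic_on UHP" unfolding Q_def D_def
        by (intro holomorphic_intros \<Phi>h) (use D0 in \<open>auto simp: D_def UHP_def\<close>)
      show "norm (Q (of_real x)) \<le> M" for x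
      proof -
        have "norm (\<Phi> (of_real x) - \<Phi> (of_real x0)) \<le> sqrt J * sqrt \<bar>x - x0\<bar>"
          using real_bd[of x x0] by (simp add: real_sqrt_mult)
        also have "\<dots> = M * sqrt (2 * \<eta> * \<bar>x - x0\<bar>)"
          using \<eta> by (simp add: M_def real_sqrt_mult)
        \<comment> \<open>Arithmetic-geometric mean: 2 \<eta> |x - x0| \<le> (x - x0)^2 + \<eta>^2.
          This fixes the constant in M.\<close>
        also have "sqrt (2 * \<eta> * \<bar>x - x0\<bar>) \<le> norm (D (of_real x))"
          using sum_squares_bound[of "\<bar>x - x0\<bar>" \<eta>]
          unfolding cmod_def by (simp add: D_def mult_ac)
        finally have "norm (\<Phi> (of_real x) - \<Phi> (of_real x0)) \<le> M * norm (D (of_real x))"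
          using M by simp
        then show ?thesis using D0[of "of_real x"] by (simp add: Q_def norm_divide divide_le_eq)
      qed
      show "C + 2 + c + 1 / \<eta> \<ge> 0" using C c0 \<eta> by simp
      show "norm (Q w) \<le> exp ((C + 2 + c + 1 / \<eta>) * (norm (w + \<i>))\<^sup>2 / Im w)" if w: "Im w > 0" for w
      proof -
        define y where "y = Im w"
        define x where "x = Re w"
        have y: "y > 0" using w by (simp add: y_def)
        define T where "T = (norm (w + \<i>))\<^sup>2 / y"
        have nw: "(norm (w + \<i>))\<^sup>2 = x\<^sup>2 + (y + 1)\<^sup>2" unfolding cmod_power2 by (simp add: x_def y_def)
        have T1: "T \<ge> (y + 1)\<^sup>2 / y" unfolding T_def nw using y by (intro divide_right_mono) auto
        have "(y + 1)\<^sup>2 / y = y + 2 + 1 / y" using y by (simp add: field_simps power2_eq_square)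
        then have T2: "T \<ge> y + 2" using T1 y by (smt (verit) divide_pos_pos)
        have T3: "\<bar>x\<bar> \<le> T"
        proof -
          have "2 * \<bar>x\<bar> * (y + 1) \<le> x\<^sup>2 + (y + 1)\<^sup>2" using sum_squares_bound[of "\<bar>x\<bar>" "y + 1"] by simp
          moreover have "\<bar>x\<bar> * y \<le> 2 * \<bar>x\<bar> * (y + 1)" using y by (simp add: algebra_simps)
          ultimately have "\<bar>x\<bar> * y \<le> (norm (w + \<i>))\<^sup>2" unfolding nw by linarith
          then show ?thesis using y by (simp add: T_def field_simps)
        qed
        define B where "B = exp (C * T)"
        have B: "B > 0" by (simp add: B_def)
        \<comment> \<open>Mean value estimate along segments on which the growth exponent stays
          below its value T at w.\<close>
        have seg: "norm (\<Phi> p - \<Phi> q) \<le> B * norm (p - q)"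
          if sg: "\<And>v. v \<in> closed_segment p q \<Longrightarrow> Im v > 0 \<and> (norm (v + \<i>))\<^sup>2 / Im v \<le> T" for p q
        proof (rule field_differentiable_bound[of "closed_segment p q" \<Phi> f])
          show "(\<Phi> has_field_derivative f v) (at v within closed_segment p q)" if v: "v \<in> closed_segment p q" for v
          proof (rule has_field_derivative_subset[OF \<Phi>])
            show "closed_segment p q \<subseteq> CUHP" using sg by (auto intro: less_imp_le)
          qed (use sg[OF v] in auto)
          show "norm (f v) \<le> B" if v: "v \<in> closed_segment p q" for v
          proof -
            have "C * ((norm (v + \<i>))\<^sup>2 / Im v) \<le> C * T" using sg[OF v] C by (intro mult_left_mono) auto
            then have "C * (norm (v + \<i>))\<^sup>2 / Im v \<le> C * T" by simp
            then have "exp (C * (norm (v + \<i>))\<^sup>2 / Im v) \<le> B" unfolding B_def exp_le_cancel_iff .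
            then show ?thesis using C(2)[of v] sg[OF v] by linarith
          qed
        qed auto
        have h1: "norm (\<Phi> w - \<Phi> (\<i> * of_real y)) \<le> B * \<bar>x\<bar>"
        proof -
          have "norm (\<Phi> w - \<Phi> (\<i> * of_real y)) \<le> B * norm (w - \<i> * of_real y)"
          proof (rule seg)
            fix v assume "v \<in> closed_segment w (\<i> * of_real y)"
            then obtain u where u: "0 \<le> u" "u \<le> 1" "v = (1 - u) *\<^sub>R w + u *\<^sub>R (\<i> * of_real y)"
              by (auto simp: in_segment)
            have Iv: "Im v = y" and Rv: "Re v = (1 - u) * x" by (simp_all add: u(3) x_def y_def algebra_simps)
            have "((1 - u) * x)\<^sup>2 \<le> x\<^sup>2"
              using u by (intro abs_le_square_iff[THEN iffD1]) (auto simp: abs_mult mult_left_le_one_le)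
            then have "(norm (v + \<i>))\<^sup>2 \<le> (norm (w + \<i>))\<^sup>2"
              unfolding nw unfolding cmod_power2 using Iv Rv by simp
            then show "Im v > 0 \<and> (norm (v + \<i>))\<^sup>2 / Im v \<le> T"
              using y Iv by (auto simp: T_def intro: divide_right_mono)
          qed
          also have "w - \<i> * of_real y = of_real x" by (simp add: complex_eq_iff x_def y_def)
          finally show ?thesis by simp
        qed
        have h2: "norm (\<Phi> (\<i> * of_real y) - \<Phi> \<i>) \<le> B * \<bar>y - 1\<bar>"
        proof -
          have "norm (\<Phi> (\<i> * of_real y) - \<Phi> \<i>) \<le> B * norm (\<i> * of_real y - \<i>)"
          proof (rule seg)
            fix v assume "v \<in> closed_segment (\<i> * of_real y) \<i>"
            then obtain u where u: "0 \<le> u" "u \<le> 1" "v = (1 - u) *\<^sub>R (\<i> * of_real y) + u *\<^sub>R \<i>"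
              by (auto simp: in_segment)
            define s where "s = (1 - u) * y + u"
            have v: "v = \<i> * of_real s" by (simp add: u(3) s_def complex_eq_iff)
            have s0: "s > 0"
              using u y unfolding s_def by (cases "u = 1") (auto intro!: add_pos_nonneg)
            have "(1 \<le> s \<and> s \<le> y) \<or> (y \<le> s \<and> s \<le> 1)"
            proof (cases "y \<ge> 1")
              case True
              have "(1 - u) * (y - 1) \<ge> 0" "u * (y - 1) \<ge> 0" using True u by auto
              then show ?thesis by (auto simp: s_def algebra_simps)
            next
              case False
              have "(1 - u) * (1 - y) \<ge> 0" "u * (1 - y) \<ge> 0" using False u by auto
              then show ?thesis by (auto simp: s_def algebra_simps)
            qed
            from growth_exponent_segment[OF s0 y this] T1
            have "(s + 1)\<^sup>2 / s \<le> T" by linarith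
            moreover have "(norm (v + \<i>))\<^sup>2 = (s + 1)\<^sup>2" unfolding cmod_power2 by (simp add: v)
            ultimately show "Im v > 0 \<and> (norm (v + \<i>))\<^sup>2 / Im v \<le> T" using s0 by (simp add: v)
          qed
          also have "norm (\<i> * of_real y - \<i>) = \<bar>y - 1\<bar>"
          proof -
            have "\<i> * of_real y - \<i> = \<i> * of_real (y - 1)" by (simp add: algebra_simps)
            then show ?thesis by (simp only: norm_mult norm_of_real norm_ii mult_1_left)
          qed
          finally show ?thesis .
        qed
        have "norm (\<Phi> w - \<Phi> (of_real x0)) \<le> norm (\<Phi> w - \<Phi> (\<i> * of_real y)) + norm (\<Phi> (\<i> * of_real y) - \<Phi> \<i>) + c"
          unfolding c_def by norm
        also have "\<dots> \<le> B * T + B * T + c"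
        proof -
          have "B * \<bar>x\<bar> \<le> B * T" using T3 B by simp
          moreover have "B * \<bar>y - 1\<bar> \<le> B * T" using T2 B y by (intro mult_left_mono) auto
          ultimately show ?thesis using h1 h2 by linarith
        qed
        also have "\<dots> \<le> B * T + B * T + c * (B * T)"
        proof -
          have "1 \<le> B" using C T2 y by (simp add: B_def)
          then have "1 * 1 \<le> B * T" using T2 y by (intro mult_mono) auto
          then have "c * 1 \<le> c * (B * T)" using c0 by (intro mult_left_mono) auto
          then show ?thesis by simp
        qed
        also have "\<dots> = B * ((2 + c) * T)" by (simp add: algebra_simps)
        also have "\<dots> \<le> B * exp ((2 + c) * T)" using B by (intro mult_left_mono le_exp_self) auto
        finally have 1: "norm (\<Phi> w - \<Phi> (of_real x0)) \<le> B * exp ((2 + c) * T)" .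
        have "norm (Q w) \<le> B * exp ((2 + c) * T) / \<eta>"
          unfolding Q_def norm_divide using 1 D[of w] w \<eta> B by (intro frac_le) auto
        also have "\<dots> = B * exp ((2 + c) * T) * (1 / \<eta>)" by simp
        also have "\<dots> \<le> B * exp ((2 + c) * T) * exp (1 / \<eta> * T)"
        proof -
          have "1 / \<eta> * 1 \<le> 1 / \<eta> * T" using T2 y \<eta> by (intro mult_left_mono) auto
          then have "1 / \<eta> \<le> exp (1 / \<eta> * T)" using le_exp_self[of "1 / \<eta> * T"] by linarith
          then show ?thesis using B by (intro mult_left_mono) auto
        qed
        also have "\<dots> = exp ((C + 2 + c + 1 / \<eta>) * T)"
          unfolding B_def exp_add[symmetric] by (simp add: algebra_simps)
        finally show ?thesis by (simp add: T_def y_def)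
      qed
      show "\<exists>N. \<forall>y\<ge>0. norm (Q (\<i> * of_real y)) \<le> N * exp (\<epsilon> * y)" if e: "\<epsilon> > 0" for \<epsilon>
      proof -
        \<comment> \<open>Half of \<epsilon> bounds f, the other half absorbs the length y of the
          path of integration.\<close>
        obtain N0 where N0: "\<And>y. y \<ge> 0 \<Longrightarrow> norm (f (\<i> * of_real y)) \<le> N0 * exp (\<epsilon> / 2 * y)"
          using mt[of "\<epsilon> / 2"] e by auto
        have N00: "N0 \<ge> 0" using order_trans[OF norm_ge_zero N0[of 0]] by simp
        define c0 where "c0 = norm (\<Phi> 0 - \<Phi> (of_real x0))"
        have "norm (Q (\<i> * of_real y)) \<le> (N0 * (2 / \<epsilon>) + c0) / \<eta> * exp (\<epsilon> * y)" if y: "y \<ge> 0" for y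
        proof -
          have "norm (\<Phi> (\<i> * of_real y) - \<Phi> 0) \<le> (N0 * exp (\<epsilon> / 2 * y)) * norm (\<i> * of_real y - 0)"
          proof (rule field_differentiable_bound[of "closed_segment (\<i> * of_real y) 0" \<Phi> f])
            have *: "\<exists>s. 0 \<le> s \<and> s \<le> y \<and> v = \<i> * of_real s" if v: "v \<in> closed_segment (\<i> * of_real y) 0" for v
            proof -
              obtain u where u: "0 \<le> u" "u \<le> 1" "v = (1 - u) *\<^sub>R (\<i> * of_real y) + u *\<^sub>R 0"
                using v unfolding in_segment by blast
              have "v = \<i> * of_real ((1 - u) * y)" by (simp add: u(3) complex_eq_iff)
              moreover have "0 \<le> (1 - u) * y" "(1 - u) * y \<le> y"
                using u y by (auto simp: mult_left_le_one_le)
              ultimately show ?thesis by blast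
            qed
            show "(\<Phi> has_field_derivative f v) (at v within closed_segment (\<i> * of_real y) 0)"
              if "v \<in> closed_segment (\<i> * of_real y) 0" for v
            proof (rule has_field_derivative_subset[OF \<Phi>])
              show "v \<in> CUHP" using *[OF that] by auto
              show "closed_segment (\<i> * of_real y) 0 \<subseteq> CUHP"
              proof
                fix v assume "v \<in> closed_segment (\<i> * of_real y) 0"
                from *[OF this] show "v \<in> CUHP" by auto
              qed
            qed
            show "norm (f v) \<le> N0 * exp (\<epsilon> / 2 * y)" if v: "v \<in> closed_segment (\<i> * of_real y) 0" for v
            proof -
              obtain s where s: "0 \<le> s" "s \<le> y" "v = \<i> * of_real s" using *[OF v] by blast
              have "norm (f v) \<le> N0 * exp (\<epsilon> / 2 * s)" using N0[OF s(1)] s by simp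
              also have "\<dots> \<le> N0 * exp (\<epsilon> / 2 * y)" using s e N00 by (intro mult_left_mono) auto
              finally show ?thesis .
            qed
          qed auto
          also have "\<dots> = N0 * exp (\<epsilon> / 2 * y) * y" using y by (simp add: norm_mult)
          also have "\<dots> \<le> N0 * exp (\<epsilon> / 2 * y) * (2 / \<epsilon> * exp (\<epsilon> / 2 * y))"
          proof -
            have "\<epsilon> / 2 * y \<le> exp (\<epsilon> / 2 * y)" by (rule le_exp_self)
            then have "y \<le> 2 / \<epsilon> * exp (\<epsilon> / 2 * y)" using e by (simp add: field_simps)
            then show ?thesis using N00 by (intro mult_left_mono) auto
          qed
          also have "\<dots> = N0 * (2 / \<epsilon>) * exp (\<epsilon> * y)"
            by (simp add: mult_exp_exp)
          finally have 1: "norm (\<Phi> (\<i> * of_real y) - \<Phi> 0) \<le> N0 * (2 / \<epsilon>) * exp (\<epsilon> * y)" .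
          have "norm (\<Phi> (\<i> * of_real y) - \<Phi> (of_real x0)) \<le> norm (\<Phi> (\<i> * of_real y) - \<Phi> 0) + c0"
            unfolding c0_def by norm
          also have "\<dots> \<le> N0 * (2 / \<epsilon>) * exp (\<epsilon> * y) + c0 * exp (\<epsilon> * y)"
          proof -
            have "c0 * 1 \<le> c0 * exp (\<epsilon> * y)" using e y by (intro mult_left_mono) (auto simp: c0_def)
            then show ?thesis using 1 by linarith
          qed
          finally have 2: "norm (\<Phi> (\<i> * of_real y) - \<Phi> (of_real x0)) \<le> (N0 * (2 / \<epsilon>) + c0) * exp (\<epsilon> * y)"
            by (simp add: algebra_simps)
          have "norm (Q (\<i> * of_real y)) \<le> (N0 * (2 / \<epsilon>) + c0) * exp (\<epsilon> * y) / \<eta>"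
            unfolding Q_def norm_divide using 2 D[of "\<i> * of_real y"] y \<eta> order_trans[OF norm_ge_zero 2] by (intro frac_le) auto
          then show ?thesis by simp
        qed
        then show ?thesis by blast
      qed
    qed (use z M in auto)
    moreover have "norm (D z) = 2 * \<eta>"
    proof -
      have "D z = \<i> * of_real (2 * \<eta>)" by (simp add: D_def x0_def \<eta>_def complex_eq_iff)
      then show ?thesis using \<eta> by (simp only: norm_mult norm_of_real norm_ii mult_1_left)
    qed
    ultimately have "norm (\<Phi> z - \<Phi> (of_real x0)) \<le> M * (2 * \<eta>)"
      using \<eta> by (simp add: Q_def norm_divide divide_le_eq)
    also have "\<dots> = sqrt J * (2 * \<eta> / sqrt (2 * \<eta>))" by (simp add: M_def)
    also have "2 * \<eta> / sqrt (2 * \<eta>) = sqrt (2 * \<eta>)" using \<eta> by (simp only: real_div_sqrt)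
    finally show ?thesis by (simp add: x0_def \<eta>_def real_sqrt_mult mult_ac)
  qed
  have \<Phi>': "(\<Phi> has_field_derivative f z) (at z within CUHP)" if "Im z \<ge> 0" for z
    using \<Phi>[of z] that by simp
  show ?thesis
    by (intro exI[of _ J] exI[of _ \<Phi>] conjI allI impI J real_bd up \<Phi>')
qed

section \<open>The Poisson kernel and contour integrals over half-circles\<close>

lemma nn_integral_inverse_1_plus_square:
  "(\<integral>\<^sup>+t. ennreal (1 / (1 + t\<^sup>2)) \<partial>lborel) \<le> ennreal pi"
proof -
  have pos: "0 < 1 + t\<^sup>2" for t :: real by (simp add: add_pos_nonneg)
  have right: "(\<integral>\<^sup>+t. ennreal (1 / (1 + t\<^sup>2)) * indicator {0..} t \<partial>lborel) = ennreal (pi / 2 - arctan 0)"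
    by (rule nn_integral_FTC_atLeast)
       (auto intro!: derivative_eq_intros tendsto_arctan_at_top simp: inverse_eq_divide less_imp_le[OF pos])
  have left: "(\<integral>\<^sup>+t. ennreal (1 / (1 + t\<^sup>2)) * indicator {..0} t \<partial>lborel) = ennreal (pi / 2)"
  proof -
    have "(\<integral>\<^sup>+t. ennreal (1 / (1 + t\<^sup>2)) * indicator {..0} t \<partial>lborel)
      = ennreal \<bar>-1\<bar> * (\<integral>\<^sup>+t. ennreal (1 / (1 + (0 + -1 * t)\<^sup>2)) * indicator {..0} (0 + -1 * t) \<partial>lborel)"
      by (rule nn_integral_real_affine) auto
    also have "\<dots> = (\<integral>\<^sup>+t. ennreal (1 / (1 + t\<^sup>2)) * indicator {0..} t \<partial>lborel)"
      by (simp add: indicator_def)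
    finally show ?thesis using right by simp
  qed
  have "(\<integral>\<^sup>+t. ennreal (1 / (1 + t\<^sup>2)) \<partial>lborel)
      \<le> (\<integral>\<^sup>+t. ennreal (1 / (1 + t\<^sup>2)) * indicator {0..} t + ennreal (1 / (1 + t\<^sup>2)) * indicator {..0} t \<partial>lborel)"
    by (rule nn_integral_mono) (auto simp: indicator_def)
  also have "\<dots> = ennreal (pi / 2) + ennreal (pi / 2)"
    using right left by (simp add: nn_integral_add)
  also have "\<dots> = ennreal pi" by (simp flip: ennreal_plus)
  finally show ?thesis .
qed

lemma poisson_kernel:
  assumes z: "Im z \<noteq> 0"
  shows "integrable lborel (\<lambda>t::real. 1 / (norm (of_real t - z))\<^sup>2)"
    "(\<integral>t. 1 / (norm (of_real t - z))\<^sup>2 \<partial>lborel) \<le> pi / \<bar>Im z\<bar>"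
proof -
  define y where "y = \<bar>Im z\<bar>"
  have y: "y > 0" using z by (simp add: y_def)
  have n: "(norm (of_real t - z))\<^sup>2 = (t - Re z)\<^sup>2 + y\<^sup>2" for t
    unfolding cmod_power2 by (simp add: y_def)
  have "(\<integral>\<^sup>+t. ennreal (1 / (norm (of_real t - z))\<^sup>2) \<partial>lborel)
      = \<bar>y\<bar> * (\<integral>\<^sup>+t. ennreal (1 / (norm (of_real (Re z + y * t) - z))\<^sup>2) \<partial>lborel)"
    by (rule nn_integral_real_affine) (use y in auto)
  also have "(\<lambda>t. ennreal (1 / (norm (of_real (Re z + y * t) - z))\<^sup>2)) = (\<lambda>t. ennreal (1 / y\<^sup>2) * ennreal (1 / (1 + t\<^sup>2)))"
  proof
    fix t
    have "(y * t)\<^sup>2 + y\<^sup>2 = y\<^sup>2 * (1 + t\<^sup>2)" by (simp add: power2_eq_square algebra_simps)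
    then show "ennreal (1 / (norm (of_real (Re z + y * t) - z))\<^sup>2) = ennreal (1 / y\<^sup>2) * ennreal (1 / (1 + t\<^sup>2))"
      unfolding n by (simp flip: ennreal_mult)
  qed
  also have "(\<integral>\<^sup>+t. ennreal (1 / y\<^sup>2) * ennreal (1 / (1 + t\<^sup>2)) \<partial>lborel)
      = ennreal (1 / y\<^sup>2) * (\<integral>\<^sup>+t. ennreal (1 / (1 + t\<^sup>2)) \<partial>lborel)"
    by (rule nn_integral_cmult) auto
  also have "ennreal \<bar>y\<bar> * (ennreal (1 / y\<^sup>2) * (\<integral>\<^sup>+t. ennreal (1 / (1 + t\<^sup>2)) \<partial>lborel))
      \<le> ennreal \<bar>y\<bar> * (ennreal (1 / y\<^sup>2) * ennreal pi)"
    by (intro mult_left_mono nn_integral_inverse_1_plus_square) auto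
  also have "\<dots> = ennreal (pi / y)"
    using y by (simp add: power2_eq_square flip: ennreal_mult)
  finally have le: "(\<integral>\<^sup>+t. ennreal (1 / (norm (of_real t - z))\<^sup>2) \<partial>lborel) \<le> ennreal (pi / y)" .
  show int: "integrable lborel (\<lambda>t::real. 1 / (norm (of_real t - z))\<^sup>2)"
    by (rule integrableI_bounded) (auto intro: le_less_trans[OF le])
  show "(\<integral>t. 1 / (norm (of_real t - z))\<^sup>2 \<partial>lborel) \<le> pi / \<bar>Im z\<bar>"
    using le y unfolding y_def[symmetric] by (subst (asm) nn_integral_eq_integral[OF int]) auto
qed

lemma cauchy_kernel_L2: "Im z \<noteq> 0 \<Longrightarrow> (\<lambda>t::real. 1 / (of_real t - z)) \<in> L2 lborel"
  using poisson_kernel(1)[of z] by (auto simp: L2_def norm_divide power_divide)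

lemma contour_integral_half_circle_split:
  assumes R: "R > 0" and F: "continuous_on (sphere 0 R) F"
  shows "contour_integral (circlepath 0 R) F
     = contour_integral (part_circlepath 0 R 0 pi) F + contour_integral (part_circlepath 0 R pi (2 * pi)) F"
proof -
  have "continuous_on {0..2*pi} (\<lambda>t. F (0 + of_real R * cis t) * of_real R * \<i> * cis t)"
    by (intro continuous_intros continuous_on_compose2[OF F]) (use R in \<open>auto simp: norm_mult\<close>)
  then have "(\<lambda>t. F (0 + of_real R * cis t) * of_real R * \<i> * cis t) integrable_on {0..2*pi}"
    by (rule integrable_continuous_real)
  from Henstock_Kurzweil_Integration.integral_combine[OF _ _ this, of pi]
  show ?thesis
    unfolding circlepath_def by (simp add: contour_integral_part_circlepath_eq)
qed

definition half_circle :: "real \<Rightarrow> real \<Rightarrow> complex" where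
  "half_circle R = linepath (- of_real R) (of_real R) +++ part_circlepath 0 R 0 pi"

lemma half_circle_props:
  assumes R: "R > 0"
  shows "valid_path (half_circle R)" "pathfinish (half_circle R) = pathstart (half_circle R)"
    "path_image (half_circle R) \<subseteq> CUHP \<inter> cball 0 R"
    "path_image (part_circlepath 0 R 0 pi) \<subseteq> CUHP \<inter> sphere 0 R"
proof -
  show "valid_path (half_circle R)" unfolding half_circle_def by (intro valid_path_join) auto
  show "pathfinish (half_circle R) = pathstart (half_circle R)" unfolding half_circle_def by simp
  show 1: "path_image (part_circlepath 0 R 0 pi) \<subseteq> CUHP \<inter> sphere 0 R"
    using R by (auto simp: path_image_part_circlepath' closed_segment_eq_real_ivl norm_mult sin_ge_zero)
  have "path_image (linepath (- of_real R) (of_real R)) \<subseteq> CUHP \<inter> cball 0 R"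
    using R unfolding path_image_linepath
    by (intro closed_segment_subset convex_Int convex_halfspace_Im_ge convex_cball) auto
  with 1 show "path_image (half_circle R) \<subseteq> CUHP \<inter> cball 0 R"
    unfolding half_circle_def by (subst path_image_join) auto
qed

lemma contour_integral_half_circle:
  assumes R: "R > 0" and F: "continuous_on (path_image (half_circle R)) F"
  shows "contour_integral (half_circle R) F
    = contour_integral (linepath (- of_real R) (of_real R)) F + contour_integral (part_circlepath 0 R 0 pi) F"
    "F contour_integrable_on linepath (- of_real R) (of_real R)" "F contour_integrable_on part_circlepath 0 R 0 pi"
proof -
  have pi: "path_image (half_circle R) = path_image (linepath (- of_real R) (of_real R)) \<union> path_image (part_circlepath 0 R 0 pi)"
    unfolding half_circle_def by (rule path_image_join) auto
  show a: "F contour_integrable_on linepath (- of_real R) (of_real R)" 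
    by (rule contour_integrable_continuous_linepath) (use F pi in \<open>auto intro: continuous_on_subset\<close>)
  show b: "F contour_integrable_on part_circlepath 0 R 0 pi"
    by (rule contour_integrable_continuous_part_circlepath) (use F pi in \<open>auto intro: continuous_on_subset\<close>)
  show "contour_integral (half_circle R) F
    = contour_integral (linepath (- of_real R) (of_real R)) F + contour_integral (part_circlepath 0 R 0 pi) F"
    unfolding half_circle_def by (rule contour_integral_join[OF a b]) auto
qed

text \<open>The full circle contributes 2 pi i and the closed lower half-circle 0, since \<zeta>
  lies above the axis. The lower contour runs through the diameter backwards, so the difference of
  the two is the upper half-circle.\<close>

lemma half_circle_winding:
  assumes \<zeta>: "Im \<zeta> > 0" "norm \<zeta> < R"
  shows "contour_integral (half_circle R) (\<lambda>z. 1 / (z - \<zeta>)) = 2 * of_real pi * \<i>"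
proof -
  have R: "R > 0" using \<zeta> by (meson norm_ge_zero order_le_less_trans)
  define F where "F = (\<lambda>z. 1 / (z - \<zeta>))"
  have Fc: "continuous_on (- {\<zeta>}) F" unfolding F_def by (intro continuous_intros) auto
  have circ: "contour_integral (circlepath 0 R) F = 2 * of_real pi * \<i>"
    using Cauchy_integral_circlepath_simple[of "\<lambda>_. 1" 0 R \<zeta>] \<zeta>
    unfolding F_def by (auto intro!: contour_integral_unique simp: holomorphic_on_const)
  let ?D = "{z. Im z \<le> 0} \<inter> cball 0 R"
  let ?g = "part_circlepath 0 R pi (2 * pi) +++ linepath (of_real R) (- of_real R)"
  have D: "convex ?D" by (intro convex_Int convex_halfspace_Im_le convex_cball)
  have sub1: "path_image (part_circlepath 0 R pi (2 * pi)) \<subseteq> ?D"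
  proof
    fix x assume "x \<in> path_image (part_circlepath 0 R pi (2 * pi))"
    then obtain t where t: "pi \<le> t" "t \<le> 2 * pi" "x = of_real R * cis t"
      by (auto simp: path_image_part_circlepath' closed_segment_eq_real_ivl)
    have "sin t \<le> 0" using t sin_le_zero[of t] by (cases "t = 2 * pi") auto
    then show "x \<in> ?D" using R by (auto simp: t norm_mult mult_le_0_iff)
  qed
  have sub2: "path_image (linepath (of_real R) (- of_real R)) \<subseteq> ?D"
    using R unfolding path_image_linepath by (intro closed_segment_subset D) auto
  have fin: "pathfinish (part_circlepath 0 R pi (2 * pi)) = pathstart (linepath (of_real R) (- of_real R))"
    "pathfinish (linepath (of_real R) (- of_real R)) = pathstart (part_circlepath 0 R pi (2 * pi))"
    using exp_two_pi_i by (simp_all add: mult_ac)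
  have "(F has_contour_integral 0) ?g"
  proof (rule Cauchy_theorem_convex_simple[OF _ D])
    show "F holomorphic_on ?D" unfolding F_def by (intro holomorphic_intros) (use \<zeta> in auto)
    show "valid_path ?g" by (intro valid_path_join fin) auto
    show "path_image ?g \<subseteq> ?D" using sub1 sub2 fin by (simp add: path_image_join)
  qed (use fin in auto)
  then have "contour_integral ?g F = 0" by (rule contour_integral_unique)
  moreover have Dz: "?D \<subseteq> - {\<zeta>}" using \<zeta> by auto
  have ci: "F contour_integrable_on part_circlepath 0 R pi (2 * pi)"
    by (intro contour_integrable_continuous_part_circlepath continuous_on_subset[OF Fc])
       (use sub1 Dz in blast)
  have cj: "F contour_integrable_on linepath (of_real R) (- of_real R)"
    by (intro contour_integrable_continuous_linepath continuous_on_subset[OF Fc])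
       (use sub2 Dz in auto)
  ultimately have "contour_integral (part_circlepath 0 R pi (2 * pi)) F + contour_integral (linepath (of_real R) (- of_real R)) F = 0"
    using contour_integral_join[OF ci cj] by simp
  moreover have "contour_integral (linepath (of_real R) (- of_real R)) F = - contour_integral (linepath (- of_real R) (of_real R)) F"
    by (rule contour_integral_reverse_linepath)
       (intro continuous_on_subset[OF Fc], use sub2 Dz in auto)
  moreover have "contour_integral (circlepath 0 R) F
     = contour_integral (part_circlepath 0 R 0 pi) F + contour_integral (part_circlepath 0 R pi (2 * pi)) F"
    by (intro contour_integral_half_circle_split R continuous_on_subset[OF Fc]) (use \<zeta> in auto)
  moreover have "contour_integral (half_circle R) F
    = contour_integral (linepath (- of_real R) (of_real R)) F + contour_integral (part_circlepath 0 R 0 pi) F"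
  proof (rule contour_integral_half_circle[OF R])
    have "\<zeta> \<notin> path_image (linepath (- of_real R) (of_real R))"
      using sub2 Dz by (auto simp: closed_segment_commute)
    moreover have "\<zeta> \<notin> path_image (part_circlepath 0 R 0 pi)"
      using half_circle_props(4)[OF R] \<zeta> by auto
    ultimately show "continuous_on (path_image (half_circle R)) F"
      unfolding half_circle_def by (intro continuous_on_subset[OF Fc]) (auto simp: path_image_join)
  qed
  ultimately show ?thesis using circ unfolding F_def by (simp add: algebra_simps)
qed

lemma interior_CUHP: "interior CUHP = UHP"
  unfolding UHP_def using interior_halfspace_ge[of \<i> 0] by (simp add: inner_complex_def)

text \<open>\<psi> is only continuous on the diameter, so the contour cannot be moved across it.
  Subtracting the principal part at \<zeta> leaves the iterated divided difference q, holomorphic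
  inside and continuous on the closed half-disc, to which Cauchy's theorem applies. The pole has
  order two because \<psi> will be a primitive.\<close>

lemma half_disc_cauchy:
  assumes \<psi>c: "continuous_on CUHP \<psi>" and \<psi>h: "\<psi> holomorphic_on UHP" and \<zeta>: "Im \<zeta> \<noteq> 0" "norm \<zeta> < R"
  shows "contour_integral (half_circle R) (\<lambda>z. \<psi> z / (z - \<zeta>)\<^sup>2)
    = (if Im \<zeta> > 0 then 2 * of_real pi * \<i> * deriv \<psi> \<zeta> else 0)"
proof -
  have R: "R > 0" using \<zeta> by (meson norm_ge_zero order_le_less_trans)
  let ?S = "CUHP \<inter> cball 0 R"
  have S: "convex ?S" by (intro convex_Int convex_halfspace_Im_ge convex_cball)
  note hc = half_circle_props[OF R]
  have opn: "open UHP" unfolding UHP_def by (rule open_halfspace_Im_gt)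
  have intS: "interior ?S \<subseteq> UHP" using interior_CUHP by auto
  show ?thesis
  proof (cases "Im \<zeta> > 0")
    case False
    have "((\<lambda>z. \<psi> z / (z - \<zeta>)\<^sup>2) has_contour_integral 0) (half_circle R)"
    proof (rule Cauchy_theorem_convex[OF _ S finite.emptyI])
      show "continuous_on ?S (\<lambda>z. \<psi> z / (z - \<zeta>)\<^sup>2)"
        by (intro continuous_intros continuous_on_subset[OF \<psi>c]) (use False \<zeta> in auto)
      fix x assume "x \<in> interior ?S - {}"
      then have x: "x \<in> UHP" using intS by auto
      have "(\<lambda>z. \<psi> z / (z - \<zeta>)\<^sup>2) holomorphic_on UHP"
        by (intro holomorphic_intros \<psi>h) (use False \<zeta> in \<open>auto simp: UHP_def\<close>)
      then show "(\<lambda>z. \<psi> z / (z - \<zeta>)\<^sup>2) field_differentiable at x"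
        using opn x by (rule holomorphic_on_imp_differentiable_at)
    qed (use hc in auto)
    then show ?thesis using False by (simp add: contour_integral_unique)
  next
    case True
    then have \<zeta>U: "\<zeta> \<in> UHP" by (simp add: UHP_def)
    define g where "g = (\<lambda>z. if z = \<zeta> then deriv \<psi> \<zeta> else (\<psi> z - \<psi> \<zeta>) / (z - \<zeta>))"
    have gh: "g holomorphic_on UHP" unfolding g_def by (rule pole_lemma_open[OF \<psi>h opn])
    define q where "q = (\<lambda>z. if z = \<zeta> then deriv g \<zeta> else (g z - g \<zeta>) / (z - \<zeta>))"
    have qh: "q holomorphic_on UHP" unfolding q_def by (rule pole_lemma_open[OF gh opn])
    have q_eq: "q z = \<psi> z / (z - \<zeta>)\<^sup>2 - \<psi> \<zeta> * (1 / (z - \<zeta>)\<^sup>2) - deriv \<psi> \<zeta> * (1 / (z - \<zeta>))" if "z \<noteq> \<zeta>" for z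
      using that by (simp add: q_def g_def power2_eq_square diff_divide_distrib)
    have qc: "continuous_on CUHP q"
    proof -
      have "CUHP = (CUHP - {\<zeta>}) \<union> UHP" using \<zeta>U by (auto simp: UHP_def)
      moreover have "continuous_on ((CUHP - {\<zeta>}) \<union> UHP) q"
      proof (rule continuous_on_Un_local_open)
        show "openin (top_of_set ((CUHP - {\<zeta>}) \<union> UHP)) (CUHP - {\<zeta>})"
        proof -
          have "openin (top_of_set CUHP) (CUHP \<inter> - {\<zeta>})" by (rule openin_open_Int) auto
          then show ?thesis using calculation by (simp add: Diff_eq)
        qed
        show "openin (top_of_set ((CUHP - {\<zeta>}) \<union> UHP)) UHP"
          using opn by (simp add: open_subset)
        have "continuous_on (CUHP - {\<zeta>}) (\<lambda>z. \<psi> z / (z - \<zeta>)\<^sup>2 - \<psi> \<zeta> * (1 / (z - \<zeta>)\<^sup>2) - deriv \<psi> \<zeta> * (1 / (z - \<zeta>)))"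
          by (intro continuous_intros continuous_on_subset[OF \<psi>c]) auto
        then show "continuous_on (CUHP - {\<zeta>}) q"
          by (rule continuous_on_eq) (simp add: q_eq)
        show "continuous_on UHP q" by (rule holomorphic_on_imp_continuous_on[OF qh])
      qed
      ultimately show ?thesis by simp
    qed
    have "(q has_contour_integral 0) (half_circle R)"
    proof (rule Cauchy_theorem_convex[OF _ S finite.emptyI])
      show "continuous_on ?S q" by (rule continuous_on_subset[OF qc]) auto
      fix x assume "x \<in> interior ?S - {}"
      then have x: "x \<in> UHP" using intS by auto
      show "q field_differentiable at x"
        using qh opn x by (rule holomorphic_on_imp_differentiable_at)
    qed (use hc in auto)
    moreover have nz: "z \<noteq> \<zeta>" if "z \<in> path_image (half_circle R)" for z
    proof
      assume "z = \<zeta>"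
      then have "\<zeta> \<in> path_image (linepath (- of_real R) (of_real R)) \<or> \<zeta> \<in> path_image (part_circlepath 0 R 0 pi)"
        using that unfolding half_circle_def by (auto simp: path_image_join)
      moreover have "path_image (linepath (- of_real R) (of_real R)) \<subseteq> {z. Im z \<le> 0}"
        unfolding path_image_linepath by (intro closed_segment_subset convex_halfspace_Im_le) auto
      ultimately show False using True \<zeta> hc(4) by auto
    qed
    have c0: "continuous_on (path_image (half_circle R)) (\<lambda>z. \<psi> z / (z - \<zeta>)\<^sup>2)"
      by (intro continuous_intros continuous_on_subset[OF \<psi>c]) (use nz hc in auto)
    have i1: "((\<lambda>z. 1 / (z - \<zeta>)\<^sup>2) has_contour_integral 0) (half_circle R)"
    proof (rule Cauchy_theorem_primitive[where f = "\<lambda>z. - 1 / (z - \<zeta>)" and S = "path_image (half_circle R)"])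
      show "((\<lambda>z. - 1 / (z - \<zeta>)) has_field_derivative 1 / (x - \<zeta>)\<^sup>2) (at x within path_image (half_circle R))"
        if "x \<in> path_image (half_circle R)" for x
        using nz[OF that] by (auto intro!: derivative_eq_intros simp: power2_eq_square)
    qed (use hc in auto)
    have integ: "h contour_integrable_on half_circle R" if "continuous_on (path_image (half_circle R)) h" for h
      using contour_integral_half_circle(2,3)[OF R that] unfolding half_circle_def
      by (intro contour_integrable_joinI) auto
    have i2: "((\<lambda>z. 1 / (z - \<zeta>)) has_contour_integral (2 * of_real pi * \<i>)) (half_circle R)"
    proof -
      have "continuous_on (path_image (half_circle R)) (\<lambda>z. 1 / (z - \<zeta>))"
        by (intro continuous_intros) (use nz in auto)
      from has_contour_integral_integral[OF integ[OF this]] show ?thesis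
        unfolding half_circle_winding[OF True \<zeta>(2)] .
    qed
    have "((\<lambda>z. \<psi> z / (z - \<zeta>)\<^sup>2 - \<psi> \<zeta> * (1 / (z - \<zeta>)\<^sup>2) - deriv \<psi> \<zeta> * (1 / (z - \<zeta>)))
        has_contour_integral (contour_integral (half_circle R) (\<lambda>z. \<psi> z / (z - \<zeta>)\<^sup>2) - \<psi> \<zeta> * 0 - deriv \<psi> \<zeta> * (2 * of_real pi * \<i>))) (half_circle R)"
      by (intro has_contour_integral_diff has_contour_integral_lmul i1 i2 has_contour_integral_integral integ c0)
    then have "(q has_contour_integral (contour_integral (half_circle R) (\<lambda>z. \<psi> z / (z - \<zeta>)\<^sup>2) - \<psi> \<zeta> * 0 - deriv \<psi> \<zeta> * (2 * of_real pi * \<i>))) (half_circle R)"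
      by (rule has_contour_integral_eq) (simp add: q_eq nz)
    ultimately have "contour_integral (half_circle R) (\<lambda>z. \<psi> z / (z - \<zeta>)\<^sup>2) - \<psi> \<zeta> * 0 - deriv \<psi> \<zeta> * (2 * of_real pi * \<i>) = 0"
      by (metis has_contour_integral_unique)
    then show ?thesis using True by (simp add: mult_ac)
  qed
qed

lemma hardy_kernel_integrable:
  assumes "hardy f" "Im \<zeta> \<noteq> 0"
  shows "integrable lborel (\<lambda>t::real. f (of_real t) / (of_real t - \<zeta>))"
  using L2_mult_integrable[OF hardy_L2[OF assms(1)] cauchy_kernel_L2[OF assms(2)]] by simp

text \<open>Square integrability on the line gives no pointwise bound on large arcs. Integration by
  parts trades f / (z - \<zeta>) for \<psi> / (z - \<zeta>)^2, where the primitive \<psi> grows like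
  |z|^(1/2), so arcs and end points contribute O(R^(-1/2)); the formula of order two returns the
  derivative f of \<psi>.\<close>

lemma hardy_cauchy:
  assumes f: "hardy f" and \<zeta>: "Im \<zeta> \<noteq> 0"
  shows "(\<integral>t. f (of_real t) / (of_real t - \<zeta>) \<partial>lborel) = (if Im \<zeta> > 0 then 2 * of_real pi * \<i> * f \<zeta> else 0)"
proof -
  define v where "v = (if Im \<zeta> > 0 then 2 * of_real pi * \<i> * f \<zeta> else 0)"
  obtain J \<Phi> where J: "J > 0"
    and \<Phi>: "\<And>z. Im z \<ge> 0 \<Longrightarrow> (\<Phi> has_field_derivative f z) (at z within CUHP)"
    and re: "\<And>x x'. norm (\<Phi> (of_real x) - \<Phi> (of_real x')) \<le> sqrt (J * \<bar>x - x'\<bar>)"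
    and up: "\<And>z. Im z > 0 \<Longrightarrow> norm (\<Phi> z - \<Phi> (of_real (Re z))) \<le> sqrt (2 * J * Im z)"
    using hardy_primitive[OF f] by metis
  define \<psi> where "\<psi> = (\<lambda>z. \<Phi> z - \<Phi> 0)"
  have \<psi>d: "(\<psi> has_field_derivative f z) (at z within CUHP)" if "Im z \<ge> 0" for z
    unfolding \<psi>_def using \<Phi>[OF that] by (auto intro!: derivative_eq_intros)
  have \<psi>c: "continuous_on CUHP \<psi>" using \<psi>d by (intro DERIV_continuous_on) auto
  have opn: "open UHP" unfolding UHP_def by (rule open_halfspace_Im_gt)
  have \<psi>U: "(\<psi> has_field_derivative f z) (at z)" if "Im z > 0" for z
  proof -
    have "(\<psi> has_field_derivative f z) (at z within UHP)"
      by (rule has_field_derivative_subset[OF \<psi>d]) (use that in \<open>auto simp: UHP_def\<close>)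
    then show ?thesis using at_within_open[OF _ opn] that by (auto simp: UHP_def)
  qed
  have \<psi>h: "\<psi> holomorphic_on UHP"
    using \<psi>U opn by (auto simp: holomorphic_on_open UHP_def)
  have bd: "norm (\<psi> z) \<le> 3 * sqrt (J * norm z)" if z: "Im z \<ge> 0" for z
  proof -
    have "norm (\<Phi> z - \<Phi> (of_real (Re z))) \<le> 2 * sqrt (J * norm z)"
    proof (cases "Im z = 0")
      case True
      then have "of_real (Re z) = z" by (simp add: complex_eq_iff)
      then show ?thesis using J by simp
    next
      case False
      then have "norm (\<Phi> z - \<Phi> (of_real (Re z))) \<le> sqrt (2 * J * Im z)" using up[of z] z by simp
      also have "\<dots> \<le> sqrt (4 * (J * norm z))"
        using abs_Im_le_cmod[of z] J z False by (intro real_sqrt_le_mono) auto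
      also have "\<dots> = 2 * sqrt (J * norm z)" by (simp add: real_sqrt_mult)
      finally show ?thesis .
    qed
    moreover have "norm (\<Phi> (of_real (Re z)) - \<Phi> 0) \<le> sqrt (J * norm z)"
      using re[of "Re z" 0] abs_Re_le_cmod[of z] J
      by (auto intro: order_trans[OF _ real_sqrt_le_mono])
    ultimately show ?thesis unfolding \<psi>_def by norm
  qed
  define g where "g = (\<lambda>t::real. f (of_real t) / (of_real t - \<zeta>))"
  have gi: "integrable lborel g" unfolding g_def by (rule hardy_kernel_integrable[OF f \<zeta>])
  have est: "norm ((\<integral>t. indicator {-R..R} t *\<^sub>R g t \<partial>lborel) - v) \<le> 60 * sqrt J / sqrt R"
    if R: "R \<ge> 2 * norm \<zeta> + 1" for R
  proof -
    have R0: "R > 0" and R\<zeta>: "norm \<zeta> < R" "norm \<zeta> \<le> R / 2"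
      using R norm_ge_zero[of \<zeta>] by linarith+
    let ?L = "linepath (- of_real R) (of_real R) :: real \<Rightarrow> complex"
    let ?A = "part_circlepath 0 R 0 pi"
    define h where "h = (\<lambda>z. \<psi> z / (z - \<zeta>)\<^sup>2)"
    have segR: "closed_segment (- of_real R) (of_real R) \<subseteq> {z. Im z = 0}"
      by (intro closed_segment_subset) (auto simp: convex_def)
    have nz: "z \<noteq> \<zeta>" if "z \<in> path_image ?L \<or> z \<in> path_image ?A" for z
      using that segR \<zeta> half_circle_props(4)[OF R0] R\<zeta> by fastforce
    have LU: "path_image ?L \<subseteq> CUHP" using segR by auto
    have hc: "continuous_on (path_image (half_circle R)) h"
      unfolding h_def using half_circle_props(3)[OF R0] nz unfolding half_circle_def
      by (intro continuous_intros continuous_on_subset[OF \<psi>c]) (auto simp: path_image_join)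
    note split = contour_integral_half_circle[OF R0 hc]
    have tot: "contour_integral (half_circle R) h = v"
      unfolding h_def half_disc_cauchy[OF \<psi>c \<psi>h \<zeta> R\<zeta>(1)] v_def using DERIV_imp_deriv[OF \<psi>U] by simp
    have far: "norm (z - \<zeta>) \<ge> R / 2" if "norm z = R" for z
      using norm_triangle_ineq2[of z \<zeta>] that R\<zeta> by linarith
    have arc: "norm (contour_integral ?A h) \<le> (3 * sqrt (J * R) / (R / 2)\<^sup>2) * R * \<bar>pi - 0\<bar>"
    proof (rule contour_integral_bound_part_circlepath[OF split(3)])
      fix z assume z: "z \<in> path_image ?A"
      then have zR: "norm z = R" "Im z \<ge> 0" using half_circle_props(4)[OF R0] by auto
      have "norm (h z) = norm (\<psi> z) / (norm (z - \<zeta>))\<^sup>2" by (simp add: h_def norm_divide norm_power)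
      also have "\<dots> \<le> 3 * sqrt (J * R) / (R / 2)\<^sup>2"
        using bd[OF zR(2)] far[OF zR(1)] zR R0 J by (intro frac_le power_mono) auto
      finally show "norm (h z) \<le> 3 * sqrt (J * R) / (R / 2)\<^sup>2" .
    qed (use J R0 in auto)
    \<comment> \<open>The integrand is the derivative of \<psi> / (z - \<zeta>).\<close>
    have prim: "((\<lambda>z. f z / (z - \<zeta>) - h z) has_contour_integral
        (\<psi> (of_real R) / (of_real R - \<zeta>) - \<psi> (- of_real R) / (- of_real R - \<zeta>))) ?L"
    proof -
      have "((\<lambda>z. f z / (z - \<zeta>) - h z) has_contour_integral
        ((\<lambda>z. \<psi> z / (z - \<zeta>)) (pathfinish ?L) - (\<lambda>z. \<psi> z / (z - \<zeta>)) (pathstart ?L))) ?L"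
      proof (rule contour_integral_primitive[where S = "path_image ?L"])
        fix x assume x: "x \<in> path_image ?L"
        have d: "(\<psi> has_field_derivative f x) (at x within path_image ?L)"
          by (rule has_field_derivative_subset[OF \<psi>d LU]) (use x LU in auto)
        have "((\<lambda>z. \<psi> z / (z - \<zeta>)) has_field_derivative (f x * (x - \<zeta>) - \<psi> x * (1 - 0)) / ((x - \<zeta>) * (x - \<zeta>))) (at x within path_image ?L)"
          by (intro DERIV_divide d DERIV_diff DERIV_ident DERIV_const) (use nz[of x] x in auto)
        also have "(f x * (x - \<zeta>) - \<psi> x * (1 - 0)) / ((x - \<zeta>) * (x - \<zeta>)) = f x / (x - \<zeta>) - h x"
          using nz[of x] x by (simp add: h_def power2_eq_square diff_divide_distrib)
        finally show "((\<lambda>z. \<psi> z / (z - \<zeta>)) has_field_derivative f x / (x - \<zeta>) - h x) (at x within path_image ?L)" .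
      qed auto
      then show ?thesis by simp
    qed
    have bdry: "norm (\<psi> (of_real R) / (of_real R - \<zeta>) - \<psi> (- of_real R) / (- of_real R - \<zeta>)) \<le> 2 * (3 * sqrt (J * R) / (R / 2))"
    proof -
      have "norm (\<psi> w / (w - \<zeta>)) \<le> 3 * sqrt (J * R) / (R / 2)" if "norm w = R" "Im w \<ge> 0" for w
        unfolding norm_divide using bd[OF that(2)] far[OF that(1)] that R0 J by (intro frac_le) auto
      from norm_triangle_le_diff[OF add_mono[OF this[of "of_real R"] this[of "- of_real R"]]] R0
      show ?thesis by simp
    qed
    have "((\<lambda>z. f z / (z - \<zeta>) - h z + h z) has_contour_integral
        (\<psi> (of_real R) / (of_real R - \<zeta>) - \<psi> (- of_real R) / (- of_real R - \<zeta>)) + contour_integral ?L h) ?L"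
      by (intro has_contour_integral_add prim has_contour_integral_integral split(2))
    then have "contour_integral ?L (\<lambda>z. f z / (z - \<zeta>)) =
        \<psi> (of_real R) / (of_real R - \<zeta>) - \<psi> (- of_real R) / (- of_real R - \<zeta>) + contour_integral ?L h"
      by (simp add: contour_integral_unique)
    moreover have "contour_integral ?L h = v - contour_integral ?A h" using split(1) tot by simp
    moreover have "contour_integral ?L (\<lambda>z. f z / (z - \<zeta>)) = (\<integral>t. indicator {-R..R} t *\<^sub>R g t \<partial>lborel)"
    proof -
      have "set_integrable lborel {-R..R} g"
        unfolding set_integrable_def by (rule integrable_mult_indicator) (auto intro: gi)
      from set_borel_integral_eq_integral(2)[OF this]
      have "(\<integral>t. indicator {-R..R} t *\<^sub>R g t \<partial>lborel) = integral {-R..R} g"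
        by (simp add: set_lebesgue_integral_def)
      then show ?thesis using R0 by (subst contour_integral_linepath_Reals_eq) (auto simp: g_def)
    qed
    ultimately have "(\<integral>t. indicator {-R..R} t *\<^sub>R g t \<partial>lborel) - v
        = (\<psi> (of_real R) / (of_real R - \<zeta>) - \<psi> (- of_real R) / (- of_real R - \<zeta>)) - contour_integral ?A h"
      by simp
    then have "norm ((\<integral>t. indicator {-R..R} t *\<^sub>R g t \<partial>lborel) - v)
        \<le> 2 * (3 * sqrt (J * R) / (R / 2)) + (3 * sqrt (J * R) / (R / 2)\<^sup>2) * R * \<bar>pi - 0\<bar>"
      using norm_triangle_le_diff[OF add_mono[OF bdry arc]] by simp
    also have "\<dots> = (12 + 12 * pi) * (sqrt (J * R) / R)"
      using R0 by (simp add: field_simps power2_eq_square)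
    \<comment> \<open>60 = 12 + 12 * 4, and pi < 4.\<close>
    also have "\<dots> \<le> 60 * (sqrt (J * R) / R)"
      using pi_less_4 R0 J by (intro mult_right_mono) auto
    also have "sqrt (J * R) / R = sqrt J * (sqrt R / R)" by (simp add: real_sqrt_mult)
    also have "sqrt R / R = 1 / sqrt R" using R0 by (simp add: sqrt_divide_self_eq inverse_eq_divide)
    finally show ?thesis by simp
  qed
  \<comment> \<open>The offset keeps every radius in the range of \<open>est\<close>.\<close>
  define Rn where "Rn = (\<lambda>n::nat. real n + (2 * norm \<zeta> + 1))"
  have lim1: "(\<lambda>n. \<integral>t. indicator {-Rn n..Rn n} t *\<^sub>R g t \<partial>lborel) \<longlonglongrightarrow> (\<integral>t. g t \<partial>lborel)"
  proof (rule integral_dominated_convergence[where w = "\<lambda>t. norm (g t)"])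
    show "AE t in lborel. (\<lambda>n. indicator {-Rn n..Rn n} t *\<^sub>R g t) \<longlonglongrightarrow> g t"
    proof (rule AE_I2)
      fix t :: real
      have "\<forall>\<^sub>F n in sequentially. indicator {-Rn n..Rn n} t *\<^sub>R g t = g t"
        using eventually_ge_at_top[of "nat \<lceil>\<bar>t\<bar>\<rceil>"]
      proof (rule eventually_mono)
        fix n assume "n \<ge> nat \<lceil>\<bar>t\<bar>\<rceil>"
        then have "real n \<ge> \<bar>t\<bar>" by linarith
        then have "t \<in> {-Rn n..Rn n}" unfolding Rn_def atLeastAtMost_iff using norm_ge_zero[of \<zeta>] by linarith
        then show "indicator {-Rn n..Rn n} t *\<^sub>R g t = g t" by simp
      qed
      then show "(\<lambda>n. indicator {-Rn n..Rn n} t *\<^sub>R g t) \<longlonglongrightarrow> g t" by (rule tendsto_eventually)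
    qed
    show "AE t in lborel. norm (indicator {-Rn n..Rn n} t *\<^sub>R g t) \<le> norm (g t)" for n
      by (auto simp: indicator_def)
  qed (use gi in auto)
  have lim2: "(\<lambda>n. \<integral>t. indicator {-Rn n..Rn n} t *\<^sub>R g t \<partial>lborel) \<longlonglongrightarrow> v"
  proof (rule LIM_zero_cancel, rule Lim_null_comparison)
    show "\<forall>\<^sub>F n in sequentially. norm ((\<integral>t. indicator {-Rn n..Rn n} t *\<^sub>R g t \<partial>lborel) - v) \<le> 60 * sqrt J / sqrt (Rn n)"
      by (intro always_eventually allI est) (simp add: Rn_def)
    have "filterlim Rn at_top sequentially" unfolding Rn_def
      by (rule filterlim_at_top_mono[OF filterlim_real_sequentially]) (auto intro!: always_eventually add_nonneg_nonneg)
    then have "filterlim (\<lambda>n. sqrt (Rn n)) at_infinity sequentially"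
      by (intro filterlim_at_top_imp_at_infinity filterlim_compose[OF sqrt_at_top])
    then show "(\<lambda>n. 60 * sqrt J / sqrt (Rn n)) \<longlonglongrightarrow> 0"
      by (rule tendsto_divide_0[OF tendsto_const])
  qed
  show ?thesis using LIMSEQ_unique[OF lim1 lim2] by (simp add: g_def v_def)
qed

text \<open>Partial fractions turn 1 / |t - z|^2 into a difference of Cauchy kernels at z and
  \<open>cnj z\<close>; the second integral vanishes, which is Poisson's formula for f. Splitting
  the Poisson kernel evenly between F and G, Cauchy--Schwarz passes to |f|^2.\<close>

lemma hardy_poisson:
  assumes f: "hardy f" and z: "Im z > 0"
  shows "(norm (f z))\<^sup>2 \<le> Im z / pi * (\<integral>t. (norm (f (of_real t)))\<^sup>2 / (norm (of_real t - z))\<^sup>2 \<partial>lborel)"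
proof -
  let ?P = "\<integral>t. (norm (f (of_real t)))\<^sup>2 / (norm (of_real t - z))\<^sup>2 \<partial>lborel"
  define F where "F = (\<lambda>t::real. f (of_real t) / (of_real t - z))"
  define G where "G = (\<lambda>t::real. 1 / (of_real t - z))"
  have y: "Im z \<noteq> 0" using z by simp
  have nz: "of_real t - z \<noteq> 0" "of_real t - cnj z \<noteq> 0" for t :: real
    using z by (auto simp: complex_eq_iff)
  have lb: "\<bar>Im z\<bar> \<le> norm (of_real t - z)" for t :: real using abs_Im_le_cmod[of "of_real t - z"] by simp
  have FL: "F \<in> L2 lborel"
  proof (rule L2_bound)
    have fr: "(\<lambda>t::real. f (of_real t)) \<in> L2 lborel" by (rule hardy_L2[OF f])
    then have [measurable]: "(\<lambda>t::real. f (of_real t)) \<in> borel_measurable borel" by (simp add: L2_def)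
    show "F \<in> borel_measurable lborel" unfolding F_def by measurable
    show "integrable lborel (\<lambda>t. (1 / (Im z)\<^sup>2) * (norm (f (of_real t)))\<^sup>2)" using fr by (auto simp: L2_def)
    fix t :: real
    have "(norm (F t))\<^sup>2 = (norm (f (of_real t)))\<^sup>2 / (norm (of_real t - z))\<^sup>2"
      by (simp add: F_def norm_divide power_divide)
    also have "\<dots> \<le> (norm (f (of_real t)))\<^sup>2 / \<bar>Im z\<bar>\<^sup>2"
      using lb[of t] z by (intro divide_left_mono power_mono mult_pos_pos) (auto intro: zero_less_power simp: nz)
    finally show "(norm (F t))\<^sup>2 \<le> (1 / (Im z)\<^sup>2) * (norm (f (of_real t)))\<^sup>2" by simp
  qed
  have GL: "G \<in> L2 lborel" unfolding G_def by (rule cauchy_kernel_L2[OF y])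
  have "ip2 lborel F G = (\<integral>t. (1 / (2 * \<i> * of_real (Im z))) * (f (of_real t) / (of_real t - z) - f (of_real t) / (of_real t - cnj z)) \<partial>lborel)"
    unfolding ip2_def
  proof (rule Bochner_Integration.integral_cong[OF refl])
    fix t :: real
    have "1 / (of_real t - z) - 1 / (of_real t - cnj z) = (z - cnj z) * (1 / (of_real t - z) * (1 / (of_real t - cnj z)))"
      using nz[of t] by (simp add: field_simps)
    also have "z - cnj z = 2 * \<i> * of_real (Im z)" by (simp add: complex_eq_iff)
    finally have "1 / (of_real t - z) * (1 / (of_real t - cnj z)) = (1 / (2 * \<i> * of_real (Im z))) * (1 / (of_real t - z) - 1 / (of_real t - cnj z))"
      using z by simp
    moreover have "F t * cnj (G t) = f (of_real t) * (1 / (of_real t - z) * (1 / (of_real t - cnj z)))"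
      by (simp add: F_def G_def)
    moreover have "a * (c * (1 / p - 1 / q)) = c * (a / p - a / q)" for a c p q :: complex
      by (simp add: algebra_simps)
    ultimately show "F t * cnj (G t) = (1 / (2 * \<i> * of_real (Im z))) * (f (of_real t) / (of_real t - z) - f (of_real t) / (of_real t - cnj z))"
      by (simp only:)
  qed
  also have "\<dots> = (1 / (2 * \<i> * of_real (Im z))) * ((2 * of_real pi * \<i> * f z) - 0)"
    using hardy_cauchy[OF f, of z] hardy_cauchy[OF f, of "cnj z"] z
      hardy_kernel_integrable[OF f, of z] hardy_kernel_integrable[OF f, of "cnj z"]
    by simp
  also have "\<dots> = of_real (pi / Im z) * f z" using z by simp
  finally have "norm (ip2 lborel F G) = pi / Im z * norm (f z)" using z by (simp add: norm_mult norm_divide)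
  then have "(pi / Im z)\<^sup>2 * (norm (f z))\<^sup>2 \<le> L2.nrm2 lborel F * L2.nrm2 lborel G"
    using L2.CS2[OF FL GL] by (simp add: power_mult_distrib power_divide)
  also have "\<dots> \<le> L2.nrm2 lborel F * (pi / Im z)"
  proof (rule mult_left_mono)
    show "L2.nrm2 lborel G \<le> pi / Im z"
    using poisson_kernel(2)[OF y] z by (simp add: L2_nrm2 G_def norm_divide power_divide)
  qed (rule L2.nrm2_ge_0[OF FL])
  also have "L2.nrm2 lborel F = ?P"
    by (simp add: L2_nrm2 F_def norm_divide power_divide)
  finally have "(pi / Im z)\<^sup>2 * (norm (f z))\<^sup>2 \<le> ?P * (pi / Im z)" .
  then have fin: "(pi / Im z)\<^sup>2 * (norm (f z))\<^sup>2 \<le> ?P * (pi / Im z)" .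
  have key: "k * n \<le> P" if "k > 0" "k\<^sup>2 * n \<le> P * k" for k n P :: real
    using mult_right_le_imp_le[of "k * n" k P] that by (simp add: power2_eq_square mult_ac)
  have "pi / Im z * (norm (f z))\<^sup>2 \<le> ?P" by (rule key[OF _ fin]) (use z in simp)
  then show ?thesis using z by (simp add: field_simps)
qed

text \<open>V is holomorphic with real part 1 plus the Poisson integral of |g|^2, hence |V| \<ge> 1
  + |G|^2, which dominates both 1 and |G|. Then G = (G / V) / (1 / V) is a quotient of bounded
  functions.\<close>

lemma poisson_bound_bounded_type:
  assumes G: "G holomorphic_on UHP" and g: "g \<in> L2 lborel"
    and le: "\<And>z. Im z > 0 \<Longrightarrow> (norm (G z))\<^sup>2 \<le> Im z / pi * (\<integral>t. (norm (g t))\<^sup>2 / (norm (of_real t - z))\<^sup>2 \<partial>lborel)"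
  shows "bounded_type_UHP G"
proof -
  define w where "w = (\<lambda>t. (norm (g t))\<^sup>2)"
  have wi: "integrable lborel w" and w0: "\<And>t. w t \<ge> 0" and [measurable]: "w \<in> borel_measurable lborel"
    using g by (auto simp: w_def L2_def)
  define I where "I = (\<integral>t. w t \<partial>lborel)"
  have lb: "Im z \<le> norm (of_real t - z)" if "Im z > 0" for t :: real and z :: complex
    using abs_Im_le_cmod[of "of_real t - z"] that by simp
  have nz: "of_real t - z \<noteq> 0" if "Im z > 0" for t :: real and z :: complex using that by (auto simp: complex_eq_iff)
  have bnd: "integrable lborel (\<lambda>t. of_real (w t) * k t)" 
    if "k \<in> borel_measurable lborel" "\<And>t. norm (k t) \<le> B" for k :: "real \<Rightarrow> complex" and B
  proof (rule Bochner_Integration.integrable_bound[where f = "\<lambda>t. B * w t"])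
    show "AE x in lborel. norm (of_real (w x) * k x) \<le> norm (B * w x)"
    proof (rule AE_I2)
      fix x
      have "norm (k x) * w x \<le> B * w x" using that(2)[of x] w0[of x] by (intro mult_right_mono)
      then show "norm (of_real (w x) * k x) \<le> norm (B * w x)"
        using w0[of x] by (simp add: norm_mult mult.commute)
    qed
  qed (use wi that(1) in auto)
  have k1: "integrable lborel (\<lambda>t. of_real (w t) * (1 / (of_real t - z)))" if "Im z > 0" for z :: complex
    using lb[OF that] nz[OF that] that by (intro bnd[of _ "1 / Im z"]) (auto simp: norm_divide frac_le)
  have k2: "integrable lborel (\<lambda>t. of_real (w t) * (1 / (of_real t - z)\<^sup>2))" if "Im z > 0" for z :: complex
    using lb[OF that] nz[OF that] that
    by (intro bnd[of _ "1 / (Im z)\<^sup>2"]) (auto simp: norm_divide norm_power intro!: frac_le power_mono)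
  define U where "U = (\<lambda>z::complex. \<integral>t. of_real (w t) * (1 / (of_real t - z)) \<partial>lborel)"
  \<comment> \<open>Differentiation under the integral, through an explicit error of order |u - z|
    on the disc of radius y / 2, where |t - u| \<ge> y / 2.\<close>
  have Ud: "(U has_field_derivative (\<integral>t. of_real (w t) * (1 / (of_real t - z)\<^sup>2) \<partial>lborel)) (at z)" if z: "Im z > 0" for z :: complex
  proof -
    define y where "y = Im z"
    have y: "y > 0" using z by (simp add: y_def)
    let ?D = "\<integral>t. of_real (w t) * (1 / (of_real t - z)\<^sup>2) \<partial>lborel"
    have est: "norm ((U u - U z) / (u - z) - ?D) \<le> (2 * I / y ^ 3) * norm (u - z)" if u: "u \<noteq> z" "norm (u - z) < y / 2" for u
    proof -
      have Iu: "Im u > y / 2" using abs_Im_le_cmod[of "u - z"] u y by (simp add: y_def)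
      have Iu0: "Im u > 0" using Iu y by linarith
      have "U u - U z = (\<integral>t. of_real (w t) * (1 / (of_real t - u)) - of_real (w t) * (1 / (of_real t - z)) \<partial>lborel)"
        unfolding U_def using k1[OF Iu0] k1[OF z] by simp
      then have "(U u - U z) / (u - z) - ?D = (\<integral>t. (of_real (w t) * (1 / (of_real t - u)) - of_real (w t) * (1 / (of_real t - z))) / (u - z)
          - of_real (w t) * (1 / (of_real t - z)\<^sup>2) \<partial>lborel)"
        using k1[OF Iu0] k1[OF z] k2[OF z] by simp
      also have "\<dots> = (\<integral>t. of_real (w t) * ((u - z) / ((of_real t - u) * (of_real t - z)\<^sup>2)) \<partial>lborel)"
      proof (rule Bochner_Integration.integral_cong[OF refl])
        fix t :: real
        define p where "p = of_real t - u"
        define q where "q = of_real t - z"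
        have pq: "p \<noteq> 0" "q \<noteq> 0" "q - p \<noteq> 0" "u - z = q - p"
          using nz[OF Iu0] nz[OF z] u by (auto simp: p_def q_def)
        have "(1 / p - 1 / q) / (q - p) - 1 / q\<^sup>2 = (q - p) / (p * q\<^sup>2)"
          using pq by (simp add: divide_simps power2_eq_square)
        then have "of_real (w t) * ((1 / p - 1 / q) / (q - p) - 1 / q\<^sup>2) = of_real (w t) * ((q - p) / (p * q\<^sup>2))" by simp
        then show "(of_real (w t) * (1 / (of_real t - u)) - of_real (w t) * (1 / (of_real t - z))) / (u - z)
          - of_real (w t) * (1 / (of_real t - z)\<^sup>2) = of_real (w t) * ((u - z) / ((of_real t - u) * (of_real t - z)\<^sup>2))"
          unfolding p_def[symmetric] q_def[symmetric] pq(4) by (simp add: right_diff_distrib diff_divide_distrib)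
      qed
      finally have eq: "(U u - U z) / (u - z) - ?D = \<dots>" .
      have "norm (\<integral>t. of_real (w t) * ((u - z) / ((of_real t - u) * (of_real t - z)\<^sup>2)) \<partial>lborel)
          \<le> (\<integral>t. w t * (norm (u - z) * (2 / y ^ 3)) \<partial>lborel)"
      proof (rule Bochner_Integration.integral_norm_bound_integral)
        have pt: "norm ((u - z) / ((of_real t - u) * (of_real t - z)\<^sup>2)) \<le> norm (u - z) * (2 / y ^ 3)" for t :: real
        proof -
          have "y / 2 * y\<^sup>2 \<le> norm (of_real t - u) * (norm (of_real t - z))\<^sup>2"
            using lb[OF Iu0, of t] lb[OF z, of t] Iu y by (intro mult_mono power_mono) (auto simp: y_def)
          then have "norm (u - z) / (norm (of_real t - u) * (norm (of_real t - z))\<^sup>2) \<le> norm (u - z) / (y / 2 * y\<^sup>2)"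
            using y by (intro frac_le) auto
          then show ?thesis by (simp add: norm_divide norm_mult norm_power power2_eq_square power3_eq_cube)
        qed
        show "integrable lborel (\<lambda>t. of_real (w t) * ((u - z) / ((of_real t - u) * (of_real t - z)\<^sup>2)))"
          by (rule bnd[OF _ pt]) measurable
        show "integrable lborel (\<lambda>t. w t * (norm (u - z) * (2 / y ^ 3)))" using wi by simp
        show "norm (of_real (w t) * ((u - z) / ((of_real t - u) * (of_real t - z)\<^sup>2))) \<le> w t * (norm (u - z) * (2 / y ^ 3))" for t
          unfolding norm_mult using pt[of t] w0[of t] by (intro mult_mono) auto
      qed
      also have "\<dots> = (2 * I / y ^ 3) * norm (u - z)" by (simp add: I_def)
      finally show ?thesis unfolding eq .
    qed
    have "((\<lambda>u. (U u - U z) / (u - z) - ?D) \<longlongrightarrow> 0) (at z)"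
    proof (rule Lim_null_comparison)
      show "\<forall>\<^sub>F u in at z. norm ((U u - U z) / (u - z) - ?D) \<le> (2 * I / y ^ 3) * norm (u - z)"
        unfolding eventually_at using y est by (intro exI[of _ "y / 2"]) (auto simp: dist_norm)
      have "((\<lambda>u. (2 * I / y ^ 3) * norm (u - z)) \<longlongrightarrow> (2 * I / y ^ 3) * norm (z - z)) (at z)"
        by (intro tendsto_intros)
      then show "((\<lambda>u. (2 * I / y ^ 3) * norm (u - z)) \<longlongrightarrow> 0) (at z)" by simp
    qed
    then show ?thesis by (simp add: has_field_derivative_iff LIM_zero_iff)
  qed
  have opn: "open UHP" unfolding UHP_def by (rule open_halfspace_Im_gt)
  have Uh: "U holomorphic_on UHP"
    using Ud opn by (auto simp: holomorphic_on_open UHP_def)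
  define V where "V = (\<lambda>z. 1 + U z / (of_real pi * \<i>))"
  have ReV: "Re (V z) = 1 + Im z / pi * (\<integral>t. w t / (norm (of_real t - z))\<^sup>2 \<partial>lborel)" if z: "Im z > 0" for z
  proof -
    have "Im (U z) = (\<integral>t. Im (of_real (w t) * (1 / (of_real t - z))) \<partial>lborel)"
      unfolding U_def by (rule integral_Im[symmetric]) (rule k1[OF z])
    also have "\<dots> = (\<integral>t. Im z * (w t / (norm (of_real t - z))\<^sup>2) \<partial>lborel)"
      by (rule Bochner_Integration.integral_cong[OF refl]) (simp add: Im_divide cmod_power2)
    also have "\<dots> = Im z * (\<integral>t. w t / (norm (of_real t - z))\<^sup>2 \<partial>lborel)" by (rule Bochner_Integration.integral_mult_right_zero)
    finally have "Im (U z) / pi = Im z / pi * (\<integral>t. w t / (norm (of_real t - z))\<^sup>2 \<partial>lborel)" by simp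
    moreover have "Re (U z / (of_real pi * \<i>)) = Im (U z) / pi"
      by (simp add: Re_divide power2_eq_square)
    ultimately show ?thesis by (simp add: V_def)
  qed
  have V1: "norm (G z) \<le> norm (V z)" "1 \<le> norm (V z)" if z: "Im z > 0" for z
  proof -
    have R: "Re (V z) \<ge> 1 + (norm (G z))\<^sup>2" using ReV[OF z] le[OF z] by (simp add: w_def)
    moreover have "norm (G z) \<le> 1 + (norm (G z))\<^sup>2"
    proof -
      have "2 * norm (G z) \<le> (norm (G z))\<^sup>2 + 1" using sum_squares_bound[of "norm (G z)" 1] by simp
      then show ?thesis using norm_ge_zero[of "G z"] by linarith
    qed
    ultimately show "norm (G z) \<le> norm (V z)" "1 \<le> norm (V z)"
      using complex_Re_le_cmod[of "V z"] zero_le_power2[of "norm (G z)"] by linarith+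
  qed
  have Vnz: "V z \<noteq> 0" if "Im z > 0" for z using V1(2)[OF that] by auto
  have Vh: "V holomorphic_on UHP" unfolding V_def by (intro holomorphic_intros Uh) auto
  show ?thesis
    unfolding bounded_type_UHP_def
  proof (rule exI[of _ "\<lambda>z. G z / V z"], rule exI[of _ "\<lambda>z. 1 / V z"], intro conjI ballI)
    show "(\<lambda>z. G z / V z) holomorphic_on UHP" "(\<lambda>z. 1 / V z) holomorphic_on UHP"
      by (intro holomorphic_intros G Vh; use Vnz in \<open>simp add: UHP_def\<close>)+
    show "bounded ((\<lambda>z. G z / V z) ` UHP)" "bounded ((\<lambda>z. 1 / V z) ` UHP)"
      unfolding bounded_iff using V1 Vnz by (auto intro!: exI[of _ 1] simp: UHP_def norm_divide divide_le_eq_1)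
    show "\<exists>z\<in>UHP. 1 / V z \<noteq> 0" using Vnz[of \<i>] by (intro bexI[of _ \<i>]) (auto simp: UHP_def)
  qed auto
qed

section \<open>De Branges spaces\<close>

lemma mean_type_nonpos_bounded:
  assumes "mean_type_nonpos f" "\<epsilon> > 0"
  obtains Y where "Y > 0" "\<And>y. y \<ge> Y \<Longrightarrow> norm (f (\<i> * of_real y)) \<le> exp (\<epsilon> * y)"
proof -
  have "Limsup at_top (\<lambda>y::real. eln (norm (f (\<i> * complex_of_real y))) / ereal y) < ereal \<epsilon>"
    using assms unfolding mean_type_nonpos_def by (auto intro: le_less_trans)
  then have "\<forall>\<^sub>F y in at_top. eln (norm (f (\<i> * complex_of_real y))) / ereal y < ereal \<epsilon>"
    by (rule Limsup_lessD)
  then obtain Y0 where Y0: "\<And>y. y \<ge> Y0 \<Longrightarrow> eln (norm (f (\<i> * complex_of_real y))) / ereal y < ereal \<epsilon>"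
    by (auto simp: eventually_at_top_linorder)
  show ?thesis
  proof (rule that[of "max 1 Y0"])
    fix y assume y: "max 1 Y0 \<le> y"
    have lt: "eln (norm (f (\<i> * complex_of_real y))) / ereal y < ereal \<epsilon>" using Y0 y by simp
    show "norm (f (\<i> * complex_of_real y)) \<le> exp (\<epsilon> * y)"
    proof (cases "norm (f (\<i> * complex_of_real y)) = 0")
      case False
      then have p: "norm (f (\<i> * complex_of_real y)) > 0" by simp
      have "ln (norm (f (\<i> * complex_of_real y))) / y < \<epsilon>"
        using lt False y by (simp add: eln_def)
      then have "ln (norm (f (\<i> * complex_of_real y))) < \<epsilon> * y" using y by (simp add: divide_less_eq)
      then show ?thesis using p by (metis exp_ln exp_less_cancel_iff less_imp_le)
    qed simp
  qed simp
qed

lemma mean_type_nonposI: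
  assumes "Y > 0" "\<And>y. y \<ge> Y \<Longrightarrow> norm (f (\<i> * of_real y)) \<le> C"
  shows "mean_type_nonpos f"
proof -
  define C' where "C' = max C 1"
  have C': "C' \<ge> 1" "C' \<ge> C" by (auto simp: C'_def)
  have "Limsup at_top (\<lambda>y::real. eln (norm (f (\<i> * complex_of_real y))) / ereal y)
      \<le> Limsup at_top (\<lambda>y::real. ereal (ln C' / y))"
  proof (rule Limsup_mono)
    show "\<forall>\<^sub>F y in at_top. eln (norm (f (\<i> * complex_of_real y))) / ereal y \<le> ereal (ln C' / y)"
      using eventually_ge_at_top[of Y]
    proof (rule eventually_mono)
      fix y assume y: "Y \<le> y"
      have y0: "y > 0" using y assms(1) by linarith
      show "eln (norm (f (\<i> * complex_of_real y))) / ereal y \<le> ereal (ln C' / y)"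
      proof (cases "norm (f (\<i> * complex_of_real y)) = 0")
        case True
        then show ?thesis using y0 by (simp add: eln_def)
      next
        case False
        have "ln (norm (f (\<i> * complex_of_real y))) \<le> ln C'"
          using assms(2)[OF y] C' False by (subst ln_le_cancel_iff) auto
        then show ?thesis using False y0 by (simp add: eln_def divide_right_mono)
      qed
    qed
  qed
  also have "Limsup at_top (\<lambda>y::real. ereal (ln C' / y)) = 0"
  proof (rule lim_imp_Limsup)
    have "((\<lambda>y::real. ln C' / y) \<longlongrightarrow> 0) at_top"
      by (rule tendsto_divide_0[OF tendsto_const]) (rule filterlim_at_top_imp_at_infinity[OF filterlim_ident])
    then show "((\<lambda>y::real. ereal (ln C' / y)) \<longlongrightarrow> 0) at_top"
      unfolding zero_ereal_def by (rule tendsto_ereal)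
  qed simp
  finally show ?thesis unfolding mean_type_nonpos_def .
qed

lemma sharp_holomorphic: "F holomorphic_on UNIV \<Longrightarrow> sharp F holomorphic_on UNIV"
proof -
  assume "F holomorphic_on UNIV"
  moreover have "cnj ` UNIV = UNIV" using surjI[of cnj cnj] by simp
  ultimately show "sharp F holomorphic_on UNIV"
    using holomorphic_on_compose_cnj_cnj[of F UNIV] by (simp add: sharp_def[abs_def] o_def)
qed

lemma sharp_sharp [simp]: "sharp (sharp F) = F"
  by (simp add: sharp_def[abs_def])

lemma norm_sharp_real [simp]: "norm (sharp F (of_real t)) = norm (F (of_real t))"
  by (simp add: sharp_def)

lemma real_line_measurable:
  fixes F :: "complex \<Rightarrow> complex"
  assumes "F holomorphic_on UNIV"
  shows "(\<lambda>t::real. F (of_real t)) \<in> borel_measurable borel"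
  by (intro borel_measurable_continuous_onI continuous_on_compose2[OF holomorphic_on_imp_continuous_on[OF assms]] continuous_intros) auto

text \<open>Since |z + i|^2 / Im z \<ge> 1 in the half-plane, the factor 1 + |\<alpha>| of the sum
  can be absorbed into the exponent.\<close>

lemma hardy_lin:
  assumes f: "hardy f" and g: "hardy g"
  shows "hardy (\<lambda>z. f z + \<alpha> * g z)"
proof -
  have L: "(\<lambda>t::real. f (of_real t) + \<alpha> * g (of_real t)) \<in> L2 lborel"
    by (intro L2_lin hardy_L2 f g)
  obtain C1 where C1: "C1 \<ge> 0" "\<And>z. Im z > 0 \<Longrightarrow> norm (f z) \<le> exp (C1 * (norm (z + \<i>))\<^sup>2 / Im z)"
    using f unfolding hardy_def by blast
  obtain C2 where C2: "C2 \<ge> 0" "\<And>z. Im z > 0 \<Longrightarrow> norm (g z) \<le> exp (C2 * (norm (z + \<i>))\<^sup>2 / Im z)"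
    using g unfolding hardy_def by blast
  define C where "C = norm \<alpha> + C1 + C2"
  have bound: "norm (f z + \<alpha> * g z) \<le> exp (C * (norm (z + \<i>))\<^sup>2 / Im z)" if z: "Im z > 0" for z
  proof -
    define X where "X = (norm (z + \<i>))\<^sup>2 / Im z"
    have "Im z + 1 \<le> norm (z + \<i>)" using abs_Im_le_cmod[of "z + \<i>"] by simp
    then have "(Im z + 1)\<^sup>2 \<le> (norm (z + \<i>))\<^sup>2" using z by (intro power_mono) auto
    moreover have "Im z \<le> (Im z + 1)\<^sup>2" using z by (simp add: power2_eq_square algebra_simps)
    ultimately have "Im z \<le> (norm (z + \<i>))\<^sup>2" by linarith
    then have X: "X \<ge> 1" unfolding X_def using z by (simp add: le_divide_eq)
    have e1: "norm (f z) \<le> exp ((C1 + C2) * X)"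
      using C1(2)[OF z] mult_nonneg_nonneg[OF C2(1), of X] X unfolding X_def[symmetric] times_divide_eq_right[symmetric]
      by (elim order_trans) (simp add: distrib_right)
    have e2: "norm (g z) \<le> exp ((C1 + C2) * X)"
      using C2(2)[OF z] mult_nonneg_nonneg[OF C1(1), of X] X unfolding X_def[symmetric] times_divide_eq_right[symmetric]
      by (elim order_trans) (simp add: distrib_right)
    have "norm (f z + \<alpha> * g z) \<le> norm (f z) + norm \<alpha> * norm (g z)"
      using norm_triangle_ineq[of "f z" "\<alpha> * g z"] by (simp add: norm_mult)
    also have "\<dots> \<le> exp ((C1 + C2) * X) + norm \<alpha> * exp ((C1 + C2) * X)"
      by (intro add_mono e1 mult_left_mono e2) auto
    also have "\<dots> = (1 + norm \<alpha>) * exp ((C1 + C2) * X)" by (simp add: algebra_simps)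
    also have "\<dots> \<le> exp (norm \<alpha> * X) * exp ((C1 + C2) * X)"
    proof (intro mult_right_mono)
      have "norm \<alpha> * 1 \<le> norm \<alpha> * X" using X by (intro mult_left_mono) auto
      then show "1 + norm \<alpha> \<le> exp (norm \<alpha> * X)" using exp_ge_add_one_self[of "norm \<alpha> * X"] by linarith
    qed auto
    also have "\<dots> = exp (C * X)" by (simp add: C_def algebra_simps flip: exp_add)
    finally show ?thesis by (simp add: X_def)
  qed
  have growth: "\<exists>N. \<forall>y\<ge>0. norm (f (\<i> * of_real y) + \<alpha> * g (\<i> * of_real y)) \<le> N * exp (\<epsilon> * y)" if "\<epsilon> > 0" for \<epsilon> :: real
  proof -
    from f \<open>\<epsilon> > 0\<close> obtain N1 where N1: "\<And>y. y \<ge> 0 \<Longrightarrow> norm (f (\<i> * of_real y)) \<le> N1 * exp (\<epsilon> * y)"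
      unfolding hardy_def by blast
    from g \<open>\<epsilon> > 0\<close> obtain N2 where N2: "\<And>y. y \<ge> 0 \<Longrightarrow> norm (g (\<i> * of_real y)) \<le> N2 * exp (\<epsilon> * y)"
      unfolding hardy_def by blast
    have "norm (f (\<i> * of_real y) + \<alpha> * g (\<i> * of_real y)) \<le> (N1 + norm \<alpha> * N2) * exp (\<epsilon> * y)" if y: "y \<ge> 0" for y
    proof -
      have "norm (f (\<i> * of_real y) + \<alpha> * g (\<i> * of_real y)) \<le> norm (f (\<i> * of_real y)) + norm \<alpha> * norm (g (\<i> * of_real y))"
        using norm_triangle_ineq[of "f (\<i> * of_real y)" "\<alpha> * g (\<i> * of_real y)"] by (simp add: norm_mult)
      also have "\<dots> \<le> N1 * exp (\<epsilon> * y) + norm \<alpha> * (N2 * exp (\<epsilon> * y))"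
        by (intro add_mono N1 mult_left_mono N2 y) auto
      finally show ?thesis by (simp add: algebra_simps)
    qed
    then show ?thesis by blast
  qed
  show ?thesis
    unfolding hardy_def
  proof (intro conjI)
    show "continuous_on CUHP (\<lambda>z. f z + \<alpha> * g z)"
      using f g unfolding hardy_def by (intro continuous_intros) auto
    show "(\<lambda>z. f z + \<alpha> * g z) holomorphic_on UHP"
      using f g unfolding hardy_def by (intro holomorphic_intros) auto
    show "integrable lborel (\<lambda>t::real. (norm (f (of_real t) + \<alpha> * g (of_real t)))\<^sup>2)"
      using L by (simp add: L2_def)
    show "\<exists>C\<ge>0. \<forall>z. Im z > 0 \<longrightarrow> norm (f z + \<alpha> * g z) \<le> exp (C * (norm (z + \<i>))\<^sup>2 / Im z)"
      by (rule exI[of _ C]) (use bound C1(1) C2(1) in \<open>auto simp: C_def\<close>)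
  qed (use growth in blast)
qed

text \<open>The Hermite--Biehler setting, with A and B real entire; \<open>A z - \<i> * B z\<close>
  is \<open>sharp E z\<close>. The last assumption admits the one real zero that occurs when A has
  the factor z: a common zero of A and B at 0, which is simple for A.\<close>

locale dB =
  fixes A B E :: "complex \<Rightarrow> complex"
  assumes A_holo: "A holomorphic_on UNIV" and B_holo: "B holomorphic_on UNIV"
    and A_cnj: "A (cnj z) = cnj (A z)" and B_cnj: "B (cnj z) = cnj (B z)"
    and E_def: "E = (\<lambda>z. A z + \<i> * B z)"
    and E_nz: "Im z > 0 \<Longrightarrow> E z \<noteq> 0"
    and E_sharp_le: "Im z > 0 \<Longrightarrow> norm (A z - \<i> * B z) \<le> norm (E z)"
    and real_zero: "A (of_real t) = 0 \<Longrightarrow> B (of_real t) = 0 \<Longrightarrow> t = 0 \<and> deriv A 0 \<noteq> 0"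
begin

lemma E_holo: "E holomorphic_on UNIV"
  unfolding E_def by (intro holomorphic_intros A_holo B_holo)

lemma cnj_E_real: "cnj (E (of_real t)) = A (of_real t) - \<i> * B (of_real t)"
  unfolding E_def using A_cnj[of "of_real t"] B_cnj[of "of_real t"] by simp

lemma E_real_zero:
  assumes "E (of_real t) = 0"
  shows "A (of_real t) = 0" "B (of_real t) = 0" "t = 0"
proof -
  have "cnj (E (of_real t)) = 0" using assms by simp
  then have "A (of_real t) - \<i> * B (of_real t) = 0" unfolding cnj_E_real .
  moreover have "A (of_real t) + \<i> * B (of_real t) = 0" using assms by (simp add: E_def)
  ultimately have "2 * A (of_real t) = 0" "2 * (\<i> * B (of_real t)) = 0" by (simp_all add: algebra_simps)
  then show "A (of_real t) = 0" "B (of_real t) = 0" by auto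
  then show "t = 0" using real_zero by blast
qed

lemma E_nz_CUHP: "Im z \<ge> 0 \<Longrightarrow> z \<noteq> 0 \<Longrightarrow> E z \<noteq> 0"
proof (cases "Im z = 0")
  case True
  then have "z = of_real (Re z)" by (simp add: complex_eq_iff)
  then show "z \<noteq> 0 \<Longrightarrow> E z \<noteq> 0" using E_real_zero(3)[of "Re z"] by (metis of_real_0)
qed (use E_nz in auto)

text \<open>A and i B are half the sum and half the difference of E and \<open>sharp E\<close>; on
  the real line these two have equal modulus.\<close>

lemma AB_le:
  assumes "Im z \<ge> 0"
  shows "norm (A z) \<le> norm (E z)" "norm (B z) \<le> norm (E z)"
proof -
  have le: "norm (A z - \<i> * B z) \<le> norm (E z)"
  proof (cases "Im z = 0")
    case True
    then have t: "z = of_real (Re z)" by (simp add: complex_eq_iff)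
    have "norm (A (of_real (Re z)) - \<i> * B (of_real (Re z))) \<le> norm (E (of_real (Re z)))"
      unfolding cnj_E_real[symmetric] by simp
    then show ?thesis unfolding t[symmetric] .
  qed (use E_sharp_le assms in auto)
  have e: "2 * A z = E z + (A z - \<i> * B z)" "2 * \<i> * B z = E z - (A z - \<i> * B z)"
    by (simp_all add: E_def algebra_simps)
  have "norm (2 * A z) \<le> norm (E z) + norm (A z - \<i> * B z)"
    unfolding e(1) by (rule norm_triangle_ineq)
  moreover have "norm (2 * \<i> * B z) \<le> norm (E z) + norm (A z - \<i> * B z)"
    unfolding e(2) by (rule norm_triangle_ineq4)
  ultimately have "norm (2 * A z) \<le> 2 * norm (E z)" "norm (2 * \<i> * B z) \<le> 2 * norm (E z)"
    using le by linarith+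
  then show "norm (A z) \<le> norm (E z)" "norm (B z) \<le> norm (E z)" by (simp_all add: norm_mult)
qed

text \<open>The derivatives of A and B at 0 are limits of real quotients, hence real, so A' + i B'
  can vanish there only if A' does.\<close>

lemma deriv_E_0: "E 0 = 0 \<Longrightarrow> deriv E 0 \<noteq> 0"
proof
  assume E0: "E 0 = 0" and d: "deriv E 0 = 0"
  have A0: "deriv A 0 \<noteq> 0" 
  proof -
    have "A 0 = 0" "B 0 = 0" using E_real_zero(1,2)[of 0] E0 by simp_all
    then show ?thesis using real_zero[of 0] by simp
  qed
  have Ad: "A field_differentiable at 0" "B field_differentiable at 0"
    by (intro holomorphic_on_imp_differentiable_at[OF A_holo open_UNIV] holomorphic_on_imp_differentiable_at[OF B_holo open_UNIV] UNIV_I)+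
  have real: "deriv F 0 \<in> \<real>" if F: "F field_differentiable at 0" "\<And>z. F (cnj z) = cnj (F z)" for F
  proof -
    have "((\<lambda>z. F z) has_field_derivative deriv F 0) (at 0)" using F(1) by (rule field_differentiable_derivI)
    then have l: "((\<lambda>h. (F h - F 0) / h) \<longlongrightarrow> deriv F 0) (at 0)"
      by (simp add: has_field_derivative_iff)
    have "filterlim (\<lambda>t::real. complex_of_real t) (at 0) (at_right 0)"
      unfolding filterlim_at by (auto intro!: tendsto_eq_intros eventually_at_rightI[of 0 1])
    from filterlim_compose[OF l this]
    have "((\<lambda>t::real. (F (of_real t) - F 0) / of_real t) \<longlongrightarrow> deriv F 0) (at_right 0)" .
    moreover have "(F (of_real t) - F 0) / of_real t \<in> \<real>" for t :: real
      using F(2)[of "of_real t"] F(2)[of 0] by (auto simp: Reals_cnj_iff)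
    ultimately show ?thesis
      by (intro Lim_in_closed_set[OF closed_complex_Reals]) auto
  qed
  have "deriv E 0 = deriv A 0 + \<i> * deriv B 0"
    unfolding E_def using Ad by (simp add: field_differentiable_mult field_differentiable_const)
  moreover obtain a b where "deriv A 0 = of_real a" "deriv B 0 = of_real b"
    using real[OF Ad(1) A_cnj] real[OF Ad(2) B_cnj] by (auto elim!: Reals_cases)
  ultimately show False using d A0 by (auto simp: complex_eq_iff)
qed

lemma boundary_measurable:
  assumes "F holomorphic_on UNIV"
  shows "(\<lambda>t::real. F (of_real t) / E (of_real t)) \<in> borel_measurable borel"
  by (intro borel_measurable_divide real_line_measurable assms E_holo)

lemma quotient_L2: "F holomorphic_on UNIV \<Longrightarrow> integrable lborel (\<lambda>t::real. (norm (F (of_real t)))\<^sup>2 / (norm (E (of_real t)))\<^sup>2)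
   \<Longrightarrow> (\<lambda>t::real. F (of_real t) / E (of_real t)) \<in> L2 lborel"
proof -
  assume F: "F holomorphic_on UNIV" and i: "integrable lborel (\<lambda>t::real. (norm (F (of_real t)))\<^sup>2 / (norm (E (of_real t)))\<^sup>2)"
  note [measurable] = real_line_measurable[OF F] real_line_measurable[OF E_holo]
  show ?thesis using i by (simp add: L2_def norm_divide power_divide)
qed

text \<open>If F 0 \<noteq> 0, then |F / E|^2 is at least of order 1 / t^2 near the zero of E, which
  is not integrable.\<close>

lemma zero_at_E_zero:
  assumes F: "F holomorphic_on UNIV" and E0: "E 0 = 0"
    and i: "integrable lborel (\<lambda>t::real. (norm (F (of_real t)))\<^sup>2 / (norm (E (of_real t)))\<^sup>2)"
  shows "F 0 = 0"
proof (rule ccontr)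
  assume F0: "F 0 \<noteq> 0"
  define m where "m = norm (F 0) / 2"
  have m: "m > 0" using F0 by (simp add: m_def)
  define D where "D = norm (deriv E 0) + 1"
  have D: "D > 0" by (simp add: D_def add_nonneg_pos)
  have "isCont F 0"
    using holomorphic_on_imp_continuous_on[OF F] continuous_on_eq_continuous_at[OF open_UNIV, of F] by blast
  then have "((\<lambda>z. norm (F z)) \<longlongrightarrow> norm (F 0)) (at 0)" by (intro tendsto_norm) (simp add: isCont_def)
  then have ev1: "\<forall>\<^sub>F z in at 0. norm (F z) > m" by (rule order_tendstoD) (use F0 in \<open>simp add: m_def\<close>)
  have "(E has_field_derivative deriv E 0) (at 0)" using E_holo by (rule holomorphic_derivI) auto
  then have "((\<lambda>z. norm (E z / z)) \<longlongrightarrow> norm (deriv E 0)) (at 0)"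
    using E0 by (intro tendsto_norm) (simp add: has_field_derivative_iff)
  then have ev2: "\<forall>\<^sub>F z in at 0. norm (E z / z) < D" by (rule order_tendstoD) (simp add: D_def)
  obtain d where d: "d > 0" "\<And>z. z \<noteq> 0 \<Longrightarrow> norm z < d \<Longrightarrow> norm (F z) > m \<and> norm (E z / z) < D"
    using eventually_conj[OF ev1 ev2] unfolding eventually_at by (auto simp: dist_norm)
  define I where "I = (\<integral>t. (norm (F (of_real t)))\<^sup>2 / (norm (E (of_real t)))\<^sup>2 \<partial>lborel)"
  \<comment> \<open>The integral from \<eta> / 2 to \<eta> alone is of order 1 / \<eta>, unbounded
    as \<eta> tends to 0.\<close>
  have bound: "(m / D)\<^sup>2 / (2 * \<eta>) \<le> I" if \<eta>: "0 < \<eta>" "\<eta> < d" for \<eta> :: real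
  proof -
    have "(\<integral>t. ((m / D)\<^sup>2 / \<eta>\<^sup>2) * indicator {\<eta>/2..\<eta>} t \<partial>lborel) \<le> I"
      unfolding I_def
    proof (rule integral_mono[OF _ i])
      show "integrable lborel (\<lambda>t. ((m / D)\<^sup>2 / \<eta>\<^sup>2) * indicator {\<eta>/2..\<eta>} t)"
        by (intro integrable_mult_right integrable_real_indicator) (auto simp: emeasure_lborel_Icc_eq)
      fix t :: real
      show "((m / D)\<^sup>2 / \<eta>\<^sup>2) * indicator {\<eta>/2..\<eta>} t \<le> (norm (F (of_real t)))\<^sup>2 / (norm (E (of_real t)))\<^sup>2"
      proof (cases "t \<in> {\<eta>/2..\<eta>}")
        case True
        then have t: "t > 0" "t \<le> \<eta>" "norm (of_real t :: complex) < d" using \<eta> by auto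
        then have Ft: "norm (F (of_real t)) > m" and Et: "norm (E (of_real t) / of_real t) < D"
          using d(2)[of "of_real t"] by auto
        have "norm (E (of_real t)) < D * t" using Et t by (simp add: norm_divide divide_less_eq)
        also have "D * t \<le> D * \<eta>" using t D by simp
        finally have E1: "norm (E (of_real t)) < D * \<eta>" .
        have E2: "norm (E (of_real t)) > 0" using E_nz_CUHP[of "of_real t"] t by simp
        have "m\<^sup>2 / (D * \<eta>)\<^sup>2 \<le> (norm (F (of_real t)))\<^sup>2 / (norm (E (of_real t)))\<^sup>2"
          using Ft E1 E2 m by (intro frac_le power_mono) auto
        then show ?thesis using True by (simp add: power_divide power_mult_distrib)
      qed simp
    qed
    then show ?thesis using \<eta> by (simp add: power2_eq_square field_simps)
  qed
  define k where "k = (m / D)\<^sup>2 / 2"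
  have k: "k > 0" using m D by (simp add: k_def)
  define \<eta> where "\<eta> = min (d / 2) (k / (\<bar>I\<bar> + 1))"
  have \<eta>: "0 < \<eta>" "\<eta> < d" using d k by (auto simp: \<eta>_def)
  have "k / \<eta> \<ge> k / (k / (\<bar>I\<bar> + 1))" using k \<eta> by (intro divide_left_mono) (auto simp: \<eta>_def)
  also have "k / (k / (\<bar>I\<bar> + 1)) = \<bar>I\<bar> + 1" using k by simp
  finally show False using bound[OF \<eta>] by (simp add: k_def)
qed

text \<open>A zero of E at 0 is simple and shared by F; cancelling it gives a quotient that is
  continuous on the closed half-plane. In that case F / E takes at 0 the default value of division
  by zero, so agreement is claimed away from 0 only.\<close>

lemma hardy_quotient:
  assumes F: "F holomorphic_on UNIV"
    and i: "integrable lborel (\<lambda>t::real. (norm (F (of_real t)))\<^sup>2 / (norm (E (of_real t)))\<^sup>2)"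
    and bt: "bounded_type_UHP (\<lambda>z. F z / E z)" and mt: "mean_type_nonpos (\<lambda>z. F z / E z)"
  obtains f where "hardy f" "\<And>z. Im z \<ge> 0 \<Longrightarrow> z \<noteq> 0 \<Longrightarrow> f z = F z / E z"
proof -
  define F1 where "F1 = (if E 0 = 0 then (\<lambda>z. if z = 0 then deriv F 0 else (F z - F 0) / (z - 0)) else F)"
  define E1 where "E1 = (if E 0 = 0 then (\<lambda>z. if z = 0 then deriv E 0 else (E z - E 0) / (z - 0)) else E)"
  have h: "F1 holomorphic_on UNIV" "E1 holomorphic_on UNIV"
    unfolding F1_def E1_def using pole_lemma_open[OF F, of 0] pole_lemma_open[OF E_holo, of 0] F E_holo by auto
  have nz: "E1 z \<noteq> 0" if "Im z \<ge> 0" for z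
    using that deriv_E_0 E_nz_CUHP[of z] by (auto simp: E1_def)
  define f where "f = (\<lambda>z. F1 z / E1 z)"
  have feq: "f z = F z / E z" if "z \<noteq> 0" for z
    using that zero_at_E_zero[OF F _ i] by (auto simp: f_def F1_def E1_def)
  have feqU: "f z = F z / E z" if "z \<in> UHP" for z
    using feq[of z] that by (cases "z = 0") (auto simp: UHP_def)
  have fc: "continuous_on CUHP f"
    unfolding f_def using nz
    by (intro continuous_intros continuous_on_subset[OF holomorphic_on_imp_continuous_on[OF h(1)]]
        continuous_on_subset[OF holomorphic_on_imp_continuous_on[OF h(2)]]) auto
  have fh: "f holomorphic_on UHP"
    unfolding f_def using nz
    by (intro holomorphic_intros holomorphic_on_subset[OF h(1)] holomorphic_on_subset[OF h(2)]) (auto simp: UHP_def)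
  have "bounded_type_UHP f" using bt feqU unfolding bounded_type_UHP_def by metis
  from bounded_type_growth[OF fh this]
  have gr: "\<exists>C\<ge>0. \<forall>z. Im z > 0 \<longrightarrow> norm (f z) \<le> exp (C * (norm (z + \<i>))\<^sup>2 / Im z)" .
  have "integrable lborel (\<lambda>t::real. (norm (f (of_real t)))\<^sup>2)"
  proof (rule integrable_cong_AE_imp[OF i])
    have "continuous_on UNIV (\<lambda>t::real. f (of_real t))"
      by (intro continuous_on_compose2[OF fc] continuous_intros) auto
    from borel_measurable_continuous_onI[OF this]
    show "(\<lambda>t::real. (norm (f (of_real t)))\<^sup>2) \<in> borel_measurable lborel" by simp
    show "AE t in lborel. (norm (F (of_real t)))\<^sup>2 / (norm (E (of_real t)))\<^sup>2 = (norm (f (of_real t)))\<^sup>2"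
      using AE_lborel_singleton[of "0::real"]
      by eventually_elim (simp add: feq norm_divide power_divide)
  qed
  moreover have "\<exists>N. \<forall>y\<ge>0. norm (f (\<i> * of_real y)) \<le> N * exp (\<epsilon> * y)" if e: "\<epsilon> > 0" for \<epsilon>
  proof -
    obtain Y where Y: "Y > 0" "\<And>y. y \<ge> Y \<Longrightarrow> norm (F (\<i> * of_real y) / E (\<i> * of_real y)) \<le> exp (\<epsilon> * y)"
      using mean_type_nonpos_bounded[OF mt e] by metis
    have "compact ((\<lambda>y::real. f (\<i> * of_real y)) ` {0..Y})"
      by (intro compact_continuous_image continuous_on_compose2[OF fc] continuous_intros) auto
    then obtain N where N: "\<And>y. 0 \<le> y \<Longrightarrow> y \<le> Y \<Longrightarrow> norm (f (\<i> * of_real y)) \<le> N"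
      by (metis (no_types, lifting) atLeastAtMost_iff bounded_iff compact_imp_bounded imageI)
    have "norm (f (\<i> * of_real y)) \<le> max N 1 * exp (\<epsilon> * y)" if y: "y \<ge> 0" for y
    proof (cases "y \<ge> Y")
      case True
      have "norm (f (\<i> * of_real y)) \<le> 1 * exp (\<epsilon> * y)"
        using Y(2)[OF True] feq[of "\<i> * of_real y"] True Y(1) by simp
      also have "\<dots> \<le> max N 1 * exp (\<epsilon> * y)" by (intro mult_right_mono) auto
      finally show ?thesis .
    next
      case False
      have "norm (f (\<i> * of_real y)) \<le> max N 1 * 1" using N[OF y] False by simp
      also have "\<dots> \<le> max N 1 * exp (\<epsilon> * y)" using e y by (intro mult_left_mono) auto
      finally show ?thesis .
    qed
    then show ?thesis by blast
  qed
  ultimately have "hardy f" unfolding hardy_def using fc fh gr by blast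
  then show ?thesis using feq that by blast
qed

lemma deBranges_sharp: "F \<in> deBranges E \<Longrightarrow> sharp F \<in> deBranges E"
  unfolding deBranges_def using sharp_holomorphic[of F] by simp

lemma deBranges_hardy:
  assumes "F \<in> deBranges E"
  obtains f where "hardy f" "\<And>z. Im z \<ge> 0 \<Longrightarrow> z \<noteq> 0 \<Longrightarrow> f z = F z / E z"
  using assms hardy_quotient[of F] unfolding deBranges_def by auto

lemma deBranges_L2: "F \<in> deBranges E \<Longrightarrow> (\<lambda>t::real. F (of_real t) / E (of_real t)) \<in> L2 lborel"
  unfolding deBranges_def using quotient_L2 by blast

lemma dB_norm2_eq:
  "dB_norm2 E F = L2.nrm2 lborel (\<lambda>t::real. F (of_real t) / E (of_real t)) / pi"
  by (simp add: dB_norm2_def L2_nrm2 norm_divide power_divide)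

lemma deBranges_holo: "F \<in> deBranges E \<Longrightarrow> F holomorphic_on UNIV"
  by (simp add: deBranges_def)

lemma poisson_if_hardy:
  assumes F: "F holomorphic_on UNIV" and f: "hardy f" "\<And>z. Im z \<ge> 0 \<Longrightarrow> z \<noteq> 0 \<Longrightarrow> f z = F z / E z" and z: "Im z > 0"
  shows "(norm (F z / E z))\<^sup>2 \<le> Im z / pi * (\<integral>t. (norm (F (of_real t) / E (of_real t)))\<^sup>2 / (norm (of_real t - z))\<^sup>2 \<partial>lborel)"
proof -
  have "(\<integral>t. (norm (f (of_real t)))\<^sup>2 / (norm (of_real t - z))\<^sup>2 \<partial>lborel)
      = (\<integral>t. (norm (F (of_real t) / E (of_real t)))\<^sup>2 / (norm (of_real t - z))\<^sup>2 \<partial>lborel)"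
  proof (rule integral_cong_AE)
    show "(\<lambda>t. (norm (f (of_real t)))\<^sup>2 / (norm (of_real t - z))\<^sup>2) \<in> borel_measurable lborel"
      using borel_measurable_continuous_onI[OF hardy_continuous_real[OF f(1)]] by measurable
    show "(\<lambda>t. (norm (F (of_real t) / E (of_real t)))\<^sup>2 / (norm (of_real t - z))\<^sup>2) \<in> borel_measurable lborel"
      using boundary_measurable[OF F] by measurable
    show "AE t in lborel. (norm (f (of_real t)))\<^sup>2 / (norm (of_real t - z))\<^sup>2 = (norm (F (of_real t) / E (of_real t)))\<^sup>2 / (norm (of_real t - z))\<^sup>2"
      using AE_lborel_singleton[of "0::real"] by eventually_elim (simp add: f(2))
  qed
  moreover have "z \<noteq> 0" using z by auto
  ultimately show ?thesis using hardy_poisson[OF f(1) z] f(2)[of z] z by simp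
qed

lemma deBranges_poisson:
  assumes F: "F \<in> deBranges E" and z: "Im z > 0"
  shows "(norm (F z / E z))\<^sup>2 \<le> Im z / pi * (\<integral>t. (norm (F (of_real t) / E (of_real t)))\<^sup>2 / (norm (of_real t - z))\<^sup>2 \<partial>lborel)"
  proof -
  obtain f where f: "hardy f" "\<And>z. Im z \<ge> 0 \<Longrightarrow> z \<noteq> 0 \<Longrightarrow> f z = F z / E z"
    using deBranges_hardy[OF F] by metis
  show ?thesis by (rule poisson_if_hardy[OF deBranges_holo[OF F] f z])
qed

lemma deBranges_I:
  assumes Q: "Q holomorphic_on UNIV" and L: "(\<lambda>t::real. Q (of_real t) / E (of_real t)) \<in> L2 lborel"
    and P: "\<And>z. Im z > 0 \<Longrightarrow> (norm (Q z / E z))\<^sup>2 \<le> Im z / pi * (\<integral>t. (norm (Q (of_real t) / E (of_real t)))\<^sup>2 / (norm (of_real t - z))\<^sup>2 \<partial>lborel)"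
    and Ps: "\<And>z. Im z > 0 \<Longrightarrow> (norm (sharp Q z / E z))\<^sup>2 \<le> Im z / pi * (\<integral>t. (norm (Q (of_real t) / E (of_real t)))\<^sup>2 / (norm (of_real t - z))\<^sup>2 \<partial>lborel)"
  shows "Q \<in> deBranges E"
proof -
  define w where "w = (\<lambda>t::real. (norm (Q (of_real t) / E (of_real t)))\<^sup>2)"
  have wi: "integrable lborel w" using L by (simp add: L2_def w_def)
  define I where "I = (\<integral>t. w t \<partial>lborel)"
  have main: "bounded_type_UHP (\<lambda>z. G z / E z) \<and> mean_type_nonpos (\<lambda>z. G z / E z)"
    if G: "G holomorphic_on UNIV" and PG: "\<And>z. Im z > 0 \<Longrightarrow> (norm (G z / E z))\<^sup>2 \<le> Im z / pi * (\<integral>t. w t / (norm (of_real t - z))\<^sup>2 \<partial>lborel)" for G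
  proof
    have "(\<lambda>z. G z / E z) holomorphic_on UHP"
      using E_nz by (intro holomorphic_intros holomorphic_on_subset[OF G] holomorphic_on_subset[OF E_holo]) (auto simp: UHP_def)
    then show "bounded_type_UHP (\<lambda>z. G z / E z)"
      by (rule poisson_bound_bounded_type[OF _ L]) (use PG in \<open>simp add: w_def\<close>)
    show "mean_type_nonpos (\<lambda>z. G z / E z)"
    proof (rule mean_type_nonposI[of 1 _ "sqrt (I / pi)"])
      fix y :: real assume y: "1 \<le> y"
      \<comment> \<open>|t - i y| \<ge> y bounds the squared quotient by I / (pi y), so it even
        stays bounded along the imaginary axis for y \<ge> 1.\<close>
      have "(\<integral>t. w t / (norm (of_real t - \<i> * of_real y))\<^sup>2 \<partial>lborel) \<le> (\<integral>t. w t / y\<^sup>2 \<partial>lborel)"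
      proof (rule integral_mono_AE')
        show "integrable lborel (\<lambda>t. w t / y\<^sup>2)" using wi by simp
        show "AE t in lborel. w t / (norm (of_real t - \<i> * of_real y))\<^sup>2 \<le> w t / y\<^sup>2"
        proof (rule AE_I2)
          fix t :: real
          have "y\<^sup>2 \<le> (norm (of_real t - \<i> * of_real y))\<^sup>2" unfolding cmod_power2 by simp
          then show "w t / (norm (of_real t - \<i> * of_real y))\<^sup>2 \<le> w t / y\<^sup>2"
            using y by (intro divide_left_mono) (auto simp: w_def intro!: mult_pos_pos zero_less_power order_less_le_trans[of 0 "y\<^sup>2"])
        qed
      qed (auto simp: w_def)
      also have "\<dots> = I / y\<^sup>2" by (simp add: I_def)
      finally have 1: "(\<integral>t. w t / (norm (of_real t - \<i> * of_real y))\<^sup>2 \<partial>lborel) \<le> I / y\<^sup>2" .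
      have "(norm (G (\<i> * of_real y) / E (\<i> * of_real y)))\<^sup>2 \<le> y / pi * (\<integral>t. w t / (norm (of_real t - \<i> * of_real y))\<^sup>2 \<partial>lborel)"
        using PG[of "\<i> * of_real y"] y by simp
      also have "\<dots> \<le> y / pi * (I / y\<^sup>2)" using 1 y by (intro mult_left_mono) auto
      also have "\<dots> = (I / pi) / y" using y by (simp add: power2_eq_square)
      also have "\<dots> \<le> (I / pi) / 1"
        using y by (intro divide_left_mono) (auto simp: I_def w_def)
      finally show "norm (G (\<i> * of_real y) / E (\<i> * of_real y)) \<le> sqrt (I / pi)"
        by (simp add: real_le_rsqrt)
    qed simp
  qed
  have "integrable lborel (\<lambda>t::real. (norm (Q (of_real t)))\<^sup>2 / (norm (E (of_real t)))\<^sup>2)"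
    using L by (simp add: L2_def norm_divide power_divide)
  then show ?thesis
    unfolding deBranges_def using main[OF Q] main[OF sharp_holomorphic[OF Q]] P Ps Q by (simp add: w_def)
qed

text \<open>\<open>kern (cnj w)\<close> is the reproducing kernel at w for the inner product with
  factor 1 / pi. Subtracting A w and B w in the numerators changes nothing off the diagonal, since
  the terms cancel, and supplies the value on it.\<close>

definition kern :: "complex \<Rightarrow> complex \<Rightarrow> complex" where
  "kern w z = B w * (if z = w then deriv A w else (A z - A w) / (z - w))
            - A w * (if z = w then deriv B w else (B z - B w) / (z - w))"

lemma kern_holo: "kern w holomorphic_on UNIV"
  unfolding kern_def by (intro holomorphic_intros pole_lemma_open A_holo B_holo) auto

lemma kern_eq: "z \<noteq> w \<Longrightarrow> kern w z = (A z * B w - B z * A w) / (z - w)"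
proof -
  assume "z \<noteq> w"
  then have "kern w z = (B w * (A z - A w) - A w * (B z - B w)) / (z - w)"
    by (simp add: kern_def flip: diff_divide_distrib)
  also have "B w * (A z - A w) - A w * (B z - B w) = A z * B w - B z * A w" by (simp add: algebra_simps)
  finally show ?thesis .
qed

text \<open>Away from \<open>cnj w\<close> both sides are given by the quotient formula and agree by
  the reality of A and B; continuity closes the gap.\<close>

lemma kern_sharp:
  assumes "Im w \<noteq> 0" shows "sharp (kern w) = kern (cnj w)"
proof -
  have *: "sharp (kern w) z = kern (cnj w) z" if "z \<noteq> cnj w" for z
  proof -
    have "cnj z \<noteq> w" using that by auto
    then show ?thesis using that by (simp add: sharp_def kern_eq A_cnj[symmetric] B_cnj[symmetric])
  qed
  have "sharp (kern w) z = kern (cnj w) z" for z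
  proof (cases "z = cnj w")
    case True
    let ?h = "\<lambda>z. sharp (kern w) z - kern (cnj w) z"
    have c: "continuous_on UNIV ?h"
      by (intro continuous_intros holomorphic_on_imp_continuous_on sharp_holomorphic kern_holo)
    have "norm (?h (cnj w)) \<le> 0"
      by (rule norm_bound_at_removed_point[OF open_UNIV c]) (use * in auto)
    then show ?thesis using True by simp
  qed (use * in auto)
  then show ?thesis by blast
qed

lemma kern_bound:
  assumes "Im z \<ge> 0" "z \<noteq> 0" "z \<noteq> w"
  shows "norm (kern w z / E z) \<le> (norm (A w) + norm (B w)) / norm (z - w)"
proof -
  have nz: "norm (E z) > 0" using E_nz_CUHP assms by simp
  have "norm (A z * B w - B z * A w) \<le> norm (A z) * norm (B w) + norm (B z) * norm (A w)"
    using norm_triangle_ineq4[of "A z * B w" "B z * A w"] by (simp add: norm_mult)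
  also have "\<dots> \<le> norm (E z) * norm (B w) + norm (E z) * norm (A w)"
    using AB_le[OF assms(1)] by (intro add_mono mult_right_mono) auto
  finally have le: "norm (A z * B w - B z * A w) \<le> norm (E z) * (norm (A w) + norm (B w))"
    by (simp add: algebra_simps)
  have "norm (kern w z / E z) = norm (A z * B w - B z * A w) / norm (E z) / norm (z - w)"
    by (simp add: kern_eq[OF assms(3)] norm_divide norm_mult mult_ac)
  also have "\<dots> \<le> (norm (E z) * (norm (A w) + norm (B w))) / norm (E z) / norm (z - w)"
    by (intro divide_right_mono le) auto
  also have "\<dots> = (norm (A w) + norm (B w)) / norm (z - w)" using nz by simp
  finally show ?thesis .
qed

lemma kern_half:
  assumes w: "Im w \<noteq> 0"
  shows "integrable lborel (\<lambda>t::real. (norm (kern w (of_real t)))\<^sup>2 / (norm (E (of_real t)))\<^sup>2)"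
    "bounded_type_UHP (\<lambda>z. kern w z / E z)" "mean_type_nonpos (\<lambda>z. kern w z / E z)"
proof -
  define c where "c = norm (A w) + norm (B w)"
  have c0: "c \<ge> 0" by (simp add: c_def)
  have nw: "of_real t \<noteq> w" for t :: real using w by auto
  show "integrable lborel (\<lambda>t::real. (norm (kern w (of_real t)))\<^sup>2 / (norm (E (of_real t)))\<^sup>2)"
  proof (rule Bochner_Integration.integrable_bound[where f = "\<lambda>t. c\<^sup>2 * (1 / (norm (of_real t - w))\<^sup>2)"])
    show "integrable lborel (\<lambda>t::real. c\<^sup>2 * (1 / (norm (of_real t - w))\<^sup>2))"
      using poisson_kernel(1)[OF w] by (intro integrable_mult_right)
    note [measurable] = real_line_measurable[OF kern_holo] real_line_measurable[OF E_holo]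
    show "(\<lambda>t::real. (norm (kern w (of_real t)))\<^sup>2 / (norm (E (of_real t)))\<^sup>2) \<in> borel_measurable lborel" by measurable
    show "AE t in lborel. norm ((norm (kern w (of_real t)))\<^sup>2 / (norm (E (of_real t)))\<^sup>2) \<le> norm (c\<^sup>2 * (1 / (norm (of_real t - w))\<^sup>2))"
      using AE_lborel_singleton[of "0::real"]
    proof eventually_elim
      case (elim t)
      then have "norm (kern w (of_real t) / E (of_real t)) \<le> c / norm (of_real t - w)"
        unfolding c_def by (intro kern_bound nw) auto
      then have "(norm (kern w (of_real t) / E (of_real t)))\<^sup>2 \<le> (c / norm (of_real t - w))\<^sup>2"
        by (intro power_mono) auto
      then show ?case by (simp add: norm_divide power_divide)
    qed
  qed
  show "bounded_type_UHP (\<lambda>z. kern w z / E z)"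
    unfolding bounded_type_UHP_def
  \<comment> \<open>The factor (z - w) / (z + \<i>) is bounded and cancels the denominator in
    \<open>kern_bound\<close>, which comes close to 0 if w lies in the half-plane.\<close>
  proof (rule exI[of _ "\<lambda>z. (kern w z / E z) * ((z - w) / (z + \<i>))"], rule exI[of _ "\<lambda>z. (z - w) / (z + \<i>)"], intro conjI ballI)
    have nz: "z + \<i> \<noteq> 0" "norm (z + \<i>) \<ge> 1" if "z \<in> UHP" for z
      using that abs_Im_le_cmod[of "z + \<i>"] by (auto simp: UHP_def complex_eq_iff)
    have Ez: "E z \<noteq> 0" if "z \<in> UHP" for z using that E_nz by (simp add: UHP_def)
    show h2: "(\<lambda>z. (z - w) / (z + \<i>)) holomorphic_on UHP"
      using nz by (intro holomorphic_intros) auto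
    show "(\<lambda>z. (kern w z / E z) * ((z - w) / (z + \<i>))) holomorphic_on UHP"
      using Ez by (intro holomorphic_intros h2 holomorphic_on_subset[OF kern_holo] holomorphic_on_subset[OF E_holo]) auto
    have b2: "norm ((z - w) / (z + \<i>)) \<le> 1 + norm (w + \<i>)" if z: "z \<in> UHP" for z
    proof -
      have "norm (z - w) \<le> norm (z + \<i>) + norm (w + \<i>)"
        using norm_triangle_ineq4[of "z + \<i>" "w + \<i>"] by simp
      also have "\<dots> \<le> norm (z + \<i>) + norm (w + \<i>) * norm (z + \<i>)"
        using nz(2)[OF z] by (simp add: mult_le_cancel_left1)
      finally have "norm (z - w) \<le> (1 + norm (w + \<i>)) * norm (z + \<i>)" by (simp add: algebra_simps)
      then show ?thesis using nz[OF z] by (simp add: norm_divide divide_le_eq)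
    qed
    then show "bounded ((\<lambda>z. (z - w) / (z + \<i>)) ` UHP)" unfolding bounded_iff by blast
    have "norm ((kern w z / E z) * ((z - w) / (z + \<i>))) \<le> c" if z: "z \<in> UHP" for z
    proof (cases "z = w")
      case False
      then have "norm (kern w z / E z) \<le> c / norm (z - w)"
        unfolding c_def using z by (intro kern_bound) (auto simp: UHP_def)
      then have "norm (kern w z / E z) * norm (z - w) \<le> c" using False by (simp add: le_divide_eq)
      also have "c \<le> c * norm (z + \<i>)" using nz(2)[OF z] c0 by (simp add: mult_le_cancel_left1)
      finally have "norm (kern w z / E z) * norm (z - w) / norm (z + \<i>) \<le> c"
        using nz(2)[OF z] by (subst pos_divide_le_eq) auto
      then show ?thesis by (simp add: norm_mult norm_divide)
    qed (use c0 in simp)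
    then show "bounded ((\<lambda>z. (kern w z / E z) * ((z - w) / (z + \<i>))) ` UHP)" unfolding bounded_iff by blast
    \<comment> \<open>A point straight above w, different from w and high enough to lie in the
      half-plane even if w does not.\<close>
    define z1 where "z1 = w + \<i> * of_real (2 * \<bar>Im w\<bar> + 1)"
    have z1: "z1 \<in> UHP" by (auto simp: UHP_def z1_def)
    moreover have "z1 - w \<noteq> 0" by (auto simp: z1_def complex_eq_iff)
    ultimately show "\<exists>z\<in>UHP. (z - w) / (z + \<i>) \<noteq> 0"
      using nz(1)[OF z1] by (intro bexI[of _ z1]) auto
  qed auto
  show "mean_type_nonpos (\<lambda>z. kern w z / E z)"
  proof (rule mean_type_nonposI[of "norm w + 1" _ c])
    show "norm w + 1 > 0" by (simp add: add_nonneg_pos)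
    fix y assume y: "norm w + 1 \<le> y"
    have y0: "y > 0" using y norm_ge_zero[of w] by linarith
    have d: "norm (\<i> * of_real y - w) \<ge> 1"
      using norm_triangle_ineq2[of "\<i> * of_real y" w] y y0 by (simp add: norm_mult)
    then have "norm (kern w (\<i> * of_real y) / E (\<i> * of_real y)) \<le> c / norm (\<i> * of_real y - w)"
      unfolding c_def using y0 by (intro kern_bound) auto
    also have "\<dots> \<le> c / 1" using d c0 by (intro divide_left_mono) auto
    finally show "norm (kern w (\<i> * of_real y) / E (\<i> * of_real y)) \<le> c" by simp
  qed
qed

lemma kern_deBranges:
  assumes w: "Im w \<noteq> 0" shows "kern w \<in> deBranges E"
proof -
  have w': "Im (cnj w) \<noteq> 0" using w by simp
  show ?thesis
    unfolding deBranges_def mem_Collect_eq kern_sharp[OF w]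
    by (intro conjI kern_half[OF w] kern_half(2,3)[OF w'] kern_holo)
qed

text \<open>On the real line |E|^2 is the product of E and \<open>cnj E\<close>, and the numerator
  of the kernel equals i/2 (Es E - E w \<open>cnj E\<close>). The integrand thus splits into a
  Cauchy kernel at w applied to F / E, which yields F w, and the conjugate of a Cauchy kernel at
  \<open>cnj w\<close> applied to \<open>sharp F / E\<close>, which yields 0.\<close>

lemma reproducing_upper:
  assumes F: "F \<in> deBranges E" and w: "Im w > 0"
  shows "ip2 lborel (\<lambda>t. F (of_real t) / E (of_real t)) (\<lambda>t. kern (cnj w) (of_real t) / E (of_real t)) = of_real pi * F w"
proof -
  obtain f where f: "hardy f" "\<And>z. Im z \<ge> 0 \<Longrightarrow> z \<noteq> 0 \<Longrightarrow> f z = F z / E z"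
    using deBranges_hardy[OF F] by metis
  obtain g where g: "hardy g" "\<And>z. Im z \<ge> 0 \<Longrightarrow> z \<noteq> 0 \<Longrightarrow> g z = sharp F z / E z"
    using deBranges_hardy[OF deBranges_sharp[OF F]] by metis
  define Es where "Es = A w - \<i> * B w"
  define f1 where "f1 = (\<lambda>t::real. f (of_real t) / (of_real t - w))"
  define g1 where "g1 = (\<lambda>t::real. g (of_real t) / (of_real t - cnj w))"
  have f1i: "integrable lborel f1" unfolding f1_def by (rule hardy_kernel_integrable[OF f(1)]) (use w in auto)
  have g1i: "integrable lborel g1" unfolding g1_def by (rule hardy_kernel_integrable[OF g(1)]) (use w in auto)
  have g1c: "integrable lborel (\<lambda>t. cnj (g1 t))" using g1i by simp
  have "ip2 lborel (\<lambda>t. F (of_real t) / E (of_real t)) (\<lambda>t. kern (cnj w) (of_real t) / E (of_real t))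
      = (\<integral>t. (\<i> / 2 * Es) * cnj (g1 t) - (\<i> / 2 * E w) * f1 t \<partial>lborel)"
    unfolding ip2_def
  proof (rule integral_cong_AE)
    show "(\<lambda>t. F (of_real t) / E (of_real t) * cnj (kern (cnj w) (of_real t) / E (of_real t))) \<in> borel_measurable lborel"
      using L2_ip_integrable[OF deBranges_L2[OF F] deBranges_L2[OF kern_deBranges[of "cnj w"]]] w by simp
    show "(\<lambda>t. (\<i> / 2 * Es) * cnj (g1 t) - (\<i> / 2 * E w) * f1 t) \<in> borel_measurable lborel"
      using f1i g1c by simp
    show "AE t in lborel. F (of_real t) / E (of_real t) * cnj (kern (cnj w) (of_real t) / E (of_real t)) = (\<i> / 2 * Es) * cnj (g1 t) - (\<i> / 2 * E w) * f1 t"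
      using AE_lborel_singleton[of "0::real"]
    proof eventually_elim
      case (elim t)
      define x where "x = complex_of_real t"
      have x0: "x \<noteq> 0" and xw: "x \<noteq> w" "x \<noteq> cnj w" and cx: "cnj x = x" using elim w by (auto simp: x_def complex_eq_iff)
      have Ex: "E x \<noteq> 0" using E_nz_CUHP[of x] x0 by (simp add: x_def)
      define p where "p = A x" define q where "q = B x"
      have Exp: "E x = p + \<i> * q" by (simp add: E_def p_def q_def)
      have cEx: "cnj (E x) = p - \<i> * q" using cnj_E_real[of t] by (simp add: x_def p_def q_def)
      have cEx0: "p - \<i> * q \<noteq> 0" using Ex cEx by (metis complex_cnj_zero_iff)
      have Ex0: "p + \<i> * q \<noteq> 0" using Ex Exp by simp
      have "cnj (kern (cnj w) x) = sharp (kern (cnj w)) x" by (simp add: sharp_def cx)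
      also have "\<dots> = kern w x" using kern_sharp[of "cnj w"] w by simp
      also have "\<dots> = (p * B w - q * A w) / (x - w)" using xw by (simp add: kern_eq p_def q_def)
      finally have k: "cnj (kern (cnj w) x) = (p * B w - q * A w) / (x - w)" .
      have g1t: "cnj (g1 t) = F x / (p - \<i> * q) / (x - w)"
        using g(2)[of x] x0 cEx cx unfolding g1_def x_def[symmetric] by (simp add: sharp_def x_def)
      have f1t: "f1 t = F x / (p + \<i> * q) / (x - w)"
        using f(2)[of x] x0 Exp unfolding f1_def x_def[symmetric] by (simp add: x_def)
      have Ew: "E w = A w + \<i> * B w" by (simp add: E_def)
      have alg: "F x / (p + \<i> * q) * ((p * B w - q * A w) / (x - w) / (p - \<i> * q))
        = \<i> / 2 * Es * (F x / (p - \<i> * q) / (x - w)) - \<i> / 2 * E w * (F x / (p + \<i> * q) / (x - w))"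
      proof -
        have id: "p * B w - q * A w = \<i> / 2 * Es * (p + \<i> * q) - \<i> / 2 * E w * (p - \<i> * q)"
        proof -
          have "\<i> * Es * (p + \<i> * q) - \<i> * E w * (p - \<i> * q) = 2 * (p * B w - q * A w)"
            unfolding Es_def Ew by (simp add: algebra_simps)
          then have "p * B w - q * A w = (\<i> * Es * (p + \<i> * q) - \<i> * E w * (p - \<i> * q)) / 2" by simp
          then show ?thesis by (simp add: diff_divide_distrib)
        qed
        have L: "a / u * ((\<alpha> * u - \<beta> * v) / d / v) = \<alpha> * (a / v / d) - \<beta> * (a / u / d)"
          if "u \<noteq> 0" "v \<noteq> 0" "d \<noteq> 0" for a \<alpha> \<beta> u v d :: complex
        proof -
          have L: "a / u * ((\<alpha> * u - \<beta> * v) / d / v) = a * \<alpha> * u / (u * d * v) - a * \<beta> * v / (u * d * v)"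
            by (simp add: right_diff_distrib diff_divide_distrib mult_ac)
          then show ?thesis using that by (simp add: mult_ac)
        qed
        have "x - w \<noteq> 0" using xw by simp
        from L[OF Ex0 cEx0 this] show ?thesis unfolding id .
      qed
      show ?case unfolding x_def[symmetric] complex_cnj_divide k cEx g1t f1t unfolding Exp by (rule alg)
    qed
  qed
  also have "\<dots> = (\<integral>t. (\<i> / 2 * Es) * cnj (g1 t) \<partial>lborel) - (\<integral>t. (\<i> / 2 * E w) * f1 t \<partial>lborel)"
    by (intro Bochner_Integration.integral_diff integrable_mult_right f1i g1c)
  also have "\<dots> = (\<i> / 2 * Es) * (\<integral>t. cnj (g1 t) \<partial>lborel) - (\<i> / 2 * E w) * (\<integral>t. f1 t \<partial>lborel)"
    by (simp only: Bochner_Integration.integral_mult_right_zero)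
  also have "(\<integral>t. cnj (g1 t) \<partial>lborel) = cnj (\<integral>t. g1 t \<partial>lborel)"
    by (rule integral_bounded_linear[OF bounded_linear_cnj g1i])
  also have "(\<integral>t. g1 t \<partial>lborel) = 0" unfolding g1_def using hardy_cauchy[OF g(1), of "cnj w"] w by simp
  also have "(\<integral>t. f1 t \<partial>lborel) = 2 * of_real pi * \<i> * f w" unfolding f1_def using hardy_cauchy[OF f(1), of w] w by simp
  also have "f w = F w / E w" using f(2)[of w] w by (cases "w = 0") auto
  finally show ?thesis using E_nz[OF w] by (simp add: mult.left_commute[of "of_real pi" \<i>])
qed

text \<open>The lower half-plane follows by applying the upper case to \<open>sharp F\<close> and
  conjugating.\<close>

lemma reproducing:
  assumes F: "F \<in> deBranges E" and w: "Im w \<noteq> 0"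
  shows "ip2 lborel (\<lambda>t. F (of_real t) / E (of_real t)) (\<lambda>t. kern (cnj w) (of_real t) / E (of_real t)) = of_real pi * F w"
proof (cases "Im w > 0")
  case True
  then show ?thesis by (rule reproducing_upper[OF F])
next
  case False
  then have w': "Im (cnj w) > 0" using w by simp
  have i: "integrable lborel (\<lambda>t. sharp F (of_real t) / E (of_real t) * cnj (kern w (of_real t) / E (of_real t)))"
    by (intro L2_ip_integrable deBranges_L2 deBranges_sharp F kern_deBranges w)
  have "cnj (ip2 lborel (\<lambda>t. sharp F (of_real t) / E (of_real t)) (\<lambda>t. kern w (of_real t) / E (of_real t)))
     = ip2 lborel (\<lambda>t. F (of_real t) / E (of_real t)) (\<lambda>t. kern (cnj w) (of_real t) / E (of_real t))"
    unfolding ip2_def integral_bounded_linear[OF bounded_linear_cnj i, symmetric]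
  proof (rule Bochner_Integration.integral_cong[OF refl])
    fix t :: real
    have "cnj (kern (cnj w) (of_real t)) = sharp (kern (cnj w)) (of_real t)" by (simp add: sharp_def)
    then have "cnj (kern (cnj w) (of_real t)) = kern w (of_real t)" using kern_sharp[of "cnj w"] w by simp
    then show "cnj (sharp F (of_real t) / E (of_real t) * cnj (kern w (of_real t) / E (of_real t)))
       = F (of_real t) / E (of_real t) * cnj (kern (cnj w) (of_real t) / E (of_real t))"
      by (simp add: sharp_def mult_ac)
  qed
  moreover have "ip2 lborel (\<lambda>t. sharp F (of_real t) / E (of_real t)) (\<lambda>t. kern w (of_real t) / E (of_real t)) = of_real pi * sharp F (cnj w)"
    using reproducing_upper[OF deBranges_sharp[OF F] w'] by simp
  ultimately show ?thesis by (simp add: sharp_def)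
qed

text \<open>Bounded type and mean type of the sum are obtained through the Hardy class: the
  quotients add there, the sum satisfies the Poisson bound, and that bound implies
  membership.\<close>

lemma deBranges_lin:
  assumes F: "F \<in> deBranges E" and G: "G \<in> deBranges E"
  shows "(\<lambda>z. F z + \<alpha> * G z) \<in> deBranges E"
proof -
  have P: "(norm ((F z + \<alpha> * G z) / E z))\<^sup>2 \<le> Im z / pi * (\<integral>t. (norm ((F (of_real t) + \<alpha> * G (of_real t)) / E (of_real t)))\<^sup>2 / (norm (of_real t - z))\<^sup>2 \<partial>lborel)"
    if F: "F \<in> deBranges E" and G: "G \<in> deBranges E" and z: "Im z > 0" for F G \<alpha> z
  proof -
    obtain f where f: "hardy f" "\<And>z. Im z \<ge> 0 \<Longrightarrow> z \<noteq> 0 \<Longrightarrow> f z = F z / E z"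
      using deBranges_hardy[OF F] by metis
    obtain g where g: "hardy g" "\<And>z. Im z \<ge> 0 \<Longrightarrow> z \<noteq> 0 \<Longrightarrow> g z = G z / E z"
      using deBranges_hardy[OF G] by metis
    have h: "(\<lambda>z. F z + \<alpha> * G z) holomorphic_on UNIV" by (intro holomorphic_intros deBranges_holo F G)
    show ?thesis
      by (rule poisson_if_hardy[OF h hardy_lin[OF f(1) g(1), of \<alpha>] _ z]) (simp add: f g add_divide_distrib)
  qed
  show ?thesis
  proof (rule deBranges_I)
    show "(\<lambda>z. F z + \<alpha> * G z) holomorphic_on UNIV" by (intro holomorphic_intros deBranges_holo F G)
    show "(\<lambda>t::real. (F (of_real t) + \<alpha> * G (of_real t)) / E (of_real t)) \<in> L2 lborel"
      using L2_lin[OF deBranges_L2[OF F] deBranges_L2[OF G], of \<alpha>] by (simp add: add_divide_distrib)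
    fix z assume z: "Im z > 0"
    show "(norm ((F z + \<alpha> * G z) / E z))\<^sup>2 \<le> Im z / pi * (\<integral>t. (norm ((F (of_real t) + \<alpha> * G (of_real t)) / E (of_real t)))\<^sup>2 / (norm (of_real t - z))\<^sup>2 \<partial>lborel)"
      by (rule P[OF F G z])
    have s: "sharp (\<lambda>z. F z + \<alpha> * G z) = (\<lambda>z. sharp F z + cnj \<alpha> * sharp G z)" by (simp add: sharp_def[abs_def])
    have n: "norm (F (of_real t) + \<alpha> * G (of_real t)) = norm (sharp F (of_real t) + cnj \<alpha> * sharp G (of_real t))" for t :: real
      using norm_sharp_real[of "\<lambda>z. F z + \<alpha> * G z" t] by (simp add: s)
    show "(norm (sharp (\<lambda>z. F z + \<alpha> * G z) z / E z))\<^sup>2 \<le> Im z / pi * (\<integral>t. (norm ((F (of_real t) + \<alpha> * G (of_real t)) / E (of_real t)))\<^sup>2 / (norm (of_real t - z))\<^sup>2 \<partial>lborel)"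
      using P[OF deBranges_sharp[OF F] deBranges_sharp[OF G] z, of "cnj \<alpha>"] unfolding s by (simp only: norm_divide n)
  qed
qed

text \<open>Pointwise convergence identifies the mean-square limit on the line. The Poisson bounds
  of \<open>Q n\<close> and \<open>sharp (Q n)\<close> then converge on both sides, which is all
  that \<open>deBranges_I\<close> asks for.\<close>

lemma deBranges_limit:
  assumes Q: "\<And>n. Q n \<in> deBranges E" and c: "L2.cauchy_seq lborel (\<lambda>n t. Q n (of_real t) / E (of_real t))"
    and R: "R holomorphic_on UNIV" and lim: "\<And>z. (\<lambda>n. Q n z) \<longlonglongrightarrow> R z"
  shows "R \<in> deBranges E" "(\<lambda>n. L2.nrm2 lborel (\<lambda>t. Q n (of_real t) / E (of_real t))) \<longlonglongrightarrow> L2.nrm2 lborel (\<lambda>t. R (of_real t) / E (of_real t))"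
proof -
  define u where "u = (\<lambda>n t. Q n (of_real t) / E (of_real t))"
  define v where "v = (\<lambda>t::real. R (of_real t) / E (of_real t))"
  have uL: "u n \<in> L2 lborel" for n unfolding u_def by (rule deBranges_L2[OF Q])
  have "AE t in lborel. (\<lambda>n. u (id n) t) \<longlonglongrightarrow> v t"
    using AE_lborel_singleton[of "0::real"]
  proof eventually_elim
    case (elim t)
    then have "E (of_real t) \<noteq> 0" using E_nz_CUHP[of "of_real t"] by simp
    then show ?case unfolding u_def v_def id_def by (intro tendsto_divide lim tendsto_const)
  qed
  then have vL: "v \<in> L2 lborel" and uv: "(\<lambda>n. L2.nrm2 lborel (\<lambda>t. u n t - v t)) \<longlonglongrightarrow> 0"
    using L2_cauchy_pointwise[of u lborel id v] uL c boundary_measurable[OF R]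
    by (auto simp: strict_mono_id u_def[symmetric] v_def[symmetric])
  show "(\<lambda>n. L2.nrm2 lborel (\<lambda>t. Q n (of_real t) / E (of_real t))) \<longlonglongrightarrow> L2.nrm2 lborel (\<lambda>t. R (of_real t) / E (of_real t))"
    using L2.nrm2_tendsto[OF uL vL uv] by (simp add: u_def v_def)
  have P: "(\<lambda>n. \<integral>t. (norm (u n t))\<^sup>2 / (norm (of_real t - z))\<^sup>2 \<partial>lborel) \<longlonglongrightarrow> (\<integral>t. (norm (v t))\<^sup>2 / (norm (of_real t - z))\<^sup>2 \<partial>lborel)"
    if z: "Im z > 0" for z
  proof -
    \<comment> \<open>Its squared modulus is the Poisson kernel up to a constant. Multiplication by
      the bounded function k preserves mean-square convergence, so the Poisson integrals
      converge.\<close>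
    define k where "k = (\<lambda>t::real. 1 / (of_real t - z))"
    have km [measurable]: "k \<in> borel_measurable lborel" unfolding k_def by measurable
    have kb: "norm (k t) \<le> 1 / Im z" for t
    proof -
      have "Im z \<le> norm (of_real t - z)" using abs_Im_le_cmod[of "of_real t - z"] by simp
      then show ?thesis using z by (simp add: k_def norm_divide frac_le)
    qed
    have m: "(\<lambda>t. f t * k t) \<in> L2 lborel" "L2.nrm2 lborel (\<lambda>t. f t * k t) \<le> (1 / Im z)\<^sup>2 * L2.nrm2 lborel f" if f: "f \<in> L2 lborel" for f
    proof -
      have [measurable]: "f \<in> borel_measurable lborel" and fi: "integrable lborel (\<lambda>t. (norm (f t))\<^sup>2)" using f by (auto simp: L2_def)
      have le: "(norm (f t * k t))\<^sup>2 \<le> (1 / Im z)\<^sup>2 * (norm (f t))\<^sup>2" for t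
        using mult_mono[OF power_mono[OF kb[of t], of 2] order_refl[of "(norm (f t))\<^sup>2"]] by (simp add: norm_mult power_mult_distrib mult.commute)
      show l: "(\<lambda>t. f t * k t) \<in> L2 lborel"
        by (rule L2_bound[where h = "\<lambda>t. (1 / Im z)\<^sup>2 * (norm (f t))\<^sup>2"]) (use fi le in auto)
      have "L2.nrm2 lborel (\<lambda>t. f t * k t) \<le> (\<integral>t. (1 / Im z)\<^sup>2 * (norm (f t))\<^sup>2 \<partial>lborel)"
        unfolding L2_nrm2 by (rule integral_mono) (use l fi le in \<open>auto simp: L2_def\<close>)
      then show "L2.nrm2 lborel (\<lambda>t. f t * k t) \<le> (1 / Im z)\<^sup>2 * L2.nrm2 lborel f" by (simp add: L2_nrm2)
    qed
    have "(\<lambda>n. L2.nrm2 lborel (\<lambda>t. u n t * k t - v t * k t)) \<longlonglongrightarrow> 0"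
    proof (rule Lim_null_comparison)
      have "(\<lambda>n. (1 / Im z)\<^sup>2 * L2.nrm2 lborel (\<lambda>t. u n t - v t)) \<longlonglongrightarrow> (1 / Im z)\<^sup>2 * 0" by (intro tendsto_mult tendsto_const uv)
      then show "(\<lambda>n. (1 / Im z)\<^sup>2 * L2.nrm2 lborel (\<lambda>t. u n t - v t)) \<longlonglongrightarrow> 0" by simp
      show "\<forall>\<^sub>F n in sequentially. norm (L2.nrm2 lborel (\<lambda>t. u n t * k t - v t * k t)) \<le> (1 / Im z)\<^sup>2 * L2.nrm2 lborel (\<lambda>t. u n t - v t)"
        using m(2)[OF L2.diff[OF uL vL]] L2.nrm2_ge_0[OF L2.diff[OF m(1)[OF uL] m(1)[OF vL]]]
        by (intro always_eventually allI) (simp add: left_diff_distrib)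
    qed
    from L2.nrm2_tendsto[OF m(1)[OF uL] m(1)[OF vL] this]
    show ?thesis by (simp add: L2_nrm2 k_def norm_divide power_divide)
  qed
  show "R \<in> deBranges E"
  proof (rule deBranges_I[OF R])
    show "(\<lambda>t::real. R (of_real t) / E (of_real t)) \<in> L2 lborel" using vL by (simp add: v_def)
    fix z assume z: "Im z > 0"
    show "(norm (R z / E z))\<^sup>2 \<le> Im z / pi * (\<integral>t. (norm (R (of_real t) / E (of_real t)))\<^sup>2 / (norm (of_real t - z))\<^sup>2 \<partial>lborel)"
    proof (rule LIMSEQ_le)
      show "(\<lambda>n. (norm (Q n z / E z))\<^sup>2) \<longlonglongrightarrow> (norm (R z / E z))\<^sup>2" by (intro tendsto_intros lim E_nz z)
      show "(\<lambda>n. Im z / pi * (\<integral>t. (norm (u n t))\<^sup>2 / (norm (of_real t - z))\<^sup>2 \<partial>lborel)) \<longlonglongrightarrow>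
        Im z / pi * (\<integral>t. (norm (R (of_real t) / E (of_real t)))\<^sup>2 / (norm (of_real t - z))\<^sup>2 \<partial>lborel)"
        using tendsto_mult_left[OF P[OF z], of "Im z / pi"] by (simp add: v_def)
    qed (use deBranges_poisson[OF Q z] in \<open>auto simp: u_def\<close>)
    show "(norm (sharp R z / E z))\<^sup>2 \<le> Im z / pi * (\<integral>t. (norm (R (of_real t) / E (of_real t)))\<^sup>2 / (norm (of_real t - z))\<^sup>2 \<partial>lborel)"
    proof (rule LIMSEQ_le)
      show "(\<lambda>n. (norm (sharp (Q n) z / E z))\<^sup>2) \<longlonglongrightarrow> (norm (sharp R z / E z))\<^sup>2"
        unfolding sharp_def by (intro tendsto_intros lim E_nz z)
      show "(\<lambda>n. Im z / pi * (\<integral>t. (norm (u n t))\<^sup>2 / (norm (of_real t - z))\<^sup>2 \<partial>lborel)) \<longlonglongrightarrow>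
        Im z / pi * (\<integral>t. (norm (R (of_real t) / E (of_real t)))\<^sup>2 / (norm (of_real t - z))\<^sup>2 \<partial>lborel)"
        using tendsto_mult_left[OF P[OF z], of "Im z / pi"] by (simp add: v_def)
      show "\<exists>N. \<forall>n\<ge>N. (norm (sharp (Q n) z / E z))\<^sup>2 \<le> Im z / pi * (\<integral>t. (norm (u n t))\<^sup>2 / (norm (of_real t - z))\<^sup>2 \<partial>lborel)"
        using deBranges_poisson[OF deBranges_sharp[OF Q] z] by (auto simp: u_def norm_divide)
    qed
  qed
qed

text \<open>Entire functions are strictly differentiable, so the diagonal needs no separate treatment.\<close>

lemma kern_tendsto:
  assumes z: "z \<longlonglongrightarrow> z0" and w: "w \<longlonglongrightarrow> w0"
  shows "(\<lambda>n. kern (w n) (z n :: complex)) \<longlonglongrightarrow> kern w0 z0"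
proof -
  have quot: "(\<lambda>n. if z n = w n then deriv F (w n) else (F (z n) - F (w n)) / (z n - w n)) \<longlonglongrightarrow>
      (if z0 = w0 then deriv F w0 else (F z0 - F w0) / (z0 - w0))" (is "?q \<longlonglongrightarrow> _") if F: "F holomorphic_on UNIV" for F
  proof -
    have cF: "isCont F x" "isCont (deriv F) x" for x
      using holomorphic_on_imp_continuous_on[OF F] holomorphic_on_imp_continuous_on[OF holomorphic_deriv[OF F open_UNIV]]
      by (simp_all add: continuous_on_eq_continuous_at)
    have Fd: "(F has_field_derivative deriv F x) (at x)" for x
      by (rule holomorphic_derivI[OF F open_UNIV UNIV_I])
    show ?thesis
    proof (cases "z0 = w0")
      case False
      have "(\<lambda>n. z n - w n) \<longlonglongrightarrow> z0 - w0" by (intro tendsto_intros z w)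
      then have "\<forall>\<^sub>F n in sequentially. z n - w n \<noteq> 0" using False by (intro tendsto_imp_eventually_ne) auto
      then have ev: "\<forall>\<^sub>F n in sequentially. (F (z n) - F (w n)) / (z n - w n) = ?q n" by eventually_elim auto
      have "(\<lambda>n. (F (z n) - F (w n)) / (z n - w n)) \<longlonglongrightarrow> (F z0 - F w0) / (z0 - w0)"
        using False by (intro tendsto_intros isCont_tendsto_compose[OF cF(1)] z w) auto
      from Lim_transform_eventually[OF this ev] show ?thesis using False by simp
    next
      case True
      have "?q \<longlonglongrightarrow> deriv F z0"
      proof (rule tendstoI)
        fix e :: real assume e: "e > 0"
        obtain d where d: "d > 0" "\<And>x. dist x z0 < d \<Longrightarrow> dist (deriv F x) (deriv F z0) < e / 2"
          using cF(2)[of z0] e unfolding continuous_at_eps_delta by (metis half_gt_zero)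
        have "\<forall>\<^sub>F n in sequentially. dist (z n) z0 < d" "\<forall>\<^sub>F n in sequentially. dist (w n) z0 < d"
          using tendstoD[OF z d(1)] tendstoD[OF w d(1)] True by auto
        then show "\<forall>\<^sub>F n in sequentially. dist (?q n) (deriv F z0) < e"
        proof eventually_elim
          case (elim n)
          show ?case
          proof (cases "z n = w n")
            case True
            then show ?thesis using d(2)[OF elim(2)] e by simp
          next
            case False
            \<comment> \<open>Subtracting the linear part at z0 leaves a function whose derivative
              is at most e / 2 near z0; the mean value inequality then bounds the error of the
              difference quotient.\<close>
            define G where "G = (\<lambda>x. F x - deriv F z0 * x)"
            have "norm (G (z n) - G (w n)) \<le> e / 2 * norm (z n - w n)"
            proof (rule field_differentiable_bound[of "ball z0 d" G "\<lambda>x. deriv F x - deriv F z0"])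
              fix x assume "x \<in> ball z0 d"
              then show "norm (deriv F x - deriv F z0) \<le> e / 2" using d(2)[of x] by (simp add: dist_commute dist_norm)
              show "(G has_field_derivative deriv F x - deriv F z0) (at x within ball z0 d)"
                unfolding G_def by (rule has_field_derivative_at_within) (auto intro!: derivative_eq_intros Fd)
            qed (use elim in \<open>auto simp: dist_commute\<close>)
            moreover have "G (z n) - G (w n) = (?q n - deriv F z0) * (z n - w n)"
              using False by (simp add: G_def field_simps)
            ultimately have "norm (?q n - deriv F z0) * norm (z n - w n) \<le> e / 2 * norm (z n - w n)" by (simp add: norm_mult)
            then have "norm (?q n - deriv F z0) \<le> e / 2" using False by (simp add: mult_le_cancel_right)
            then show ?thesis using e by (simp add: dist_norm)
          qed
        qed
      qed
      then show ?thesis using True by simp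
    qed
  qed
  have c: "isCont A w0" "isCont B w0"
    using holomorphic_on_imp_continuous_on[OF A_holo] holomorphic_on_imp_continuous_on[OF B_holo]
    by (simp_all add: continuous_on_eq_continuous_at)
  show ?thesis
    unfolding kern_def by (intro tendsto_diff tendsto_mult quot A_holo B_holo isCont_tendsto_compose[OF c(1) w] isCont_tendsto_compose[OF c(2) w])
qed

end

section \<open>Models of the reproducing kernel\<close>

text \<open>The sequence approaches from the side of the real axis on which z lies, from above for
  real z. Staying on one side, it never meets its own conjugates, as \<open>\<Phi>_limit\<close>
  requires.\<close>

lemma nonreal_sequence: "\<exists>v. v \<longlonglongrightarrow> z \<and> (\<forall>n. v n \<noteq> z \<and> Im (v n) \<noteq> 0 \<and> (Im (v n) > 0 \<longleftrightarrow> Im z \<ge> 0))"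
proof -
  define \<sigma> :: real where "\<sigma> = (if Im z \<ge> 0 then 1 else -1)"
  define v where "v = (\<lambda>n. z + \<i> * of_real (\<sigma> * inverse (real (Suc n))))"
  have "v \<longlonglongrightarrow> z + \<i> * of_real (\<sigma> * 0)"
    unfolding v_def by (intro tendsto_intros LIMSEQ_inverse_real_of_nat)
  moreover have "v n \<noteq> z \<and> Im (v n) \<noteq> 0 \<and> (Im (v n) > 0 \<longleftrightarrow> Im z \<ge> 0)" for n
  proof -
    have i: "inverse (real (Suc n)) > 0" by simp
    have "Im (v n) = Im z + \<sigma> * inverse (real (Suc n))" by (simp only: v_def plus_complex.sel Im_i_times Re_complex_of_real)
    then show ?thesis using i by (cases "Im z \<ge> 0") (auto simp: \<sigma>_def simp del: of_nat_Suc inverse_positive_iff_positive)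
  qed
  ultimately show ?thesis by (intro exI[of _ v]) simp
qed

text \<open>All that the transformation needs from the differential equation is condensed into the
  Gram matrix. V need not be complete and the form need not be definite, so functions may be used in
  place of classes.\<close>

locale dB_model = dB A B E + semi_inner V ip
  for A B E :: "complex \<Rightarrow> complex" and V :: "('x \<Rightarrow> complex) set" and ip +
  fixes \<Phi> :: "complex \<Rightarrow> 'x \<Rightarrow> complex"
  assumes \<Phi>_V: "\<Phi> w \<in> V" and gram: "ip (\<Phi> z) (\<Phi> w) = kern (cnj w) z"
begin

text \<open>The conjugate undoes the antilinearity of the second slot; for the solutions it leaves
  \<phi> at z itself in the integrals.\<close>

definition hat :: "('x \<Rightarrow> complex) \<Rightarrow> complex \<Rightarrow> complex" where
  "hat f z = ip f (\<Phi> (cnj z))"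

definition nonreal :: "('x \<Rightarrow> complex) set" where
  "nonreal = {\<Phi> w | w. Im w \<noteq> 0}"

lemma nonreal_V: "nonreal \<subseteq> V" using \<Phi>_V by (auto simp: nonreal_def)

lemma kern_commute: "kern w z = kern z w"
proof (cases "z = w")
  case False
  have "(A z * B w - B z * A w) / (z - w) = (A w * B z - B w * A z) / (w - z)"
    using minus_divide_divide[of "A z * B w - B z * A w" "z - w"] by (simp add: mult.commute)
  then show ?thesis using False by (simp add: kern_eq)
qed simp

lemma hat_\<Phi>: "hat (\<Phi> w) = kern w"
  unfolding hat_def gram by (auto simp: kern_commute)

lemma hat_lin: "f \<in> V \<Longrightarrow> g \<in> V \<Longrightarrow> hat (\<lambda>x. f x + \<alpha> * g x) = (\<lambda>z. hat f z + \<alpha> * hat g z)"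
  unfolding hat_def by (rule ext) (simp add: ip_lin \<Phi>_V)

lemma hat_zero: "hat (\<lambda>x. 0) = (\<lambda>z. 0)"
  unfolding hat_def by (simp add: ip_zero \<Phi>_V)

lemma hat_bound:
  assumes "f \<in> V" "g \<in> V"
  shows "norm (hat f z - hat g z) \<le> nrm (\<lambda>x. f x - g x) * nrm (\<Phi> (cnj z))"
  using CS[OF diff[OF assms] \<Phi>_V[of "cnj z"]] by (simp add: hat_def ip_diff assms \<Phi>_V)

text \<open>The squared norm is the kernel on the diagonal, which is continuous.\<close>

lemma \<Phi>_bounded:
  assumes "compact K" shows "\<exists>M>0. \<forall>z\<in>K. nrm (\<Phi> (cnj z)) \<le> M"
proof -
  have c: "continuous_on UNIV (\<lambda>z. kern z (cnj z))"
    unfolding continuous_on_sequentially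
    by (auto simp: o_def intro!: kern_tendsto tendsto_cnj)
  have "bounded ((\<lambda>z. kern z (cnj z)) ` K)"
    by (intro compact_imp_bounded compact_continuous_image[OF continuous_on_subset[OF c subset_UNIV] assms])
  then obtain M where M: "\<And>z. z \<in> K \<Longrightarrow> norm (kern z (cnj z)) \<le> M"
    unfolding bounded_iff by auto
  have "nrm (\<Phi> (cnj z)) \<le> sqrt (\<bar>M\<bar> + 1)" if "z \<in> K" for z
  proof -
    have "nrm2 (\<Phi> (cnj z)) = Re (kern z (cnj z))" by (simp add: nrm2_def gram)
    also have "\<dots> \<le> \<bar>M\<bar> + 1" using complex_Re_le_cmod[of "kern z (cnj z)"] M[OF that] by linarith
    finally show ?thesis by (simp add: nrm_def)
  qed
  then show ?thesis by (intro exI[of _ "sqrt (\<bar>M\<bar> + 1)"]) auto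
qed

lemma \<Phi>_tendsto:
  assumes v: "v \<longlonglongrightarrow> w"
  shows "(\<lambda>n. nrm2 (\<lambda>x. \<Phi> (v n) x - \<Phi> w x)) \<longlonglongrightarrow> 0"
proof -
  have e: "nrm2 (\<lambda>x. \<Phi> (v n) x - \<Phi> w x) = Re (kern (cnj (v n)) (v n)) - 2 * Re (kern (cnj w) (v n)) + Re (kern (cnj w) w)" for n
    by (simp add: nrm2_diff \<Phi>_V nrm2_def[of "\<Phi> _"] gram)
  have "(\<lambda>n. Re (kern (cnj (v n)) (v n)) - 2 * Re (kern (cnj w) (v n)) + Re (kern (cnj w) w))
    \<longlonglongrightarrow> Re (kern (cnj w) w) - 2 * Re (kern (cnj w) w) + Re (kern (cnj w) w)"
    by (intro tendsto_intros kern_tendsto v)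
  then show ?thesis unfolding e by simp
qed

text \<open>The reproducing property is available at nonreal points only. Both sides are continuous,
  \<open>hat f\<close> because \<open>\<Phi>\<close> is continuous in norm.\<close>

lemma hat_eqI:
  assumes f: "f \<in> V" and R: "continuous_on UNIV R" and e: "\<And>z. Im z \<noteq> 0 \<Longrightarrow> hat f z = R z"
  shows "hat f = R"
proof
  fix z
  from nonreal_sequence[of z] obtain v where vz: "v \<longlonglongrightarrow> z" and vn: "\<And>n. Im (v n) \<noteq> 0" by blast
  have "(\<lambda>n. cnj (v n)) \<longlonglongrightarrow> cnj z" using tendsto_cnj[OF vz] by simp
  from ip_tendsto[OF \<Phi>_V \<Phi>_V \<Phi>_tendsto[OF this] f]
  have "(\<lambda>n. cnj (ip (\<Phi> (cnj (v n))) f)) \<longlonglongrightarrow> cnj (ip (\<Phi> (cnj z)) f)" by (rule tendsto_cnj)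
  then have "(\<lambda>n. hat f (v n)) \<longlonglongrightarrow> hat f z"
    unfolding hat_def using ip_cnj[OF \<Phi>_V f] by simp
  moreover have "(\<lambda>n. R (v n)) \<longlonglongrightarrow> R z"
    using R vz unfolding continuous_on_eq_continuous_at[OF open_UNIV]
    by (intro isCont_tendsto_compose[of z R]) auto
  ultimately show "hat f z = R z" unfolding e[OF vn] by (rule LIMSEQ_unique)
qed

lemma hat_cspan_deBranges: "p \<in> cspan nonreal \<Longrightarrow> hat p \<in> deBranges E"
proof (induction rule: cspan.induct)
  case null
  have "(\<lambda>z. kern \<i> z + (-1) * kern \<i> z) \<in> deBranges E" by (intro deBranges_lin kern_deBranges) auto
  then show ?case by (simp add: hat_zero)
next
  case (step p e \<alpha>)
  obtain w where w: "e = \<Phi> w" "Im w \<noteq> 0" using step.hyps(2) by (auto simp: nonreal_def)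
  show ?case
    using deBranges_lin[OF step.IH kern_deBranges[OF w(2)]]
    by (simp add: hat_lin[OF cspan_in[OF step.hyps(1) nonreal_V] \<Phi>_V] hat_\<Phi> w(1))
qed

text \<open>\<open>hat (\<Phi> w)\<close> is a kernel function, so pairing F with it gives pi times
  F at \<open>cnj w\<close>, that is, pi times the pairing of f with \<open>\<Phi> w\<close>.
  Induction on the span extends this by linearity.\<close>

lemma isometry_cspan_ip:
  assumes F: "F \<in> deBranges E" and p: "p \<in> cspan nonreal"
    and f: "f \<in> V" and eq: "\<And>w. Im w \<noteq> 0 \<Longrightarrow> F w = hat f w"
  shows "ip2 lborel (\<lambda>t. F (of_real t) / E (of_real t)) (\<lambda>t. hat p (of_real t) / E (of_real t)) = of_real pi * ip f p"
  using p
proof (induction rule: cspan.induct)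
  case null
  then show ?case using ip_cnj[OF f zero] by (simp add: hat_zero ip_zero f ip2_def)
next
  case (step p e \<alpha>)
  obtain w where w: "e = \<Phi> w" "Im w \<noteq> 0" using step.hyps(2) by (auto simp: nonreal_def)
  have pV: "p \<in> V" using cspan_in[OF step.hyps(1) nonreal_V] .
  have w': "Im (cnj w) \<noteq> 0" using w by simp
  have r: "ip2 lborel (\<lambda>t. F (of_real t) / E (of_real t)) (\<lambda>t. kern w (of_real t) / E (of_real t)) = of_real pi * ip f e"
    using reproducing[OF F w'] eq[OF w'] by (simp add: hat_def w(1))
  have "ip2 lborel (\<lambda>t. F (of_real t) / E (of_real t)) (\<lambda>t. hat (\<lambda>x. p x + \<alpha> * e x) (of_real t) / E (of_real t))
     = ip2 lborel (\<lambda>t. F (of_real t) / E (of_real t)) (\<lambda>t. hat p (of_real t) / E (of_real t) + \<alpha> * (kern w (of_real t) / E (of_real t)))"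
    by (simp add: hat_lin[OF pV \<Phi>_V] w(1) hat_\<Phi> add_divide_distrib)
  also have "\<dots> = of_real pi * ip f p + cnj \<alpha> * (of_real pi * ip f e)"
    unfolding L2.ip_lin2[OF deBranges_L2[OF hat_cspan_deBranges[OF step.hyps(1)]] deBranges_L2[OF kern_deBranges[OF w(2)]] deBranges_L2[OF F]]
    by (simp only: step.IH r)
  also have "\<dots> = of_real pi * ip f (\<lambda>x. p x + \<alpha> * e x)"
    by (simp add: ip_lin2 pV f \<Phi>_V w(1) algebra_simps)
  finally show ?case .
qed

lemma isometry_cspan:
  assumes "p \<in> cspan nonreal"
  shows "L2.nrm2 lborel (\<lambda>t. hat p (of_real t) / E (of_real t)) = pi * nrm2 p"
  using isometry_cspan_ip[OF hat_cspan_deBranges[OF assms] assms cspan_in[OF assms nonreal_V] refl]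
  by (simp add: L2.nrm2_def nrm2_def)

lemma isometry_cspan_diff:
  assumes p: "p \<in> cspan nonreal" and q: "q \<in> cspan nonreal"
  shows "L2.nrm2 lborel (\<lambda>t. hat p (of_real t) / E (of_real t) - hat q (of_real t) / E (of_real t)) = pi * nrm2 (\<lambda>x. p x - q x)"
proof -
  have "hat (\<lambda>x. p x - q x) = (\<lambda>z. hat p z - hat q z)"
    using hat_lin[OF cspan_in[OF p nonreal_V] cspan_in[OF q nonreal_V], of "-1"] by simp
  moreover have "(\<lambda>x. p x - q x) \<in> cspan nonreal" using cspan_lin[OF p q, of "-1"] by simp
  ultimately show ?thesis using isometry_cspan[of "\<lambda>x. p x - q x"] by (simp add: diff_divide_distrib)
qed

lemma cauchy_transfer:
  assumes p: "\<And>n. p n \<in> cspan nonreal"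
  shows "L2.cauchy_seq lborel (\<lambda>n t. hat (p n) (of_real t) / E (of_real t)) \<longleftrightarrow> cauchy_seq p"
  unfolding L2.cauchy_seq_def cauchy_seq_def isometry_cspan_diff[OF p p]
proof (intro iffI allI impI)
  fix \<epsilon> :: real assume *: "\<forall>\<epsilon>>0. \<exists>N. \<forall>m\<ge>N. \<forall>n\<ge>N. pi * nrm2 (\<lambda>x. p m x - p n x) < \<epsilon>" "\<epsilon> > 0"
  have "pi * \<epsilon> > 0" using *(2) by simp
  from *(1)[rule_format, OF this] show "\<exists>N. \<forall>m\<ge>N. \<forall>n\<ge>N. nrm2 (\<lambda>x. p m x - p n x) < \<epsilon>" by simp
next
  fix \<epsilon> :: real assume *: "\<forall>\<epsilon>>0. \<exists>N. \<forall>m\<ge>N. \<forall>n\<ge>N. nrm2 (\<lambda>x. p m x - p n x) < \<epsilon>" "\<epsilon> > 0"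
  have "\<epsilon> / pi > 0" using *(2) by simp
  from *(1)[rule_format, OF this] show "\<exists>N. \<forall>m\<ge>N. \<forall>n\<ge>N. pi * nrm2 (\<lambda>x. p m x - p n x) < \<epsilon>"
    by (simp add: less_divide_eq mult.commute)
qed

text \<open>The norms of \<open>\<Phi>\<close> are locally bounded, so the transforms of a norm
  Cauchy sequence converge locally uniformly; the limit is entire, and
  \<open>deBranges_limit\<close> places it in the space. The sequence itself may have no limit in
  V.\<close>

lemma cauchy_hat_limit:
  assumes p: "\<And>n. p n \<in> cspan nonreal" and c: "cauchy_seq p"
  shows "\<exists>R. R \<in> deBranges E \<and> (\<forall>z. (\<lambda>n. hat (p n) z) \<longlonglongrightarrow> R z) \<and>
    (\<lambda>n. pi * nrm2 (p n)) \<longlonglongrightarrow> L2.nrm2 lborel (\<lambda>t. R (of_real t) / E (of_real t))"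
proof -
  have pV: "p n \<in> V" for n using cspan_in[OF p nonreal_V] .
  have holo: "hat (p n) holomorphic_on UNIV" for n by (rule deBranges_holo[OF hat_cspan_deBranges[OF p]])
  have unif: "uniformly_Cauchy_on K (\<lambda>n. hat (p n))" if K: "compact K" for K
    unfolding uniformly_Cauchy_on_def
  proof (intro allI impI)
    fix e :: real assume e: "e > 0"
    obtain M where M: "M > 0" "\<forall>z\<in>K. nrm (\<Phi> (cnj z)) \<le> M" using \<Phi>_bounded[OF K] by blast
    have "(e / M)\<^sup>2 > 0" using e M by simp
    then obtain N where N: "\<And>m n. m \<ge> N \<Longrightarrow> n \<ge> N \<Longrightarrow> nrm2 (\<lambda>x. p m x - p n x) < (e / M)\<^sup>2"
      using c unfolding cauchy_seq_def by blast
    show "\<exists>Na. \<forall>x\<in>K. \<forall>m\<ge>Na. \<forall>n\<ge>Na. dist (hat (p m) x) (hat (p n) x) < e"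
    proof (intro exI[of _ N] ballI allI impI)
      fix z m n assume z: "z \<in> K" and mn: "N \<le> m" "N \<le> n"
      have n: "nrm (\<lambda>x. p m x - p n x) < e / M"
        unfolding nrm_def using N[OF mn] e M by (intro real_less_lsqrt) auto
      have "norm (hat (p m) z - hat (p n) z) \<le> nrm (\<lambda>x. p m x - p n x) * nrm (\<Phi> (cnj z))"
        by (rule hat_bound[OF pV pV])
      also have "\<dots> \<le> nrm (\<lambda>x. p m x - p n x) * M"
        using M z nrm_ge_0[OF diff[OF pV pV]] by (intro mult_left_mono) auto
      also have "\<dots> < e / M * M" using n M by (intro mult_strict_right_mono) auto
      finally show "dist (hat (p m) z) (hat (p n) z) < e" using M by (simp add: dist_norm)
    qed
  qed
  define R where "R = (\<lambda>z. lim (\<lambda>n. hat (p n) z))"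
  have ul: "uniform_limit K (\<lambda>n. hat (p n)) R sequentially" if "compact K" for K
    using Cauchy_uniformly_convergent[OF unif[OF that]] unfolding R_def uniformly_convergent_uniform_limit_iff .
  have lim: "(\<lambda>n. hat (p n) z) \<longlonglongrightarrow> R z" for z
    using tendsto_uniform_limitI[OF ul[of "{z}"], of z] by simp
  have R: "R holomorphic_on UNIV"
  proof (rule holomorphic_uniform_sequence[OF open_UNIV holo])
    fix x :: complex
    show "\<exists>d>0. cball x d \<subseteq> UNIV \<and> uniform_limit (cball x d) (\<lambda>n. hat (p n)) R sequentially"
      by (intro exI[of _ 1]) (auto intro: ul)
  qed
  have cL: "L2.cauchy_seq lborel (\<lambda>n t. hat (p n) (of_real t) / E (of_real t))"
    by (rule cauchy_transfer[of p, OF p, THEN iffD2, OF c])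
  note dl = deBranges_limit[OF hat_cspan_deBranges[OF p] cL R lim]
  show ?thesis
    using dl lim unfolding isometry_cspan[OF p] by blast
qed

text \<open>The residuals of a minimizing sequence become orthogonal to the nonreal
  \<open>\<Phi> w\<close>. Its transforms therefore converge to \<open>hat f\<close> at nonreal
  points, although the sequence itself approximates only the projection of f.\<close>

lemma hat_deBranges:
  assumes f: "f \<in> V" shows "hat f \<in> deBranges E"
proof -
  obtain p where p: "\<And>n. p n \<in> cspan nonreal" "cauchy_seq p"
    "\<And>e. e \<in> nonreal \<Longrightarrow> (\<lambda>n. ip (\<lambda>x. f x - p n x) e) \<longlonglongrightarrow> 0"
    using minimizing_sequence[OF nonreal_V f] by blast
  have pV: "p n \<in> V" for n using cspan_in[OF p(1) nonreal_V] .
  from cauchy_hat_limit[OF p(1,2)] obtain R where R: "R \<in> deBranges E" "\<And>z. (\<lambda>n. hat (p n) z) \<longlonglongrightarrow> R z" by blast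
  have "hat f = R"
  proof (rule hat_eqI[OF f holomorphic_on_imp_continuous_on[OF deBranges_holo[OF R(1)]]])
    fix z assume z: "Im z \<noteq> 0"
    then have "\<Phi> (cnj z) \<in> nonreal" unfolding nonreal_def by force
    from p(3)[OF this] have "(\<lambda>n. hat f z - hat (p n) z) \<longlonglongrightarrow> 0"
      by (simp add: hat_def ip_diff f pV \<Phi>_V)
    then have "(\<lambda>n. hat f z - (hat f z - hat (p n) z)) \<longlonglongrightarrow> hat f z - 0" by (intro tendsto_diff tendsto_const)
    then have "(\<lambda>n. hat (p n) z) \<longlonglongrightarrow> hat f z" by simp
    then show "hat f z = R z" using R(2) LIMSEQ_unique by blast
  qed
  then show ?thesis using R by simp
qed

lemma hat_tendsto:
  assumes p: "\<And>n. p n \<in> V" and f: "f \<in> V" and c: "(\<lambda>n. nrm2 (\<lambda>x. p n x - f x)) \<longlonglongrightarrow> 0"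
  shows "(\<lambda>n. hat (p n) z) \<longlonglongrightarrow> hat f z"
  unfolding hat_def by (rule ip_tendsto[OF p f c \<Phi>_V])

text \<open>Parameters on the real axis are moved off it by norm continuity of
  \<open>\<Phi>\<close>.\<close>

lemma nonreal_approx:
  assumes q: "q \<in> cspan (range \<Phi>)" and "\<epsilon> > 0"
  shows "\<exists>p\<in>cspan nonreal. nrm (\<lambda>x. q x - p x) < \<epsilon>"
  using q \<open>\<epsilon> > 0\<close>
proof (induction arbitrary: \<epsilon> rule: cspan.induct)
  case null
  then show ?case using cspan.null[of nonreal] by (intro bexI[of _ "\<lambda>x. 0"]) (auto simp: nrm_def nrm2_def ip_zero zero)
next
  case (step q e \<alpha>)
  obtain w where w: "e = \<Phi> w" using step.hyps(2) by auto
  have qV: "q \<in> V" by (rule cspan_in[OF step.hyps(1)]) (use \<Phi>_V in auto)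
  obtain p where p: "p \<in> cspan nonreal" "nrm (\<lambda>x. q x - p x) < \<epsilon> / 2"
    using step.IH[of "\<epsilon> / 2"] step.prems by auto
  have pV: "p \<in> V" using cspan_in[OF p(1) nonreal_V] .
  from nonreal_sequence[of w] obtain v where vz: "v \<longlonglongrightarrow> w" and vn: "\<And>n. Im (v n) \<noteq> 0" by blast
  have "(\<lambda>n. norm \<alpha> * sqrt (nrm2 (\<lambda>x. \<Phi> (v n) x - \<Phi> w x))) \<longlonglongrightarrow> norm \<alpha> * sqrt 0"
    using vz by (intro tendsto_mult tendsto_const tendsto_real_sqrt \<Phi>_tendsto) simp
  then have "\<forall>\<^sub>F n in sequentially. norm \<alpha> * sqrt (nrm2 (\<lambda>x. \<Phi> (v n) x - \<Phi> w x)) < \<epsilon> / 2"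
    by (rule order_tendstoD) (use step.prems in simp)
  then obtain n where n: "norm \<alpha> * sqrt (nrm2 (\<lambda>x. \<Phi> (v n) x - \<Phi> w x)) < \<epsilon> / 2"
    by (auto simp: eventually_sequentially)
  define d where "d = (\<lambda>x. \<Phi> w x - \<Phi> (v n) x)"
  have dV: "d \<in> V" unfolding d_def by (intro diff \<Phi>_V)
  have "nrm (\<lambda>x. \<alpha> * d x) = norm \<alpha> * sqrt (nrm2 d)"
    using nrm2_lin[OF zero dV, of \<alpha>] zero by (simp add: nrm_def nrm2_def ip_zero real_sqrt_mult dV)
  also have "nrm2 d = nrm2 (\<lambda>x. \<Phi> (v n) x - \<Phi> w x)"
    unfolding d_def by (rule nrm2_diff_commute[OF \<Phi>_V \<Phi>_V])
  finally have dn: "nrm (\<lambda>x. \<alpha> * d x) < \<epsilon> / 2" using n by simp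
  have pin: "(\<lambda>x. p x + \<alpha> * \<Phi> (v n) x) \<in> cspan nonreal"
    by (intro cspan.step p) (use vn in \<open>auto simp: nonreal_def\<close>)
  have "nrm (\<lambda>x. (q x - p x) + \<alpha> * d x) \<le> nrm (\<lambda>x. q x - p x) + nrm (\<lambda>x. \<alpha> * d x)"
    by (intro nrm_triangle diff scale dV qV pV)
  then have "nrm (\<lambda>x. (q x + \<alpha> * e x) - (p x + \<alpha> * \<Phi> (v n) x)) < \<epsilon>"
    using p(2) dn by (simp add: w d_def algebra_simps)
  then show ?case by (rule bexI[OF _ pin])
qed

text \<open>f is a limit of combinations with nonreal parameters, whose transforms have pi times
  their squared norm on the line; the factor 1 / pi in \<open>dB_norm2\<close> compensates.\<close>

lemma isometry_closure:
  assumes f: "f \<in> V" and c: "\<And>\<epsilon>. \<epsilon> > 0 \<Longrightarrow> \<exists>q\<in>cspan (range \<Phi>). nrm2 (\<lambda>x. f x - q x) < \<epsilon>"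
  shows "dB_norm2 E (hat f) = nrm2 f"
proof -
  have rV: "range \<Phi> \<subseteq> V" using \<Phi>_V by auto
  have "\<exists>p. p \<in> cspan nonreal \<and> nrm2 (\<lambda>x. p x - f x) < (1 / real (Suc n))\<^sup>2" for n
  proof -
    define \<epsilon> where "\<epsilon> = 1 / real (Suc n)"
    have e: "\<epsilon> > 0" by (simp add: \<epsilon>_def)
    then have "(\<epsilon> / 2)\<^sup>2 > 0" by simp
    from c[OF this] obtain q where q: "q \<in> cspan (range \<Phi>)" "nrm2 (\<lambda>x. f x - q x) < (\<epsilon> / 2)\<^sup>2" by blast
    have qV: "q \<in> V" using cspan_in[OF q(1) rV] .
    from nonreal_approx[OF q(1), of "\<epsilon> / 2"] e obtain p where p: "p \<in> cspan nonreal" "nrm (\<lambda>x. q x - p x) < \<epsilon> / 2" by auto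
    have pV: "p \<in> V" using cspan_in[OF p(1) nonreal_V] .
    have "nrm (\<lambda>x. f x - q x) < \<epsilon> / 2" unfolding nrm_def using q(2) e by (intro real_less_lsqrt) auto
    then have "nrm (\<lambda>x. f x - p x) < \<epsilon>" using nrm_diff_triangle[OF f qV pV] p(2) by simp
    then have "(nrm (\<lambda>x. f x - p x))\<^sup>2 < \<epsilon>\<^sup>2" using nrm_ge_0[OF diff[OF f pV]] by (intro power_strict_mono) auto
    then show ?thesis using p(1) nrm2_diff_commute[OF f pV] by (auto simp: nrm_sq diff f pV \<epsilon>_def)
  qed
  then obtain p where p: "\<And>n. p n \<in> cspan nonreal" "\<And>n. nrm2 (\<lambda>x. p n x - f x) < (1 / real (Suc n))\<^sup>2" by metis
  have pV: "p n \<in> V" for n using cspan_in[OF p(1) nonreal_V] .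
  have lim: "(\<lambda>n. nrm2 (\<lambda>x. p n x - f x)) \<longlonglongrightarrow> 0"
  proof (rule Lim_null_comparison)
    have "(\<lambda>n. (1 / real (Suc n))\<^sup>2) \<longlonglongrightarrow> 0\<^sup>2"
      using LIMSEQ_inverse_real_of_nat by (intro tendsto_power) (simp add: inverse_eq_divide)
    then show "(\<lambda>n. (1 / real (Suc n))\<^sup>2) \<longlonglongrightarrow> 0" by simp
    show "\<forall>\<^sub>F n in sequentially. norm (nrm2 (\<lambda>x. p n x - f x)) \<le> (1 / real (Suc n))\<^sup>2"
      using p(2) nrm2_ge_0[OF diff[OF pV f]] by (intro always_eventually allI) (auto intro: less_imp_le)
  qed
  have "cauchy_seq p"
    unfolding cauchy_seq_def
  proof (intro allI impI)
    fix \<epsilon> :: real assume e: "\<epsilon> > 0"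
    have "(\<lambda>n. nrm (\<lambda>x. p n x - f x)) \<longlonglongrightarrow> 0" unfolding nrm_def using tendsto_real_sqrt[OF lim] by simp
    then have "\<forall>\<^sub>F n in sequentially. nrm (\<lambda>x. p n x - f x) < sqrt \<epsilon> / 2" by (rule order_tendstoD) (use e in simp)
    then obtain N where N: "\<And>n. n \<ge> N \<Longrightarrow> nrm (\<lambda>x. p n x - f x) < sqrt \<epsilon> / 2" by (auto simp: eventually_sequentially)
    have "nrm2 (\<lambda>x. p m x - p n x) < \<epsilon>" if "m \<ge> N" "n \<ge> N" for m n
    proof -
      have "nrm (\<lambda>x. p m x - p n x) \<le> nrm (\<lambda>x. p m x - f x) + nrm (\<lambda>x. f x - p n x)"
        by (rule nrm_diff_triangle[OF pV f pV])
      also have "nrm (\<lambda>x. f x - p n x) = nrm (\<lambda>x. p n x - f x)" unfolding nrm_def nrm2_diff_commute[OF f pV] ..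
      finally have "nrm (\<lambda>x. p m x - p n x) < sqrt \<epsilon>" using N[OF that(1)] N[OF that(2)] by linarith
      then show ?thesis unfolding nrm_def by simp
    qed
    then show "\<exists>N. \<forall>m\<ge>N. \<forall>n\<ge>N. nrm2 (\<lambda>x. p m x - p n x) < \<epsilon>" by blast
  qed
  from cauchy_hat_limit[OF p(1) this] obtain R where R: "R \<in> deBranges E" "\<And>z. (\<lambda>n. hat (p n) z) \<longlonglongrightarrow> R z"
    "(\<lambda>n. pi * nrm2 (p n)) \<longlonglongrightarrow> L2.nrm2 lborel (\<lambda>t. R (of_real t) / E (of_real t))" by blast
  have "hat f = R" using LIMSEQ_unique[OF hat_tendsto[OF pV f lim] R(2)] by blast
  moreover have "L2.nrm2 lborel (\<lambda>t. R (of_real t) / E (of_real t)) = pi * nrm2 f"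
    using LIMSEQ_unique[OF R(3) tendsto_mult_left[OF nrm2_tendsto[OF pV f lim], of pi]] .
  ultimately show ?thesis by (simp add: dB_norm2_eq)
qed

text \<open>The minimizing sequence is taken among combinations of kernels, on the side of the de
  Branges space, and lifted to V through the isometry on the span. Its residuals, tested against
  kernels, are pi times the values of F - \<open>hat (p n)\<close>, so the transforms converge to F
  at nonreal points. The conclusion is conditional on a limit g, since V is not assumed
  complete.\<close>

lemma surjective:
  assumes F: "F \<in> deBranges E"
  shows "\<exists>p. (\<forall>n. p n \<in> cspan nonreal) \<and> cauchy_seq p \<and> (\<forall>g\<in>V. (\<lambda>n. nrm2 (\<lambda>x. p n x - g x)) \<longlonglongrightarrow> 0 \<longrightarrow> hat g = F)"
proof -
  define q where "q = (\<lambda>(G :: complex \<Rightarrow> complex) (t::real). G (of_real t) / E (of_real t))"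
  define S where "S = {q (kern w) | w. Im w \<noteq> 0}"
  have S: "S \<subseteq> L2 lborel" using deBranges_L2[OF kern_deBranges] by (auto simp: S_def q_def)
  have FL: "q F \<in> L2 lborel" unfolding q_def by (rule deBranges_L2[OF F])
  obtain P where P: "\<And>n. P n \<in> L2.cspan S" "L2.cauchy_seq lborel P"
    "\<And>e. e \<in> S \<Longrightarrow> (\<lambda>n. ip2 lborel (\<lambda>x. q F x - P n x) e) \<longlonglongrightarrow> 0"
    using L2.minimizing_sequence[OF S FL] by blast
  have lift: "\<exists>p\<in>cspan nonreal. q (hat p) = r" if "r \<in> L2.cspan S" for r
    using that
  proof (induction rule: L2.cspan.induct)
    case null
    show ?case using cspan.null by (intro bexI[of _ "\<lambda>x. 0"]) (auto simp: hat_zero q_def)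
  next
    case (step r e \<alpha>)
    obtain p where p: "p \<in> cspan nonreal" "q (hat p) = r" using step.IH by blast
    obtain w where w: "e = q (kern w)" "Im w \<noteq> 0" using step.hyps(2) by (auto simp: S_def)
    have "(\<lambda>x. p x + \<alpha> * \<Phi> w x) \<in> cspan nonreal" by (intro cspan.step p) (use w in \<open>auto simp: nonreal_def\<close>)
    moreover have "q (hat (\<lambda>x. p x + \<alpha> * \<Phi> w x)) = (\<lambda>x. r x + \<alpha> * e x)"
      unfolding hat_lin[OF cspan_in[OF p(1) nonreal_V] \<Phi>_V] hat_\<Phi> w(1) p(2)[symmetric]
      by (simp add: q_def add_divide_distrib)
    ultimately show ?case by blast
  qed
  then have "\<forall>n. \<exists>p. p \<in> cspan nonreal \<and> q (hat p) = P n" using P(1) by blast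
  then obtain p where p: "\<And>n. p n \<in> cspan nonreal" "\<And>n. q (hat (p n)) = P n" by metis
  have pV: "p n \<in> V" for n using cspan_in[OF p(1) nonreal_V] .
  have Pq: "P = (\<lambda>n t. hat (p n) (of_real t) / E (of_real t))" using p(2) by (auto simp: q_def fun_eq_iff)
  have c: "cauchy_seq p" by (rule cauchy_transfer[of p, OF p(1), THEN iffD1, OF P(2)[unfolded Pq]])
  have "hat g = F" if g: "g \<in> V" "(\<lambda>n. nrm2 (\<lambda>x. p n x - g x)) \<longlonglongrightarrow> 0" for g
  proof (rule hat_eqI[OF g(1) holomorphic_on_imp_continuous_on[OF deBranges_holo[OF F]]])
    fix z assume z: "Im z \<noteq> 0"
    then have z': "Im (cnj z) \<noteq> 0" by simp
    have e: "q (kern (cnj z)) \<in> S" using z' unfolding S_def by blast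
    have r: "ip2 lborel (q G) (q (kern (cnj z))) = of_real pi * G z" if "G \<in> deBranges E" for G
      unfolding q_def by (rule reproducing[OF that z])
    have "ip2 lborel (\<lambda>x. q F x - P n x) (q (kern (cnj z))) = of_real pi * F z - of_real pi * hat (p n) z" for n
      unfolding p(2)[of n, symmetric]
      using L2.ip_diff[OF FL deBranges_L2[OF hat_cspan_deBranges[OF p(1)[of n]], folded q_def], of "q (kern (cnj z))"] e S
        r[OF F] r[OF hat_cspan_deBranges[OF p(1)[of n]]] by (auto simp: q_def)
    with P(3)[OF e] have "(\<lambda>n. of_real pi * F z - of_real pi * hat (p n) z) \<longlonglongrightarrow> 0" by simp
    then have "(\<lambda>n. F z - (of_real pi * F z - of_real pi * hat (p n) z) / of_real pi) \<longlonglongrightarrow> F z - 0 / of_real pi"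
      by (intro tendsto_intros) auto
    then have "(\<lambda>n. hat (p n) z) \<longlonglongrightarrow> F z" by (simp add: diff_divide_distrib)
    then show "hat g z = F z" using hat_tendsto[OF pV g] LIMSEQ_unique by blast
  qed
  then show ?thesis using p(1) c by blast
qed

end

section \<open>Integration over intervals\<close>

lemma ivlD: "x \<in> ivl l r \<Longrightarrow> l < ereal x" "x \<in> ivl l r \<Longrightarrow> ereal x < r"
  by (auto simp: ivl_def)

lemma ivl_convex: "x \<in> ivl l r \<Longrightarrow> y \<in> ivl l r \<Longrightarrow> {x..y} \<subseteq> ivl l r"
  unfolding ivl_def by (auto intro: less_le_trans le_less_trans simp flip: ereal_less_eq(3))

lemma ivl_mono: "l' \<le> l \<Longrightarrow> r \<le> r' \<Longrightarrow> ivl l r \<subseteq> ivl l' r'"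
  unfolding ivl_def by (auto intro: le_less_trans less_le_trans)

lemma ivl_less: "x \<in> ivl l (ereal c) \<Longrightarrow> ereal c < r \<Longrightarrow> x \<in> ivl l r"
  by (meson ivl_mono less_imp_le order_refl subsetD)

lemma connected_ivl: "connected (ivl l r)"
proof (rule is_interval_connected, unfold is_interval_1, intro ballI allI impI)
  fix x y t assume "x \<in> ivl l r" "y \<in> ivl l r" "x \<le> t \<and> t \<le> y"
  then show "t \<in> ivl l r" using ivl_convex[of x l r y] by auto
qed

lemma open_ivl: "open (ivl l r)"
  unfolding ivl_def by (intro open_Collect_conj open_Collect_less continuous_intros)

lemma ivl_sets [measurable]: "ivl l r \<in> sets borel"
  by (simp add: open_ivl)

text \<open>The interval contains its left but not its right end point, as in \<open>iint\<close>;
  this makes the integral additive even where \<mu> has atoms.\<close>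

definition lint :: "real measure \<Rightarrow> (real \<Rightarrow> complex) \<Rightarrow> real \<Rightarrow> real \<Rightarrow> complex" where
  "lint \<mu> h x y = set_lebesgue_integral \<mu> {x..<y} h"

lemma locint_sub:
  assumes "sets \<mu> = sets borel" "locint l r \<mu> h" "x \<in> ivl l r" "y \<in> ivl l r"
  shows "set_integrable \<mu> {x..<y} h"
proof (rule set_integrable_subset)
  show "set_integrable \<mu> {x..y} h" using assms(2-4) unfolding locint_def ivl_def by auto
qed (use assms(1) in auto)

lemma lint_add:
  assumes \<mu>: "sets \<mu> = sets borel" and h: "locint l r \<mu> h" and xyz: "x \<in> ivl l r" "y \<in> ivl l r" "z \<in> ivl l r" "x \<le> y" "y \<le> z"
  shows "lint \<mu> h x z = lint \<mu> h x y + lint \<mu> h y z"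
proof -
  have "{x..<z} = {x..<y} \<union> {y..<z}" using xyz by auto
  then show ?thesis unfolding lint_def
    using set_integral_Un[OF _ locint_sub[OF \<mu> h xyz(1,2)] locint_sub[OF \<mu> h xyz(2,3)]] by auto
qed

lemma iint_diff:
  assumes \<mu>: "sets \<mu> = sets borel" and h: "locint l r \<mu> h" and xyz: "c \<in> ivl l r" "x \<in> ivl l r" "y \<in> ivl l r" "x < y"
  shows "iint \<mu> c y h - iint \<mu> c x h = lint \<mu> h x y"
proof -
  have i: "iint \<mu> c u h = (if c < u then lint \<mu> h c u else if u = c then 0 else - lint \<mu> h u c)" for u
    by (simp add: iint_def lint_def)
  note add = lint_add[OF \<mu> h]
  consider "c < x" | "c = x" | "x < c" "c < y" | "c = y" | "y < c" by linarith
  then show ?thesis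
  proof cases
    case 1 then show ?thesis using add[of c x y] xyz by (simp add: i)
  next
    case 2 then show ?thesis using xyz unfolding i by simp
  next
    case 3 then show ?thesis using add[of x c y] xyz by (simp add: i)
  next
    case 4 then show ?thesis using xyz unfolding i by simp
  next
    case 5 then show ?thesis using add[of x y c] xyz by (simp add: i)
  qed
qed

text \<open>Eliminates the orientation sign of \<open>iint\<close>: comparing ordered pairs of
  points is enough.\<close>

lemma ACloc_iff:
  "ACloc l r \<mu> f h \<longleftrightarrow> locint l r \<mu> h \<and> (\<forall>x\<in>ivl l r. \<forall>y\<in>ivl l r. x < y \<longrightarrow> f y = f x + lint \<mu> h x y)"
proof -
  have "(\<forall>c\<in>ivl l r. \<forall>x\<in>ivl l r. f x = f c + iint \<mu> c x h) \<longleftrightarrow>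
    (\<forall>x\<in>ivl l r. \<forall>y\<in>ivl l r. x < y \<longrightarrow> f y = f x + lint \<mu> h x y)" (is "?L \<longleftrightarrow> ?R")
  proof
    assume L: ?L
    show ?R
    proof (intro ballI impI)
      fix x y assume xy: "x \<in> ivl l r" "y \<in> ivl l r" "x < y"
      have "iint \<mu> x y h = lint \<mu> h x y" using xy by (simp add: iint_def lint_def)
      then show "f y = f x + lint \<mu> h x y" using L[rule_format, OF xy(1,2)] by metis
    qed
  next
    assume R: ?R
    show ?L
    proof (intro ballI)
      fix c x assume cx: "c \<in> ivl l r" "x \<in> ivl l r"
      show "f x = f c + iint \<mu> c x h"
      proof (cases c x rule: linorder_cases)
        case less
        then have "iint \<mu> c x h = lint \<mu> h c x" by (simp add: iint_def lint_def)
        then show ?thesis using R[rule_format, OF cx less] by metis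
      next
        case equal
        then show ?thesis by (simp add: iint_def)
      next
        case greater
        then have i: "iint \<mu> c x h = - lint \<mu> h x c" by (simp add: iint_def lint_def)
        show ?thesis unfolding i R[rule_format, OF cx(2,1) greater] by simp
      qed
    qed
  qed
  then show ?thesis unfolding ACloc_def by blast
qed

lemma locint_mono: "locint l r \<mu> h \<Longrightarrow> l \<le> l' \<Longrightarrow> r' \<le> r \<Longrightarrow> locint l' r' \<mu> h"
  unfolding locint_def by (meson le_less_trans less_le_trans)

lemma ACloc_mono: "ACloc l r \<mu> f h \<Longrightarrow> l \<le> l' \<Longrightarrow> r' \<le> r \<Longrightarrow> ACloc l' r' \<mu> f h"
  unfolding ACloc_iff using locint_mono ivl_mono by blast

lemma locint_lin:
  assumes "locint l r \<mu> f" "locint l r \<mu> g"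
  shows "locint l r \<mu> (\<lambda>x. f x + \<alpha> * g x)"
  unfolding locint_def using assms unfolding locint_def
  by (auto intro!: set_integral_add set_integrable_mult_right)

lemma ACloc_zero: "ACloc l r \<mu> (\<lambda>x. 0) (\<lambda>x. 0)"
  unfolding ACloc_iff by (auto simp: locint_def lint_def set_integrable_def set_lebesgue_integral_def)

lemma ACloc_lin:
  assumes \<mu>: "sets \<mu> = sets borel" and f: "ACloc l r \<mu> f f1" and g: "ACloc l r \<mu> g g1"
  shows "ACloc l r \<mu> (\<lambda>x. f x + \<alpha> * g x) (\<lambda>x. f1 x + \<alpha> * g1 x)"
  unfolding ACloc_iff
proof (intro conjI ballI impI)
  show "locint l r \<mu> (\<lambda>x. f1 x + \<alpha> * g1 x)" using f g by (intro locint_lin) (auto simp: ACloc_iff)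
  fix x y assume xy: "x \<in> ivl l r" "y \<in> ivl l r" "x < y"
  have i: "set_integrable \<mu> {x..<y} f1" "set_integrable \<mu> {x..<y} g1"
    using f g locint_sub[OF \<mu> _ xy(1,2)] by (auto simp: ACloc_iff)
  have "lint \<mu> (\<lambda>x. f1 x + \<alpha> * g1 x) x y = lint \<mu> f1 x y + \<alpha> * lint \<mu> g1 x y"
    unfolding lint_def using i by (simp add: set_integral_add set_integral_mult_right)
  then show "f y + \<alpha> * g y = f x + \<alpha> * g x + lint \<mu> (\<lambda>x. f1 x + \<alpha> * g1 x) x y"
    using f g xy unfolding ACloc_iff by (auto simp: algebra_simps)
qed

text \<open>Fubini for the two triangles \<open>t < r\<close> and \<open>r < t\<close>; the diagonal is null because \<open>M\<close> has no atoms.\<close>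

lemma integral_by_parts:
  fixes k h :: "real \<Rightarrow> complex"
  assumes M: "finite_measure M" "sets M = sets borel" "\<And>x. emeasure M {x} = 0"
    and N: "finite_measure N" "sets N = sets borel"
    and k: "integrable M k" and h: "integrable N h"
  defines "W \<equiv> \<lambda>t. \<integral>r. indicator {..<t} r * h r \<partial>N" and "U \<equiv> \<lambda>r. \<integral>t. indicator {..<r} t * k t \<partial>M"
  shows "integrable M (\<lambda>t. k t * W t)" "integrable N (\<lambda>r. U r * h r)"
    "(\<integral>t. k t * W t \<partial>M) + (\<integral>r. U r * h r \<partial>N) = (\<integral>t. k t \<partial>M) * (\<integral>r. h r \<partial>N)"
proof -
  interpret M: finite_measure M by fact
  interpret N: finite_measure N by fact
  interpret P: pair_sigma_finite M N ..
  note [measurable_cong] = M(2) N(2)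
  have [measurable]: "k \<in> borel_measurable M" "h \<in> borel_measurable N" using k h by auto
  have Pi: "integrable (M \<Otimes>\<^sub>M N) (\<lambda>p. k (fst p) * h (snd p))"
  proof (rule P.Fubini_integrable)
    show "integrable M (\<lambda>x. \<integral>y. norm (k (fst (x, y)) * h (snd (x, y))) \<partial>N)"
      using k by (simp add: norm_mult)
    show "AE x in M. integrable N (\<lambda>y. k (fst (x, y)) * h (snd (x, y)))"
      using h by simp
  qed measurable
  have Q: "integrable (M \<Otimes>\<^sub>M N) (\<lambda>p. indicator S p * (k (fst p) * h (snd p)))" if "S \<in> sets (borel \<Otimes>\<^sub>M borel)" for S
  proof -
    have "S \<in> sets (M \<Otimes>\<^sub>M N)" using that by (simp add: M(2) N(2) cong: sets_pair_measure_cong)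
    from integrable_mult_indicator[OF this Pi] show ?thesis
      by (rule Bochner_Integration.integrable_cong[THEN iffD1, rotated -1]) (auto simp: indicator_def)
  qed
  define S1 where "S1 = {p :: real \<times> real. snd p < fst p}"
  define S2 where "S2 = {p :: real \<times> real. fst p < snd p}"
  define S3 where "S3 = {p :: real \<times> real. fst p = snd p}"
  have S: "S1 \<in> sets (borel \<Otimes>\<^sub>M borel)" "S2 \<in> sets (borel \<Otimes>\<^sub>M borel)" "S3 \<in> sets (borel \<Otimes>\<^sub>M borel)"
    unfolding S1_def S2_def S3_def borel_prod
    by (intro borel_open open_Collect_less borel_closed closed_Collect_eq continuous_intros)+
  have i1: "(\<integral>r. indicator S1 (t, r) * (k t * h r) \<partial>N) = k t * W t" for t
  proof -
    have "(\<lambda>r. indicator S1 (t, r) * (k t * h r)) = (\<lambda>r. k t * (indicator {..<t} r * h r))"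
      by (auto simp: S1_def indicator_def)
    then show ?thesis by (simp add: W_def)
  qed
  have i2: "(\<integral>t. indicator S2 (t, r) * (k t * h r) \<partial>M) = U r * h r" for r
  proof -
    have "(\<lambda>t. indicator S2 (t, r) * (k t * h r)) = (\<lambda>t. (indicator {..<r} t * k t) * h r)"
      by (auto simp: S2_def indicator_def)
    then show ?thesis by (simp add: U_def)
  qed
  have i3: "(\<integral>t. indicator S3 (t, r) * (k t * h r) \<partial>M) = 0" for r
  proof -
    have "AE t in M. t \<noteq> r" by (rule AE_I[of _ _ "{r}"]) (use M in \<open>auto simp: sets_eq_imp_space_eq\<close>)
    then have "AE t in M. indicator S3 (t, r) * (k t * h r) = 0" by eventually_elim (simp add: S3_def)
    then show ?thesis by (rule integral_eq_zero_AE)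
  qed
  show "integrable M (\<lambda>t. k t * W t)"
    using P.integrable_fst'[OF Q[OF S(1)]] by (simp add: i1)
  have Q2: "integrable (M \<Otimes>\<^sub>M N) (\<lambda>(t, r). indicator S2 (t, r) * (k t * h r))"
    "integrable (M \<Otimes>\<^sub>M N) (\<lambda>(t, r). indicator S3 (t, r) * (k t * h r))"
    using Q[OF S(2)] Q[OF S(3)] by (simp_all add: case_prod_beta')
  show "integrable N (\<lambda>r. U r * h r)"
    using P.integrable_snd[OF Q2(1)] by (simp add: i2)
  have "(\<integral>t. k t \<partial>M) * (\<integral>r. h r \<partial>N) = (\<integral>p. k (fst p) * h (snd p) \<partial>(M \<Otimes>\<^sub>M N))"
    using P.integral_fst'[OF Pi] by simp
  also have "\<dots> = (\<integral>p. indicator S1 p * (k (fst p) * h (snd p)) + (indicator S2 p * (k (fst p) * h (snd p))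
      + indicator S3 p * (k (fst p) * h (snd p))) \<partial>(M \<Otimes>\<^sub>M N))"
    by (rule Bochner_Integration.integral_cong) (auto simp: S1_def S2_def S3_def indicator_def)
  also have "\<dots> = (\<integral>p. indicator S1 p * (k (fst p) * h (snd p)) \<partial>(M \<Otimes>\<^sub>M N))
     + ((\<integral>p. indicator S2 p * (k (fst p) * h (snd p)) \<partial>(M \<Otimes>\<^sub>M N)) + (\<integral>p. indicator S3 p * (k (fst p) * h (snd p)) \<partial>(M \<Otimes>\<^sub>M N)))"
    using Q[OF S(1)] Q[OF S(2)] Q[OF S(3)] by (simp add: Bochner_Integration.integral_add)
  also have "(\<integral>p. indicator S1 p * (k (fst p) * h (snd p)) \<partial>(M \<Otimes>\<^sub>M N)) = (\<integral>t. k t * W t \<partial>M)"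
    using P.integral_fst'[OF Q[OF S(1)]] by (simp add: i1)
  also have "(\<integral>p. indicator S2 p * (k (fst p) * h (snd p)) \<partial>(M \<Otimes>\<^sub>M N)) = (\<integral>r. U r * h r \<partial>N)"
    using P.integral_snd[OF Q2(1)] by (simp add: i2 case_prod_beta')
  also have "(\<integral>p. indicator S3 p * (k (fst p) * h (snd p)) \<partial>(M \<Otimes>\<^sub>M N)) = 0"
    using P.integral_snd[OF Q2(2)] by (simp add: i3 case_prod_beta')
  finally show "(\<integral>t. k t * W t \<partial>M) + (\<integral>r. U r * h r \<partial>N) = (\<integral>t. k t \<partial>M) * (\<integral>r. h r \<partial>N)" by simp
qed

text \<open>Both measures are cut off to the half-open interval by a density, which makes them
  finite. The half-open convention of \<open>lint\<close> matches the strict inequalities that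
  define the two triangles.\<close>

lemma lint_by_parts:
  assumes M: "sets M = sets borel" "emeasure M {lo..hi} < \<infinity>" "\<And>x. emeasure M {x} = 0"
    and N: "sets N = sets borel" "emeasure N {lo..hi} < \<infinity>"
    and k: "set_integrable M {lo..<hi} k" and h: "set_integrable N {lo..<hi} h"
  shows "set_integrable M {lo..<hi} (\<lambda>t. k t * lint N h lo t)" "set_integrable N {lo..<hi} (\<lambda>t. lint M k lo t * h t)"
    "lint M (\<lambda>t. k t * lint N h lo t) lo hi + lint N (\<lambda>t. lint M k lo t * h t) lo hi = lint M k lo hi * lint N h lo hi"
proof -
  let ?A = "{lo..<hi}"
  define M' where "M' = density M (\<lambda>x. ennreal (indicator ?A x))"
  define N' where "N' = density N (\<lambda>x. ennreal (indicator ?A x))"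
  define k' where "k' = (\<lambda>x. indicator ?A x *\<^sub>R k x)"
  define h' where "h' = (\<lambda>x. indicator ?A x *\<^sub>R h x)"
  note [measurable_cong] = M(1) N(1)
  have km [measurable]: "k' \<in> borel_measurable M" and hm [measurable]: "h' \<in> borel_measurable N"
    using k h unfolding k'_def h'_def set_integrable_def by auto
  have fin: "emeasure M ?A < \<infinity>" "emeasure N ?A < \<infinity>"
    using M N by (auto intro!: le_less_trans[OF emeasure_mono[of ?A "{lo..hi}"]])
  have e: "emeasure (density K (\<lambda>x. ennreal (indicator ?A x))) B = emeasure K (?A \<inter> B)"
    if "sets K = sets borel" "B \<in> sets borel" for K B
  proof -
    note [measurable_cong] = that(1)
    have "emeasure (density K (\<lambda>x. ennreal (indicator ?A x))) B = (\<integral>\<^sup>+x. ennreal (indicator ?A x) * indicator B x \<partial>K)"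
      by (rule emeasure_density) (use that in auto)
    also have "\<dots> = (\<integral>\<^sup>+x. indicator (?A \<inter> B) x \<partial>K)"
      by (rule nn_integral_cong) (auto simp: indicator_def)
    also have "\<dots> = emeasure K (?A \<inter> B)" using that by simp
    finally show ?thesis .
  qed
  have sp: "space M = UNIV" "space N = UNIV" using M(1) N(1) by (auto dest: sets_eq_imp_space_eq)
  have M': "finite_measure M'" "sets M' = sets borel" "emeasure M' {x} = 0" for x
  proof -
    show "finite_measure M'" by (rule finite_measureI) (use fin sp in \<open>simp add: M'_def e M(1)\<close>)
    show "sets M' = sets borel" using M(1) by (simp add: M'_def)
    have "emeasure M' {x} \<le> emeasure M {x}" unfolding M'_def using M(1) by (subst e) (auto intro: emeasure_mono)
    then show "emeasure M' {x} = 0" using M(3) by simp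
  qed
  have N': "finite_measure N'" "sets N' = sets borel"
  proof -
    show "finite_measure N'" by (rule finite_measureI) (use fin sp in \<open>simp add: N'_def e N(1)\<close>)
    show "sets N' = sets borel" using N(1) by (simp add: N'_def)
  qed
  have dM: "integral\<^sup>L M' (\<lambda>x. g x) = set_lebesgue_integral M ?A g" "integrable M' g \<longleftrightarrow> set_integrable M ?A g"
    if "g \<in> borel_measurable M" for g :: "real \<Rightarrow> complex"
    unfolding M'_def set_lebesgue_integral_def set_integrable_def using that
    by (auto simp: integral_density integrable_density)
  have dN: "integral\<^sup>L N' (\<lambda>x. g x) = set_lebesgue_integral N ?A g" "integrable N' g \<longleftrightarrow> set_integrable N ?A g"
    if "g \<in> borel_measurable N" for g :: "real \<Rightarrow> complex"
    unfolding N'_def set_lebesgue_integral_def set_integrable_def using that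
    by (auto simp: integral_density integrable_density)
  have ki: "integrable M' k'" using k by (subst dM) (auto simp: k'_def set_integrable_def simp flip: indicator_inter_arith)
  have hi': "integrable N' h'" using h by (subst dN) (auto simp: h'_def set_integrable_def simp flip: indicator_inter_arith)
  define W where "W = (\<lambda>t. \<integral>r. indicator {..<t} r * h' r \<partial>N')"
  define U where "U = (\<lambda>r. \<integral>t. indicator {..<r} t * k' t \<partial>M')"
  have Wt: "W t = lint N h lo t" if "t \<le> hi" for t
  proof -
    have "W t = set_lebesgue_integral N ?A (\<lambda>r. indicator {..<t} r * h' r)" unfolding W_def by (rule dN) measurable
    also have "\<dots> = lint N h lo t" unfolding lint_def set_lebesgue_integral_def h'_def
      by (rule Bochner_Integration.integral_cong) (use that in \<open>auto simp: indicator_def\<close>)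
    finally show ?thesis .
  qed
  have Ut: "U t = lint M k lo t" if "t \<le> hi" for t
  proof -
    have "U t = set_lebesgue_integral M ?A (\<lambda>r. indicator {..<t} r * k' r)" unfolding U_def by (rule dM) measurable
    also have "\<dots> = lint M k lo t" unfolding lint_def set_lebesgue_integral_def k'_def
      by (rule Bochner_Integration.integral_cong) (use that in \<open>auto simp: indicator_def\<close>)
    finally show ?thesis .
  qed
  have P: "integrable M' (\<lambda>t. k' t * W t)" "integrable N' (\<lambda>r. U r * h' r)"
    "(\<integral>t. k' t * W t \<partial>M') + (\<integral>r. U r * h' r \<partial>N') = (\<integral>t. k' t \<partial>M') * (\<integral>r. h' r \<partial>N')"
    using integral_by_parts[OF M' N' ki hi'] by (simp_all only: W_def U_def)
  have m1: "(\<lambda>t. k' t * W t) \<in> borel_measurable M" using P(1) by (auto simp: M'_def)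
  have m2: "(\<lambda>t. U t * h' t) \<in> borel_measurable N" using P(2) by (auto simp: N'_def)
  have c1: "indicator ?A t *\<^sub>R (k' t * W t) = indicator ?A t *\<^sub>R (k t * lint N h lo t)" for t
    using Wt[of t] by (auto simp: indicator_def k'_def)
  have c2: "indicator ?A t *\<^sub>R (U t * h' t) = indicator ?A t *\<^sub>R (lint M k lo t * h t)" for t
    using Ut[of t] by (auto simp: indicator_def h'_def)
  show "set_integrable M ?A (\<lambda>t. k t * lint N h lo t)"
    using P(1) unfolding dM(2)[OF m1] unfolding set_integrable_def c1 .
  show "set_integrable N ?A (\<lambda>t. lint M k lo t * h t)"
    using P(2) unfolding dN(2)[OF m2] unfolding set_integrable_def c2 .
  have "set_lebesgue_integral M ?A (\<lambda>t. k t * lint N h lo t) = integral\<^sup>L M' (\<lambda>t. k' t * W t)"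
    unfolding dM(1)[OF m1] set_lebesgue_integral_def c1 ..
  moreover have "set_lebesgue_integral N ?A (\<lambda>t. lint M k lo t * h t) = integral\<^sup>L N' (\<lambda>t. U t * h' t)"
    unfolding dN(1)[OF m2] set_lebesgue_integral_def c2 ..
  moreover have "integral\<^sup>L M' k' = lint M k lo hi"
    unfolding dM(1)[OF km] unfolding lint_def set_lebesgue_integral_def k'_def by (rule Bochner_Integration.integral_cong) (auto simp: indicator_def)
  moreover have "integral\<^sup>L N' h' = lint N h lo hi"
    unfolding dN(1)[OF hm] unfolding lint_def set_lebesgue_integral_def h'_def by (rule Bochner_Integration.integral_cong) (auto simp: indicator_def)
  ultimately show "lint M (\<lambda>t. k t * lint N h lo t) lo hi + lint N (\<lambda>t. lint M k lo t * h t) lo hi = lint M k lo hi * lint N h lo hi"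
    using P(3) by (simp add: lint_def)
qed

section \<open>Estimates and limits of interval integrals\<close>

lemma lint_cong: "(\<And>t. x \<le> t \<Longrightarrow> t < y \<Longrightarrow> f t = g t) \<Longrightarrow> lint \<mu> f x y = lint \<mu> g x y"
  unfolding lint_def set_lebesgue_integral_def
  by (rule Bochner_Integration.integral_cong) (auto simp: indicator_def)

lemma lint_refl [simp]: "lint \<mu> f x x = 0"
  by (simp add: lint_def set_lebesgue_integral_def)

lemma lint_plus:
  "set_integrable \<mu> {x..<y} f \<Longrightarrow> set_integrable \<mu> {x..<y} g \<Longrightarrow> lint \<mu> (\<lambda>t. f t + g t) x y = lint \<mu> f x y + lint \<mu> g x y"
  unfolding lint_def by (rule set_integral_add)

lemma lint_minus:
  "set_integrable \<mu> {x..<y} f \<Longrightarrow> set_integrable \<mu> {x..<y} g \<Longrightarrow> lint \<mu> (\<lambda>t. f t - g t) x y = lint \<mu> f x y - lint \<mu> g x y"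
  unfolding lint_def by (rule set_integral_diff)

lemma lint_cmult: "lint \<mu> (\<lambda>t. c * f t) x y = c * lint \<mu> f x y"
  unfolding lint_def set_lebesgue_integral_def by (simp add: mult.left_commute[of _ c] flip: mult_scaleR_right)

lemma set_integrable_cong_on:
  "(\<And>t. t \<in> A \<Longrightarrow> f t = g t) \<Longrightarrow> set_integrable \<mu> A f \<longleftrightarrow> set_integrable \<mu> A g"
  unfolding set_integrable_def by (rule Bochner_Integration.integrable_cong) (auto simp: indicator_def)

lemma lint_bound:
  assumes \<mu>: "sets \<mu> = sets borel" "emeasure \<mu> {x..<y} < \<infinity>" and h: "set_integrable \<mu> {x..<y} h"
    and B: "\<And>t. x \<le> t \<Longrightarrow> t < y \<Longrightarrow> norm (h t) \<le> B"
  shows "norm (lint \<mu> h x y) \<le> B * measure \<mu> {x..<y}"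
proof -
  have m: "{x..<y} \<in> sets \<mu>" using \<mu> by simp
  have "norm (lint \<mu> h x y) \<le> (\<integral>t. B * indicator {x..<y} t \<partial>\<mu>)"
    unfolding lint_def set_lebesgue_integral_def
  proof (rule Bochner_Integration.integral_norm_bound_integral)
    show "integrable \<mu> (\<lambda>t. indicator {x..<y} t *\<^sub>R h t)" using h by (simp add: set_integrable_def)
    show "integrable \<mu> (\<lambda>t. B * indicator {x..<y} t)"
      using m \<mu> by (intro integrable_mult_right integrable_real_indicator) auto
    show "norm (indicator {x..<y} t *\<^sub>R h t) \<le> B * indicator {x..<y} t" for t
      using B[of t] by (auto simp: indicator_def)
  qed
  also have "\<dots> = B * measure \<mu> {x..<y}" using m by (simp add: sets_eq_imp_space_eq[OF \<mu>(1)])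
  finally show ?thesis .
qed

lemma set_integrable_continuous:
  fixes f :: "real \<Rightarrow> complex"
  assumes \<mu>: "sets \<mu> = sets borel" "emeasure \<mu> {x..y} < \<infinity>" and f: "continuous_on {x..y} f"
  shows "set_integrable \<mu> {x..y} f"
proof -
  have "compact (f ` {x..y})" by (intro compact_continuous_image f) auto
  then obtain B where B: "\<And>t. t \<in> {x..y} \<Longrightarrow> norm (f t) \<le> B"
    by (metis bounded_iff compact_imp_bounded imageI)
  show ?thesis
    unfolding set_integrable_def
  proof (rule Bochner_Integration.integrable_bound[where f = "\<lambda>t. B * indicator {x..y} t"])
    show "integrable \<mu> (\<lambda>t. B * indicator {x..y} t)"
      using \<mu> by (intro integrable_mult_right integrable_real_indicator) auto
    have "(\<lambda>t. indicator {x..y} t *\<^sub>R f t) \<in> borel_measurable borel"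
      by (intro borel_measurable_continuous_on_indicator f) auto
    then show "(\<lambda>t. indicator {x..y} t *\<^sub>R f t) \<in> borel_measurable \<mu>"
      using measurable_cong_sets[OF \<mu>(1) refl] by blast
    show "AE t in \<mu>. norm (indicator {x..y} t *\<^sub>R f t) \<le> norm (B * indicator {x..y} t)"
      using B by (intro AE_I2) (auto simp: indicator_def intro!: order_trans[OF _ abs_ge_self])
  qed
qed

lemma ivl_nbhd:
  assumes "x \<in> ivl l r"
  shows "\<exists>lo hi. lo < x \<and> x < hi \<and> lo \<in> ivl l r \<and> hi \<in> ivl l r"
proof -
  obtain e where e: "e > 0" "ball x e \<subseteq> ivl l r" using open_ivl assms openE by blast
  then have "x - e/2 \<in> ivl l r" "x + e/2 \<in> ivl l r"
    by (auto intro!: subsetD[OF e(2)] simp: dist_real_def)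
  then show ?thesis using e(1) by (intro exI[of _ "x - e/2"] exI[of _ "x + e/2"]) auto
qed

text \<open>As y tends to x, the indicator of {..< y} converges everywhere except at x, which is a
  null set in the absence of atoms; dominated convergence does the rest.\<close>

lemma ACloc_continuous:
  assumes \<mu>: "sets \<mu> = sets borel" "\<And>x. emeasure \<mu> {x} = 0" and f: "ACloc l r \<mu> f h"
  shows "continuous_on (ivl l r) f"
proof -
  have "isCont f x" if x: "x \<in> ivl l r" for x
  proof -
    obtain lo hi where lh: "lo < x" "x < hi" "lo \<in> ivl l r" "hi \<in> ivl l r" using ivl_nbhd[OF x] by blast
    define S where "S = {lo<..<hi}"
    have S: "open S" "x \<in> S" "\<And>y. y \<in> S \<Longrightarrow> y \<in> ivl l r \<and> lo < y \<and> y < hi"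
      using lh ivl_convex[OF lh(3,4)] by (auto simp: S_def)
    have hi_int: "set_integrable \<mu> {lo..<hi} h" using f locint_sub[OF \<mu>(1) _ lh(3,4)] by (auto simp: ACloc_iff)
    define h' where "h' = (\<lambda>t. indicator {lo..<hi} t *\<^sub>R h t)"
    have h': "integrable \<mu> h'" using hi_int by (simp add: h'_def set_integrable_def)
    have feq: "f y = f lo + (\<integral>t. indicator {..<y} t *\<^sub>R h' t \<partial>\<mu>)" if "y \<in> S" for y
    proof -
      have "f y = f lo + lint \<mu> h lo y" using f S(3)[OF that] lh(3) unfolding ACloc_iff by blast
      also have "lint \<mu> h lo y = (\<integral>t. indicator {..<y} t *\<^sub>R h' t \<partial>\<mu>)"
        unfolding lint_def set_lebesgue_integral_def h'_def
        by (rule Bochner_Integration.integral_cong) (use S(3)[OF that] in \<open>auto simp: indicator_def\<close>)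
      finally show ?thesis .
    qed
    have "((\<lambda>y. \<integral>t. indicator {..<y} t *\<^sub>R h' t \<partial>\<mu>) \<longlongrightarrow> (\<integral>t. indicator {..<x} t *\<^sub>R h' t \<partial>\<mu>)) (at x)"
      unfolding tendsto_at_iff_sequentially comp_def
    proof (intro allI impI)
      fix X :: "nat \<Rightarrow> real" assume X: "X \<longlonglongrightarrow> x"
      have hm: "h' \<in> borel_measurable \<mu>" using h' by auto
      show "(\<lambda>i. \<integral>t. indicator {..<X i} t *\<^sub>R h' t \<partial>\<mu>) \<longlonglongrightarrow> (\<integral>t. indicator {..<x} t *\<^sub>R h' t \<partial>\<mu>)"
      proof (rule integral_dominated_convergence[where w = "\<lambda>t. norm (h' t)"])
        show "(\<lambda>t. indicator {..<x} t *\<^sub>R h' t) \<in> borel_measurable \<mu>"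
          using \<mu>(1) hm by (intro borel_measurable_scaleR borel_measurable_indicator) auto
        show "(\<lambda>t. indicator {..<X i} t *\<^sub>R h' t) \<in> borel_measurable \<mu>" for i
          using \<mu>(1) hm by (intro borel_measurable_scaleR borel_measurable_indicator) auto
        have "AE t in \<mu>. t \<noteq> x"
          by (rule AE_I[of _ _ "{x}"]) (use \<mu> in \<open>auto simp: sets_eq_imp_space_eq\<close>)
        then show "AE t in \<mu>. (\<lambda>i. indicator {..<X i} t *\<^sub>R h' t) \<longlonglongrightarrow> indicator {..<x} t *\<^sub>R h' t"
        proof eventually_elim
          case (elim t)
          have "\<forall>\<^sub>F i in sequentially. (t < X i) = (t < x)"
          proof (cases "t < x")
            case True then show ?thesis using order_tendstoD(1)[OF X True] by (auto elim: eventually_mono)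
          next
            case False
            then have "x < t" using elim by simp
            from order_tendstoD(2)[OF X this] show ?thesis using False by (auto elim!: eventually_mono)
          qed
          then have "\<forall>\<^sub>F i in sequentially. indicator {..<X i} t *\<^sub>R h' t = indicator {..<x} t *\<^sub>R h' t"
            by eventually_elim (simp add: indicator_def)
          then show ?case by (rule tendsto_eventually)
        qed
        show "AE t in \<mu>. norm (indicator {..<X i} t *\<^sub>R h' t) \<le> norm (h' t)" for i
          by (auto simp: indicator_def)
      qed (use h' in auto)
    qed
    then have "((\<lambda>y. f lo + (\<integral>t. indicator {..<y} t *\<^sub>R h' t \<partial>\<mu>)) \<longlongrightarrow> f x) (at x)"
      unfolding feq[OF S(2)] by (intro tendsto_intros)
    then have "(f \<longlongrightarrow> f x) (at x)"
      by (rule Lim_transform_within_open[OF _ S(1,2)]) (simp add: feq)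
    then show ?thesis by (simp add: isCont_def)
  qed
  then show ?thesis by (simp add: continuous_at_imp_continuous_on)
qed

text \<open>As x increases to y, the half-open intervals from x to y shrink to the empty set, since
  y never belongs to them. Hence the limit is 0 even if \<mu> has an atom at y.\<close>

lemma lint_left_tendsto:
  assumes \<mu>: "sets \<mu> = sets borel" and h: "locint l r \<mu> h" and y: "y \<in> ivl l r"
  shows "((\<lambda>x. lint \<mu> h x y) \<longlongrightarrow> 0) (at_left y)"
proof -
  obtain lo hi where lh: "lo < y" "lo \<in> ivl l r" using ivl_nbhd[OF y] by blast
  define h' where "h' = (\<lambda>t. indicator {lo..<y} t *\<^sub>R h t)"
  have h': "integrable \<mu> h'" using locint_sub[OF \<mu> h lh(2) y] by (simp add: h'_def set_integrable_def)
  show ?thesis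
  proof (rule tendsto_at_left_sequentially[OF lh(1)])
    fix S :: "nat \<Rightarrow> real" assume S: "\<And>n. S n < y" "\<And>n. lo < S n" "incseq S" "S \<longlonglongrightarrow> y"
    have hm: "h' \<in> borel_measurable \<mu>" using h' by auto
    have eq: "lint \<mu> h (S n) y = (\<integral>t. indicator {S n..} t *\<^sub>R h' t \<partial>\<mu>)" for n
      unfolding lint_def set_lebesgue_integral_def h'_def
      by (rule Bochner_Integration.integral_cong) (use S(2)[of n] in \<open>auto simp: indicator_def\<close>)
    have "(\<lambda>n. \<integral>t. indicator {S n..} t *\<^sub>R h' t \<partial>\<mu>) \<longlonglongrightarrow> (\<integral>t. 0 \<partial>\<mu>)"
    proof (rule integral_dominated_convergence[where w = "\<lambda>t. norm (h' t)"])
      show "(\<lambda>t. indicator {S i..} t *\<^sub>R h' t) \<in> borel_measurable \<mu>" for i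
        using \<mu>(1) hm by (intro borel_measurable_scaleR borel_measurable_indicator) auto
      show "AE t in \<mu>. (\<lambda>i. indicator {S i..} t *\<^sub>R h' t) \<longlonglongrightarrow> 0"
      proof (rule AE_I2)
        fix t
        have "\<forall>\<^sub>F i in sequentially. indicator {S i..} t *\<^sub>R h' t = 0"
        proof (cases "t < y")
          case True
          from order_tendstoD(1)[OF S(4) True] show ?thesis by eventually_elim simp
        qed (simp add: h'_def)
        then show "(\<lambda>i. indicator {S i..} t *\<^sub>R h' t) \<longlonglongrightarrow> 0" by (rule tendsto_eventually)
      qed
      show "AE t in \<mu>. norm (indicator {S i..} t *\<^sub>R h' t) \<le> norm (h' t)" for i by (auto simp: indicator_def)
    qed (use h' in auto)
    then show "(\<lambda>n. lint \<mu> h (S n) y) \<longlonglongrightarrow> 0" by (simp add: eq)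
  qed
qed

section \<open>The differential expression\<close>

locale SL =
  fixes a b :: ereal and rp rn s ch :: "real measure"
  assumes st: "standing a b rp rn s ch"
begin

abbreviation "D \<equiv> Dtau_rel a b rp rn s ch"
abbreviation "Q \<equiv> qd a b rp rn s ch"

lemma sets_\<mu> [simp]: "sets rp = sets borel" "sets rn = sets borel" "sets s = sets borel" "sets ch = sets borel"
  and lf: "loc_finite_on a b rp" "loc_finite_on a b rn" "loc_finite_on a b s" "loc_finite_on a b ch"
  using st by (auto simp: standing_def loc_finite_on_def)

lemma fin: "loc_finite_on a b \<mu> \<Longrightarrow> x \<in> ivl a b \<Longrightarrow> y \<in> ivl a b \<Longrightarrow> emeasure \<mu> {x..y} < \<infinity>"
  by (auto simp: loc_finite_on_def ivl_def)

lemma fin': "loc_finite_on a b \<mu> \<Longrightarrow> x \<in> ivl a b \<Longrightarrow> y \<in> ivl a b \<Longrightarrow> emeasure \<mu> {x..<y} < \<infinity>"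
proof -
  assume *: "loc_finite_on a b \<mu>" "x \<in> ivl a b" "y \<in> ivl a b"
  have "emeasure \<mu> {x..<y} \<le> emeasure \<mu> {x..y}"
    using *(1) by (intro emeasure_mono) (auto simp: loc_finite_on_def)
  then show "emeasure \<mu> {x..<y} < \<infinity>" using fin[OF *] by (rule le_less_trans)
qed

lemma s_atom: "emeasure s {x} = 0"
proof -
  have "{x} \<in> null_sets lborel" by (auto simp: null_sets_def)
  then have "{x} \<in> null_sets s" using st by (auto simp: standing_def absolutely_continuous_def)
  then show ?thesis by auto
qed

lemma s_pos: "x \<in> ivl a b \<Longrightarrow> y \<in> ivl a b \<Longrightarrow> x < y \<Longrightarrow> emeasure s {x<..<y} > 0"
  using st by (auto simp: standing_def ivl_def)

lemma ACs_continuous: "ACloc l r s f h \<Longrightarrow> continuous_on (ivl l r) f"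
  using ACloc_continuous[of s] s_atom by simp

lemma locint_continuous:
  assumes \<mu>: "loc_finite_on a b \<mu>" and f: "continuous_on (ivl a b) f"
  shows "locint a b \<mu> f"
  unfolding locint_def
proof (intro allI impI)
  fix x y assume xy: "a < ereal x \<and> ereal y < b"
  show "set_integrable \<mu> {x..y} f"
  proof (rule set_integrable_continuous)
    show "sets \<mu> = sets borel" "emeasure \<mu> {x..y} < \<infinity>" using \<mu> xy by (auto simp: loc_finite_on_def)
    have "{x..y} \<subseteq> ivl a b"
    proof (cases "x \<le> y")
      case True
      then have "ereal x \<le> ereal y" by simp
      then have "x \<in> ivl a b" "y \<in> ivl a b"
        using xy le_less_trans[of "ereal x" "ereal y" b] less_le_trans[of a "ereal x" "ereal y"]
        by (simp_all add: ivl_def)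
      then show ?thesis by (rule ivl_convex)
    qed simp
    then show "continuous_on {x..y} f" using f continuous_on_subset by blast
  qed
qed

lemma D_cont: "D f f1 g \<Longrightarrow> continuous_on (ivl a b) f"
  unfolding Dtau_rel_def using ACs_continuous by blast

lemma D_locint:
  assumes "D f f1 g"
  shows "locint a b ch f" "locint a b rp g" "locint a b rn g" "locint a b s f1"
proof -
  show "locint a b ch f" by (rule locint_continuous[OF lf(4) D_cont[OF assms]])
  show "locint a b rp g" "locint a b rn g" using assms unfolding Dtau_rel_def ACloc_s_def by blast+
  show "locint a b s f1" using assms unfolding Dtau_rel_def ACloc_def by blast
qed

text \<open>The condition on the derivative, differenced between two points, where the base point c
  drops out. Atoms of \<open>ch\<close>, \<open>rp\<close> and \<open>rn\<close> enter here as
  possible jumps of f1.\<close>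

lemma D_jump:
  assumes D: "D f f1 g" and xy: "x \<in> ivl a b" "y \<in> ivl a b" "x \<le> y"
  shows "f1 y = f1 x + lint ch f x y - lint rp g x y + lint rn g x y"
proof (cases "x = y")
  case False
  then have lt: "x < y" using xy by simp
  obtain c where c: "c \<in> ivl a b" "ACloc_s a b rp rn (\<lambda>x. - f1 x + iint ch c x f) g"
    using D unfolding Dtau_rel_def by blast
  have "- f1 y + iint ch c y f = - f1 x + iint ch c x f + (iint rp x y g - iint rn x y g)"
    using c(2) xy(1,2) unfolding ACloc_s_def by blast
  moreover have "iint rp x y g = lint rp g x y" "iint rn x y g = lint rn g x y"
    using lt by (simp_all add: iint_def lint_def)
  moreover have "iint ch c y f - iint ch c x f = lint ch f x y"
    by (rule iint_diff[OF _ D_locint(1)[OF D] c(1) xy(1,2) lt]) simp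
  ultimately show ?thesis by (simp add: algebra_simps)
qed simp

lemma D_left_cont:
  assumes D: "D f f1 g" and y: "y \<in> ivl a b"
  shows "(f1 \<longlongrightarrow> f1 y) (at_left y)"
proof -
  obtain lo hi where lh: "lo < y" "lo \<in> ivl a b" using ivl_nbhd[OF y] by blast
  have t: "((\<lambda>x. f1 y - (lint ch f x y - lint rp g x y + lint rn g x y)) \<longlongrightarrow> f1 y - (0 - 0 + 0)) (at_left y)"
    using D_locint[OF D] y by (intro tendsto_intros lint_left_tendsto[of _ a b]) auto
  have ev: "\<forall>\<^sub>F x in at_left y. f1 y - (lint ch f x y - lint rp g x y + lint rn g x y) = f1 x"
    using eventually_at_left_real[OF lh(1)]
  proof (rule eventually_mono)
    fix x assume "x \<in> {lo<..<y}"
    then have "x \<in> ivl a b" "x \<le> y" using ivl_convex[OF lh(2) y] by auto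
    from D_jump[OF D this(1) y this(2)] show "f1 y - (lint ch f x y - lint rp g x y + lint rn g x y) = f1 x" by simp
  qed
  show ?thesis using Lim_transform_eventually[OF t ev] by simp
qed

text \<open>The derivative with respect to \<open>s\<close> is fixed only almost everywhere, but
  both representatives are left-continuous. If they differed at y, their difference would stay close
  to d y on an interval to the left of y; \<open>s\<close> charges that interval, so the integrals
  could not agree.\<close>

lemma D_unique:
  assumes D: "D f f1 g" "D f f1' g'" and y: "y \<in> ivl a b"
  shows "f1 y = f1' y"
proof (rule ccontr)
  assume ne: "f1 y \<noteq> f1' y"
  define d where "d = (\<lambda>x. f1 x - f1' x)"
  have dy: "norm (d y) > 0" using ne by (simp add: d_def)
  have "(d \<longlongrightarrow> d y) (at_left y)" unfolding d_def by (intro tendsto_intros D_left_cont[OF D(1) y] D_left_cont[OF D(2) y])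
  then have "\<forall>\<^sub>F x in at_left y. dist (d x) (d y) < norm (d y) / 2"
    by (rule tendstoD) (use dy in simp)
  then obtain x0 where x0: "x0 < y" "\<And>x. x0 < x \<Longrightarrow> x < y \<Longrightarrow> dist (d x) (d y) < norm (d y) / 2"
    by (auto simp: eventually_at_left_field)
  obtain lo hi where lh: "lo < y" "lo \<in> ivl a b" using ivl_nbhd[OF y] by blast
  define x where "x = (max x0 lo + y) / 2"
  have x: "x0 < x" "x < y" "lo < x" using x0(1) lh(1) by (auto simp: x_def)
  have xi: "x \<in> ivl a b" using ivl_convex[OF lh(2) y] x by auto
  have AC: "ACloc a b s f f1" "ACloc a b s f f1'" using D by (auto simp: Dtau_rel_def)
  have i: "set_integrable s {x..<y} f1" "set_integrable s {x..<y} f1'"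
    using AC locint_sub[OF _ _ xi y] by (auto simp: ACloc_iff)
  have ic: "set_integrable s {x..<y} (\<lambda>_. d y)"
    unfolding set_integrable_def using fin'[OF lf(3) xi y]
    by (intro integrable_scaleR_left integrable_real_indicator) auto
  have id: "set_integrable s {x..<y} d" unfolding d_def by (rule set_integral_diff(1)[OF i])
  have "lint s d x y = 0"
  proof -
    have "f y = f x + lint s f1 x y" "f y = f x + lint s f1' x y"
      using AC xi y x(2) unfolding ACloc_iff by blast+
    then have "lint s f1 x y = lint s f1' x y" by (metis add_left_cancel)
    then show ?thesis unfolding d_def lint_minus[OF i] by simp
  qed
  moreover have "lint s (\<lambda>t. d t - d y) x y = lint s d x y - lint s (\<lambda>_. d y) x y"
    by (rule lint_minus[OF id ic])
  moreover have "norm (lint s (\<lambda>t. d t - d y) x y) \<le> norm (d y) / 2 * measure s {x..<y}"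
  proof (rule lint_bound)
    show "set_integrable s {x..<y} (\<lambda>t. d t - d y)" by (rule set_integral_diff(1)[OF id ic])
    fix t assume "x \<le> t" "t < y"
    then show "norm (d t - d y) \<le> norm (d y) / 2" using x0(2)[of t] x by (auto simp: dist_norm)
  qed (use fin'[OF lf(3) xi y] in auto)
  moreover have "lint s (\<lambda>_. d y) x y = measure s {x..<y} * d y"
    unfolding lint_def using fin'[OF lf(3) xi y] by (subst set_integral_const) (auto simp: scaleR_conv_of_real)
  ultimately have "norm (d y) * measure s {x..<y} \<le> norm (d y) / 2 * measure s {x..<y}"
    by (simp add: norm_mult mult.commute)
  moreover have "measure s {x..<y} > 0"
  proof -
    have "emeasure s {x<..<y} \<le> emeasure s {x..<y}" by (rule emeasure_mono) auto
    then have "emeasure s {x..<y} > 0" using s_pos[OF xi y x(2)] by simp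
    then show ?thesis using fin'[OF lf(3) xi y]
      by (simp add: emeasure_eq_ennreal_measure)
  qed
  then have "norm (d y) * measure s {x..<y} > 0" using dy by simp
  ultimately show False by linarith
qed

end

section \<open>Conjugation, change of representatives, and limits at the left endpoint\<close>

lemma integral_cnj_complex: "(\<integral>x. cnj (f x) \<partial>M) = cnj (\<integral>x. f x \<partial>M)" for f :: "'a \<Rightarrow> complex"
proof (cases "integrable M f")
  case True
  then show ?thesis by (rule integral_bounded_linear[OF bounded_linear_cnj])
next
  case False
  then have "\<not> integrable M (\<lambda>x. cnj (f x))"
    using integrable_bounded_linear[OF bounded_linear_cnj, of M "\<lambda>x. cnj (f x)"] by auto
  then show ?thesis using False by (simp add: not_integrable_integral_eq)
qed

lemma set_integral_cnj_complex:
  "set_lebesgue_integral M A (\<lambda>x. cnj (f x)) = cnj (set_lebesgue_integral M A f)"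
  unfolding set_lebesgue_integral_def integral_cnj_complex[symmetric] by simp

lemma set_integrable_cnj: "set_integrable M A f \<Longrightarrow> set_integrable M A (\<lambda>x. cnj (f x))" for f :: "'a \<Rightarrow> complex"
  unfolding set_integrable_def using integrable_bounded_linear[OF bounded_linear_cnj, of M "\<lambda>x. indicator A x *\<^sub>R f x"] by simp

lemma locint_cnj: "locint l r \<mu> h \<Longrightarrow> locint l r \<mu> (\<lambda>x. cnj (h x))"
  unfolding locint_def using set_integrable_cnj by blast

lemma iint_cnj: "iint \<mu> c x (\<lambda>t. cnj (h t)) = cnj (iint \<mu> c x h)"
  by (simp add: iint_def set_integral_cnj_complex)

lemma ACloc_cnj:
  assumes "ACloc l r \<mu> f h" shows "ACloc l r \<mu> (\<lambda>x. cnj (f x)) (\<lambda>x. cnj (h x))"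
  unfolding ACloc_def iint_cnj
proof (intro conjI ballI)
  show "locint l r \<mu> (\<lambda>x. cnj (h x))" using assms locint_cnj unfolding ACloc_def by blast
  fix c x assume "c \<in> ivl l r" "x \<in> ivl l r"
  then have "f x = f c + iint \<mu> c x h" using assms unfolding ACloc_def by blast
  then show "cnj (f x) = cnj (f c) + cnj (iint \<mu> c x h)" by (metis complex_cnj_add)
qed

lemma Dtau_rel_cnj:
  assumes "Dtau_rel a b rp rn s ch f f1 g"
  shows "Dtau_rel a b rp rn s ch (\<lambda>x. cnj (f x)) (\<lambda>x. cnj (f1 x)) (\<lambda>x. cnj (g x))"
proof -
  obtain c where c: "c \<in> ivl a b" "ACloc_s a b rp rn (\<lambda>x. - f1 x + iint ch c x f) g" and f: "ACloc a b s f f1"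
    using assms unfolding Dtau_rel_def by blast
  have "ACloc_s a b rp rn (\<lambda>x. - cnj (f1 x) + iint ch c x (\<lambda>t. cnj (f t))) (\<lambda>x. cnj (g x))"
    unfolding ACloc_s_def iint_cnj
  proof (intro conjI ballI)
    show "locint a b rp (\<lambda>x. cnj (g x))" "locint a b rn (\<lambda>x. cnj (g x))"
      using c(2) locint_cnj unfolding ACloc_s_def by blast+
    fix c' x assume "c' \<in> ivl a b" "x \<in> ivl a b"
    then have "- f1 x + iint ch c x f = - f1 c' + iint ch c c' f + (iint rp c' x g - iint rn c' x g)"
      using c(2) unfolding ACloc_s_def by blast
    from arg_cong[OF this, of cnj]
    show "- cnj (f1 x) + cnj (iint ch c x f) = - cnj (f1 c') + cnj (iint ch c c' f) + (cnj (iint rp c' x g) - cnj (iint rn c' x g))"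
      by simp
  qed
  then show ?thesis using c(1) ACloc_cnj[OF f] unfolding Dtau_rel_def by blast
qed

lemma Icc_subset_ivl: "l < ereal x \<Longrightarrow> ereal y < r \<Longrightarrow> {x..y} \<subseteq> ivl l r"
proof
  fix t assume *: "l < ereal x" "ereal y < r" "t \<in> {x..y}"
  then have "ereal x \<le> ereal t" "ereal t \<le> ereal y" by auto
  then show "t \<in> ivl l r" using * unfolding ivl_def
    using less_le_trans[of l "ereal x" "ereal t"] le_less_trans[of "ereal t" "ereal y" r] by blast
qed

lemma iint_cong:
  assumes "\<And>t. t \<in> ivl l r \<Longrightarrow> f t = g t" "c \<in> ivl l r" "x \<in> ivl l r"
  shows "iint \<mu> c x f = iint \<mu> c x g"
proof -
  have "set_lebesgue_integral \<mu> {p..<q} f = set_lebesgue_integral \<mu> {p..<q} g" if "p \<in> ivl l r" "q \<in> ivl l r" for p q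
    using lint_cong[of p q f g \<mu>] ivl_convex[OF that] assms(1) unfolding lint_def by force
  then show ?thesis using assms(2,3) by (simp add: iint_def)
qed

lemma locint_cong:
  assumes "\<And>t. t \<in> ivl l r \<Longrightarrow> f t = g t" "locint l r \<mu> f"
  shows "locint l r \<mu> g"
  unfolding locint_def
proof (intro allI impI)
  fix x y assume xy: "l < ereal x \<and> ereal y < r"
  have "set_integrable \<mu> {x..y} f" using assms(2) xy unfolding locint_def by blast
  moreover have "\<And>t. t \<in> {x..y} \<Longrightarrow> f t = g t" using Icc_subset_ivl[of l x y r] xy assms(1) by blast
  ultimately show "set_integrable \<mu> {x..y} g" using set_integrable_cong_on by blast
qed

lemma ACloc_cong:
  assumes "\<And>t. t \<in> ivl l r \<Longrightarrow> h t = h' t" "ACloc l r \<mu> f h"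
  shows "ACloc l r \<mu> f h'"
  unfolding ACloc_def
proof (intro conjI ballI)
  show "locint l r \<mu> h'" using locint_cong assms unfolding ACloc_def by blast
  fix c x assume cx: "c \<in> ivl l r" "x \<in> ivl l r"
  have "f x = f c + iint \<mu> c x h" using assms(2) cx unfolding ACloc_def by blast
  also have "iint \<mu> c x h = iint \<mu> c x h'" by (rule iint_cong[OF assms(1) cx])
  finally show "f x = f c + iint \<mu> c x h'" .
qed

lemma Dtau_rel_cong:
  assumes e: "\<And>t. t \<in> ivl a b \<Longrightarrow> f1 t = f1' t" and D: "Dtau_rel a b rp rn s ch f f1 g"
  shows "Dtau_rel a b rp rn s ch f f1' g"
proof -
  obtain c where c: "c \<in> ivl a b" "ACloc_s a b rp rn (\<lambda>x. - f1 x + iint ch c x f) g" and f: "ACloc a b s f f1"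
    using D unfolding Dtau_rel_def by blast
  have "ACloc_s a b rp rn (\<lambda>x. - f1' x + iint ch c x f) g"
    unfolding ACloc_s_def
  proof (intro conjI ballI)
    show "locint a b rp g" "locint a b rn g" using c(2) unfolding ACloc_s_def by blast+
    fix c' x assume cx: "c' \<in> ivl a b" "x \<in> ivl a b"
    then have "- f1 x + iint ch c x f = - f1 c' + iint ch c c' f + (iint rp c' x g - iint rn c' x g)"
      using c(2) unfolding ACloc_s_def by blast
    then show "- f1' x + iint ch c x f = - f1' c' + iint ch c c' f + (iint rp c' x g - iint rn c' x g)"
      using e[OF cx(1)] e[OF cx(2)] by metis
  qed
  then show ?thesis using c(1) ACloc_cong[OF e f] unfolding Dtau_rel_def by blast
qed

text \<open>On a fixed interval from p to q, Dynkin's theorem, with the rays {..< y} as a generator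
  stable under intersection, makes the integral over every measurable set vanish. Rational p and q
  leave only countably many exceptional sets.\<close>

lemma zero_AE_if_lint_zero:
  assumes sf: "sigma_finite_measure \<mu>" and \<mu>: "sets \<mu> = sets borel" and k: "locint l r \<mu> k"
    and z: "\<And>x y. x \<in> ivl l r \<Longrightarrow> y \<in> ivl l r \<Longrightarrow> x < y \<Longrightarrow> lint \<mu> k x y = 0"
  shows "AE x in \<mu>. x \<in> ivl l r \<longrightarrow> k x = 0"
proof -
  have sp: "space \<mu> = UNIV" using \<mu> by (auto dest: sets_eq_imp_space_eq)
  have loc: "AE x in \<mu>. p \<le> x \<and> x < q \<longrightarrow> k x = 0" if pq: "p \<in> ivl l r" "q \<in> ivl l r" for p q
  proof (cases "p < q")
    case True
    define g where "g = (\<lambda>x. indicator {p..<q} x *\<^sub>R k x)"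
    have gi: "integrable \<mu> g" using locint_sub[OF \<mu> k pq] by (simp add: g_def set_integrable_def)
    have gA: "set_integrable \<mu> A g" if "A \<in> sets \<mu>" for A
      unfolding set_integrable_def by (rule integrable_mult_indicator[OF that gi])
    have g0: "(\<integral>x. g x \<partial>\<mu>) = 0"
      using z[OF pq True] by (simp add: g_def lint_def set_lebesgue_integral_def)
    have "set_lebesgue_integral \<mu> A g = 0" if "A \<in> sets \<mu>" for A
    proof -
      have A: "A \<in> sigma_sets UNIV (range lessThan)"
        using that unfolding \<mu> by (simp add: borel_Iio)
      have Ist: "Int_stable (range lessThan :: real set set)"
      proof -
        have "{..<x} \<inter> {..<y} = {..<min x y}" for x y :: real by auto
        then show ?thesis unfolding Int_stable_def by blast
      qed
      have sig: "B \<in> sets \<mu>" if "B \<in> sigma_sets UNIV (range lessThan)" for B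
        using that unfolding \<mu> by (simp add: borel_Iio)
      show ?thesis
      proof (rule sigma_sets_induct_disjoint[OF Ist _ A])
        fix B :: "real set" assume "B \<in> range lessThan"
        then obtain y where B: "B = {..<y}" by blast
        have "set_lebesgue_integral \<mu> B g = lint \<mu> k p (min y q)"
          unfolding lint_def set_lebesgue_integral_def B g_def
          by (rule Bochner_Integration.integral_cong) (auto simp: indicator_def)
        also have "\<dots> = 0"
        proof (cases "p < min y q")
          case True
          then have "min y q \<in> ivl l r" using ivl_convex[OF pq] by auto
          then show ?thesis using z[OF pq(1) _ True] by blast
        next
          case False
          then have e: "{p..<min y q} = {}" by simp
          show ?thesis unfolding lint_def set_lebesgue_integral_def e by simp
        qed
        finally show "set_lebesgue_integral \<mu> B g = 0" .
      next
        show "set_lebesgue_integral \<mu> {} g = 0" by (simp add: set_lebesgue_integral_def)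
      next
        fix B assume B: "B \<in> sigma_sets UNIV (range lessThan)" "set_lebesgue_integral \<mu> B g = 0"
        have "set_lebesgue_integral \<mu> (B \<union> (UNIV - B)) g = set_lebesgue_integral \<mu> B g + set_lebesgue_integral \<mu> (UNIV - B) g"
          using sig[OF B(1)] \<mu> by (intro set_integral_Un gA) auto
        moreover have "set_lebesgue_integral \<mu> (B \<union> (UNIV - B)) g = 0" using g0 by (simp add: set_lebesgue_integral_def)
        ultimately show "set_lebesgue_integral \<mu> (UNIV - B) g = 0" using B(2) by simp
      next
        fix F :: "nat \<Rightarrow> real set"
        assume F: "disjoint_family F" "range F \<subseteq> sigma_sets UNIV (range lessThan)" "\<And>i. set_lebesgue_integral \<mu> (F i) g = 0"
        have Fs: "F i \<in> sets \<mu>" for i using F(2) sig by blast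
        have "(\<Union>i. F i) \<in> sets \<mu>" using Fs by blast
        from lebesgue_integral_countable_add[OF Fs _ gA[OF this]] F(1,3)
        show "set_lebesgue_integral \<mu> (\<Union>i. F i) g = 0"
          by (simp add: disjoint_family_on_def)
      qed auto
    qed
    from sigma_finite_measure.density_zero[OF sf gi this] have "AE x in \<mu>. g x = 0" .
    then show ?thesis by eventually_elim (auto simp: g_def indicator_def)
  qed auto
  have "AE x in \<mu>. \<forall>pq\<in>{pq \<in> \<rat> \<times> \<rat>. fst pq \<in> ivl l r \<and> snd pq \<in> ivl l r}. fst pq \<le> x \<and> x < snd pq \<longrightarrow> k x = 0"
  proof (rule AE_ball_countable[THEN iffD2])
    show "countable {pq \<in> \<rat> \<times> (\<rat>::real set). fst pq \<in> ivl l r \<and> snd pq \<in> ivl l r}"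
      by (rule countable_subset[of _ "\<rat> \<times> \<rat>"]) (auto intro: countable_rat)
  qed (use loc in auto)
  then show ?thesis
  proof eventually_elim
    case (elim x)
    show ?case
    proof
      assume x: "x \<in> ivl l r"
      obtain lo hi where lh: "lo < x" "x < hi" "lo \<in> ivl l r" "hi \<in> ivl l r" using ivl_nbhd[OF x] by blast
      obtain p where p: "p \<in> \<rat>" "lo < p" "p < x" using Rats_dense_in_real[OF lh(1)] by blast
      obtain q where q: "q \<in> \<rat>" "x < q" "q < hi" using Rats_dense_in_real[OF lh(2)] by blast
      have "p \<in> ivl l r" "q \<in> ivl l r" using ivl_convex[OF lh(3) x] ivl_convex[OF x lh(4)] p q by auto
      then show "k x = 0" using elim p q by force
    qed
  qed
qed

lemma ACloc_unique_AE:
  assumes sf: "sigma_finite_measure \<mu>" and \<mu>: "sets \<mu> = sets borel" and h: "ACloc l r \<mu> f h" "ACloc l r \<mu> f h'"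
  shows "AE x in \<mu>. x \<in> ivl l r \<longrightarrow> h x = h' x"
proof -
  have i: "locint l r \<mu> h" "locint l r \<mu> h'" using h unfolding ACloc_def by blast+
  have "AE x in \<mu>. x \<in> ivl l r \<longrightarrow> h x - h' x = 0"
  proof (rule zero_AE_if_lint_zero[OF sf \<mu>])
    show "locint l r \<mu> (\<lambda>x. h x - h' x)" using locint_lin[OF i, of "-1"] by simp
    fix x y assume xy: "x \<in> ivl l r" "y \<in> ivl l r" "x < y"
    have "f y = f x + lint \<mu> h x y" "f y = f x + lint \<mu> h' x y" using h xy unfolding ACloc_iff by blast+
    then have "lint \<mu> h x y = lint \<mu> h' x y" by (metis add_left_cancel)
    then show "lint \<mu> (\<lambda>x. h x - h' x) x y = 0"
      using lint_minus[OF locint_sub[OF \<mu> i(1) xy(1,2)] locint_sub[OF \<mu> i(2) xy(1,2)]] by simp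
  qed
  then show ?thesis by eventually_elim simp
qed

lemma ivl_exhaust:
  assumes d: "a < ereal d"
  shows "\<exists>lo :: nat \<Rightarrow> real. (\<forall>n. lo n \<in> ivl a (ereal d)) \<and> (\<forall>t. a < ereal t \<longrightarrow> (\<forall>\<^sub>F n in sequentially. lo n < t))"
proof (cases a)
  case (real a')
  \<comment> \<open>The 2 in the denominator keeps every term below d, including the one for n =
    0.\<close>
  define lo where "lo = (\<lambda>n::nat. a' + (d - a') / (real n + 2))"
  have ad: "a' < d" using d real by simp
  have p: "0 < (d - a') / (real n + 2)" "(d - a') / (real n + 2) < d - a'" for n
  proof -
    show "0 < (d - a') / (real n + 2)" using ad by (intro divide_pos_pos) auto
    have "(d - a') * 1 < (d - a') * (real n + 2)" using ad by (intro mult_strict_left_mono) auto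
    then show "(d - a') / (real n + 2) < d - a'" by (subst divide_less_eq) simp
  qed
  have "lo n \<in> ivl a (ereal d)" for n
    unfolding ivl_def lo_def real using p[of n] by simp
  moreover have "filterlim (\<lambda>n. real n + 2) at_top sequentially"
    by (rule filterlim_at_top_mono[OF filterlim_real_sequentially]) auto
  then have "lo \<longlonglongrightarrow> a' + 0"
    unfolding lo_def by (intro tendsto_add tendsto_const real_tendsto_divide_at_top[OF tendsto_const])
  then have "\<forall>\<^sub>F n in sequentially. lo n < t" if "a < ereal t" for t
    using order_tendstoD(2)[of lo "a' + 0" sequentially t] that real by simp
  ultimately show ?thesis by (intro exI[of _ lo]) blast
next
  case MInf
  define lo where "lo = (\<lambda>n::nat. d - 1 - real n)"
  have "lo n \<in> ivl a (ereal d)" for n unfolding ivl_def lo_def MInf by simp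
  moreover have "\<forall>\<^sub>F n in sequentially. lo n < t" for t
    using eventually_gt_at_top[of "nat \<lceil>\<bar>d\<bar> + \<bar>t\<bar>\<rceil>"]
    by eventually_elim (unfold lo_def, linarith)
  ultimately show ?thesis by (intro exI[of _ lo]) blast
qed (use d in auto)

text \<open>Dominated convergence along an exhausting sequence. The bound is uniform over Borel
  subsets, so that it applies to every later cut-off point at once.\<close>

lemma ivl_tail:
  fixes h :: "real \<Rightarrow> 'c :: {banach, second_countable_topology}"
  assumes \<mu>: "sets \<mu> = sets borel" and d: "a < ereal d" and h: "set_integrable \<mu> (ivl a (ereal d)) h" and e: "\<epsilon> > 0"
  shows "\<exists>x0\<in>ivl a (ereal d). \<forall>X\<in>sets borel. X \<subseteq> ivl a (ereal x0) \<longrightarrow> set_lebesgue_integral \<mu> X (\<lambda>t. norm (h t)) < \<epsilon>"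
proof -
  from ivl_exhaust[OF d] obtain lo :: "nat \<Rightarrow> real" where lo: "\<And>n. lo n \<in> ivl a (ereal d)" "\<And>t. a < ereal t \<Longrightarrow> \<forall>\<^sub>F n in sequentially. lo n < t"
    by blast
  define h' where "h' = (\<lambda>t. indicator (ivl a (ereal d)) t *\<^sub>R h t)"
  have h': "integrable \<mu> h'" using h by (simp add: h'_def set_integrable_def)
  then have hm: "(\<lambda>t. norm (h' t)) \<in> borel_measurable \<mu>" by auto
  have "(\<lambda>n. \<integral>t. indicator (ivl a (ereal (lo n))) t *\<^sub>R norm (h' t) \<partial>\<mu>) \<longlonglongrightarrow> (\<integral>t. 0 \<partial>\<mu>)"
  proof (rule integral_dominated_convergence[where w = "\<lambda>t. norm (h' t)"])
    show "(\<lambda>t. indicator (ivl a (ereal (lo i))) t *\<^sub>R norm (h' t)) \<in> borel_measurable \<mu>" for i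
      using \<mu> by (intro borel_measurable_scaleR borel_measurable_indicator hm) auto
    show "AE t in \<mu>. (\<lambda>i. indicator (ivl a (ereal (lo i))) t *\<^sub>R norm (h' t)) \<longlonglongrightarrow> 0"
    proof (rule AE_I2)
      fix t
      have "\<forall>\<^sub>F i in sequentially. indicator (ivl a (ereal (lo i))) t *\<^sub>R norm (h' t) = 0"
      proof (cases "a < ereal t")
        case True
        from lo(2)[OF True] show ?thesis by eventually_elim (auto simp: ivl_def indicator_def)
      qed (simp add: ivl_def)
      then show "(\<lambda>i. indicator (ivl a (ereal (lo i))) t *\<^sub>R norm (h' t)) \<longlonglongrightarrow> 0" by (rule tendsto_eventually)
    qed
    show "AE t in \<mu>. norm (indicator (ivl a (ereal (lo i))) t *\<^sub>R norm (h' t)) \<le> norm (h' t)" for i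
      by (auto simp: indicator_def)
  qed (use h' in auto)
  then have "(\<lambda>n. \<integral>t. indicator (ivl a (ereal (lo n))) t *\<^sub>R norm (h' t) \<partial>\<mu>) \<longlonglongrightarrow> 0" by simp
  from order_tendstoD(2)[OF this e] obtain n where n: "(\<integral>t. indicator (ivl a (ereal (lo n))) t *\<^sub>R norm (h' t) \<partial>\<mu>) < \<epsilon>"
    by (auto simp: eventually_sequentially)
  have sub: "ivl a (ereal (lo n)) \<subseteq> ivl a (ereal d)" using lo(1)[of n] unfolding ivl_def by auto
  show ?thesis
  proof (intro bexI[OF _ lo(1)] ballI impI)
    fix X :: "real set" assume X: "X \<in> sets borel" "X \<subseteq> ivl a (ereal (lo n))"
    have "set_lebesgue_integral \<mu> X (\<lambda>t. norm (h t)) = (\<integral>t. indicator X t *\<^sub>R norm (h' t) \<partial>\<mu>)"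
      unfolding set_lebesgue_integral_def h'_def
      by (rule Bochner_Integration.integral_cong) (use X sub in \<open>auto simp: indicator_def\<close>)
    also have "\<dots> \<le> (\<integral>t. indicator (ivl a (ereal (lo n))) t *\<^sub>R norm (h' t) \<partial>\<mu>)"
      by (intro integral_mono integrable_mult_indicator integrable_norm h') (use X \<mu> in \<open>auto simp: indicator_def\<close>)
    finally show "set_lebesgue_integral \<mu> X (\<lambda>t. norm (h t)) < \<epsilon>" using n by linarith
  qed
qed

lemma eventually_at_a: "a < ereal d \<Longrightarrow> \<forall>\<^sub>F x in at_a a. x \<in> ivl a (ereal d)"
proof (cases a)
  case (real a')
  assume "a < ereal d"
  then show ?thesis using real eventually_at_right_real[of a' d]
    by (auto simp: at_a_def ivl_def elim: eventually_mono)
next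
  case MInf
  then show ?thesis using eventually_gt_at_bot[of d] eventually_at_bot_dense[of "\<lambda>x. x < d"]
    by (auto simp: at_a_def ivl_def)
qed auto

lemma at_a_nontrivial: "a < ereal d \<Longrightarrow> at_a a \<noteq> bot"
  by (cases a) (auto simp: at_a_def trivial_limit_at_bot_linorder)

lemma ivl_split: "x \<in> ivl l (ereal c) \<Longrightarrow> ivl l (ereal c) = ivl l (ereal x) \<union> {x..<c}" "ivl l (ereal x) \<inter> {x..<c} = {}"
proof -
  assume x: "x \<in> ivl l (ereal c)"
  have xd: "x < c" using x by (auto simp: ivl_def)
  show "ivl l (ereal c) = ivl l (ereal x) \<union> {x..<c}"
  proof (rule set_eqI)
    fix t
    show "t \<in> ivl l (ereal c) \<longleftrightarrow> t \<in> ivl l (ereal x) \<union> {x..<c}"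
    proof (cases "t < x")
      case True then show ?thesis using xd by (simp add: ivl_def)
    next
      case False
      then have "ereal x \<le> ereal t" by simp
      moreover have "l < ereal x" using x by (simp add: ivl_def)
      ultimately have "l < ereal t" by (rule less_le_trans[rotated])
      then show ?thesis using False by (simp add: ivl_def)
    qed
  qed
qed (auto simp: ivl_def)

lemma lint_tendsto_at_a:
  assumes \<mu>: "sets \<mu> = sets borel" and d: "a < ereal d" and h: "set_integrable \<mu> (ivl a (ereal d)) h"
  shows "((\<lambda>x. lint \<mu> h x d) \<longlongrightarrow> set_lebesgue_integral \<mu> (ivl a (ereal d)) h) (at_a a)"
proof (rule tendstoI)
  fix \<epsilon> :: real assume e: "\<epsilon> > 0"
  obtain x0 where x0: "x0 \<in> ivl a (ereal d)"
    "\<And>X. X \<in> sets borel \<Longrightarrow> X \<subseteq> ivl a (ereal x0) \<Longrightarrow> set_lebesgue_integral \<mu> X (\<lambda>t. norm (h t)) < \<epsilon>"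
    using ivl_tail[OF \<mu> d h e] by blast
  have "a < ereal x0" using x0(1) by (simp add: ivl_def)
  from eventually_at_a[OF this]
  show "\<forall>\<^sub>F x in at_a a. dist (lint \<mu> h x d) (set_lebesgue_integral \<mu> (ivl a (ereal d)) h) < \<epsilon>"
  proof (rule eventually_mono)
    fix x assume x: "x \<in> ivl a (ereal x0)"
    have "x \<in> ivl a (ereal d)" using x by (rule ivl_less) (use x0(1) in \<open>simp add: ivl_def\<close>)
    note un = ivl_split(1)[OF this] and dj = ivl_split(2)[of a x d]
    have si: "set_integrable \<mu> (ivl a (ereal x)) h" "set_integrable \<mu> {x..<d} h"
      by (rule set_integrable_subset[OF h]; use un \<mu> in auto)+
    have "set_lebesgue_integral \<mu> (ivl a (ereal d)) h = set_lebesgue_integral \<mu> (ivl a (ereal x)) h + lint \<mu> h x d"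
      unfolding un lint_def by (rule set_integral_Un[OF dj si])
    then have "dist (lint \<mu> h x d) (set_lebesgue_integral \<mu> (ivl a (ereal d)) h) = norm (set_lebesgue_integral \<mu> (ivl a (ereal x)) h)"
      by (simp add: dist_norm)
    also have "\<dots> \<le> set_lebesgue_integral \<mu> (ivl a (ereal x)) (\<lambda>t. norm (h t))"
      by (rule set_integral_norm_bound[OF si(1)])
    also have "\<dots> < \<epsilon>" by (rule x0(2)) (use x in \<open>auto simp: ivl_def\<close>)
    finally show "dist (lint \<mu> h x d) (set_lebesgue_integral \<mu> (ivl a (ereal d)) h) < \<epsilon>" .
  qed
qed

lemma sigma_finite_if_loc_finite_on:
  assumes "loc_finite_on a b \<mu>"
  shows "sigma_finite_measure \<mu>"
proof
  have \<mu>: "sets \<mu> = sets borel" "emeasure \<mu> (- ivl a b) = 0"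
    and fin: "\<And>x y. x \<in> ivl a b \<Longrightarrow> y \<in> ivl a b \<Longrightarrow> emeasure \<mu> {x..y} < \<infinity>"
    using assms by (auto simp: loc_finite_on_def ivl_def)
  have sp: "space \<mu> = UNIV" using \<mu>(1) by (auto dest: sets_eq_imp_space_eq)
  define P where "P = {pq \<in> \<rat> \<times> (\<rat>::real set). fst pq \<in> ivl a b \<and> snd pq \<in> ivl a b}"
  define F where "F = insert (- ivl a b) ((\<lambda>pq. {fst pq..snd pq}) ` P)"
  have "countable P" unfolding P_def by (rule countable_subset[of _ "\<rat> \<times> \<rat>"]) (auto intro: countable_rat)
  then have "countable F" by (simp add: F_def)
  moreover have "F \<subseteq> sets \<mu>" unfolding F_def \<mu>(1) by (auto intro: borel_closed closed_Compl open_ivl)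
  moreover have "x \<in> \<Union> F" for x
  proof (cases "x \<in> ivl a b")
    case True
    obtain lo hi where lh: "lo < x" "x < hi" "lo \<in> ivl a b" "hi \<in> ivl a b" using ivl_nbhd[OF True] by blast
    obtain p where p: "p \<in> \<rat>" "lo < p" "p < x" using Rats_dense_in_real[OF lh(1)] by blast
    obtain q where q: "q \<in> \<rat>" "x < q" "q < hi" using Rats_dense_in_real[OF lh(2)] by blast
    have "p \<in> ivl a b" "q \<in> ivl a b" using ivl_convex[OF lh(3) True] ivl_convex[OF True lh(4)] p q by auto
    then have "(p, q) \<in> P" using p q by (simp add: P_def)
    moreover have "x \<in> {p..q}" using p q by simp
    ultimately show ?thesis unfolding F_def by force
  qed (auto simp: F_def)
  then have "\<Union> F = space \<mu>" using sp by auto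
  moreover have "\<forall>A\<in>F. emeasure \<mu> A \<noteq> \<infinity>"
    using \<mu>(2) fin by (auto simp: F_def P_def less_top[symmetric])
  ultimately show "\<exists>A. countable A \<and> A \<subseteq> sets \<mu> \<and> \<Union> A = space \<mu> \<and> (\<forall>a\<in>A. emeasure \<mu> a \<noteq> \<infinity>)" by blast
qed

section \<open>The Lagrange identity and uniqueness for initial values\<close>

context SL begin

text \<open>The description operator in \<open>qd\<close> has a unique witness because
  \<open>D_unique\<close> fixes the values inside the interval and the definition those
  outside.\<close>

lemma Q_eq:
  assumes D: "D f f1 g" and x: "x \<in> ivl a b"
  shows "Q f x = f1 x"
proof -
  define f1' where "f1' = (\<lambda>x. if x \<in> ivl a b then f1 x else 0)"
  have D': "D f f1' g" by (rule Dtau_rel_cong[OF _ D]) (simp add: f1'_def)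
  have "Q f = f1'"
    unfolding qd_def
  proof (rule the_equality)
    show "(\<exists>g. D f f1' g) \<and> (\<forall>x. x \<notin> ivl a b \<longrightarrow> f1' x = 0)" using D' by (auto simp: f1'_def)
    fix k assume k: "(\<exists>g. D f k g) \<and> (\<forall>x. x \<notin> ivl a b \<longrightarrow> k x = 0)"
    then obtain g' where g': "D f k g'" by blast
    show "k = f1'"
    proof
      fix x show "k x = f1' x"
        using D_unique[OF g' D', of x] k by (cases "x \<in> ivl a b") (auto simp: f1'_def)
    qed
  qed
  then show ?thesis using x by (simp add: f1'_def)
qed

lemma tau_D: "tau_eq a b rp rn s ch f g \<Longrightarrow> D f (Q f) g"
proof -
  assume "tau_eq a b rp rn s ch f g"
  then obtain f1 where D: "D f f1 g" unfolding tau_eq_def by blast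
  show ?thesis by (rule Dtau_rel_cong[OF _ D]) (simp add: Q_eq[OF D])
qed

text \<open>Integration by parts of u, absolutely continuous with respect to \<open>s\<close>,
  against each of the three measures that make up the increments of f1. Because \<open>s\<close> has
  no atoms, no jump terms arise although f1 may jump.\<close>

lemma product_rule:
  assumes l: "a \<le> l" "r \<le> b" and u: "ACloc l r s u u1" and D: "D f f1 g"
    and lh: "lo \<in> ivl l r" "hi \<in> ivl l r" "lo < hi"
  shows "set_integrable s {lo..<hi} (\<lambda>t. u1 t * f1 t)" "set_integrable ch {lo..<hi} (\<lambda>t. u t * f t)"
    "u hi * f1 hi - u lo * f1 lo = lint s (\<lambda>t. u1 t * f1 t) lo hi + lint ch (\<lambda>t. u t * f t) lo hi
       - lint rp (\<lambda>t. u t * g t) lo hi + lint rn (\<lambda>t. u t * g t) lo hi"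
proof -
  have sub: "ivl l r \<subseteq> ivl a b" by (rule ivl_mono[OF l])
  have lh': "lo \<in> ivl a b" "hi \<in> ivl a b" using lh sub by auto
  have ui: "set_integrable s {lo..<hi} u1" using u locint_sub[OF _ _ lh(1,2)] unfolding ACloc_iff by auto
  have inr: "t \<in> ivl l r" if "lo \<le> t" "t \<le> hi" for t using ivl_convex[OF lh(1,2)] that by auto
  have ut: "u t = u lo + lint s u1 lo t" if "lo \<le> t" "t \<le> hi" for t
  proof (cases "t = lo")
    case False
    then show ?thesis using u lh(1) inr[OF that] that unfolding ACloc_iff by (metis order_le_neq_trans)
  qed simp
  define W where "W = (\<lambda>\<mu> h t. lint \<mu> h lo t)"
  have f1t: "f1 t = f1 lo + W ch f t - W rp g t + W rn g t" if "lo \<le> t" "t \<le> hi" for t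
    unfolding W_def by (rule D_jump[OF D lh'(1) _ that(1)]) (use inr[OF that] sub in auto)
  \<comment> \<open>Fubini for \<open>s\<close> and \<mu>, to be used with \<open>ch\<close>,
    \<open>rp\<close> and \<open>rn\<close> in place of \<mu>.\<close>
  have part: "set_integrable s {lo..<hi} (\<lambda>t. u1 t * W \<mu> h t)"
      "set_integrable \<mu> {lo..<hi} (\<lambda>t. u t * h t)"
      "lint \<mu> (\<lambda>t. u t * h t) lo hi = u hi * W \<mu> h hi - lint s (\<lambda>t. u1 t * W \<mu> h t) lo hi"
    if \<mu>: "loc_finite_on a b \<mu>" and h: "locint a b \<mu> h" for \<mu> h
  proof -
    have sm: "sets \<mu> = sets borel" using \<mu> by (simp add: loc_finite_on_def)
    have hi': "set_integrable \<mu> {lo..<hi} h" by (rule locint_sub[OF sm h lh'])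
    note P = lint_by_parts[OF sets_\<mu>(3) fin[OF lf(3) lh'] s_atom sm fin[OF \<mu> lh'] ui hi']
    show p1: "set_integrable s {lo..<hi} (\<lambda>t. u1 t * W \<mu> h t)" unfolding W_def by (rule P(1))
    have c: "u t * h t = u lo * h t + lint s u1 lo t * h t" if "t \<in> {lo..<hi}" for t
      using ut[of t] that by (simp add: distrib_right)
    have i2: "set_integrable \<mu> {lo..<hi} (\<lambda>t. u lo * h t)" using hi' by (rule set_integrable_mult_right)
    show "set_integrable \<mu> {lo..<hi} (\<lambda>t. u t * h t)"
      using set_integral_add(1)[OF i2 P(2)]
        set_integrable_cong_on[of "{lo..<hi}" "\<lambda>t. u t * h t" "\<lambda>t. u lo * h t + lint s u1 lo t * h t" \<mu>] c by blast
    have "lint \<mu> (\<lambda>t. u t * h t) lo hi = lint \<mu> (\<lambda>t. u lo * h t + lint s u1 lo t * h t) lo hi"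
      by (rule lint_cong) (simp add: c)
    also have "\<dots> = u lo * lint \<mu> h lo hi + lint \<mu> (\<lambda>t. lint s u1 lo t * h t) lo hi"
      by (simp add: lint_plus[OF i2 P(2)] lint_cmult)
    also have "\<dots> = u lo * lint \<mu> h lo hi + (lint s u1 lo hi * lint \<mu> h lo hi - lint s (\<lambda>t. u1 t * lint \<mu> h lo t) lo hi)"
      using P(3) by (simp add: algebra_simps)
    also have "\<dots> = (u lo + lint s u1 lo hi) * lint \<mu> h lo hi - lint s (\<lambda>t. u1 t * lint \<mu> h lo t) lo hi"
      by (simp add: algebra_simps)
    also have "u lo + lint s u1 lo hi = u hi" using ut[of hi] lh(3) by simp
    finally show "lint \<mu> (\<lambda>t. u t * h t) lo hi = u hi * W \<mu> h hi - lint s (\<lambda>t. u1 t * W \<mu> h t) lo hi"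
      by (simp add: W_def)
  qed
  note Dl = D_locint[OF D]
  note pc = part[OF lf(4) Dl(1)] and pp = part[OF lf(1) Dl(2)] and pn = part[OF lf(2) Dl(3)]
  show "set_integrable ch {lo..<hi} (\<lambda>t. u t * f t)" by (rule pc(2))
  have c1: "u1 t * f1 t = f1 lo * u1 t + u1 t * W ch f t - u1 t * W rp g t + u1 t * W rn g t" if "t \<in> {lo..<hi}" for t
  proof -
    have ft: "f1 t = f1 lo + W ch f t - W rp g t + W rn g t" using f1t[of t] that by simp
    show ?thesis unfolding ft by (simp add: algebra_simps)
  qed
  have i0: "set_integrable s {lo..<hi} (\<lambda>t. f1 lo * u1 t)" using ui by (rule set_integrable_mult_right)
  note i1 = set_integral_add(1)[OF i0 pc(1)]
  note i2 = set_integral_diff(1)[OF i1 pp(1)]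
  show "set_integrable s {lo..<hi} (\<lambda>t. u1 t * f1 t)"
    using set_integral_add(1)[OF i2 pn(1)] c1
      set_integrable_cong_on[of "{lo..<hi}" "\<lambda>t. u1 t * f1 t" "\<lambda>t. f1 lo * u1 t + u1 t * W ch f t - u1 t * W rp g t + u1 t * W rn g t" s] by blast
  have "lint s (\<lambda>t. u1 t * f1 t) lo hi = lint s (\<lambda>t. f1 lo * u1 t + u1 t * W ch f t - u1 t * W rp g t + u1 t * W rn g t) lo hi"
    by (rule lint_cong) (simp add: c1)
  also have "\<dots> = f1 lo * lint s u1 lo hi + lint s (\<lambda>t. u1 t * W ch f t) lo hi - lint s (\<lambda>t. u1 t * W rp g t) lo hi + lint s (\<lambda>t. u1 t * W rn g t) lo hi"
    by (simp add: lint_plus[OF i2 pn(1)] lint_minus[OF i1 pp(1)] lint_plus[OF i0 pc(1)] lint_cmult)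
  finally have L: "lint s (\<lambda>t. u1 t * f1 t) lo hi = \<dots>" .
  have U: "lint s u1 lo hi = u hi - u lo" using ut[of hi] lh(3) by simp
  have F: "f1 hi = f1 lo + W ch f hi - W rp g hi + W rn g hi" using f1t[of hi] lh(3) by simp
  show "u hi * f1 hi - u lo * f1 lo = lint s (\<lambda>t. u1 t * f1 t) lo hi + lint ch (\<lambda>t. u t * f t) lo hi
       - lint rp (\<lambda>t. u t * g t) lo hi + lint rn (\<lambda>t. u t * g t) lo hi"
    unfolding L U pc(3) pp(3) pn(3) F by (simp add: algebra_simps)
qed

text \<open>In the difference of two product rules the integrals against \<open>rp\<close> and
  \<open>rn\<close> carry the symmetric integrand ft gt and cancel. What remains involves the
  derivatives of ft and gt, which is why the pairing is that of H1 and not an integral against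
  rho.\<close>

lemma lagrange:
  assumes l: "a \<le> l" "r \<le> b" and f: "D f f1 ft" "ACloc l r s ft ft1" and g: "D g g1 gt" "ACloc l r s gt gt1"
    and lh: "lo \<in> ivl l r" "hi \<in> ivl l r" "lo < hi"
  shows "(ft hi * g1 hi - f1 hi * gt hi) - (ft lo * g1 lo - f1 lo * gt lo)
     = lint s (\<lambda>t. ft1 t * g1 t - f1 t * gt1 t) lo hi + lint ch (\<lambda>t. ft t * g t - f t * gt t) lo hi"
proof -
  note p = product_rule[OF l f(2) g(1) lh] and q = product_rule[OF l g(2) f(1) lh]
  have e1: "lint s (\<lambda>t. ft1 t * g1 t - f1 t * gt1 t) lo hi = lint s (\<lambda>t. ft1 t * g1 t) lo hi - lint s (\<lambda>t. gt1 t * f1 t) lo hi"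
    using lint_minus[OF p(1) q(1)] by (simp add: mult.commute)
  have e2: "lint ch (\<lambda>t. ft t * g t - f t * gt t) lo hi = lint ch (\<lambda>t. ft t * g t) lo hi - lint ch (\<lambda>t. gt t * f t) lo hi"
    using lint_minus[OF p(2) q(2)] by (simp add: mult.commute)
  have e3: "lint \<mu> (\<lambda>t. gt t * ft t) lo hi = lint \<mu> (\<lambda>t. ft t * gt t) lo hi" for \<mu>
    by (simp add: mult.commute)
  have "(ft hi * g1 hi - f1 hi * gt hi) - (ft lo * g1 lo - f1 lo * gt lo)
    = (ft hi * g1 hi - ft lo * g1 lo) - (gt hi * f1 hi - gt lo * f1 lo)" by (simp add: algebra_simps)
  then show ?thesis unfolding p(3) q(3) e1 e2 e3 by simp
qed

text \<open>On a short interval around \<open>x\<close> a solution vanishing at one point satisfies \<open>m \<le> m / 2\<close> for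
  \<open>m = sup \<bar>u\<bar>\<close>, since the \<open>s\<close>-measure of short intervals is small.\<close>

lemma ivp_local:
  assumes D: "D u u1 (\<lambda>x. z * u x)" and x: "x \<in> ivl a b"
  shows "\<exists>T. open T \<and> x \<in> T \<and> T \<subseteq> ivl a b \<and> (\<forall>p\<in>T. \<forall>q\<in>T. u p = 0 \<and> u1 p = 0 \<longrightarrow> u q = 0 \<and> u1 q = 0)"
proof -
  obtain lo hi where lh: "lo < x" "x < hi" "lo \<in> ivl a b" "hi \<in> ivl a b" using ivl_nbhd[OF x] by blast
  have inr: "t \<in> ivl a b" if "lo \<le> t" "t \<le> hi" for t using ivl_convex[OF lh(3,4)] that by auto
  \<comment> \<open>N bounds the variation of u1 on the interval per unit of sup |u|.\<close>
  define N where "N = measure ch {lo..hi} + norm z * measure rp {lo..hi} + norm z * measure rn {lo..hi}"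
  have N0: "N \<ge> 0" by (simp add: N_def)
  define S where "S = (\<lambda>t. lint s (\<lambda>_. 1) lo t)"
  have one: "locint a b s (\<lambda>_. 1)" by (rule locint_continuous[OF lf(3)]) auto
  have Sx: "S q - S p = of_real (measure s {p..<q})" if "lo \<le> p" "p \<le> q" "q \<le> hi" for p q
  proof -
    have "S q = S p + lint s (\<lambda>_. 1) p q"
      unfolding S_def using lint_add[OF sets_\<mu>(3) one lh(3) inr inr, of p q] that by simp
    moreover have "lint s (\<lambda>_. 1) p q = of_real (measure s {p..<q})"
      unfolding lint_def using fin'[OF lf(3) inr inr, of p q] that
      by (subst set_integral_const) (auto simp: scaleR_conv_of_real)
    ultimately show ?thesis by simp
  qed
  have "ACloc a b s (\<lambda>t. iint s lo t (\<lambda>_. 1)) (\<lambda>_. 1)"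
    unfolding ACloc_iff
  proof (intro conjI one ballI impI)
    fix p q assume "p \<in> ivl a b" "q \<in> ivl a b" "p < q"
    from iint_diff[OF sets_\<mu>(3) one lh(3) this]
    show "iint s lo q (\<lambda>_. 1) = iint s lo p (\<lambda>_. 1) + lint s (\<lambda>_. 1) p q" by (simp add: algebra_simps)
  qed
  then have Sc: "continuous_on (ivl a b) (\<lambda>t. iint s lo t (\<lambda>_. 1))" by (rule ACs_continuous)
  have SS: "S t = iint s lo t (\<lambda>_. 1)" if "lo \<le> t" for t
    using that by (auto simp: S_def iint_def lint_def set_lebesgue_integral_def)
  \<comment> \<open>Chosen so that on an interval of s-measure at most \<kappa> the bound m N for u1
    becomes the bound m / 2 for u.\<close>
  define \<kappa> where "\<kappa> = 1 / (2 * N + 2)"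
  have \<kappa>: "\<kappa> > 0" "\<kappa> * N \<le> 1/2" using N0 by (auto simp: \<kappa>_def field_simps)
  obtain \<delta> where \<delta>: "\<delta> > 0" "\<And>t. t \<in> ivl a b \<Longrightarrow> dist t x < \<delta> \<Longrightarrow> dist (iint s lo t (\<lambda>_. 1)) (iint s lo x (\<lambda>_. 1)) < \<kappa> / 2"
    using Sc \<kappa>(1) x unfolding continuous_on_iff by (metis half_gt_zero)
  define T where "T = {lo<..<hi} \<inter> ball x \<delta>"
  have Tin: "t \<in> ivl a b \<and> lo < t \<and> t < hi" if "t \<in> T" for t using that inr by (auto simp: T_def)
  have Tcv: "{p..q} \<subseteq> T" if "p \<in> T" "q \<in> T" for p q
    using that by (auto simp: T_def dist_real_def)
  have sm: "measure s {p..<q} \<le> \<kappa>" if "p \<in> T" "q \<in> T" "p \<le> q" for p q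
  proof -
    have "dist (S q) (S p) < \<kappa>"
    proof -
      have "dist (S p) (S x) < \<kappa> / 2" "dist (S q) (S x) < \<kappa> / 2"
        using \<delta>(2)[of p] \<delta>(2)[of q] that Tin[OF that(1)] Tin[OF that(2)] lh(1)
        by (auto simp: SS T_def dist_commute)
      then show ?thesis using dist_triangle2[of "S q" "S p" "S x"] by linarith
    qed
    then show ?thesis using Sx[of p q] Tin[OF that(1)] Tin[OF that(2)] that(3) by (simp add: dist_norm)
  qed
  have AC: "ACloc a b s u u1" using D by (simp add: Dtau_rel_def)
  have uc: "continuous_on (ivl a b) u" by (rule D_cont[OF D])
  have main: "u q = 0 \<and> u1 q = 0" if pq: "p \<in> T" "q \<in> T" and z0: "u p = 0" "u1 p = 0" for p q
  proof -
    define K where "K = {min p q..max p q}"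
    have KT: "K \<subseteq> T" unfolding K_def using Tcv[OF pq] Tcv[OF pq(2,1)] by (auto simp: min_def max_def)
    have "compact K" "K \<noteq> {}" "continuous_on K (\<lambda>t. norm (u t))"
      unfolding K_def using KT Tin by (auto intro!: continuous_intros continuous_on_subset[OF uc] simp: K_def)
    then obtain e where e: "e \<in> K" "\<And>t. t \<in> K \<Longrightarrow> norm (u t) \<le> norm (u e)"
      using continuous_attains_sup[of K "\<lambda>t. norm (u t)"] by blast
    define m where "m = norm (u e)"
    have m0: "m \<ge> 0" by (simp add: m_def)
    have lb: "norm (lint \<mu> (\<lambda>t. c * u t) v w) \<le> norm c * m * measure \<mu> {lo..hi}"
      if \<mu>: "loc_finite_on a b \<mu>" and vw: "v \<in> K" "w \<in> K" for \<mu> c v w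
    proof -
      have vwi: "v \<in> ivl a b" "w \<in> ivl a b" using vw KT Tin by auto
      have sm: "sets \<mu> = sets borel" using \<mu> by (simp add: loc_finite_on_def)
      have "norm (lint \<mu> (\<lambda>t. c * u t) v w) \<le> (norm c * m) * measure \<mu> {v..<w}"
      proof (rule lint_bound[OF sm fin'[OF \<mu> vwi]])
        show "set_integrable \<mu> {v..<w} (\<lambda>t. c * u t)"
          by (rule set_integrable_mult_right[OF locint_sub[OF sm locint_continuous[OF \<mu> uc] vwi]])
        fix t assume "v \<le> t" "t < w"
        then have "t \<in> K" using vw by (auto simp: K_def)
        then show "norm (c * u t) \<le> norm c * m" using e(2) by (auto simp: norm_mult m_def intro: mult_left_mono)
      qed
      also have "\<dots> \<le> (norm c * m) * measure \<mu> {lo..hi}"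
      proof (intro mult_left_mono)
        show "measure \<mu> {v..<w} \<le> measure \<mu> {lo..hi}"
          unfolding measure_def
        proof (rule enn2real_mono)
          have "v \<in> T" "w \<in> T" using vw KT by auto
          then have "{v..<w} \<subseteq> {lo..hi}" using Tin[of v] Tin[of w] by auto
          then show "emeasure \<mu> {v..<w} \<le> emeasure \<mu> {lo..hi}" using sm by (intro emeasure_mono) auto
          show "emeasure \<mu> {lo..hi} < top" using fin[OF \<mu> lh(3,4)] by simp
        qed
      qed (use m0 in auto)
      finally show ?thesis .
    qed
    have lbN: "norm (u1 w - u1 v) \<le> m * N" if "v \<in> K" "w \<in> K" "v \<le> w" for v w
    proof -
      have vwi: "v \<in> ivl a b" "w \<in> ivl a b" using that KT Tin by auto
      have e: "u1 w - u1 v = lint ch (\<lambda>t. 1 * u t) v w - lint rp (\<lambda>t. z * u t) v w + lint rn (\<lambda>t. z * u t) v w"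
        using D_jump[OF D vwi that(3)] by simp
      have "norm (u1 w - u1 v) \<le> norm (lint ch (\<lambda>t. 1 * u t) v w) + norm (lint rp (\<lambda>t. z * u t) v w) + norm (lint rn (\<lambda>t. z * u t) v w)"
        unfolding e by (rule order_trans[OF norm_triangle_ineq add_mono[OF norm_triangle_ineq4 order_refl]])
      also have "\<dots> \<le> norm (1::complex) * m * measure ch {lo..hi} + norm z * m * measure rp {lo..hi} + norm z * m * measure rn {lo..hi}"
        by (intro add_mono lb[OF lf(4) that(1,2)] lb[OF lf(1) that(1,2)] lb[OF lf(2) that(1,2)])
      also have "\<dots> = m * N" by (simp add: N_def algebra_simps)
      finally show ?thesis .
    qed
    have pK: "p \<in> K" and qK: "q \<in> K" by (auto simp: K_def)
    have u1b: "norm (u1 w) \<le> m * N" if "w \<in> K" for w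
      using lbN[OF pK that] lbN[OF that pK] z0(2) by (cases "p \<le> w") (auto simp: norm_minus_commute)
    have seg: "norm (u w - u v) \<le> m / 2" if "v \<in> K" "w \<in> K" "v \<le> w" for v w
    proof (cases "v = w")
      case False
      have vwi: "v \<in> ivl a b" "w \<in> ivl a b" using that KT Tin by auto
      have "u w = u v + lint s u1 v w" using AC vwi that(3) False unfolding ACloc_iff by (metis order_le_neq_trans)
      then have "norm (u w - u v) = norm (lint s u1 v w)" by simp
      also have "\<dots> \<le> (m * N) * measure s {v..<w}"
      proof (rule lint_bound[OF sets_\<mu>(3) fin'[OF lf(3) vwi] locint_sub[OF sets_\<mu>(3) D_locint(4)[OF D] vwi]])
        fix t assume "v \<le> t" "t < w"
        then have "t \<in> K" using that by (auto simp: K_def)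
        then show "norm (u1 t) \<le> m * N" by (rule u1b)
      qed
      also have "\<dots> \<le> (m * N) * \<kappa>"
        using sm[of v w] that KT m0 N0 by (intro mult_left_mono) auto
      also have "\<dots> \<le> m / 2" using mult_left_mono[OF \<kappa>(2) m0] by (simp add: mult_ac)
      finally show ?thesis .
    qed (use m0 in simp)
    have "norm (u e) \<le> m / 2"
      using seg[OF pK e(1)] seg[OF e(1) pK] z0(1) by (cases "p \<le> e") (auto simp: norm_minus_commute)
    then have "m = 0" using m0 by (simp add: m_def)
    then show ?thesis using e(2)[OF qK] u1b[OF qK] by (simp add: m_def)
  qed
  show ?thesis
  proof (intro exI[of _ T] conjI)
    show "open T" "x \<in> T" using lh \<delta>(1) by (auto simp: T_def)
    show "T \<subseteq> ivl a b" using Tin by blast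
  qed (use main in blast)
qed

text \<open>The local statement spreads along the connected interval.\<close>

lemma ivp_unique:
  assumes D: "D u u1 (\<lambda>x. z * u x)" and c: "c \<in> ivl a b" "u c = 0" "u1 c = 0" and x: "x \<in> ivl a b"
  shows "u x = 0 \<and> u1 x = 0"
proof (rule connected_induction_simple[OF connected_ivl c(1) x, where P = "\<lambda>x. u x = 0 \<and> u1 x = 0"])
  fix y assume "y \<in> ivl a b"
  from ivp_local[OF D this] obtain T where T: "open T" "y \<in> T" "T \<subseteq> ivl a b"
    "\<forall>p\<in>T. \<forall>q\<in>T. u p = 0 \<and> u1 p = 0 \<longrightarrow> u q = 0 \<and> u1 q = 0" by (elim exE conjE)
  show "\<exists>T. openin (top_of_set (ivl a b)) T \<and> y \<in> T \<and> (\<forall>x\<in>T. \<forall>y\<in>T. u x = 0 \<and> u1 x = 0 \<longrightarrow> u y = 0 \<and> u1 y = 0)"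
    by (rule exI[of _ T], intro conjI open_subset[OF T(3,1)] T(2,4))
qed (use c in simp)

end

section \<open>Square integrability near the left endpoint\<close>

text \<open>Local integrability gives measurability on compact intervals; countably many of these,
  with rational end points, cover the open one.\<close>

lemma locint_measurable:
  assumes \<mu>: "sets \<mu> = sets borel" and h: "locint l r \<mu> h"
  shows "h \<in> borel_measurable (restrict_space \<mu> (ivl l r))"
proof -
  define C where "C = {{p..q} | p q. p \<in> \<rat> \<and> q \<in> \<rat> \<and> p \<in> ivl l r \<and> q \<in> ivl l r}"
  show ?thesis
  proof (rule measurable_piecewise_restrict)
    have "C \<subseteq> (\<lambda>(p, q). {p..q}) ` (\<rat> \<times> \<rat>)" by (auto simp: C_def)
    then show "countable C" by (rule countable_subset) (auto intro: countable_rat)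
    have I: "ivl l r \<inter> space \<mu> \<in> sets \<mu>" using \<mu> by (simp add: sets_eq_imp_space_eq)
    show "\<Omega> \<inter> space (restrict_space \<mu> (ivl l r)) \<in> sets (restrict_space \<mu> (ivl l r))" if "\<Omega> \<in> C" for \<Omega>
    proof -
      from \<open>\<Omega> \<in> C\<close> obtain p q where "\<Omega> = {p..q}" unfolding C_def by blast
      then have "\<Omega> \<inter> ivl l r \<in> sets \<mu>" using \<mu> by simp
      then show ?thesis unfolding sets_restrict_space_iff[OF I] space_restrict_space sets_eq_imp_space_eq[OF \<mu>] by simp
    qed
    show "space (restrict_space \<mu> (ivl l r)) \<subseteq> \<Union> C"
    proof
      fix x assume "x \<in> space (restrict_space \<mu> (ivl l r))"
      then have x: "x \<in> ivl l r" by (simp add: space_restrict_space)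
      obtain lo hi where lh: "lo < x" "x < hi" "lo \<in> ivl l r" "hi \<in> ivl l r" using ivl_nbhd[OF x] by blast
      obtain p where p: "p \<in> \<rat>" "lo < p" "p < x" using Rats_dense_in_real[OF lh(1)] by blast
      obtain q where q: "q \<in> \<rat>" "x < q" "q < hi" using Rats_dense_in_real[OF lh(2)] by blast
      have "p \<in> ivl l r" "q \<in> ivl l r" using ivl_convex[OF lh(3) x] ivl_convex[OF x lh(4)] p q by auto
      then have "{p..q} \<in> C" using p q by (auto simp: C_def)
      moreover have "x \<in> {p..q}" using p q by simp
      ultimately show "x \<in> \<Union> C" by blast
    qed
    fix \<Omega> assume "\<Omega> \<in> C"
    then obtain p q where pq: "\<Omega> = {p..q}" "p \<in> ivl l r" "q \<in> ivl l r" by (auto simp: C_def)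
    have sub: "ivl l r \<inter> \<Omega> = {p..q}" using ivl_convex[OF pq(2,3)] pq(1) by auto
    have "set_integrable \<mu> {p..q} h" using h pq(2,3) unfolding locint_def ivl_def by simp
    then have "(\<lambda>x. indicator {p..q} x *\<^sub>R h x) \<in> borel_measurable \<mu>" unfolding set_integrable_def by auto
    then have "h \<in> borel_measurable (restrict_space \<mu> {p..q})"
      using \<mu> by (subst borel_measurable_restrict_space_iff) (auto simp: sets_eq_imp_space_eq)
    then show "h \<in> borel_measurable (restrict_space (restrict_space \<mu> (ivl l r)) \<Omega>)"
      using I by (simp add: restrict_restrict_space \<mu> pq(1) sub[unfolded pq(1)] sets_eq_imp_space_eq[OF \<mu>])
  qed
qed

lemma L2_restrict_iff:
  assumes "sets \<mu> = sets borel" "X \<in> sets borel"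
  shows "f \<in> L2 (restrict_space \<mu> X) \<longleftrightarrow> f \<in> borel_measurable (restrict_space \<mu> X) \<and> set_integrable \<mu> X (\<lambda>x. (norm (f x))\<^sup>2)"
  unfolding L2_def set_integrable_def using assms by (subst integrable_restrict_space[symmetric]) auto

lemma L2_restrict_subset:
  assumes \<mu>: "sets \<mu> = sets borel" and X: "X \<in> sets borel" "Y \<in> sets borel" "Y \<subseteq> X" and f: "f \<in> L2 (restrict_space \<mu> X)"
  shows "f \<in> L2 (restrict_space \<mu> Y)"
proof -
  have m: "f \<in> borel_measurable (restrict_space \<mu> X)" and i: "set_integrable \<mu> X (\<lambda>x. (norm (f x))\<^sup>2)"
    using f L2_restrict_iff[OF \<mu> X(1)] by auto
  have "f \<in> borel_measurable (restrict_space \<mu> Y)" by (rule measurable_restrict_mono[OF m X(3)])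
  moreover have "set_integrable \<mu> Y (\<lambda>x. (norm (f x))\<^sup>2)"
    by (rule set_integrable_subset[OF i]) (use X \<mu> in auto)
  ultimately show ?thesis using L2_restrict_iff[OF \<mu> X(2)] by blast
qed

lemma L2_restrict_mult:
  assumes \<mu>: "sets \<mu> = sets borel" and X: "X \<in> sets borel" and f: "f \<in> L2 (restrict_space \<mu> X)" "g \<in> L2 (restrict_space \<mu> X)"
  shows "set_integrable \<mu> X (\<lambda>x. f x * g x)"
  unfolding set_integrable_def
  using L2_mult_integrable[OF f] \<mu> X by (subst integrable_restrict_space[symmetric]) auto

lemma restrict_integral:
  assumes "sets \<mu> = sets borel" "X \<in> sets borel"
  shows "(\<integral>x. h x \<partial>restrict_space \<mu> X) = set_lebesgue_integral \<mu> X (h :: real \<Rightarrow> 'c :: {banach, second_countable_topology})"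
  unfolding set_lebesgue_integral_def using assms by (subst integral_restrict_space) auto

text \<open>The orthogonal sum of two L2 spaces, realised by functions on the disjoint sum, so that
  a pair (f, f1) is a single function and the abstract results apply to it.\<close>

definition L2s :: "real measure \<Rightarrow> real measure \<Rightarrow> (real + real \<Rightarrow> complex) set" where
  "L2s M N = {F. (\<lambda>x. F (Inl x)) \<in> L2 M \<and> (\<lambda>x. F (Inr x)) \<in> L2 N}"

definition ips :: "real measure \<Rightarrow> real measure \<Rightarrow> (real + real \<Rightarrow> complex) \<Rightarrow> (real + real \<Rightarrow> complex) \<Rightarrow> complex" where
  "ips M N F G = ip2 M (\<lambda>x. F (Inl x)) (\<lambda>x. G (Inl x)) + ip2 N (\<lambda>x. F (Inr x)) (\<lambda>x. G (Inr x))"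

interpretation L2s: semi_inner "L2s M N" "ips M N" for M N
proof
  fix f g h :: "real + real \<Rightarrow> complex" and \<alpha> :: complex
  show "(\<lambda>x. f x + \<alpha> * g x) \<in> L2s M N" if "f \<in> L2s M N" "g \<in> L2s M N"
    using that by (auto simp: L2s_def intro: L2_lin)
  show "(\<lambda>x. 0) \<in> L2s M N" by (simp add: L2s_def L2.zero)
  show "ips M N (\<lambda>x. f x + \<alpha> * g x) h = ips M N f h + \<alpha> * ips M N g h" if "f \<in> L2s M N" "g \<in> L2s M N" "h \<in> L2s M N"
    using that by (simp add: L2s_def ips_def L2.ip_lin distrib_left)
  show "ips M N g f = cnj (ips M N f g)" if "f \<in> L2s M N" "g \<in> L2s M N"
    using that L2.ip_cnj[of "\<lambda>x. f (Inl x)" M "\<lambda>x. g (Inl x)"] L2.ip_cnj[of "\<lambda>x. f (Inr x)" N "\<lambda>x. g (Inr x)"]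
    by (simp add: L2s_def ips_def)
  show "Re (ips M N f f) \<ge> 0" if "f \<in> L2s M N"
    using that L2.ip_pos[of "\<lambda>x. f (Inl x)" M] L2.ip_pos[of "\<lambda>x. f (Inr x)" N] by (simp add: L2s_def ips_def)
qed

lemma L2s_nrm2: "L2s.nrm2 M N F = L2.nrm2 M (\<lambda>x. F (Inl x)) + L2.nrm2 N (\<lambda>x. F (Inr x))"
  by (simp add: L2s.nrm2_def L2.nrm2_def ips_def)

section \<open>Square integrable pairs of functions and derivatives\<close>

context SL begin

definition H2 :: "real set \<Rightarrow> (real \<Rightarrow> complex) \<Rightarrow> (real \<Rightarrow> complex) \<Rightarrow> bool" where
  "H2 X f f1 \<longleftrightarrow> f \<in> L2 (restrict_space ch X) \<and> f1 \<in> L2 (restrict_space s X)"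

text \<open>Bilinear, without conjugation, to match the Lagrange identity; the conjugates are put
  back in \<open>ipH_ips\<close>.\<close>

definition ipH :: "real set \<Rightarrow> (real \<Rightarrow> complex) \<Rightarrow> (real \<Rightarrow> complex) \<Rightarrow> (real \<Rightarrow> complex) \<Rightarrow> (real \<Rightarrow> complex) \<Rightarrow> complex" where
  "ipH X f f1 g g1 = set_lebesgue_integral ch X (\<lambda>x. f x * g x) + set_lebesgue_integral s X (\<lambda>x. f1 x * g1 x)"

definition nH :: "real set \<Rightarrow> (real \<Rightarrow> complex) \<Rightarrow> (real \<Rightarrow> complex) \<Rightarrow> real" where
  "nH X f f1 = set_lebesgue_integral ch X (\<lambda>x. (norm (f x))\<^sup>2) + set_lebesgue_integral s X (\<lambda>x. (norm (f1 x))\<^sup>2)"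

lemma H2_L2s: "H2 X f f1 \<longleftrightarrow> case_sum f f1 \<in> L2s (restrict_space ch X) (restrict_space s X)"
  by (simp add: H2_def L2s_def)

lemma nH_nrm2: "X \<in> sets borel \<Longrightarrow> L2s.nrm2 (restrict_space ch X) (restrict_space s X) (case_sum f f1) = nH X f f1"
  by (simp add: L2s_nrm2 L2_nrm2 nH_def restrict_integral)

lemma ipH_ips: "X \<in> sets borel \<Longrightarrow>
  ips (restrict_space ch X) (restrict_space s X) (case_sum f f1) (case_sum g g1) = ipH X f f1 (\<lambda>x. cnj (g x)) (\<lambda>x. cnj (g1 x))"
  by (simp add: ips_def ip2_def ipH_def restrict_integral)

lemma H2_subset: "X \<in> sets borel \<Longrightarrow> Y \<in> sets borel \<Longrightarrow> Y \<subseteq> X \<Longrightarrow> H2 X f f1 \<Longrightarrow> H2 Y f f1"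
  unfolding H2_def by (intro conjI L2_restrict_subset[of _ X Y]) auto

lemma H2_cnj: "H2 X f f1 \<Longrightarrow> H2 X (\<lambda>x. cnj (f x)) (\<lambda>x. cnj (f1 x))"
  unfolding H2_def using L2_cnj by blast

lemma H2_scale: "H2 X f f1 \<Longrightarrow> H2 X (\<lambda>x. z * f x) (\<lambda>x. w * f1 x)"
  unfolding H2_def using L2.scale by blast

lemma H2_mult:
  assumes "X \<in> sets borel" "H2 X f f1" "H2 X g g1"
  shows "set_integrable ch X (\<lambda>x. f x * g x)" "set_integrable s X (\<lambda>x. f1 x * g1 x)"
  using assms L2_restrict_mult[of ch X f g] L2_restrict_mult[of s X f1 g1] by (auto simp: H2_def)

lemma H2_sq:
  assumes "X \<in> sets borel" "H2 X f f1"
  shows "set_integrable ch X (\<lambda>x. (norm (f x))\<^sup>2)" "set_integrable s X (\<lambda>x. (norm (f1 x))\<^sup>2)"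
  using assms L2_restrict_iff[of ch X f] L2_restrict_iff[of s X f1] by (auto simp: H2_def)

lemma nH_ge_0: "nH X f f1 \<ge> 0"
  unfolding nH_def set_lebesgue_integral_def by (intro add_nonneg_nonneg integral_nonneg_AE) auto

lemma nH_cnj: "nH X (\<lambda>x. cnj (f x)) (\<lambda>x. cnj (f1 x)) = nH X f f1"
  by (simp add: nH_def)

lemma ipH_bound:
  assumes "X \<in> sets borel" "H2 X f f1" "H2 X g g1"
  shows "norm (ipH X f f1 g g1) \<le> sqrt (nH X f f1) * sqrt (nH X g g1)"
proof -
  have g: "H2 X (\<lambda>x. cnj (g x)) (\<lambda>x. cnj (g1 x))" by (rule H2_cnj[OF assms(3)])
  from L2s.CS[OF assms(2)[unfolded H2_L2s] g[unfolded H2_L2s]]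
  show ?thesis unfolding L2s.nrm_def nH_nrm2[OF assms(1)] ipH_ips[OF assms(1)] nH_cnj by simp
qed

lemma H2_measurable:
  assumes "ACloc l r s f f1"
  shows "f \<in> borel_measurable (restrict_space ch (ivl l r))" "f1 \<in> borel_measurable (restrict_space s (ivl l r))"
proof -
  have "f \<in> borel_measurable (restrict_space borel (ivl l r))"
    by (rule borel_measurable_continuous_on_restrict[OF ACs_continuous[OF assms]])
  then show "f \<in> borel_measurable (restrict_space ch (ivl l r))"
    using measurable_cong_sets[OF sets_restrict_space_cong[OF sets_\<mu>(4)] refl] by blast
  have "locint l r s f1" using assms unfolding ACloc_iff by blast
  then show "f1 \<in> borel_measurable (restrict_space s (ivl l r))" by (rule locint_measurable[OF sets_\<mu>(3)])
qed

lemma H1rel_iff: "H1rel l r s ch f f1 \<longleftrightarrow> ACloc l r s f f1 \<and> H2 (ivl l r) f f1"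
  unfolding H1rel_def H2_def using H2_measurable[of l r f f1] L2_restrict_iff[of ch "ivl l r" f] L2_restrict_iff[of s "ivl l r" f1] by auto

text \<open>\<open>H1\<close> asks for some derivative of finite norm. The given f1 agrees with it
  almost everywhere with respect to \<open>s\<close>, so square integrability passes over.\<close>

lemma H1_H2:
  assumes f: "ACloc l r s f f1" and h: "H1 l r s ch f"
  shows "H2 (ivl l r) f f1"
proof -
  obtain k where k: "ACloc l r s f k" "H2 (ivl l r) f k" using h unfolding H1_def H1rel_iff by blast
  have "AE x in s. x \<in> ivl l r \<longrightarrow> f1 x = k x"
    by (rule ACloc_unique_AE[OF sigma_finite_if_loc_finite_on[OF lf(3)] sets_\<mu>(3) f k(1)])
  then have ae: "AE x in restrict_space s (ivl l r). f1 x = k x" by (subst AE_restrict_space_iff) auto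
  have m: "f1 \<in> borel_measurable (restrict_space s (ivl l r))" "k \<in> borel_measurable (restrict_space s (ivl l r))"
    using H2_measurable(2)[OF f] H2_measurable(2)[OF k(1)] by auto
  have "integrable (restrict_space s (ivl l r)) (\<lambda>x. (norm (f1 x))\<^sup>2)"
  proof (rule integrable_cong_AE_imp)
    show "integrable (restrict_space s (ivl l r)) (\<lambda>x. (norm (k x))\<^sup>2)" using k(2) by (simp add: H2_def L2_def)
    show "AE x in restrict_space s (ivl l r). (norm (k x))\<^sup>2 = (norm (f1 x))\<^sup>2" using ae by eventually_elim simp
  qed (use m in measurable)
  then show ?thesis using k(2) m(1) by (simp add: H2_def L2_def)
qed

text \<open>f1 may jump, so the bound cannot come from continuity on a compact set; it comes from
  integrating absolute values in the jump formula.\<close>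

lemma D_bounded:
  assumes D: "D f f1 g" and lh: "lo \<in> ivl a b" "hi \<in> ivl a b"
  shows "\<exists>B. \<forall>t. lo \<le> t \<and> t < hi \<longrightarrow> norm (f1 t) \<le> B"
proof -
  have lb: "norm (lint \<mu> h lo t) \<le> set_lebesgue_integral \<mu> {lo..<hi} (\<lambda>x. norm (h x))"
    if \<mu>: "sets \<mu> = sets borel" and h: "locint a b \<mu> h" and t: "lo \<le> t" "t < hi" for \<mu> h t
  proof -
    have ti: "t \<in> ivl a b" using ivl_convex[OF lh] t by auto
    have i: "set_integrable \<mu> {lo..<hi} h" "set_integrable \<mu> {lo..<t} h"
      using locint_sub[OF \<mu> h lh] locint_sub[OF \<mu> h lh(1) ti] by auto
    have "norm (lint \<mu> h lo t) \<le> set_lebesgue_integral \<mu> {lo..<t} (\<lambda>x. norm (h x))"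
      unfolding lint_def by (rule set_integral_norm_bound[OF i(2)])
    also have "\<dots> \<le> set_lebesgue_integral \<mu> {lo..<hi} (\<lambda>x. norm (h x))"
      unfolding set_lebesgue_integral_def using set_integrable_norm[OF i(1)] set_integrable_norm[OF i(2)] t
      by (intro integral_mono) (auto simp: set_integrable_def indicator_def)
    finally show ?thesis .
  qed
  define B where "B = norm (f1 lo) + set_lebesgue_integral ch {lo..<hi} (\<lambda>x. norm (f x))
    + set_lebesgue_integral rp {lo..<hi} (\<lambda>x. norm (g x)) + set_lebesgue_integral rn {lo..<hi} (\<lambda>x. norm (g x))"
  have "norm (f1 t) \<le> B" if t: "lo \<le> t" "t < hi" for t
  proof -
    have ti: "t \<in> ivl a b" using ivl_convex[OF lh] t by auto
    have "norm (f1 t) \<le> norm (f1 lo) + norm (lint ch f lo t) + norm (lint rp g lo t) + norm (lint rn g lo t)"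
      unfolding D_jump[OF D lh(1) ti t(1)]
      by (rule order_trans[OF norm_triangle_ineq add_mono[OF order_trans[OF norm_triangle_ineq4 add_mono[OF norm_triangle_ineq order_refl]] order_refl]])
    also have "\<dots> \<le> B"
      unfolding B_def by (intro add_mono order_refl lb D_locint[OF D] sets_\<mu> t)
    finally show ?thesis .
  qed
  then show ?thesis by blast
qed

lemma H2_Ico:
  assumes D: "D f f1 g" and lh: "lo \<in> ivl a b" "hi \<in> ivl a b"
  shows "H2 {lo..<hi} f f1"
proof -
  have sub: "{lo..<hi} \<subseteq> ivl a b" "{lo..hi} \<subseteq> ivl a b" using ivl_convex[OF lh] by auto
  have AC: "ACloc a b s f f1" using D by (simp add: Dtau_rel_def)
  have m: "f \<in> borel_measurable (restrict_space ch {lo..<hi})" "f1 \<in> borel_measurable (restrict_space s {lo..<hi})"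
    using H2_measurable[OF AC] measurable_restrict_mono sub(1) by blast+
  have "bounded (f ` {lo..hi})"
    by (intro compact_imp_bounded compact_continuous_image continuous_on_subset[OF D_cont[OF D] sub(2)]) auto
  then obtain B0 where B0: "\<forall>t\<in>{lo..hi}. norm (f t) \<le> B0" unfolding bounded_iff by auto
  from D_bounded[OF D lh] obtain B1 where B1: "\<forall>t. lo \<le> t \<and> t < hi \<longrightarrow> norm (f1 t) \<le> B1" by blast
  have main: "h \<in> L2 (restrict_space \<mu> {lo..<hi})"
    if \<mu>: "loc_finite_on a b \<mu>" and h: "h \<in> borel_measurable (restrict_space \<mu> {lo..<hi})" "\<And>t. lo \<le> t \<Longrightarrow> t < hi \<Longrightarrow> norm (h t) \<le> B" for \<mu> h B
  proof (rule L2_bound[OF h(1)])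
    have sm: "sets \<mu> = sets borel" using \<mu> by (simp add: loc_finite_on_def)
    have "emeasure (restrict_space \<mu> {lo..<hi}) {lo..<hi} \<noteq> \<infinity>"
      using fin'[OF \<mu> lh] sm by (subst emeasure_restrict_space) (auto simp: sets_eq_imp_space_eq[OF sm])
    then have "finite_measure (restrict_space \<mu> {lo..<hi})"
      by (intro finite_measureI) (simp add: space_restrict_space sets_eq_imp_space_eq[OF sm])
    then show "integrable (restrict_space \<mu> {lo..<hi}) (\<lambda>_. B\<^sup>2)" by (rule finite_measure.integrable_const)
    fix x assume "x \<in> space (restrict_space \<mu> {lo..<hi})"
    then have "norm (h x) \<le> B" using h(2) by (simp add: space_restrict_space)
    then show "(norm (h x))\<^sup>2 \<le> B\<^sup>2" by (rule power_mono) simp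
  qed
  show ?thesis unfolding H2_def
    by (intro conjI main[OF lf(4) m(1), of B0] main[OF lf(3) m(2), of B1]) (use B0 B1 in auto)
qed

text \<open>Between d and c both f and f1 are bounded and the measures finite, so square
  integrability near a reaches any c inside the interval.\<close>

lemma H2_extend:
  assumes D: "D f f1 g" and d: "a < ereal d" "ereal d < b" and c: "a < ereal c" "ereal c < b" and h: "H2 (ivl a (ereal d)) f f1"
  shows "H2 (ivl a (ereal c)) f f1"
proof (cases "c \<le> d")
  case True
  then show ?thesis using H2_subset[OF _ _ _ h, of "ivl a (ereal c)"] ivl_mono[of a a "ereal c" "ereal d"] by simp
next
  case False
  then have di: "d \<in> ivl a (ereal c)" using d by (simp add: ivl_def)
  have AC: "ACloc a (ereal c) s f f1" using D c by (auto simp: Dtau_rel_def intro: ACloc_mono)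
  have k: "H2 {d..<c} f f1" using d c by (intro H2_Ico[OF D]) (auto simp: ivl_def)
  show ?thesis
    unfolding H2_def L2_restrict_iff[OF sets_\<mu>(3) ivl_sets] L2_restrict_iff[OF sets_\<mu>(4) ivl_sets]
  proof (intro conjI H2_measurable[OF AC])
    show "set_integrable ch (ivl a (ereal c)) (\<lambda>x. (norm (f x))\<^sup>2)"
      unfolding ivl_split(1)[OF di] by (intro set_integrable_Un H2_sq(1)[OF _ h] H2_sq(1)[OF _ k]) auto
    show "set_integrable s (ivl a (ereal c)) (\<lambda>x. (norm (f1 x))\<^sup>2)"
      unfolding ivl_split(1)[OF di] by (intro set_integrable_Un H2_sq(2)[OF _ h] H2_sq(2)[OF _ k]) auto
  qed
qed

lemma H2_near_a:
  assumes D: "D f f1 g" and d: "a < d" "d < b" "H1 a d s ch f" and c: "a < ereal c" "ereal c < b"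
  shows "H2 (ivl a (ereal c)) f f1"
proof -
  obtain d' where d': "d = ereal d'" using d by (cases d) auto
  have "ACloc a d s f f1" using D d by (auto simp: Dtau_rel_def intro: ACloc_mono)
  from H1_H2[OF this d(3)] show ?thesis using H2_extend[OF D _ _ c, of d'] d d' by simp
qed

section \<open>Boundary values of Wronskians\<close>

text \<open>The bracket V(f, g) with the quasi-derivatives as explicit arguments; f and g themselves
  do not occur in it.\<close>

definition Wr :: "(real \<Rightarrow> complex) \<Rightarrow> (real \<Rightarrow> complex) \<Rightarrow> (real \<Rightarrow> complex) \<Rightarrow> (real \<Rightarrow> complex) \<Rightarrow> real \<Rightarrow> complex" where
  "Wr f1 ft g1 gt x = ft x * g1 x - f1 x * gt x"

definition Tpair :: "real \<Rightarrow> (real \<Rightarrow> complex) \<Rightarrow> (real \<Rightarrow> complex) \<Rightarrow> (real \<Rightarrow> complex) \<Rightarrow> (real \<Rightarrow> complex) \<Rightarrow> bool" where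
  "Tpair c f f1 ft ft1 \<longleftrightarrow> D f f1 ft \<and> ACloc a b s ft ft1 \<and> H2 (ivl a (ereal c)) f f1 \<and> H2 (ivl a (ereal c)) ft ft1"

lemma Tpair_cnj: "Tpair c f f1 ft ft1 \<Longrightarrow> Tpair c (\<lambda>x. cnj (f x)) (\<lambda>x. cnj (f1 x)) (\<lambda>x. cnj (ft x)) (\<lambda>x. cnj (ft1 x))"
  unfolding Tpair_def using Dtau_rel_cnj ACloc_cnj H2_cnj by blast

lemma Tpair_solution:
  assumes D: "D u u1 (\<lambda>x. z * u x)" and h: "H2 (ivl a (ereal c)) u u1"
  shows "Tpair c u u1 (\<lambda>x. z * u x) (\<lambda>x. z * u1 x)"
proof -
  have AC: "ACloc a b s u u1" using D by (simp add: Dtau_rel_def)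
  have "ACloc a b s (\<lambda>x. 0 + z * u x) (\<lambda>x. 0 + z * u1 x)"
    by (rule ACloc_lin[OF _ ACloc_zero AC]) simp
  then show ?thesis using D H2_scale[OF h] h by (simp add: Tpair_def)
qed

lemma Tpair_Tmax:
  assumes p: "p \<in> Tmax a b rp rn s ch" and c: "a < ereal c" "ereal c < b"
  shows "\<exists>ft1. Tpair c (fst p) (Q (fst p)) (snd p) ft1"
proof -
  obtain f ft where pe: "p = (f, ft)" by (cases p)
  have t: "tau_eq a b rp rn s ch f ft" "H1 a b s ch f" "H1 a b s ch ft" using p by (auto simp: Tmax_def pe)
  have D: "D f (Q f) ft" by (rule tau_D[OF t(1)])
  have AC: "ACloc a b s f (Q f)" using D by (simp add: Dtau_rel_def)
  obtain ft1 where ft1: "ACloc a b s ft ft1" "H2 (ivl a b) ft ft1" using t(3) unfolding H1_def H1rel_iff by blast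
  have sub: "ivl a (ereal c) \<subseteq> ivl a b" using c by (intro ivl_mono) auto
  show ?thesis
    unfolding pe fst_conv snd_conv Tpair_def
    by (intro exI[of _ ft1] conjI D ft1(1) H2_subset[OF _ _ sub H1_H2[OF AC t(2)]] H2_subset[OF _ _ sub ft1(2)]) auto
qed

text \<open>By Lagrange the bracket differs from its value at c by integrals of products of square
  integrable functions, and these converge as the lower end tends to a.\<close>

lemma Wr_tendsto:
  assumes c: "a < ereal c" "ereal c < b" and f: "Tpair c f f1 ft ft1" and g: "Tpair c g g1 gt gt1"
  shows "(Wr f1 ft g1 gt \<longlongrightarrow> Wr f1 ft g1 gt c
     - (ipH (ivl a (ereal c)) ft ft1 g g1 - ipH (ivl a (ereal c)) f f1 gt gt1)) (at_a a)"
proof -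
  let ?I = "ivl a (ereal c)"
  have h: "H2 ?I f f1" "H2 ?I ft ft1" "H2 ?I g g1" "H2 ?I gt gt1" using f g by (auto simp: Tpair_def)
  define j where "j = (\<lambda>t. ft1 t * g1 t - f1 t * gt1 t)"
  define k where "k = (\<lambda>t. ft t * g t - f t * gt t)"
  have I: "?I \<in> sets borel" by simp
  note m1 = H2_mult[OF I h(2,3)] and m2 = H2_mult[OF I h(1,4)]
  have ij: "set_integrable s ?I j" unfolding j_def by (rule set_integral_diff(1)[OF m1(2) m2(2)])
  have ik: "set_integrable ch ?I k" unfolding k_def by (rule set_integral_diff(1)[OF m1(1) m2(1)])
  have eq: "set_lebesgue_integral s ?I j + set_lebesgue_integral ch ?I k = ipH ?I ft ft1 g g1 - ipH ?I f f1 gt gt1"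
    unfolding j_def k_def set_integral_diff(2)[OF m1(2) m2(2)] set_integral_diff(2)[OF m1(1) m2(1)] ipH_def by simp
  have lim: "((\<lambda>x. Wr f1 ft g1 gt c - (lint s j x c + lint ch k x c)) \<longlongrightarrow>
    Wr f1 ft g1 gt c - (set_lebesgue_integral s ?I j + set_lebesgue_integral ch ?I k)) (at_a a)"
    by (intro tendsto_intros lint_tendsto_at_a c ij ik sets_\<mu>)
  have ev: "\<forall>\<^sub>F x in at_a a. Wr f1 ft g1 gt c - (lint s j x c + lint ch k x c) = Wr f1 ft g1 gt x"
    using eventually_at_a[OF c(1)]
  proof (rule eventually_mono)
    fix x assume x: "x \<in> ?I"
    have xc: "x < c" "x \<in> ivl a b" "c \<in> ivl a b" using x c ivl_less[OF x c(2)] by (auto simp: ivl_def)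
    have "Wr f1 ft g1 gt c - Wr f1 ft g1 gt x = lint s j x c + lint ch k x c"
      unfolding Wr_def j_def k_def using f g
      by (intro lagrange[OF order_refl order_refl _ _ _ _ xc(2,3,1)]) (auto simp: Tpair_def)
    then show "Wr f1 ft g1 gt c - (lint s j x c + lint ch k x c) = Wr f1 ft g1 gt x" by (simp add: algebra_simps)
  qed
  show ?thesis using Lim_transform_eventually[OF lim ev] unfolding eq .
qed

lemma Vw_tendsto_iff:
  assumes c: "a < ereal c" "ereal c < b" and f: "D (fst p) f1 ft" and g: "D (fst q) g1 gt"
  shows "(Vw a b rp rn s ch p q \<longlongrightarrow> L) (at_a a) \<longleftrightarrow> (Wr f1 (snd p) g1 (snd q) \<longlongrightarrow> L) (at_a a)"
proof (rule tendsto_cong)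
  show "\<forall>\<^sub>F x in at_a a. Vw a b rp rn s ch p q x = Wr f1 (snd p) g1 (snd q) x"
    using eventually_at_a[OF c(1)]
  proof (rule eventually_mono)
    fix x assume "x \<in> ivl a (ereal c)"
    then have x: "x \<in> ivl a b" using c(2) by (rule ivl_less)
    show "Vw a b rp rn s ch p q x = Wr f1 (snd p) g1 (snd q) x"
      by (simp add: Vw_def Wr_def Q_eq[OF f x] Q_eq[OF g x])
  qed
qed

lemma Wr_Va:
  assumes c: "a < ereal c" "ereal c < b" and f: "Tpair c (fst p) f1 (snd p) ft1" and g: "Tpair c (fst q) g1 (snd q) gt1"
  shows "(Wr f1 (snd p) g1 (snd q) \<longlongrightarrow> Va a b rp rn s ch p q) (at_a a)"
proof -
  have D: "D (fst p) f1 (snd p)" "D (fst q) g1 (snd q)" using f g by (auto simp: Tpair_def)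
  note t = Wr_tendsto[OF c f g]
  have "Va a b rp rn s ch p q = Wr f1 (snd p) g1 (snd q) c
     - (ipH (ivl a (ereal c)) (snd p) ft1 (fst q) g1 - ipH (ivl a (ereal c)) (fst p) f1 (snd q) gt1)"
    unfolding Va_def by (rule tendsto_Lim[OF at_a_nontrivial[OF c(1)]]) (use Vw_tendsto_iff[OF c D] t in blast)
  then show ?thesis using t by simp
qed

text \<open>In the limit circle case the boundary values span a two-dimensional space, so the condition
  \<open>V(\<cdot>, v\<^sup>*)(a) = 0\<close> cuts out a line; this is the Pluecker relation.\<close>

lemma limit_circle_zero:
  assumes c: "a < ereal c" "ereal c < b"
    and f: "Tpair c f f1 ft ft1" and g: "Tpair c g g1 gt gt1"
    and v: "v \<in> Tmax a b rp rn s ch" "h \<in> Tmax a b rp rn s ch" "Va a b rp rn s ch h (cpair v) \<noteq> 0"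
    and fv: "Va a b rp rn s ch (f, ft) (cpair v) = 0" and gv: "Va a b rp rn s ch (g, gt) (cpair v) = 0"
  shows "(Wr f1 ft g1 gt \<longlongrightarrow> 0) (at_a a)"
proof -
  obtain v2 where v2: "Tpair c (fst v) (Q (fst v)) (snd v) v2" using Tpair_Tmax[OF v(1) c] by blast
  obtain h2 where h2: "Tpair c (fst h) (Q (fst h)) (snd h) h2" using Tpair_Tmax[OF v(2) c] by blast
  define v1 where "v1 = (\<lambda>x. cnj (Q (fst v) x))"
  define vt where "vt = (\<lambda>x. cnj (snd v x))"
  have cv: "Tpair c (fst (cpair v)) v1 (snd (cpair v)) (\<lambda>x. cnj (v2 x))" "snd (cpair v) = vt"
    using Tpair_cnj[OF v2] by (simp_all add: cpair_def v1_def vt_def)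
  define h1 where "h1 = Q (fst h)"
  define ht where "ht = snd h"
  have hv: "(Wr h1 ht v1 vt \<longlongrightarrow> Va a b rp rn s ch h (cpair v)) (at_a a)"
    using Wr_Va[OF c h2 cv(1)] by (simp add: cv(2) h1_def ht_def)
  have fv': "(Wr f1 ft v1 vt \<longlongrightarrow> 0) (at_a a)" using Wr_Va[OF c _ cv(1), of "(f, ft)" f1 ft1] f fv by (simp add: cv(2))
  have gv': "(Wr g1 gt v1 vt \<longlongrightarrow> 0) (at_a a)" using Wr_Va[OF c _ cv(1), of "(g, gt)" g1 gt1] g gv by (simp add: cv(2))
  have h2': "Tpair c (fst h) h1 ht h2" using h2 by (simp add: h1_def ht_def)
  note gh = Wr_tendsto[OF c g h2'] and fh = Wr_tendsto[OF c f h2'] and fg = Wr_tendsto[OF c f g]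
  \<comment> \<open>The relation [f,g] [h,v] = [f,h] [g,v] - [f,v] [g,h] between 2 by 2
    determinants, solved for [f,g].\<close>
  have pl: "Wr f1 ft g1 gt x = (Wr f1 ft h1 ht x * Wr g1 gt v1 vt x - Wr f1 ft v1 vt x * Wr g1 gt h1 ht x) / Wr h1 ht v1 vt x"
    if "Wr h1 ht v1 vt x \<noteq> 0" for x
    using that by (simp add: divide_simps) (simp add: Wr_def algebra_simps)
  have ev: "\<forall>\<^sub>F x in at_a a. (Wr f1 ft h1 ht x * Wr g1 gt v1 vt x - Wr f1 ft v1 vt x * Wr g1 gt h1 ht x) / Wr h1 ht v1 vt x = Wr f1 ft g1 gt x"
    using tendsto_imp_eventually_ne[OF hv v(3)] by eventually_elim (simp add: pl)
  have "((\<lambda>x. (Wr f1 ft h1 ht x * Wr g1 gt v1 vt x - Wr f1 ft v1 vt x * Wr g1 gt h1 ht x) / Wr h1 ht v1 vt x) \<longlongrightarrow>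
     ((Wr f1 ft h1 ht c - (ipH (ivl a (ereal c)) ft ft1 (fst h) h1 - ipH (ivl a (ereal c)) f f1 ht h2)) * 0
      - 0 * (Wr g1 gt h1 ht c - (ipH (ivl a (ereal c)) gt gt1 (fst h) h1 - ipH (ivl a (ereal c)) g g1 ht h2))) / Va a b rp rn s ch h (cpair v)) (at_a a)"
    by (intro tendsto_divide tendsto_diff tendsto_mult fh gh fv' gv' hv v(3))
  then have "((\<lambda>x. (Wr f1 ft h1 ht x * Wr g1 gt v1 vt x - Wr f1 ft v1 vt x * Wr g1 gt h1 ht x) / Wr h1 ht v1 vt x) \<longlongrightarrow> 0) (at_a a)"
    by simp
  from Lim_transform_eventually[OF this ev] show ?thesis .
qed

lemma nH_mono:
  assumes X: "X \<in> sets borel" "Y \<in> sets borel" "Y \<subseteq> X" and h: "H2 X f f1"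
  shows "nH Y f f1 \<le> nH X f f1"
proof -
  have "set_lebesgue_integral \<mu> Y (\<lambda>x. (norm (k x))\<^sup>2) \<le> set_lebesgue_integral \<mu> X (\<lambda>x. (norm (k x))\<^sup>2)"
    if "sets \<mu> = sets borel" "set_integrable \<mu> X (\<lambda>x. (norm (k x))\<^sup>2)" for \<mu> and k :: "real \<Rightarrow> complex"
  proof -
    have "set_integrable \<mu> Y (\<lambda>x. (norm (k x))\<^sup>2)" by (rule set_integrable_subset[OF that(2)]) (use X that in auto)
    then show ?thesis unfolding set_lebesgue_integral_def using that(2) X(3)
      by (intro integral_mono) (auto simp: set_integrable_def indicator_def)
  qed
  then show ?thesis unfolding nH_def using H2_sq[OF X(1) h] by (intro add_mono) auto
qed

lemma nH_tail:
  assumes d: "a < ereal d" and h: "H2 (ivl a (ereal d)) f f1" and e: "\<epsilon> > 0"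
  shows "\<exists>x0\<in>ivl a (ereal d). nH (ivl a (ereal x0)) f f1 < \<epsilon>"
proof -
  have I: "ivl a (ereal d) \<in> sets borel" by simp
  have e2: "\<epsilon> / 2 > 0" using e by simp
  obtain x1 where x1: "x1 \<in> ivl a (ereal d)" "\<forall>X\<in>sets borel. X \<subseteq> ivl a (ereal x1) \<longrightarrow> set_lebesgue_integral ch X (\<lambda>t. norm ((norm (f t))\<^sup>2)) < \<epsilon> / 2"
    using ivl_tail[OF sets_\<mu>(4) d H2_sq(1)[OF I h] e2] by blast
  obtain x2 where x2: "x2 \<in> ivl a (ereal d)" "\<forall>X\<in>sets borel. X \<subseteq> ivl a (ereal x2) \<longrightarrow> set_lebesgue_integral s X (\<lambda>t. norm ((norm (f1 t))\<^sup>2)) < \<epsilon> / 2"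
    using ivl_tail[OF sets_\<mu>(3) d H2_sq(2)[OF I h] e2] by blast
  define x0 where "x0 = min x1 x2"
  have "x0 \<in> ivl a (ereal d)" using x1(1) x2(1) by (auto simp: x0_def min_def)
  moreover have "ivl a (ereal x0) \<subseteq> ivl a (ereal x1)" "ivl a (ereal x0) \<subseteq> ivl a (ereal x2)"
    by (rule ivl_mono; simp add: x0_def)+
  then have "nH (ivl a (ereal x0)) f f1 < \<epsilon>"
    unfolding nH_def using x1(2)[rule_format, of "ivl a (ereal x0)"] x2(2)[rule_format, of "ivl a (ereal x0)"] by simp
  ultimately show ?thesis by blast
qed

text \<open>Fatou's lemma along half-open intervals that exhaust (a, d).\<close>

lemma H2_if_bounded:
  assumes d: "a < ereal d" "ereal d < b" and D: "D u u1 g" and B: "\<And>x. x \<in> ivl a (ereal d) \<Longrightarrow> nH {x..<d} u u1 \<le> B"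
  shows "H2 (ivl a (ereal d)) u u1"
proof -
  have AC: "ACloc a (ereal d) s u u1" using D d by (auto simp: Dtau_rel_def intro: ACloc_mono)
  from ivl_exhaust[OF d(1)] obtain lo :: "nat \<Rightarrow> real" where lo: "\<And>n. lo n \<in> ivl a (ereal d)"
    "\<And>t. a < ereal t \<Longrightarrow> \<forall>\<^sub>F n in sequentially. lo n < t" by blast
  have hx: "H2 {x..<d} u u1" if "x \<in> ivl a (ereal d)" for x
    using ivl_less[OF that d(2)] d by (intro H2_Ico[OF D]) (auto simp: ivl_def)
  have main: "k \<in> L2 (restrict_space \<mu> (ivl a (ereal d)))"
    if \<mu>: "sets \<mu> = sets borel" and k: "k \<in> borel_measurable (restrict_space \<mu> (ivl a (ereal d)))"
      and i: "\<And>n. set_integrable \<mu> {lo n..<d} (\<lambda>x. (norm (k x))\<^sup>2)"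
      and le: "\<And>n. set_lebesgue_integral \<mu> {lo n..<d} (\<lambda>x. (norm (k x))\<^sup>2) \<le> B" for \<mu> and k :: "real \<Rightarrow> complex"
  proof -
    have sp: "space \<mu> = UNIV" using \<mu> by (auto dest: sets_eq_imp_space_eq)
    define K where "K = (\<lambda>x. indicator (ivl a (ereal d)) x *\<^sub>R (norm (k x))\<^sup>2)"
    have "(\<lambda>x. (norm (k x))\<^sup>2) \<in> borel_measurable (restrict_space \<mu> (ivl a (ereal d)))" using k by measurable
    then have [measurable]: "K \<in> borel_measurable \<mu>"
      unfolding K_def using \<mu> sp by (subst (asm) borel_measurable_restrict_space_iff) auto
    have Kn: "indicator {lo n..<d} x *\<^sub>R K x = indicator {lo n..<d} x *\<^sub>R (norm (k x))\<^sup>2" for n x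
      using lo(1)[of n] less_le_trans[of a "ereal (lo n)" "ereal x"] by (auto simp: K_def ivl_def indicator_def)
    have m: "(\<lambda>x. indicator {lo n..<d} x *\<^sub>R K x) \<in> borel_measurable \<mu>" for n
      using \<mu> by (intro borel_measurable_scaleR borel_measurable_indicator) auto
    have n: "(\<integral>\<^sup>+x. ennreal (indicator {lo n..<d} x *\<^sub>R K x) \<partial>\<mu>) \<le> ennreal B" for n
      using i[of n] le[of n] unfolding set_integrable_def set_lebesgue_integral_def Kn
      by (subst nn_integral_eq_integral) (auto intro: ennreal_leI)
    have "(\<integral>\<^sup>+x. ennreal (K x) \<partial>\<mu>) = (\<integral>\<^sup>+x. liminf (\<lambda>n. ennreal (indicator {lo n..<d} x *\<^sub>R K x)) \<partial>\<mu>)"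
    proof (rule nn_integral_cong)
      fix x
      have "\<forall>\<^sub>F n in sequentially. indicator {lo n..<d} x *\<^sub>R K x = K x"
      proof (cases "x \<in> ivl a (ereal d)")
        case True
        then have "a < ereal x" "x < d" by (auto simp: ivl_def)
        from lo(2)[OF this(1)] show ?thesis by eventually_elim (use \<open>x < d\<close> in simp)
      qed (simp add: K_def)
      then have "\<forall>\<^sub>F n in sequentially. ennreal (indicator {lo n..<d} x *\<^sub>R K x) = ennreal (K x)" by eventually_elim (simp only:)
      then have "(\<lambda>n. ennreal (indicator {lo n..<d} x *\<^sub>R K x)) \<longlonglongrightarrow> ennreal (K x)" by (rule tendsto_eventually)
      from lim_imp_Liminf[OF _ this] show "ennreal (K x) = liminf (\<lambda>n. ennreal (indicator {lo n..<d} x *\<^sub>R K x))" by simp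
    qed
    also have "\<dots> \<le> liminf (\<lambda>n. \<integral>\<^sup>+x. ennreal (indicator {lo n..<d} x *\<^sub>R K x) \<partial>\<mu>)"
      using m by (intro nn_integral_liminf) simp
    also have "\<dots> \<le> ennreal B"
      by (rule Liminf_le) (use n in \<open>auto intro: always_eventually\<close>)
    finally have "(\<integral>\<^sup>+x. ennreal (norm (K x)) \<partial>\<mu>) < \<infinity>"
      by (auto simp: K_def less_top[symmetric] top_unique)
    then have "integrable \<mu> K" by (intro integrableI_bounded) auto
    then show ?thesis using k unfolding K_def by (subst L2_restrict_iff[OF \<mu>]) (auto simp: set_integrable_def)
  qed
  have nn: "set_lebesgue_integral \<mu> X (\<lambda>x. (norm (k x))\<^sup>2) \<ge> 0" for \<mu> :: "real measure" and X and k :: "real \<Rightarrow> complex"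
    unfolding set_lebesgue_integral_def by (intro integral_nonneg_AE) auto
  show ?thesis
    unfolding H2_def
  proof (intro conjI main sets_\<mu> H2_measurable[OF AC])
    fix n
    show "set_integrable ch {lo n..<d} (\<lambda>x. (norm (u x))\<^sup>2)" "set_integrable s {lo n..<d} (\<lambda>x. (norm (u1 x))\<^sup>2)"
      using H2_sq[OF _ hx[OF lo(1)]] by auto
    show "set_lebesgue_integral ch {lo n..<d} (\<lambda>x. (norm (u x))\<^sup>2) \<le> B" "set_lebesgue_integral s {lo n..<d} (\<lambda>x. (norm (u1 x))\<^sup>2) \<le> B"
      using B[OF lo(1)[of n]] nn[of ch "{lo n..<d}" u] nn[of s "{lo n..<d}" u1] unfolding nH_def by linarith+
  qed
qed

end

section \<open>The limit point case and the identity for solutions\<close>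

lemma eventually_at_aE:
  assumes d: "a < ereal d" and P: "eventually P (at_a a)"
  shows "\<exists>x0\<in>ivl a (ereal d). \<forall>x\<in>ivl a (ereal x0). P x"
proof (cases a)
  case (real a')
  then have "a' < d" using d by simp
  obtain y where y: "y > a'" "\<forall>x>a'. x < y \<longrightarrow> P x" using P real by (auto simp: at_a_def eventually_at_right_field)
  define x0 where "x0 = (a' + min y d) / 2"
  have "a' < x0" "x0 < d" "x0 < y" using y(1) \<open>a' < d\<close> by (auto simp: x0_def min_def)
  then show ?thesis using y(2) real by (intro bexI[of _ x0]) (auto simp: ivl_def)
next
  case MInf
  obtain N where N: "\<forall>n<N. P n" using P MInf by (auto simp: at_a_def eventually_at_bot_dense)
  show ?thesis using N MInf by (intro bexI[of _ "min N (d - 1)"]) (auto simp: ivl_def)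
qed (use d in auto)

lemma norm_sum_sq:
  fixes x y z :: complex
  assumes "norm x \<le> K * (norm y + norm z)" "K \<ge> 0"
  shows "(norm x)\<^sup>2 \<le> 2 * K\<^sup>2 * ((norm y)\<^sup>2 + (norm z)\<^sup>2)"
proof -
  have "(norm x)\<^sup>2 \<le> (K * (norm y + norm z))\<^sup>2" using assms(1) by (intro power_mono) auto
  also have "\<dots> = K\<^sup>2 * (norm y + norm z)\<^sup>2" by (simp add: power_mult_distrib)
  also have "\<dots> \<le> K\<^sup>2 * (2 * ((norm y)\<^sup>2 + (norm z)\<^sup>2))"
    using sum_squares_bound[of "norm y" "norm z"] by (intro mult_left_mono) (auto simp: power2_sum)
  finally show ?thesis by (simp add: algebra_simps)
qed

context SL begin

lemma nH_le:
  assumes X: "X \<in> sets borel" and h: "H2 X u u1" "H2 X f f1" "H2 X g g1"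
    and le: "\<And>t. t \<in> X \<Longrightarrow> (norm (u t))\<^sup>2 \<le> K * ((norm (f t))\<^sup>2 + (norm (g t))\<^sup>2)"
      "\<And>t. t \<in> X \<Longrightarrow> (norm (u1 t))\<^sup>2 \<le> K * ((norm (f1 t))\<^sup>2 + (norm (g1 t))\<^sup>2)"
  shows "nH X u u1 \<le> K * (nH X f f1 + nH X g g1)"
proof -
  note i = H2_sq[OF X h(1)] H2_sq[OF X h(2)] H2_sq[OF X h(3)]
  have main: "set_lebesgue_integral \<mu> X p \<le> K * (set_lebesgue_integral \<mu> X q + set_lebesgue_integral \<mu> X r)"
    if i: "set_integrable \<mu> X p" "set_integrable \<mu> X q" "set_integrable \<mu> X r" and le: "\<And>t. t \<in> X \<Longrightarrow> p t \<le> K * (q t + r t)"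
    for \<mu> and p q r :: "real \<Rightarrow> real"
  proof -
    note j = set_integral_add[OF i(2,3)]
    have "set_lebesgue_integral \<mu> X p \<le> set_lebesgue_integral \<mu> X (\<lambda>t. K * (q t + r t))"
      by (rule set_integral_mono[OF i(1) set_integrable_mult_right[OF j(1)] le])
    then show ?thesis by (simp add: j(2))
  qed
  have "nH X u u1 \<le> K * (set_lebesgue_integral ch X (\<lambda>x. (norm (f x))\<^sup>2) + set_lebesgue_integral ch X (\<lambda>x. (norm (g x))\<^sup>2))
    + K * (set_lebesgue_integral s X (\<lambda>x. (norm (f1 x))\<^sup>2) + set_lebesgue_integral s X (\<lambda>x. (norm (g1 x))\<^sup>2))"
    unfolding nH_def using i le by (intro add_mono main) auto
  then show ?thesis by (simp add: nH_def algebra_simps)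
qed

lemma Wr_solutions:
  assumes f: "D f f1 (\<lambda>x. z * f x)" and g: "D g g1 (\<lambda>x. w * g x)" and xy: "x \<in> ivl a b" "y \<in> ivl a b" "x < y"
  shows "Wr f1 (\<lambda>x. z * f x) g1 (\<lambda>x. w * g x) y - Wr f1 (\<lambda>x. z * f x) g1 (\<lambda>x. w * g x) x = (z - w) * ipH {x..<y} f f1 g g1"
proof -
  have AC: "ACloc a b s f f1" "ACloc a b s g g1" using f g by (auto simp: Dtau_rel_def)
  have ACs: "ACloc a b s (\<lambda>x. z * f x) (\<lambda>x. z * f1 x)" "ACloc a b s (\<lambda>x. w * g x) (\<lambda>x. w * g1 x)"
    using ACloc_lin[OF _ ACloc_zero AC(1), of z] ACloc_lin[OF _ ACloc_zero AC(2), of w] by simp_all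
  have e: "lint s (\<lambda>t. z * f1 t * g1 t - f1 t * (w * g1 t)) x y = (z - w) * lint s (\<lambda>t. f1 t * g1 t) x y"
    "lint ch (\<lambda>t. z * f t * g t - f t * (w * g t)) x y = (z - w) * lint ch (\<lambda>t. f t * g t) x y"
    unfolding lint_cmult[symmetric] by (simp_all add: algebra_simps)
  show ?thesis
    using lagrange[OF order_refl order_refl f ACs(1) g ACs(2) xy] unfolding e
    by (simp add: Wr_def ipH_def lint_def algebra_simps)
qed

text \<open>If the limit were nonzero, then Cramer's rule would express \<open>u\<close> through \<open>f\<close> and \<open>g\<close> with
  coefficients \<open>O(1 + \<epsilon> \<parallel>u\<parallel>)\<close>, where \<open>\<epsilon>\<close> is the norm of \<open>f, g\<close> near \<open>a\<close>; hence \<open>u\<close> would be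
  square integrable near \<open>a\<close>.\<close>

lemma limit_point_zero:
  assumes c: "a < ereal c" "ereal c < b"
    and u: "D u u1 (\<lambda>x. z' * u x)" "z' \<noteq> 0" "\<And>d. a < ereal d \<Longrightarrow> ereal d < b \<Longrightarrow> \<not> H2 (ivl a (ereal d)) u u1"
    and f: "D f f1 (\<lambda>x. z * f x)" "H2 (ivl a (ereal c)) f f1"
    and g: "D g g1 (\<lambda>x. w * g x)" "H2 (ivl a (ereal c)) g g1"
    and lim: "(Wr f1 (\<lambda>x. z * f x) g1 (\<lambda>x. w * g x) \<longlongrightarrow> k) (at_a a)"
  shows "k = 0"
proof (rule ccontr)
  assume k: "k \<noteq> 0"
  define ut where "ut = (\<lambda>x. z' * u x)"
  define ft where "ft = (\<lambda>x. z * f x)"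
  define gt where "gt = (\<lambda>x. w * g x)"
  have "((\<lambda>x. norm (Wr f1 ft g1 gt x)) \<longlongrightarrow> norm k) (at_a a)" using tendsto_norm[OF lim] by (simp add: ft_def gt_def)
  then have "\<forall>\<^sub>F x in at_a a. norm k / 2 < norm (Wr f1 ft g1 gt x)" by (rule order_tendstoD) (use k in simp)
  from eventually_at_aE[OF c(1) this] obtain x1 where x1: "x1 \<in> ivl a (ereal c)" "\<And>x. x \<in> ivl a (ereal x1) \<Longrightarrow> norm k / 2 < norm (Wr f1 ft g1 gt x)"
    by blast
  \<comment> \<open>2 / |k| bounds the inverse of the determinant in Cramer's rule near a. The
    second summand serves u itself, which is recovered from z' u by division, with |ft| and |gt|
    estimated through |z| and |w|.\<close>
  define \<kappa> where "\<kappa> = 2 / norm k * (1 + (norm z + norm w) / norm z')"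
  define m where "m = norm (z' - z) + norm (z' - w)"
  have k0: "norm k > 0" "norm z' > 0" using k u(2) by auto
  have kap: "\<kappa> > 0" unfolding \<kappa>_def using k0 by (intro mult_pos_pos divide_pos_pos add_pos_nonneg divide_nonneg_pos) auto
  have m0: "m \<ge> 0" by (simp add: m_def)
  \<comment> \<open>Small enough for 2 \<kappa> m \<eta> \<le> 1/2, so that the norm of u can be
    absorbed; m + 1 keeps the denominator positive.\<close>
  define \<eta> where "\<eta> = 1 / (4 * \<kappa> * (m + 1))"
  have eta: "\<eta> > 0" unfolding \<eta>_def using kap m0 by (intro divide_pos_pos mult_pos_pos add_nonneg_pos) auto
  have x1': "a < ereal x1" "ereal x1 < b" "ivl a (ereal x1) \<subseteq> ivl a (ereal c)"
    by (rule ivlD(1)[OF x1(1)], rule ivlD(2)[OF ivl_less[OF x1(1) c(2)]],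
        rule ivl_mono[OF order_refl less_imp_le[OF ivlD(2)[OF x1(1)]]])
  have hf: "H2 (ivl a (ereal x1)) f f1" and hg: "H2 (ivl a (ereal x1)) g g1"
    using H2_subset[OF _ _ x1'(3)] f(2) g(2) by auto
  have e2: "\<eta> / 2 > 0" using eta by simp
  obtain y1 where y1: "y1 \<in> ivl a (ereal x1)" "nH (ivl a (ereal y1)) f f1 < \<eta> / 2" using nH_tail[OF x1'(1) hf e2] by blast
  obtain y2 where y2: "y2 \<in> ivl a (ereal x1)" "nH (ivl a (ereal y2)) g g1 < \<eta> / 2" using nH_tail[OF x1'(1) hg e2] by blast
  define d where "d = min y1 y2"
  have dx: "d \<in> ivl a (ereal x1)" using y1(1) y2(1) by (auto simp: d_def min_def)
  have ivd: "ivl a (ereal d) \<subseteq> ivl a (ereal y1)" "ivl a (ereal d) \<subseteq> ivl a (ereal y2)"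
    by (rule ivl_mono; simp add: d_def)+
  have sx: "ivl a (ereal y1) \<subseteq> ivl a (ereal x1)" "ivl a (ereal y2) \<subseteq> ivl a (ereal x1)"
    by (rule ivl_mono; use y1(1) y2(1) in \<open>simp add: ivl_def\<close>)+
  have nfd: "nH (ivl a (ereal d)) f f1 + nH (ivl a (ereal d)) g g1 \<le> \<eta>"
    using nH_mono[OF _ _ ivd(1) H2_subset[OF _ _ sx(1) hf]] nH_mono[OF _ _ ivd(2) H2_subset[OF _ _ sx(2) hg]] y1(2) y2(2) by simp
  have dd: "a < ereal d" "ereal d < b" "d \<in> ivl a b" using dx ivl_less[OF dx x1'(2)] by (auto simp: ivl_def)
  have hfd: "H2 (ivl a (ereal d)) f f1" "H2 (ivl a (ereal d)) g g1"
    using H2_subset[OF _ _ order_trans[OF ivd(1) sx(1)] hf] H2_subset[OF _ _ order_trans[OF ivd(2) sx(2)] hg] by auto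
  define C where "C = norm (Wr u1 ut f1 ft d) + norm (Wr u1 ut g1 gt d)"
  have C0: "C \<ge> 0" by (simp add: C_def)
  have bound: "nH {x..<d} u u1 \<le> (4 * \<kappa> * sqrt \<eta> * C)\<^sup>2" if x: "x \<in> ivl a (ereal d)" for x
  proof -
    have xi: "x \<in> ivl a b" using x dd(2) by (rule ivl_less)
    have sub: "{t..<d} \<subseteq> ivl a (ereal d)" if "x \<le> t" for t
      using ivl_split(1)[OF x] that by auto
    define N where "N = sqrt (nH {x..<d} u u1)"
    have N0: "N \<ge> 0" by (simp add: N_def nH_ge_0)
    define P where "P = C + m * N * sqrt \<eta>"
    have P0: "P \<ge> 0" using C0 m0 N0 eta by (simp add: P_def)
    have hux: "H2 {x..<d} u u1" by (rule H2_Ico[OF u(1) xi dd(3)])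
    \<comment> \<open>By the Lagrange identity the brackets of u with f and g at t differ from those
      at d by at most m times the norm of u on the interval times the small norm of f or g.\<close>
    have Vb: "norm (Wr u1 ut h1 (\<lambda>x. v * h x) t) \<le> P"
      if h: "D h h1 (\<lambda>x. v * h x)" "H2 (ivl a (ereal d)) h h1" "nH (ivl a (ereal d)) h h1 \<le> \<eta>"
        "norm (z' - v) \<le> m" "norm (Wr u1 ut h1 (\<lambda>x. v * h x) d) \<le> C" and t: "x \<le> t" "t < d" for h h1 v t
    proof -
      have ti: "t \<in> ivl a b" using ivl_convex[OF xi dd(3)] t by auto
      have tsub: "{t..<d} \<subseteq> {x..<d}" using t by auto
      have hut: "H2 {t..<d} u u1" by (rule H2_subset[OF _ _ tsub hux]) auto
      have hht: "H2 {t..<d} h h1" by (rule H2_subset[OF _ _ sub[OF t(1)] h(2)]) auto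
      have "norm (ipH {t..<d} u u1 h h1) \<le> sqrt (nH {t..<d} u u1) * sqrt (nH {t..<d} h h1)"
        by (rule ipH_bound[OF _ hut hht]) simp
      also have "\<dots> \<le> N * sqrt \<eta>"
      proof (rule mult_mono)
        show "sqrt (nH {t..<d} u u1) \<le> N" unfolding N_def using nH_mono[OF _ _ tsub hux] by simp
        show "sqrt (nH {t..<d} h h1) \<le> sqrt \<eta>" using nH_mono[OF _ _ sub[OF t(1)] h(2)] h(3) by simp
      qed (use N0 nH_ge_0 in auto)
      finally have ip: "norm (ipH {t..<d} u u1 h h1) \<le> N * sqrt \<eta>" .
      have "Wr u1 ut h1 (\<lambda>x. v * h x) t = Wr u1 ut h1 (\<lambda>x. v * h x) d - (z' - v) * ipH {t..<d} u u1 h h1"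
        using Wr_solutions[OF u(1) h(1) ti dd(3) t(2)] by (simp add: ut_def algebra_simps)
      then have "norm (Wr u1 ut h1 (\<lambda>x. v * h x) t) \<le> norm (Wr u1 ut h1 (\<lambda>x. v * h x) d) + norm (z' - v) * norm (ipH {t..<d} u u1 h h1)"
        using norm_triangle_ineq4[of "Wr u1 ut h1 (\<lambda>x. v * h x) d" "(z' - v) * ipH {t..<d} u u1 h h1"] by (simp add: norm_mult)
      also have "\<dots> \<le> C + m * (N * sqrt \<eta>)"
        by (intro add_mono mult_mono h(4,5) ip) (use m0 in auto)
      finally show ?thesis by (simp add: P_def)
    qed
    have nn: "nH (ivl a (ereal d)) f f1 \<ge> 0" "nH (ivl a (ereal d)) g g1 \<ge> 0" by (rule nH_ge_0)+
    have Vf: "norm (Wr u1 ut f1 ft t) \<le> P" if "x \<le> t" "t < d" for t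
      unfolding ft_def by (rule Vb[OF f(1) hfd(1) _ _ _ that]) (use nfd nn in \<open>auto simp: m_def C_def ft_def\<close>)
    have Vg: "norm (Wr u1 ut g1 gt t) \<le> P" if "x \<le> t" "t < d" for t
      unfolding gt_def by (rule Vb[OF g(1) hfd(2) _ _ _ that]) (use nfd nn in \<open>auto simp: m_def C_def gt_def\<close>)
    have pw: "norm (u t) \<le> (\<kappa> * P) * (norm (f t) + norm (g t)) \<and> norm (u1 t) \<le> (\<kappa> * P) * (norm (f1 t) + norm (g1 t))"
      if t: "x \<le> t" "t < d" for t
    proof -
      have "t \<in> ivl a (ereal d)" using sub[OF t(1)] t by auto
      then have "t \<in> ivl a (ereal x1)" using ivd(1) sx(1) by blast
      from x1(2)[OF this] have Wk: "norm k / 2 < norm (Wr f1 ft g1 gt t)" .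
      define \<omega> where "\<omega> = Wr f1 ft g1 gt t"
      have om: "norm \<omega> > norm k / 2" "\<omega> \<noteq> 0" using Wk k0 by (auto simp: \<omega>_def)
      \<comment> \<open>Cramer's rule: q is u1 t or ut t, and its product with the determinant
        \<omega> of f and g is a combination of the two brackets of u.\<close>
      have fin: "norm q \<le> 2 / norm k * P * (norm y + norm y')"
        if q: "q * \<omega> = Wr u1 ut g1 gt t * y - Wr u1 ut f1 ft t * y'" for q y y'
      proof -
        have "norm q * norm \<omega> \<le> norm (Wr u1 ut g1 gt t) * norm y + norm (Wr u1 ut f1 ft t) * norm y'"
          using norm_triangle_ineq4[of "Wr u1 ut g1 gt t * y" "Wr u1 ut f1 ft t * y'"] q by (metis norm_mult)
        also have "\<dots> \<le> P * norm y + P * norm y'" by (intro add_mono mult_right_mono Vf Vg t) auto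
        finally have l: "norm q * norm \<omega> \<le> P * (norm y + norm y')" by (simp add: distrib_left)
        have "norm q * (norm k / 2) \<le> norm q * norm \<omega>" using om by (intro mult_left_mono) auto
        with l have "norm q * (norm k / 2) \<le> P * (norm y + norm y')" by linarith
        then show ?thesis using k0 by (simp add: field_simps)
      qed
      have a1: "norm (u1 t) \<le> 2 / norm k * P * (norm (f1 t) + norm (g1 t))"
        by (rule fin) (simp add: \<omega>_def Wr_def algebra_simps)
      have a2: "norm (ut t) \<le> 2 / norm k * P * (norm (ft t) + norm (gt t))"
        by (rule fin) (simp add: \<omega>_def Wr_def algebra_simps)
      have kk: "2 / norm k \<le> \<kappa>" "2 / norm k * ((norm z + norm w) / norm z') \<le> \<kappa>"
        unfolding \<kappa>_def using k0 by (simp_all add: distrib_left)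
      have "norm (u1 t) \<le> \<kappa> * P * (norm (f1 t) + norm (g1 t))"
        by (rule order_trans[OF a1]) (intro mult_right_mono kk P0 add_nonneg_nonneg norm_ge_zero)
      moreover have "norm (u t) \<le> \<kappa> * P * (norm (f t) + norm (g t))"
      proof -
        have "norm (u t) = norm (ut t) / norm z'" using k0 by (simp add: ut_def norm_mult)
        also have "\<dots> \<le> (2 / norm k * P * (norm (ft t) + norm (gt t))) / norm z'" by (intro divide_right_mono a2) simp
        also have "\<dots> \<le> (2 / norm k * P * ((norm z + norm w) * (norm (f t) + norm (g t)))) / norm z'"
        proof (intro divide_right_mono mult_left_mono)
          show "norm (ft t) + norm (gt t) \<le> (norm z + norm w) * (norm (f t) + norm (g t))"
            by (simp add: ft_def gt_def norm_mult algebra_simps)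
        qed (use P0 in auto)
        also have "\<dots> = (2 / norm k * ((norm z + norm w) / norm z')) * P * (norm (f t) + norm (g t))" by simp
        also have "\<dots> \<le> \<kappa> * P * (norm (f t) + norm (g t))" by (intro mult_right_mono kk P0 add_nonneg_nonneg norm_ge_zero)
        finally show ?thesis .
      qed
      ultimately show ?thesis by simp
    qed
    have kP: "\<kappa> * P \<ge> 0" using kap P0 by simp
    have sxd: "{x..<d} \<subseteq> ivl a (ereal d)" using sub by simp
    have "nH {x..<d} u u1 \<le> (2 * (\<kappa> * P)\<^sup>2) * (nH {x..<d} f f1 + nH {x..<d} g g1)"
      by (rule nH_le[OF _ hux H2_subset[OF _ _ sxd hfd(1)] H2_subset[OF _ _ sxd hfd(2)]])
        (use pw norm_sum_sq[OF _ kP] in auto)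
    also have "\<dots> \<le> (2 * (\<kappa> * P)\<^sup>2) * \<eta>"
      using nH_mono[OF _ _ sxd hfd(1)] nH_mono[OF _ _ sxd hfd(2)] nfd by (intro mult_left_mono) auto
    also have "\<dots> \<le> (2 * (\<kappa> * P) * sqrt \<eta>)\<^sup>2"
      using eta by (simp add: power_mult_distrib)
    finally have "N\<^sup>2 \<le> (2 * (\<kappa> * P) * sqrt \<eta>)\<^sup>2" by (simp add: N_def nH_ge_0)
    then have "N \<le> 2 * (\<kappa> * P) * sqrt \<eta>" by (rule power2_le_imp_le) (use kP eta in simp)
    also have "\<dots> = 2 * \<kappa> * sqrt \<eta> * C + (2 * \<kappa> * m * \<eta>) * N"
      using eta by (simp add: P_def algebra_simps)
    \<comment> \<open>The term with N / 2 is absorbed on the left. N is an actual norm, since u is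
      square integrable on the interval from x to d, and the resulting bound does not depend on
      x.\<close>
    also have "\<dots> \<le> 2 * \<kappa> * sqrt \<eta> * C + (1 / 2) * N"
    proof (intro add_left_mono mult_right_mono N0)
      have "2 * \<kappa> * m * \<eta> \<le> 2 * \<kappa> * (m + 1) * \<eta>" using kap eta by (intro mult_right_mono mult_left_mono) auto
      also have "\<dots> = 1 / 2" using kap m0 by (simp add: \<eta>_def)
      finally show "2 * \<kappa> * m * \<eta> \<le> 1 / 2" .
    qed
    finally have "N \<le> 4 * \<kappa> * sqrt \<eta> * C" by simp
    then have "N\<^sup>2 \<le> (4 * \<kappa> * sqrt \<eta> * C)\<^sup>2" using N0 by (intro power_mono) auto
    then show ?thesis by (simp add: N_def nH_ge_0)
  qed
  show False using H2_if_bounded[OF dd(1,2) u(1) bound] u(3)[OF dd(1,2)] by blast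
qed

lemma S_near_a_H2:
  assumes f: "S_near_a a b rp rn s ch va f (\<lambda>x. z * f x)" and c: "a < ereal c" "ereal c < b"
  shows "D f (Q f) (\<lambda>x. z * f x)" "H2 (ivl a (ereal c)) f (Q f)"
proof -
  obtain d where d: "a < d" "d < b" "H1 a d s ch f" and t: "tau_eq a b rp rn s ch f (\<lambda>x. z * f x)"
    using f by (auto simp: S_near_a_def Tmax_near_a_def)
  show D: "D f (Q f) (\<lambda>x. z * f x)" by (rule tau_D[OF t])
  show "H2 (ivl a (ereal c)) f (Q f)" by (rule H2_near_a[OF D d c])
qed

text \<open>The bracket vanishes at a in both cases, so only its value at c survives. In the limit
  point case the negated definition provides a nonzero z' and a solution for z' outside H1 near a,
  which is what \<open>limit_point_zero\<close> consumes.\<close>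

lemma solution_identity:
  assumes bca: "bc_a a b rp rn s ch va" and c: "a < ereal c" "ereal c < b"
    and f: "S_near_a a b rp rn s ch va f (\<lambda>x. z * f x)" and g: "S_near_a a b rp rn s ch va g (\<lambda>x. w * g x)"
  shows "(z - w) * ipH (ivl a (ereal c)) f (Q f) g (Q g) = (z * f c) * Q g c - Q f c * (w * g c)"
proof -
  note F = S_near_a_H2[OF f c] and G = S_near_a_H2[OF g c]
  note TF = Tpair_solution[OF F] and TG = Tpair_solution[OF G]
  let ?W = "Wr (Q f) (\<lambda>x. z * f x) (Q g) (\<lambda>x. w * g x)"
  note lim = Wr_tendsto[OF c TF TG]
  have z: "(?W \<longlongrightarrow> 0) (at_a a)"
  proof (cases "lc_a a b rp rn s ch")
    case True
    then obtain h where v: "va \<in> Tmax a b rp rn s ch" "h \<in> Tmax a b rp rn s ch" "Va a b rp rn s ch h (cpair va) \<noteq> 0"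
      using bca unfolding bc_a_def by blast
    have "Va a b rp rn s ch (f, \<lambda>x. z * f x) (cpair va) = 0" "Va a b rp rn s ch (g, \<lambda>x. w * g x) (cpair va) = 0"
      using f g True unfolding S_near_a_def by blast+
    from limit_circle_zero[OF c TF TG v this] show ?thesis .
  next
    case False
    then obtain z' u where u: "z' \<noteq> 0" "tau_eq a b rp rn s ch u (\<lambda>x. z' * u x)" "\<And>d. a < d \<Longrightarrow> d < b \<Longrightarrow> \<not> H1 a d s ch u"
      unfolding lc_a_def by blast
    have Du: "D u (Q u) (\<lambda>x. z' * u x)" by (rule tau_D[OF u(2)])
    have nu: "\<not> H2 (ivl a (ereal d)) u (Q u)" if "a < ereal d" "ereal d < b" for d
    proof
      assume h: "H2 (ivl a (ereal d)) u (Q u)"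
      have "ACloc a (ereal d) s u (Q u)" using Du that by (auto simp: Dtau_rel_def intro: ACloc_mono)
      then have "H1 a (ereal d) s ch u" unfolding H1_def H1rel_iff using h by blast
      then show False using u(3)[OF that] by blast
    qed
    from limit_point_zero[OF c Du u(1) nu F G lim] show ?thesis using lim by simp
  qed
  have "?W c - (ipH (ivl a (ereal c)) (\<lambda>x. z * f x) (\<lambda>x. z * Q f x) g (Q g)
      - ipH (ivl a (ereal c)) f (Q f) (\<lambda>x. w * g x) (\<lambda>x. w * Q g x)) = 0"
    by (rule tendsto_unique[OF at_a_nontrivial[OF c(1)] lim z])
  moreover have "ipH X (\<lambda>x. z * f x) (\<lambda>x. z * Q f x) g (Q g) = z * ipH X f (Q f) g (Q g)"
    "ipH X f (Q f) (\<lambda>x. w * g x) (\<lambda>x. w * Q g x) = w * ipH X f (Q f) g (Q g)" for X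
    unfolding ipH_def distrib_left set_integral_mult_right[symmetric] by (simp_all add: mult_ac)
  ultimately show ?thesis by (simp add: Wr_def algebra_simps)
qed

end

section \<open>The transformation\<close>

lemma L2s_cauchy_components:
  assumes F: "\<And>n. F n \<in> L2s M N" and c: "L2s.cauchy_seq M N F"
  shows "L2.cauchy_seq M (\<lambda>n x. F n (Inl x))" "L2.cauchy_seq N (\<lambda>n x. F n (Inr x))"
proof -
  have nn: "L2.nrm2 M (\<lambda>x. F m (Inl x) - F n (Inl x)) \<ge> 0" "L2.nrm2 N (\<lambda>x. F m (Inr x) - F n (Inr x)) \<ge> 0" for m n
    using F by (auto simp: L2s_def intro!: L2.nrm2_ge_0 L2.diff)
  have *: "\<exists>K. \<forall>m\<ge>K. \<forall>n\<ge>K. L2.nrm2 M (\<lambda>x. F m (Inl x) - F n (Inl x)) < \<epsilon> \<and> L2.nrm2 N (\<lambda>x. F m (Inr x) - F n (Inr x)) < \<epsilon>"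
    if e: "\<epsilon> > 0" for \<epsilon>
  proof -
    obtain K where K: "\<forall>m\<ge>K. \<forall>n\<ge>K. L2s.nrm2 M N (\<lambda>x. F m x - F n x) < \<epsilon>" using c e unfolding L2s.cauchy_seq_def by blast
    have "L2.nrm2 M (\<lambda>x. F m (Inl x) - F n (Inl x)) < \<epsilon> \<and> L2.nrm2 N (\<lambda>x. F m (Inr x) - F n (Inr x)) < \<epsilon>" if "m \<ge> K" "n \<ge> K" for m n
      using K[rule_format, OF that] nn[of m n] unfolding L2s_nrm2 by linarith
    then show ?thesis by blast
  qed
  show "L2.cauchy_seq M (\<lambda>n x. F n (Inl x))" "L2.cauchy_seq N (\<lambda>n x. F n (Inr x))"
    unfolding L2.cauchy_seq_def using * by meson+
qed

context SL begin

lemma restrict_indicator_L2: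
  assumes c: "ereal c < b" and pq: "p \<in> ivl a (ereal c)" "q \<in> ivl a (ereal c)" and X: "X \<in> sets borel" "X \<subseteq> {p..q}"
  shows "indicator X \<in> L2 (restrict_space s (ivl a (ereal c)))"
proof -
  have "emeasure s X \<le> emeasure s {p..q}" using X by (intro emeasure_mono) auto
  also have "\<dots> < \<infinity>" by (intro fin[OF lf(3)] ivl_less[OF _ c] pq)
  finally have "integrable s (indicator X :: real \<Rightarrow> real)" using X by (intro integrable_real_indicator) auto
  then have "set_integrable s (ivl a (ereal c)) (indicator X :: real \<Rightarrow> real)"
    unfolding set_integrable_def by (intro integrable_mult_indicator) auto
  moreover have "(norm (indicator X x :: complex))\<^sup>2 = (indicator X x :: real)" for x by (auto simp: indicator_def)
  moreover have "(indicator X :: real \<Rightarrow> complex) \<in> borel_measurable s" using X by (intro borel_measurable_indicator) simp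
  ultimately show ?thesis
    by (subst L2_restrict_iff[OF sets_\<mu>(3)]) (simp_all add: measurable_restrict_space1)
qed

text \<open>\<open>s\<close> is finite on compact intervals, so their indicators are square
  integrable and can be paired with h.\<close>

lemma L2_locint:
  assumes c: "ereal c < b" and h: "h \<in> L2 (restrict_space s (ivl a (ereal c)))"
  shows "locint a (ereal c) s h"
  unfolding locint_def
proof (intro allI impI)
  fix p q assume pq: "a < ereal p \<and> ereal q < ereal c"
  show "set_integrable s {p..q} h"
  proof (cases "p \<le> q")
    case True
    then have i: "p \<in> ivl a (ereal c)" "q \<in> ivl a (ereal c)"
      using pq less_le_trans[of a "ereal p" "ereal q"] by (auto simp: ivl_def)
    have "set_integrable s (ivl a (ereal c)) (\<lambda>x. h x * indicator {p..q} x)"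
      by (rule L2_restrict_mult[OF sets_\<mu>(3) _ h restrict_indicator_L2[OF c i]]) auto
    moreover have "(\<lambda>x. indicator (ivl a (ereal c)) x *\<^sub>R (h x * indicator {p..q} x)) = (\<lambda>x. indicator {p..q} x *\<^sub>R h x)"
      using ivl_convex[OF i] by (auto simp: indicator_def fun_eq_iff)
    ultimately show ?thesis by (simp add: set_integrable_def)
  qed (simp add: set_integrable_def)
qed

lemma lint_ip2:
  assumes "x \<in> ivl a (ereal c)" "y \<in> ivl a (ereal c)"
  shows "lint s h x y = ip2 (restrict_space s (ivl a (ereal c))) h (indicator {x..<y})"
proof -
  have sub: "t \<in> ivl a (ereal c)" if "x \<le> t" "t < y" for t using ivl_convex[OF assms] that by auto
  have "ip2 (restrict_space s (ivl a (ereal c))) h (indicator {x..<y}) = set_lebesgue_integral s (ivl a (ereal c)) (\<lambda>t. h t * cnj (indicator {x..<y} t))"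
    unfolding ip2_def by (rule restrict_integral) auto
  also have "\<dots> = lint s h x y"
    unfolding lint_def set_lebesgue_integral_def
    by (rule Bochner_Integration.integral_cong) (use sub in \<open>auto simp: indicator_def\<close>)
  finally show ?thesis ..
qed

text \<open>The derivatives converge in mean square, hence their integrals over compact intervals
  converge. One point at which a subsequence of the functions converges then fixes the integration
  constant, and f is the integral of f1 from that point.\<close>

lemma H2_complete:
  fixes c :: real
  defines "I \<equiv> ivl a (ereal c)"
  defines "M \<equiv> restrict_space ch I" and "N \<equiv> restrict_space s I"
  assumes c: "a < ereal c" "ereal c < b"
    and p: "\<And>n. ACloc a (ereal c) s (p n) (q n)" "\<And>n. H2 I (p n) (q n)"
    and cauchy: "L2s.cauchy_seq M N (\<lambda>n. case_sum (p n) (q n))"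
  shows "\<exists>f f1. ACloc a (ereal c) s f f1 \<and> H2 I f f1 \<and>
    (\<lambda>n. L2s.nrm2 M N (\<lambda>x. case_sum (p n) (q n) x - case_sum f f1 x)) \<longlonglongrightarrow> 0"
proof -
  have I: "I \<in> sets borel" by (simp add: I_def)
  have pL: "p n \<in> L2 M" and qL: "q n \<in> L2 N" for n using p(2)[of n] by (auto simp: H2_def M_def N_def)
  have FL: "case_sum (p n) (q n) \<in> L2s M N" for n using pL qL by (simp add: L2s_def)
  from L2s_cauchy_components[OF FL cauchy] have cp: "L2.cauchy_seq M p" and cq: "L2.cauchy_seq N q" by simp_all
  obtain r g0 where r: "strict_mono r" "g0 \<in> L2 M" "AE x in M. (\<lambda>n. p (r n) x) \<longlonglongrightarrow> g0 x"
    by (rule L2_complete[OF pL cp])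
  obtain r' f1 where f1: "f1 \<in> L2 N" "(\<lambda>n. L2.nrm2 N (\<lambda>x. q n x - f1 x)) \<longlonglongrightarrow> 0"
    by (rule L2_complete[OF qL cq])
  have lf1: "locint a (ereal c) s f1" using L2_locint[OF c(2)] f1(1) by (simp add: N_def I_def)
  have lim: "(\<lambda>n. lint s (q (r n)) x y) \<longlonglongrightarrow> lint s f1 x y" if xy: "x \<in> I" "y \<in> I" for x y
  proof -
    have ind: "indicator {x..<y} \<in> L2 N"
      unfolding N_def I_def by (rule restrict_indicator_L2[OF c(2) xy[unfolded I_def]]) auto
    have "(\<lambda>n. L2.nrm2 N (\<lambda>x. q (r n) x - f1 x)) \<longlonglongrightarrow> 0"
      using LIMSEQ_subseq_LIMSEQ[OF f1(2) r(1)] by (simp add: o_def)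
    from L2.ip_tendsto[OF qL f1(1) this ind] show ?thesis
      using xy by (simp add: lint_ip2[of x c y] N_def I_def)
  qed
  have limi: "(\<lambda>n. iint s x0 x (q (r n))) \<longlonglongrightarrow> iint s x0 x f1" if "x0 \<in> I" "x \<in> I" for x0 x
    using lim[OF that] lim[OF that(2,1)] by (auto simp: iint_def lint_def intro: tendsto_minus)
  have "\<exists>x0 y0. x0 \<in> I \<and> (AE x in M. (\<lambda>n. p (r n) x) \<longlonglongrightarrow> y0 + iint s x0 x f1)"
  proof (cases "\<exists>x0\<in>I. (\<lambda>n. p (r n) x0) \<longlonglongrightarrow> g0 x0")
    case True
    then obtain x0 where x0: "x0 \<in> I" "(\<lambda>n. p (r n) x0) \<longlonglongrightarrow> g0 x0" by blast
    have "(\<lambda>n. p (r n) x) \<longlonglongrightarrow> g0 x0 + iint s x0 x f1" if x: "x \<in> I" for x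
    proof -
      have "p n x = p n x0 + iint s x0 x (q n)" for n using p(1)[of n] x0(1) x unfolding ACloc_def I_def by blast
      then have "(\<lambda>n. p (r n) x) = (\<lambda>n. p (r n) x0 + iint s x0 x (q (r n)))" by (rule ext)
      then show ?thesis using tendsto_add[OF x0(2) limi[OF x0(1) x]] by simp
    qed
    then have "AE x in M. (\<lambda>n. p (r n) x) \<longlonglongrightarrow> g0 x0 + iint s x0 x f1"
      by (intro AE_I2) (simp add: M_def space_restrict_space)
    then show ?thesis using x0(1) by blast
  next
    \<comment> \<open>Convergence holds almost everywhere, so the absence of a point of convergence
      means that \<open>ch\<close> has no mass on I. Then every statement holds almost everywhere,
      and the constant 0 serves.\<close>
    case False
    have "AE x in M. x \<in> I" by (rule AE_I2) (simp add: M_def space_restrict_space)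
    with r(3) have "AE x in M. False" by eventually_elim (use False in blast)
    then have ae: "AE x in M. (\<lambda>n. p (r n) x) \<longlonglongrightarrow> 0 + iint s x0 x f1" for x0 by eventually_elim simp
    have "\<exists>x0. x0 \<in> I" using ivl_exhaust[OF c(1)] unfolding I_def by blast
    then show ?thesis using ae by blast
  qed
  then obtain x0 y0 where x0: "x0 \<in> I" and ae: "AE x in M. (\<lambda>n. p (r n) x) \<longlonglongrightarrow> y0 + iint s x0 x f1" by blast
  define f where "f = (\<lambda>x. y0 + iint s x0 x f1)"
  have AC: "ACloc a (ereal c) s f f1"
    unfolding ACloc_iff
  proof (intro conjI lf1 ballI impI)
    fix x y assume "x \<in> ivl a (ereal c)" "y \<in> ivl a (ereal c)" "x < y"
    from iint_diff[OF sets_\<mu>(3) lf1 x0[unfolded I_def] this]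
    show "f y = f x + lint s f1 x y" by (simp add: f_def algebra_simps)
  qed
  have fm: "f \<in> borel_measurable M" using H2_measurable(1)[OF AC] by (simp add: M_def I_def)
  have ae': "AE x in M. (\<lambda>n. p (r n) x) \<longlonglongrightarrow> f x" using ae by (simp add: f_def)
  note fl = L2_cauchy_pointwise[OF pL cp r(1) fm ae']
  have "(\<lambda>n. L2s.nrm2 M N (\<lambda>x. case_sum (p n) (q n) x - case_sum f f1 x)) \<longlonglongrightarrow> 0 + 0"
    unfolding L2s_nrm2 sum.case by (rule tendsto_add[OF fl(2) f1(2)])
  then show ?thesis using AC fl(1) f1(1) by (auto simp: H2_def M_def N_def)
qed

end

section \<open>The solutions as a model of the reproducing kernel\<close>

lemma (in dB) kern_cauchy:
  assumes v: "v \<longlonglongrightarrow> z0" and e: "\<epsilon> > 0"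
  shows "\<exists>K. \<forall>m\<ge>K. \<forall>n\<ge>K. norm (kern (cnj (v m)) (v n) - kern (cnj z0) z0) < \<epsilon>"
proof -
  have "continuous_on UNIV (\<lambda>p :: complex \<times> complex. kern (fst p) (snd p))"
    unfolding continuous_on_sequentially o_def
    by (intro allI ballI impI, elim conjE, intro kern_tendsto tendsto_fst tendsto_snd)
  then obtain \<delta> where \<delta>: "\<delta> > 0" "\<And>p :: complex \<times> complex. dist p (cnj z0, z0) < \<delta> \<Longrightarrow> dist (kern (fst p) (snd p)) (kern (cnj z0) z0) < \<epsilon>"
    using e unfolding continuous_on_iff by (metis UNIV_I fst_conv snd_conv)
  have "\<delta> / 2 > 0" using \<delta>(1) by simp
  from metric_LIMSEQ_D[OF v this] obtain K where K: "\<And>n. n \<ge> K \<Longrightarrow> dist (v n) z0 < \<delta> / 2" by blast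
  have "norm (kern (cnj (v m)) (v n) - kern (cnj z0) z0) < \<epsilon>" if "m \<ge> K" "n \<ge> K" for m n
  proof -
    have "dist (cnj (v m)) (cnj z0) = dist (v m) z0" by (simp add: dist_norm flip: complex_cnj_diff)
    moreover have "dist (cnj (v m), v n) (cnj z0, z0) \<le> dist (cnj (v m)) (cnj z0) + dist (v n) z0"
      unfolding dist_Pair_Pair using sqrt_sum_squares_le_sum_abs[of "dist (cnj (v m)) (cnj z0)" "dist (v n) z0"] by simp
    ultimately have "dist (cnj (v m), v n) (cnj z0, z0) < \<delta>" using K[OF that(1)] K[OF that(2)] by linarith
    from \<delta>(2)[OF this] show ?thesis by (simp add: dist_norm)
  qed
  then show ?thesis by blast
qed

locale SL_phi = SL +
  fixes va :: "(real \<Rightarrow> complex) \<times> (real \<Rightarrow> complex)" and \<phi> :: "complex \<Rightarrow> real \<Rightarrow> complex" and c :: real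
  assumes bca: "bc_a a b rp rn s ch va" and phi: "phi_ok a b rp rn s ch va \<phi>"
    and c: "a < ereal c" "ereal c < b"
begin

definition "I = ivl a (ereal c)"
definition "M = restrict_space ch I"
definition "N = restrict_space s I"
definition A :: "complex \<Rightarrow> complex" where "A z = z * \<phi> z c"
definition B :: "complex \<Rightarrow> complex" where "B z = Q (\<phi> z) c"
definition E :: "complex \<Rightarrow> complex" where "E = (\<lambda>z. A z + \<i> * B z)"
definition \<Phi> :: "complex \<Rightarrow> real + real \<Rightarrow> complex" where "\<Phi> z = case_sum (\<phi> z) (Q (\<phi> z))"

lemma I [simp]: "I \<in> sets borel" by (simp add: I_def)

lemma I_sub: "x \<in> I \<Longrightarrow> x \<in> ivl a b" unfolding I_def by (rule ivl_less[OF _ c(2)])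

lemma c_in: "c \<in> ivl a b" using c by (simp add: ivl_def)

lemma Efun_E: "Efun a b rp rn s ch \<phi> c = E"
  by (auto simp: Efun_def E_def A_def B_def)

lemma near: "S_near_a a b rp rn s ch va (\<phi> z) (\<lambda>x. z * \<phi> z x)" using phi by (simp add: phi_ok_def)

lemma D_\<phi>: "D (\<phi> z) (Q (\<phi> z)) (\<lambda>x. z * \<phi> z x)" by (rule S_near_a_H2(1)[OF near c])

lemma H2_\<phi>: "H2 I (\<phi> z) (Q (\<phi> z))" unfolding I_def by (rule S_near_a_H2(2)[OF near c])

lemma \<Phi>_in: "\<Phi> z \<in> L2s M N" using H2_\<phi> unfolding H2_L2s \<Phi>_def M_def N_def .

lemma cnj_\<phi>: "x \<in> ivl a b \<Longrightarrow> \<phi> (cnj z) x = cnj (\<phi> z x)" "x \<in> ivl a b \<Longrightarrow> Q (\<phi> (cnj z)) x = cnj (Q (\<phi> z) x)"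
  using phi by (auto simp: phi_ok_def)

lemma holo_\<phi>: "x \<in> ivl a b \<Longrightarrow> (\<lambda>z. \<phi> z x) holomorphic_on UNIV" "x \<in> ivl a b \<Longrightarrow> (\<lambda>z. Q (\<phi> z) x) holomorphic_on UNIV"
  using phi by (auto simp: phi_ok_def)

lemma not_zero: "\<phi> z c = 0 \<Longrightarrow> Q (\<phi> z) c = 0 \<Longrightarrow> False"
proof -
  assume z: "\<phi> z c = 0" "Q (\<phi> z) c = 0"
  have "\<exists>x\<in>ivl a b. \<phi> z x \<noteq> 0" using phi by (simp add: phi_ok_def)
  then show False using ivp_unique[OF D_\<phi> c_in z] by blast
qed

lemma ips_\<Phi>: "ips M N (case_sum f f1) (\<Phi> z) = set_lebesgue_integral ch I (\<lambda>x. \<phi> (cnj z) x * f x) + set_lebesgue_integral s I (\<lambda>x. Q (\<phi> (cnj z)) x * f1 x)"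
proof -
  have e: "set_lebesgue_integral ch I (\<lambda>x. f x * cnj (\<phi> z x)) = set_lebesgue_integral ch I (\<lambda>x. \<phi> (cnj z) x * f x)"
    "set_lebesgue_integral s I (\<lambda>x. f1 x * cnj (Q (\<phi> z) x)) = set_lebesgue_integral s I (\<lambda>x. Q (\<phi> (cnj z)) x * f1 x)"
    unfolding set_lebesgue_integral_def
    by (rule Bochner_Integration.integral_cong; use cnj_\<phi> I_sub in \<open>auto simp: indicator_def mult.commute\<close>)+
  show ?thesis unfolding M_def N_def \<Phi>_def ipH_ips[OF I] ipH_def e ..
qed

text \<open>By reality, conjugation in the second slot turns \<open>\<phi> w\<close> into the
  solution for \<open>cnj w\<close>, so the bilinear identity for solutions becomes one for the
  inner product.\<close>

lemma ips_\<Phi>_\<Phi>: "(z - cnj w) * ips M N (\<Phi> z) (\<Phi> w) = A z * B (cnj w) - B z * A (cnj w)"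
proof -
  have "ips M N (\<Phi> z) (\<Phi> w) = ipH I (\<phi> z) (Q (\<phi> z)) (\<phi> (cnj w)) (Q (\<phi> (cnj w)))"
    using ips_\<Phi>[of "\<phi> z" "Q (\<phi> z)" w] by (simp add: \<Phi>_def ipH_def mult.commute)
  then show ?thesis
    using solution_identity[OF bca c near[of z] near[of "cnj w"]] by (simp add: A_def B_def I_def mult.commute)
qed

text \<open>The Gram identity for w = z. It reduces the Hermite--Biehler inequality to the
  positivity of a norm.\<close>

lemma norm_E_diff: "(norm (E z))\<^sup>2 - (norm (A z - \<i> * B z))\<^sup>2 = 4 * Im z * L2s.nrm2 M N (\<Phi> z)"
proof -
  have cn: "A (cnj z) = cnj (A z)" "B (cnj z) = cnj (B z)" by (simp_all add: A_def B_def cnj_\<phi>[OF c_in])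
  have "(z - cnj z) * of_real (L2s.nrm2 M N (\<Phi> z)) = A z * cnj (B z) - B z * cnj (A z)"
    using ips_\<Phi>_\<Phi>[of z z] L2s.ip_self[OF \<Phi>_in] by (simp add: cn)
  then have "Im ((z - cnj z) * of_real (L2s.nrm2 M N (\<Phi> z))) = Im (A z * cnj (B z) - B z * cnj (A z))" by simp
  then have "Im z * L2s.nrm2 M N (\<Phi> z) * 2 = 2 * (Im (A z) * Re (B z) - Re (A z) * Im (B z))" by (simp add: algebra_simps)
  then show ?thesis unfolding E_def cmod_power2 by (simp add: power2_eq_square algebra_simps)
qed

sublocale dB A B E
proof
  show "A holomorphic_on UNIV" "B holomorphic_on UNIV"
    unfolding A_def[abs_def] B_def[abs_def] by (intro holomorphic_intros holo_\<phi> c_in)+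
  show "A (cnj z) = cnj (A z)" "B (cnj z) = cnj (B z)" for z by (simp_all add: A_def B_def cnj_\<phi>[OF c_in])
  show "E = (\<lambda>z. A z + \<i> * B z)" by (simp add: E_def)
  show le: "norm (A z - \<i> * B z) \<le> norm (E z)" if "Im z > 0" for z
  proof (rule power2_le_imp_le)
    have "0 \<le> 4 * Im z * L2s.nrm2 M N (\<Phi> z)" using that L2s.nrm2_ge_0[OF \<Phi>_in] by simp
    then show "(norm (A z - \<i> * B z))\<^sup>2 \<le> (norm (E z))\<^sup>2" using norm_E_diff[of z] by linarith
  qed simp
  show "E z \<noteq> 0" if z: "Im z > 0" for z
  proof
    assume E0: "E z = 0"
    then have "A z - \<i> * B z = 0" using le[OF z] by simp
    moreover have "A z + \<i> * B z = 0" using E0 by (simp add: E_def)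
    ultimately have "2 * A z = 0" "2 * (\<i> * B z) = 0" by (simp_all add: algebra_simps)
    then have "A z = 0" "B z = 0" by auto
    moreover have "z \<noteq> 0" using z by auto
    ultimately show False using not_zero[of z] by (simp add: A_def B_def)
  qed
  \<comment> \<open>The initial values at c never vanish together, so a common real zero must come
    from the factor z in A; the derivative of A there is \<open>\<phi> 0 c\<close>.\<close>
  show "t = 0 \<and> deriv A 0 \<noteq> 0" if t: "A (of_real t) = 0" "B (of_real t) = 0" for t
  proof -
    have "\<phi> (of_real t) c \<noteq> 0" using not_zero[of "of_real t"] t by (auto simp: B_def)
    then have t0: "t = 0" using t(1) by (simp add: A_def)
    have d: "((\<lambda>z. \<phi> z c) has_field_derivative deriv (\<lambda>z. \<phi> z c) 0) (at 0)"
      by (rule holomorphic_derivI[OF holo_\<phi>(1)[OF c_in] open_UNIV UNIV_I])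
    have "(A has_field_derivative \<phi> 0 c) (at 0)"
      unfolding A_def[abs_def] by (auto intro!: derivative_eq_intros d)
    then have "deriv A 0 = \<phi> 0 c" by (rule DERIV_imp_deriv)
    then show ?thesis using t0 \<open>\<phi> (of_real t) c \<noteq> 0\<close> by simp
  qed
qed

lemma gram_off: "z \<noteq> cnj w \<Longrightarrow> ips M N (\<Phi> z) (\<Phi> w) = kern (cnj w) z"
  using ips_\<Phi>_\<Phi>[of z w] by (simp add: kern_eq eq_divide_eq mult.commute)

text \<open>Off the diagonal the Gram matrix is the kernel, so \<open>\<Phi>\<close> is Cauchy along suitable sequences;
  pointwise convergence identifies the limit.\<close>

lemma \<Phi>_limit:
  "\<exists>v. v \<longlonglongrightarrow> z \<and> (\<forall>n. v n \<noteq> z) \<and> (\<lambda>n. L2s.nrm2 M N (\<lambda>x. \<Phi> (v n) x - \<Phi> z x)) \<longlonglongrightarrow> 0"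
proof -
  obtain v where v: "v \<longlonglongrightarrow> z" "\<And>n. v n \<noteq> z" "\<And>n. Im (v n) \<noteq> 0" "\<And>n. Im (v n) > 0 \<longleftrightarrow> Im z \<ge> 0"
    using nonreal_sequence[of z] by blast
  \<comment> \<open>The sequence stays on one side of the axis, where no point is the conjugate of
    another; this keeps all pairs off the diagonal.\<close>
  have vv: "v m \<noteq> cnj (v n)" for m n
  proof
    assume "v m = cnj (v n)"
    then have "Im (v m) = - Im (v n)" by simp
    then show False using v(3)[of m] v(4)[of m] v(4)[of n] by linarith
  qed
  define L where "L = kern (cnj z) z"
  have "L2s.cauchy_seq M N (\<lambda>n. \<Phi> (v n))"
    unfolding L2s.cauchy_seq_def
  proof (intro allI impI)
    fix \<epsilon> :: real assume "\<epsilon> > 0"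
    then have "\<epsilon> / 4 > 0" by simp
    from kern_cauchy[OF v(1) this] obtain K where K: "\<And>m n. m \<ge> K \<Longrightarrow> n \<ge> K \<Longrightarrow> norm (kern (cnj (v m)) (v n) - L) < \<epsilon> / 4"
      unfolding L_def by blast
    have "L2s.nrm2 M N (\<lambda>x. \<Phi> (v m) x - \<Phi> (v n) x) < \<epsilon>" if mn: "m \<ge> K" "n \<ge> K" for m n
    proof -
      have k: "\<bar>Re (kern (cnj (v i)) (v j)) - Re L\<bar> < \<epsilon> / 4" if "i \<ge> K" "j \<ge> K" for i j
        using abs_Re_le_cmod[of "kern (cnj (v i)) (v j) - L"] K[OF that] by simp
      have "L2s.nrm2 M N (\<lambda>x. \<Phi> (v m) x - \<Phi> (v n) x)
        = Re (kern (cnj (v m)) (v m)) - 2 * Re (kern (cnj (v n)) (v m)) + Re (kern (cnj (v n)) (v n))"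
        unfolding L2s.nrm2_diff[OF \<Phi>_in \<Phi>_in] by (simp add: L2s.nrm2_def gram_off[OF vv])
      then show ?thesis using k[OF mn(1,1)] k[OF mn(2,1)] k[OF mn(2,2)] by linarith
    qed
    then show "\<exists>K. \<forall>m\<ge>K. \<forall>n\<ge>K. L2s.nrm2 M N (\<lambda>x. \<Phi> (v m) x - \<Phi> (v n) x) < \<epsilon>" by blast
  qed
  from L2s_cauchy_components[OF \<Phi>_in this]
  have cs: "L2.cauchy_seq M (\<lambda>n. \<phi> (v n))" "L2.cauchy_seq N (\<lambda>n. Q (\<phi> (v n)))" by (simp_all add: \<Phi>_def)
  have L: "\<phi> w \<in> L2 M" "Q (\<phi> w) \<in> L2 N" for w using H2_\<phi>[of w] by (simp_all add: H2_def M_def N_def)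
  have lim: "(\<lambda>n. h (v (id n)) x) \<longlonglongrightarrow> h z x" if "(\<lambda>z. h z x) holomorphic_on UNIV" for h :: "complex \<Rightarrow> real \<Rightarrow> complex" and x
    using holomorphic_on_imp_continuous_on[OF that] v(1)
    by (auto simp: continuous_on_eq_continuous_at intro: isCont_tendsto_compose[of z "\<lambda>z. h z x"])
  have "(\<lambda>n. L2.nrm2 M (\<lambda>x. \<phi> (v n) x - \<phi> z x)) \<longlonglongrightarrow> 0"
  proof (rule L2_cauchy_pointwise(2)[OF L(1) cs(1) strict_mono_id])
    show "\<phi> z \<in> borel_measurable M" using L(1)[of z] by (simp add: L2_def)
    show "AE x in M. (\<lambda>n. \<phi> (v (id n)) x) \<longlonglongrightarrow> \<phi> z x"
      by (rule AE_I2, rule lim, rule holo_\<phi>(1), rule I_sub) (simp add: M_def space_restrict_space)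
  qed
  moreover have "(\<lambda>n. L2.nrm2 N (\<lambda>x. Q (\<phi> (v n)) x - Q (\<phi> z) x)) \<longlonglongrightarrow> 0"
  proof (rule L2_cauchy_pointwise(2)[OF L(2) cs(2) strict_mono_id])
    show "Q (\<phi> z) \<in> borel_measurable N" using L(2)[of z] by (simp add: L2_def)
    show "AE x in N. (\<lambda>n. Q (\<phi> (v (id n))) x) \<longlonglongrightarrow> Q (\<phi> z) x"
      by (rule AE_I2, rule lim[of "\<lambda>z. Q (\<phi> z)"], rule holo_\<phi>(2), rule I_sub) (simp add: N_def space_restrict_space)
  qed
  ultimately have "(\<lambda>n. L2s.nrm2 M N (\<lambda>x. \<Phi> (v n) x - \<Phi> z x)) \<longlonglongrightarrow> 0 + 0"
    unfolding L2s_nrm2 \<Phi>_def sum.case by (rule tendsto_add)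
  then show ?thesis using v(1,2) by auto
qed

text \<open>At z = \<open>cnj w\<close> the identity for solutions reads 0 = 0; norm convergence
  along a sequence and continuity of the kernel supply the value.\<close>

lemma gram_all: "ips M N (\<Phi> z) (\<Phi> w) = kern (cnj w) z"
proof (cases "z = cnj w")
  case True
  obtain v where v: "v \<longlonglongrightarrow> z" "\<And>n. v n \<noteq> z" "(\<lambda>n. L2s.nrm2 M N (\<lambda>x. \<Phi> (v n) x - \<Phi> z x)) \<longlonglongrightarrow> 0"
    using \<Phi>_limit[of z] by blast
  have "(\<lambda>n. ips M N (\<Phi> (v n)) (\<Phi> w)) \<longlonglongrightarrow> ips M N (\<Phi> z) (\<Phi> w)" by (rule L2s.ip_tendsto[OF \<Phi>_in \<Phi>_in v(3) \<Phi>_in])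
  moreover have "ips M N (\<Phi> (v n)) (\<Phi> w) = kern (cnj w) (v n)" for n
    by (rule gram_off) (use v(2)[of n] True in simp)
  moreover have "(\<lambda>n. kern (cnj w) (v n)) \<longlonglongrightarrow> kern (cnj w) z" by (rule kern_tendsto[OF v(1) tendsto_const])
  ultimately show ?thesis using LIMSEQ_unique by fastforce
qed (rule gram_off)

sublocale model: dB_model A B E "L2s M N" "ips M N" \<Phi>
  by unfold_locales (rule \<Phi>_in, rule gram_all)

lemma fhat_hat: "fhat a b rp rn s ch \<phi> c f f1 = model.hat (case_sum f f1)"
  by (rule ext) (simp add: fhat_def model.hat_def ips_\<Phi> I_def)

lemma H1rel_c: "H1rel a (ereal c) s ch f f1 \<longleftrightarrow> ACloc a (ereal c) s f f1 \<and> case_sum f f1 \<in> L2s M N"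
  unfolding H1rel_iff H2_L2s M_def N_def I_def ..

lemma H1norm2_nrm2: "H1norm2 a (ereal c) s ch f f1 = L2s.nrm2 M N (case_sum f f1)"
  unfolding M_def N_def nH_nrm2[OF I] by (simp add: H1norm2_def nH_def I_def)

lemma AC_\<phi>: "ACloc a (ereal c) s (\<phi> z) (Q (\<phi> z))"
  using D_\<phi>[of z] c(2) by (auto simp: Dtau_rel_def intro: ACloc_mono)

lemma integrable_fhat:
  assumes "H1rel a (ereal c) s ch f f1"
  shows "set_integrable ch (ivl a (ereal c)) (\<lambda>x. \<phi> z x * f x)"
    "set_integrable s (ivl a (ereal c)) (\<lambda>x. Q (\<phi> z) x * f1 x)"
  using H2_mult[OF I H2_\<phi>, of f f1 z] assms unfolding H1rel_iff I_def by auto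

lemma fhat_isometry:
  assumes "(f, f1) \<in> Dc a b rp rn s ch \<phi> c"
  shows "dB_norm2 E (fhat a b rp rn s ch \<phi> c f f1) = H1norm2 a (ereal c) s ch f f1"
  unfolding fhat_hat H1norm2_nrm2
proof (rule model.isometry_closure)
  show "case_sum f f1 \<in> L2s M N" using assms by (simp add: Dc_def H1rel_c)
  fix \<epsilon> :: real assume "\<epsilon> > 0"
  then obtain Z \<alpha> where Z: "finite Z" "H1norm2 a (ereal c) s ch (\<lambda>x. f x - (\<Sum>z\<in>Z. \<alpha> z * \<phi> z x)) (\<lambda>x. f1 x - (\<Sum>z\<in>Z. \<alpha> z * Q (\<phi> z) x)) < \<epsilon>"
    using assms unfolding Dc_def by blast
  have e: "(\<lambda>x. case_sum f f1 x - (\<Sum>z\<in>Z. \<alpha> z * \<Phi> z x)) = case_sum (\<lambda>x. f x - (\<Sum>z\<in>Z. \<alpha> z * \<phi> z x)) (\<lambda>x. f1 x - (\<Sum>z\<in>Z. \<alpha> z * Q (\<phi> z) x))"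
    by (rule ext) (simp add: \<Phi>_def split: sum.split)
  have "(\<lambda>x. \<Sum>z\<in>Z. \<alpha> z * \<Phi> z x) \<in> L2s.cspan (range \<Phi>)" by (rule L2s.cspan_sum[OF Z(1)]) simp
  then show "\<exists>q\<in>L2s.cspan (range \<Phi>). L2s.nrm2 M N (\<lambda>x. case_sum f f1 x - q x) < \<epsilon>"
    by (rule bexI[rotated]) (use Z(2) in \<open>simp add: e H1norm2_nrm2\<close>)
qed

text \<open>The solution for \<open>cnj z\<close> itself belongs to \<open>Dc\<close>, and the inner
  product with it is the transform at z.\<close>

lemma fhat_orthogonal:
  assumes o: "\<forall>(g, g1)\<in>Dc a b rp rn s ch \<phi> c. H1inner a (ereal c) s ch f f1 g g1 = 0"
  shows "fhat a b rp rn s ch \<phi> c f f1 z = 0"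
proof -
  let ?w = "cnj z"
  have "(\<phi> ?w, Q (\<phi> ?w)) \<in> Dc a b rp rn s ch \<phi> c"
    unfolding Dc_def
  proof (intro CollectI case_prodI conjI allI impI)
    show "H1rel a (ereal c) s ch (\<phi> ?w) (Q (\<phi> ?w))" unfolding H1rel_c using AC_\<phi> \<Phi>_in by (simp add: \<Phi>_def)
    fix \<epsilon> :: real assume "\<epsilon> > 0"
    then show "\<exists>Z \<alpha>. finite Z \<and> H1norm2 a (ereal c) s ch (\<lambda>x. \<phi> ?w x - (\<Sum>z\<in>Z. \<alpha> z * \<phi> z x)) (\<lambda>x. Q (\<phi> ?w) x - (\<Sum>z\<in>Z. \<alpha> z * Q (\<phi> z) x)) < \<epsilon>"
      by (intro exI[of _ "{?w}"] exI[of _ "\<lambda>_. 1"]) (simp add: H1norm2_def set_lebesgue_integral_def)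
  qed
  with o have "H1inner a (ereal c) s ch f f1 (\<phi> ?w) (Q (\<phi> ?w)) = 0" by blast
  moreover have "H1inner a (ereal c) s ch f f1 (\<phi> ?w) (Q (\<phi> ?w)) = model.hat (case_sum f f1) z"
  proof -
    have "model.hat (case_sum f f1) z = ips M N (case_sum f f1) (case_sum (\<phi> ?w) (Q (\<phi> ?w)))"
      unfolding model.hat_def \<Phi>_def ..
    then show ?thesis unfolding M_def N_def ipH_ips[OF I] by (simp add: H1inner_def ipH_def I_def)
  qed
  ultimately show ?thesis by (simp add: fhat_hat)
qed

lemma fhat_surjective:
  assumes F: "F \<in> deBranges E"
  shows "\<exists>f f1. H1rel a (ereal c) s ch f f1 \<and> fhat a b rp rn s ch \<phi> c f f1 = F"
proof -
  obtain p where p: "\<And>n. p n \<in> L2s.cspan model.nonreal" "L2s.cauchy_seq M N p"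
    "\<And>g. g \<in> L2s M N \<Longrightarrow> (\<lambda>n. L2s.nrm2 M N (\<lambda>x. p n x - g x)) \<longlonglongrightarrow> 0 \<Longrightarrow> model.hat g = F"
    using model.surjective[OF F] by blast
  \<comment> \<open>Combinations of solutions keep the relation between function and derivative.
    Through \<open>H2_complete\<close> the limit inherits it, so it is an element of H1 and not just
    a pair of square integrable functions.\<close>
  have AC: "ACloc a (ereal c) s (\<lambda>x. q (Inl x)) (\<lambda>x. q (Inr x))" if "q \<in> L2s.cspan model.nonreal" for q
    using that
  proof (induction rule: L2s.cspan.induct)
    case (step q e \<alpha>)
    obtain w where "e = \<Phi> w" using step.hyps(2) by (auto simp: model.nonreal_def)
    then show ?case using ACloc_lin[OF _ step.IH AC_\<phi>[of w], of \<alpha>] by (simp add: \<Phi>_def)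
  qed (simp add: ACloc_zero)
  define P where "P = (\<lambda>n x. p n (Inl x))"
  define R where "R = (\<lambda>n x. p n (Inr x))"
  have pe: "p = (\<lambda>n. case_sum (P n) (R n))" by (auto simp: P_def R_def fun_eq_iff split: sum.split)
  have pL: "p n \<in> L2s M N" for n by (rule L2s.cspan_in[OF p(1) model.nonreal_V])
  have "\<exists>f f1. ACloc a (ereal c) s f f1 \<and> H2 I f f1 \<and> (\<lambda>n. L2s.nrm2 M N (\<lambda>x. case_sum (P n) (R n) x - case_sum f f1 x)) \<longlonglongrightarrow> 0"
    unfolding M_def N_def I_def
  proof (rule H2_complete[OF c])
    show "ACloc a (ereal c) s (P n) (R n)" for n unfolding P_def R_def by (rule AC[OF p(1)])
    show "H2 (ivl a (ereal c)) (P n) (R n)" for n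
      using pL[of n] unfolding pe by (simp add: H2_L2s M_def N_def I_def)
    show "L2s.cauchy_seq (restrict_space ch (ivl a (ereal c))) (restrict_space s (ivl a (ereal c))) (\<lambda>n. case_sum (P n) (R n))"
      using p(2) unfolding pe M_def N_def I_def .
  qed
  then obtain f f1 where f: "ACloc a (ereal c) s f f1" "H2 I f f1" "(\<lambda>n. L2s.nrm2 M N (\<lambda>x. p n x - case_sum f f1 x)) \<longlonglongrightarrow> 0"
    unfolding pe by blast
  have h: "H1rel a (ereal c) s ch f f1" using f(1,2) unfolding H1rel_iff I_def by blast
  have "model.hat (case_sum f f1) = F" by (rule p(3)[OF _ f(3)]) (use h in \<open>simp add: H1rel_c\<close>)
  then show ?thesis using h unfolding fhat_hat by blast
qed

end

text \<open>The two middle clauses express that the map is a partial isometry with initial subspace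
  D(c): isometric there and zero on the orthogonal complement.\<close>

theorem theorem6p1:
  fixes a b :: ereal and rp rn s ch :: "real measure" and c :: real
    and va vb :: "(real \<Rightarrow> complex) \<times> (real \<Rightarrow> complex)"
    and \<phi> :: "complex \<Rightarrow> real \<Rightarrow> complex"
  assumes st: "standing a b rp rn s ch"
    and bca: "bc_a a b rp rn s ch va"
    and bcb: "bc_b a b rp rn s ch vb"
    and nz: "\<not> zero_eigenvalue a b rp rn s ch va vb"
    and phi: "phi_ok a b rp rn s ch va \<phi>"
    and c: "a < ereal c" "ereal c < b"
  shows
    "(\<forall>f f1. H1rel a (ereal c) s ch f f1 \<longrightarrow>
        (\<forall>z. set_integrable ch (ivl a (ereal c)) (\<lambda>x. \<phi> z x * f x) \<and>
             set_integrable s (ivl a (ereal c)) (\<lambda>x. qd a b rp rn s ch (\<phi> z) x * f1 x)) \<and>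
        fhat a b rp rn s ch \<phi> c f f1 \<in> deBranges (Efun a b rp rn s ch \<phi> c))
   \<and> (\<forall>f f1. (f, f1) \<in> Dc a b rp rn s ch \<phi> c \<longrightarrow>
        dB_norm2 (Efun a b rp rn s ch \<phi> c) (fhat a b rp rn s ch \<phi> c f f1) = H1norm2 a (ereal c) s ch f f1)
   \<and> (\<forall>f f1. H1rel a (ereal c) s ch f f1 \<and>
        (\<forall>(g, g1)\<in>Dc a b rp rn s ch \<phi> c. H1inner a (ereal c) s ch f f1 g g1 = 0) \<longrightarrow>
        (\<forall>z. fhat a b rp rn s ch \<phi> c f f1 z = 0))
   \<and> (\<forall>F\<in>deBranges (Efun a b rp rn s ch \<phi> c).
        \<exists>f f1. H1rel a (ereal c) s ch f f1 \<and> fhat a b rp rn s ch \<phi> c f f1 = F)"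
proof -
  interpret SL_phi a b rp rn s ch va \<phi> c
    by (unfold_locales) (rule st bca phi c)+
  have 1: "fhat a b rp rn s ch \<phi> c f f1 \<in> deBranges (Efun a b rp rn s ch \<phi> c)" if "H1rel a (ereal c) s ch f f1" for f f1
    unfolding fhat_hat Efun_E by (rule model.hat_deBranges) (use that in \<open>simp add: H1rel_c\<close>)
  show ?thesis
  proof (intro conjI)
    show "\<forall>f f1. H1rel a (ereal c) s ch f f1 \<longrightarrow>
        (\<forall>z. set_integrable ch (ivl a (ereal c)) (\<lambda>x. \<phi> z x * f x) \<and>
             set_integrable s (ivl a (ereal c)) (\<lambda>x. qd a b rp rn s ch (\<phi> z) x * f1 x)) \<and>
        fhat a b rp rn s ch \<phi> c f f1 \<in> deBranges (Efun a b rp rn s ch \<phi> c)"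
      by (intro allI impI conjI integrable_fhat 1)
    show "\<forall>f f1. (f, f1) \<in> Dc a b rp rn s ch \<phi> c \<longrightarrow>
        dB_norm2 (Efun a b rp rn s ch \<phi> c) (fhat a b rp rn s ch \<phi> c f f1) = H1norm2 a (ereal c) s ch f f1"
      unfolding Efun_E by (intro allI impI fhat_isometry)
    show "\<forall>f f1. H1rel a (ereal c) s ch f f1 \<and>
        (\<forall>(g, g1)\<in>Dc a b rp rn s ch \<phi> c. H1inner a (ereal c) s ch f f1 g g1 = 0) \<longrightarrow>
        (\<forall>z. fhat a b rp rn s ch \<phi> c f f1 z = 0)"
      by (intro allI impI fhat_orthogonal) (erule conjunct2)
    show "\<forall>F\<in>deBranges (Efun a b rp rn s ch \<phi> c).
        \<exists>f f1. H1rel a (ereal c) s ch f f1 \<and> fhat a b rp rn s ch \<phi> c f f1 = F"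
      unfolding Efun_E by (intro ballI fhat_surjective)
  qed
qed

end
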